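(* On a word RAM with words of $\Omega(\lg n)$ bits, a collection of $c$ disjoint sets that partition a universe $\{1,\dots,n\}$ can be maintained using $n\lg c+o(n)$ bits so that insert, delete, search and findany operations (each given the index of the set concerned) take constant time. Moreover, all elements of any given set can be enumerated (in no particular order) in $O(k+1)$ time, where $k$ is the number of elements of that set, and the data structure can be initialized in $O(1)$ time.
   Context: For a set in the collection: insert$(i)$ adds element $i$ to the specified set; search$(i)$ determines membership; delete$(i)$ removes $i$ from the specified set; findany returns some arbitrary element of the specified set, or NIL if it is empty. Space is measured in bits of working memory; word operations on a constant number of words take constant time. *)

theory Defs
  imports Complex_Main "HOL-Library.Landau_Symbols" "HOL-Library.Disjoint_Sets"
begin

text \<open>
  A word RAM with words of \<open>w\<close> bits.  The working memory is a string of exactly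
  \<open>s\<close> bits, addressed in words: word \<open>a\<close> consists of the bits at positions
  \<open>a * w, \<dots>, a * w + w - 1\<close> (least significant first).  If \<open>w\<close> does not
  divide \<open>s\<close>, the last word is cut short.  Bits at positions \<open>\<ge> s\<close> do not exist:
  they read as 0 and writing them has no effect.  Hence \<open>s\<close> is the space in bits, for every
  word length.

  One instruction operates on a constant number \<open>K\<close> of words, that is, on registers of
  \<open>L = K * w\<close> bits.  So with \<open>w \<ge> \<kappa> * log 2 n\<close> a register can hold an element or an
  address even if \<open>\<kappa> < 1\<close>.
\<close>

type_synonym memory = "nat \<Rightarrow> bool"

definition load_word :: "nat \<Rightarrow> nat \<Rightarrow> memory \<Rightarrow> nat \<Rightarrow> nat" where
  "load_word s w m a =
     (\<Sum>b<w. if a * w + b < s \<and> m (a * w + b) then 2 ^ b else 0)"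

definition store_word :: "nat \<Rightarrow> nat \<Rightarrow> memory \<Rightarrow> nat \<Rightarrow> nat \<Rightarrow> memory" where
  "store_word s w m a v =
     (\<lambda>p. if p < s \<and> p div w = a then bit v (p mod w) else m p)"

datatype word_op = Add | Sub | Mul | Div | Mod | And | Or | Xor | Shl | Shr

context
  includes bit_operations_syntax
begin

text \<open>Arithmetic is modulo \<open>2 ^ L\<close>; the arguments are assumed to be less than \<open>2 ^ L\<close>.\<close>

fun apply_op :: "nat \<Rightarrow> word_op \<Rightarrow> nat \<Rightarrow> nat \<Rightarrow> nat" where
  "apply_op L Add x y = take_bit L (x + y)"
| "apply_op L Sub x y = take_bit L (x + 2 ^ L - y)"
| "apply_op L Mul x y = take_bit L (x * y)"
| "apply_op L Div x y = take_bit L (x div y)"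
| "apply_op L Mod x y = take_bit L (x mod y)"
| "apply_op L And x y = take_bit L (x AND y)"
| "apply_op L Or  x y = take_bit L (x OR y)"
| "apply_op L Xor x y = take_bit L (x XOR y)"
| "apply_op L Shl x y = take_bit L (push_bit y x)"
| "apply_op L Shr x y = take_bit L (drop_bit y x)"

end

text \<open>
  Operands of instructions are register numbers, except for the literal of \<open>Const\<close> and the
  jump targets.  There is no indirect access to registers, so a program uses constantly many of
  them.  \<open>Emit\<close> appends to a write-only output stream.
\<close>

datatype instr =
    Const nat nat
  | Op word_op nat nat nat
  | Load nat nat
  | Store nat nat
  | Emit nat
  | Jump nat
  | Jump_less nat nat nat

type_synonym program = "instr list"

record config =
  pc :: nat
  regs :: "nat \<Rightarrow> nat"
  mem :: memory
  emitted :: "nat list"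

fun exec_instr :: "nat \<Rightarrow> nat \<Rightarrow> nat \<Rightarrow> instr \<Rightarrow> config \<Rightarrow> config" where
  "exec_instr s w L (Const r k) f =
     f\<lparr>pc := Suc (pc f), regs := (regs f)(r := take_bit L k)\<rparr>"
| "exec_instr s w L (Op g r x y) f =
     f\<lparr>pc := Suc (pc f), regs := (regs f)(r := apply_op L g (regs f x) (regs f y))\<rparr>"
| "exec_instr s w L (Load r x) f =
     f\<lparr>pc := Suc (pc f), regs := (regs f)(r := take_bit L (load_word s w (mem f) (regs f x)))\<rparr>"
| "exec_instr s w L (Store x y) f =
     f\<lparr>pc := Suc (pc f), mem := store_word s w (mem f) (regs f x) (regs f y)\<rparr>"
| "exec_instr s w L (Emit x) f =
     f\<lparr>pc := Suc (pc f), emitted := emitted f @ [regs f x]\<rparr>"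
| "exec_instr s w L (Jump l) f = f\<lparr>pc := l\<rparr>"
| "exec_instr s w L (Jump_less x y l) f =
     f\<lparr>pc := (if regs f x < regs f y then l else Suc (pc f))\<rparr>"

definition halted :: "program \<Rightarrow> config \<Rightarrow> bool" where
  "halted P f \<longleftrightarrow> length P \<le> pc f"

definition step :: "nat \<Rightarrow> nat \<Rightarrow> nat \<Rightarrow> program \<Rightarrow> config \<Rightarrow> config" where
  "step s w L P f = (if halted P f then f else exec_instr s w L (P ! pc f) f)"

text \<open>
  The arguments of a call are passed in the registers \<open>0, 1, \<dots>\<close>; nothing else but the memory
  survives from one call to the next.
\<close>

definition start :: "nat \<Rightarrow> nat list \<Rightarrow> memory \<Rightarrow> config" where
  "start L args m =
     \<lparr>pc = 0, regs = (\<lambda>r. if r < length args then take_bit L (args ! r) else 0),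
      mem = m, emitted = []\<rparr>"

definition halts_within ::
  "nat \<Rightarrow> nat \<Rightarrow> nat \<Rightarrow> program \<Rightarrow> nat list \<Rightarrow> memory \<Rightarrow> nat \<Rightarrow> config \<Rightarrow> bool" where
  "halts_within s w L P args m t f \<longleftrightarrow>
     (\<exists>t'\<le>t. f = (step s w L P ^^ t') (start L args m)) \<and> halted P f"

abbreviation result :: "config \<Rightarrow> nat" where
  "result f \<equiv> regs f 0"

text \<open>
  Deleting an element from its set takes it out of the partition until it is inserted again
  (into the same or another set).  At most one element may be missing at any time: if arbitrarily
  many could be missing, there would be \<open>(c + 1) ^ n\<close> states, too many for
  \<open>n * log 2 c + o(n)\<close> bits.
\<close>

definition partition_up_to_one :: "nat \<Rightarrow> nat \<Rightarrow> (nat \<Rightarrow> nat set) \<Rightarrow> bool" where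
  "partition_up_to_one n c S \<longleftrightarrow>
     disjoint_family_on S {..<c} \<and> (\<Union>j<c. S j) \<subseteq> {1..n} \<and>
     card ({1..n} - (\<Union>j<c. S j)) \<le> 1"

text \<open>
  Insertion keeps the sets disjoint: an element of another set is moved.
\<close>

definition insert_elem :: "nat \<Rightarrow> nat \<Rightarrow> (nat \<Rightarrow> nat set) \<Rightarrow> (nat \<Rightarrow> nat set)" where
  "insert_elem j i S = (\<lambda>k. if k = j then insert i (S k) else S k - {i})"

definition delete_elem :: "nat \<Rightarrow> nat \<Rightarrow> (nat \<Rightarrow> nat set) \<Rightarrow> (nat \<Rightarrow> nat set)" where
  "delete_elem j i S = S(j := S j - {i})"

lemma partition_up_to_one_insert_elem:
  assumes "partition_up_to_one n c S" "j < c" "i \<in> {1..n}"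
  shows "partition_up_to_one n c (insert_elem j i S)"
proof -
  have "(\<Union>k<c. insert_elem j i S k) = insert i (\<Union>k<c. S k)"
    using assms(2) by (auto simp: insert_elem_def)
  moreover have "disjoint_family_on (insert_elem j i S) {..<c}"
    using assms(1)
    unfolding partition_up_to_one_def disjoint_family_on_def insert_elem_def by auto
  moreover have "card ({1..n} - insert i (\<Union>k<c. S k)) \<le> card ({1..n} - (\<Union>k<c. S k))"
    by (rule card_mono) auto
  ultimately show ?thesis
    using assms(1,3) unfolding partition_up_to_one_def by simp
qed

lemma partition_up_to_one_delete_elem:
  assumes "disjoint_family_on S {..<c}" "(\<Union>k<c. S k) = {1..n}"
  shows "partition_up_to_one n c (delete_elem j i S)"
proof -
  have "disjoint_family_on (delete_elem j i S) {..<c}"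
    using assms(1) unfolding disjoint_family_on_def delete_elem_def by auto
  moreover have "(\<Union>k<c. delete_elem j i S k) \<subseteq> (\<Union>k<c. S k)"
    by (auto simp: delete_elem_def split: if_splits)
  moreover have "(\<Union>k<c. S k) - (\<Union>k<c. delete_elem j i S k) \<subseteq> {i}"
    by (auto simp: delete_elem_def)
  then have "card ((\<Union>k<c. S k) - (\<Union>k<c. delete_elem j i S k)) \<le> card {i}"
    by (intro card_mono) auto
  ultimately show ?thesis
    using assms(2) unfolding partition_up_to_one_def by simp
qed

record data_structure =
  init_prog :: program
  insert_prog :: program
  delete_prog :: program
  search_prog :: program
  findany_prog :: program
  enum_prog :: program

text \<open>
  \<open>R m S\<close> states that the memory \<open>m\<close> represents the collection \<open>S\<close>; queries may
  reorganize the memory.  The memory is uninitialized when the data structure is created, with all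
  elements in the set with index \<open>d\<close>.  Sets are indexed by \<open>{..<c}\<close>, and 0 serves
  as NIL, as it is not in the universe.
\<close>

definition maintains_collection ::
  "data_structure \<Rightarrow> nat \<Rightarrow> nat \<Rightarrow> nat \<Rightarrow> nat \<Rightarrow> nat \<Rightarrow> nat \<Rightarrow> nat \<Rightarrow> bool" where
  "maintains_collection D K T s w n c d \<longleftrightarrow>
    (\<exists>R :: memory \<Rightarrow> (nat \<Rightarrow> nat set) \<Rightarrow> bool.
      (\<forall>m. \<exists>f. halts_within s w (K * w) (init_prog D) [n, w] m T f \<and>
         R (mem f) (\<lambda>j. if j = d then {1..n} else {})) \<and>
      (\<forall>m S. R m S \<and> partition_up_to_one n c S \<longrightarrow>
        (\<forall>j<c. \<forall>i\<in>{1..n}.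
          (\<exists>f. halts_within s w (K * w) (insert_prog D) [n, w, j, i] m T f \<and>
             R (mem f) (insert_elem j i S)) \<and>
          (partition_up_to_one n c (delete_elem j i S) \<longrightarrow>
           (\<exists>f. halts_within s w (K * w) (delete_prog D) [n, w, j, i] m T f \<and>
             R (mem f) (delete_elem j i S))) \<and>
          (\<exists>f. halts_within s w (K * w) (search_prog D) [n, w, j, i] m T f \<and>
             R (mem f) S \<and> result f = (if i \<in> S j then 1 else 0))) \<and>
        (\<forall>j<c.
          (\<exists>f. halts_within s w (K * w) (findany_prog D) [n, w, j] m T f \<and>
             R (mem f) S \<and> (if S j = {} then result f = 0 else result f \<in> S j)) \<and>
          (\<exists>f. halts_within s w (K * w) (enum_prog D) [n, w, j] m (T * (card (S j) + 1)) f \<and>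
             R (mem f) S \<and> distinct (emitted f) \<and> set (emitted f) = S j))))"

end

theory Submission
  imports Defs "HOL-Real_Asymp.Real_Asymp"
begin

text \<open>
  The sets are the colour classes of a map from the universe to \<open>c\<close> colours. A block of \<open>b\<^sup>2\<close> colours
  is stored as one number in base \<open>c\<close>, with less than one bit of rounding; a few words of arithmetic
  extract all its digits in parallel and search them. Blocks are combined by uninitialized tables of
  cells of \<open>b\<close> bits, namely one virtual permutation that tells which blocks have been touched, and for
  every colour a sparse set of the blocks in which it occurs. So the overhead is \<open>O(n / b)\<close> bits, and
  \<open>b\<close> has to grow with \<open>n\<close> while a block must fit into constantly many words.

  Such a \<open>b\<close> cannot be computed in constant time from \<open>n\<close> and \<open>w\<close> (there is no logarithm and no root),
  so it is found in the course of the operations. A group of elements begins with a short list of the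
  touched elements and their colours in a single number. Its cells are narrowed by the factor \<open>m + 9\<close>
  when an element is appended to a list of length \<open>m\<close>, which keeps the number within the same length. After
  logarithmically many steps the width \<open>b\<close> satisfies \<open>b ^ 8 \<le> min n w\<close> up to a constant, but it is still
  at least logarithmic in \<open>min n w\<close>. From then on the list is frozen, and all other elements live in
  blocks. If \<open>n > w\<^sup>2\<close>, the universe is cut into groups of about \<open>w\<^sup>2\<close> elements, which are combined by
  another table. An element that is missing from the partition keeps its colour in the map and is
  recorded separately.
\<close>

text \<open>The width \<open>b\<close> is squeezed from two sides. Cells of \<open>b\<close> bits
  can number fewer than \<open>2 ^ b\<close> blocks, so \<open>b\<close> must be at least
  logarithmic in the size of the map it serves; the arithmetic on a block takes
  O(\<open>b ^ 4\<close>) bits, so \<open>b\<close> must be at most a small power of the word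
  length. A call knows only \<open>n\<close> and \<open>w\<close>, hence the width has to be read
  from memory before anything else can be decoded: it is the position of a lowest set bit. The width
  that is reached depends on \<open>min n w\<close> only, and for \<open>w\<close> near
  \<open>log 2 n\<close> it is too small to number the blocks of the whole universe. This forces the
  groups: \<open>w\<^sup>2\<close> elements are few enough for \<open>b\<close> and many enough to
  make the O(\<open>w\<close>) bits per group of the outer table negligible. One memory size must
  serve all admissible \<open>w\<close>, so it is computed for the shortest words, which gives an
  overhead of O(\<open>n / ln (log 2 n)\<close>) bits. Before blocks exist, the list of a single
  group occupies space that the main term \<open>n * log 2 c\<close> reserves for them; for
  \<open>c = 1\<close> there is none, so this case is separate.\<close>

section \<open>Code fragments and bounded runs\<close>

definition code_at :: "program \<Rightarrow> nat \<Rightarrow> program \<Rightarrow> bool" where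
  "code_at P a c \<longleftrightarrow> (\<exists>x y. P = x @ c @ y \<and> length x = a)"

text \<open>Jump targets are absolute, so code is generated for a given address and located in an
  otherwise unknown program. This equivalence lets fragments be composed.\<close>

lemma code_at_append:
  "code_at P a (c @ c') \<longleftrightarrow> code_at P a c \<and> code_at P (a + length c) c'"
proof
  assume "code_at P a (c @ c')"
  then obtain x y where "P = x @ (c @ c') @ y" "length x = a"
    unfolding code_at_def by blast
  then have "P = x @ c @ (c' @ y)" "P = (x @ c) @ c' @ y" "length (x @ c) = a + length c"
    by auto
  with \<open>length x = a\<close> show "code_at P a c \<and> code_at P (a + length c) c'"
    unfolding code_at_def by blast
next
  assume "code_at P a c \<and> code_at P (a + length c) c'"
  then obtain x y x' y' where *: "P = x @ c @ y" "length x = a"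
      "P = x' @ c' @ y'" "length x' = a + length c"
    unfolding code_at_def by blast
  then have "(x @ c) @ y = x' @ (c' @ y')" "length (x @ c) = length x'"
    by auto
  then have "y = c' @ y'"
    by (metis append_eq_append_conv)
  with * show "code_at P a (c @ c')"
    unfolding code_at_def by auto
qed

lemma code_at_nth:
  assumes "code_at P a c" "i < length c"
  shows "code_at P (a + i) [c ! i]"
proof -
  have "c = take i c @ [c ! i] @ drop (Suc i) c" "length (take i c) = i"
    using assms(2) by (simp_all add: Cons_nth_drop_Suc)
  then show ?thesis
    using assms(1) code_at_append by metis
qed

lemma code_at_single: "code_at P a [i] \<Longrightarrow> a < length P \<and> P ! a = i"
  unfolding code_at_def by (auto simp: nth_append)

text \<open>At most \<open>t\<close> steps rather than exactly \<open>t\<close>, so that branches of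
  different length share one bound.\<close>

definition reach :: "nat \<Rightarrow> nat \<Rightarrow> nat \<Rightarrow> program \<Rightarrow> nat \<Rightarrow> config \<Rightarrow> config \<Rightarrow> bool" where
  "reach s w L P t f f' \<longleftrightarrow> (\<exists>t'\<le>t. f' = (step s w L P ^^ t') f)"

lemma reach_refl: "reach s w L P t f f"
  unfolding reach_def by (rule exI[of _ 0]) simp

lemma reach_trans: "reach s w L P t f f' \<Longrightarrow> reach s w L P u f' f'' \<Longrightarrow> reach s w L P (t + u) f f''"
proof -
  assume "reach s w L P t f f'" "reach s w L P u f' f''"
  then obtain a b where "a \<le> t" "f' = (step s w L P ^^ a) f" "b \<le> u" "f'' = (step s w L P ^^ b) f'"
    unfolding reach_def by blast
  then have "a + b \<le> t + u" "f'' = (step s w L P ^^ (a + b)) f"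
    by (simp_all add: add.commute[of a b] funpow_add)
  then show ?thesis
    unfolding reach_def by blast
qed

lemma reach_mono: "reach s w L P t f f' \<Longrightarrow> t \<le> u \<Longrightarrow> reach s w L P u f f'"
  unfolding reach_def using order_trans by blast

lemma reach_step:
  assumes "code_at P a [i]" "pc f = a" "reach s w L P t (exec_instr s w L i f) f'"
  shows "reach s w L P (Suc t) f f'"
proof -
  have "(step s w L P ^^ 1) f = exec_instr s w L i f"
    using code_at_single[OF assms(1)] assms(2) by (simp add: step_def halted_def)
  then have "reach s w L P 1 f (exec_instr s w L i f)"
    unfolding reach_def by (metis order_refl)
  from reach_trans[OF this assms(3)] show ?thesis
    by simp
qed

section \<open>Expressions computed in constant time\<close>

record state =
  lim :: nat
  wid :: nat
  univ :: nat
  store :: memory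

definition ld :: "state \<Rightarrow> nat \<Rightarrow> nat" where
  "ld \<sigma> a = load_word (lim \<sigma>) (wid \<sigma>) (store \<sigma>) a"

definition st :: "state \<Rightarrow> nat \<Rightarrow> nat \<Rightarrow> state" where
  "st \<sigma> a v = \<sigma>\<lparr>store := store_word (lim \<sigma>) (wid \<sigma>) (store \<sigma>) a v\<rparr>"

text \<open>The arguments \<open>n\<close> and \<open>w\<close> of a call stay in the registers 0 and 1 throughout.\<close>

definition snap :: "nat \<Rightarrow> config \<Rightarrow> state" where
  "snap s f = \<lparr>lim = s, wid = regs f 1, univ = regs f 0, store = mem f\<rparr>"

text \<open>De Bruijn style: binding a variable takes the next register, and \<open>\<rho> 0\<close> is the latest.\<close>

definition env :: "nat \<Rightarrow> config \<Rightarrow> nat \<Rightarrow> nat" where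
  "env E f = (\<lambda>i. if i < E then regs f (E - 1 - i) else 0)"

definition ready_at :: "nat \<Rightarrow> nat \<Rightarrow> program \<Rightarrow> program \<Rightarrow> nat \<Rightarrow> nat \<Rightarrow> config \<Rightarrow> bool" where
  "ready_at E A P c a w f \<longleftrightarrow>
     1 \<le> w \<and> code_at P a c \<and> pc f = a \<and> regs f 1 = w \<and> (\<forall>i<max 2 E. regs f i < 2 ^ (A * w))"

text \<open>
  \<open>CE F\<close>: on all sufficiently wide registers, the value \<open>F\<close> of the variables and the memory is
  computed in constant time, without overflow and without touching the registers below any
  given \<open>D\<close>.
\<close>

definition computes where
  "computes F E D A code len K0 T \<longleftrightarrow> (\<forall>a. length (code a) = len) \<and>
    (\<forall>K\<ge>K0. \<forall>s w P a f. ready_at E A P (code a) a w f \<longrightarrow>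
      F (env E f) (snap s f) < 2 ^ (K0 * w) \<and>
      (\<exists>f'. reach s w (K * w) P T f f' \<and> pc f' = a + len \<and> mem f' = mem f \<and>
         emitted f' = emitted f \<and> (\<forall>i<D. regs f' i = regs f i) \<and>
         regs f' D = F (env E f) (snap s f)))"

definition CE :: "((nat \<Rightarrow> nat) \<Rightarrow> state \<Rightarrow> nat) \<Rightarrow> bool" where
  "CE F \<longleftrightarrow> (\<forall>E D A. 2 \<le> D \<and> E \<le> D \<longrightarrow>
     (\<exists>(code :: nat \<Rightarrow> program) len K0 T. computes F E D A code len K0 T))"

lemma CE_E:
  assumes "CE F" "2 \<le> D" "E \<le> D"
  obtains code len K0 T where "computes F E D A code len K0 T"
  using assms unfolding CE_def by meson

lemma computes_len: "computes F E D A code len K0 T \<Longrightarrow> length (code a) = len"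
  unfolding computes_def by simp

lemma computes_run:
  assumes "computes F E D A code len K0 T" "K0 \<le> K" "ready_at E A P (code a) a w f"
  obtains f' where "reach s w (K * w) P T f f'" "pc f' = a + len" "mem f' = mem f"
    "emitted f' = emitted f" "\<forall>i<D. regs f' i = regs f i"
    "regs f' D = F (env E f) (snap s f)" "F (env E f) (snap s f) < 2 ^ (K0 * w)"
  using assms unfolding computes_def by meson

lemma env_cong: "\<forall>i<E. regs f' i = regs f i \<Longrightarrow> env E f' = env E f"
  unfolding env_def by auto

lemma snap_cong:
  "2 \<le> D \<Longrightarrow> \<forall>i<D. regs f' i = regs f i \<Longrightarrow> mem f' = mem f \<Longrightarrow> snap s f' = snap s f"
  unfolding snap_def by simp

lemma ready_at_cong:
  assumes "ready_at E A P c a w f" "2 \<le> D" "E \<le> D" "\<forall>i<D. regs f' i = regs f i"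
    "code_at P a' c'" "pc f' = a'"
  shows "ready_at E A P c' a' w f'"
  using assms unfolding ready_at_def by auto

lemma take_bit_small: "(x::nat) < 2 ^ (A * w) \<Longrightarrow> A \<le> K \<Longrightarrow> take_bit (K * w) x = x"
proof -
  assume "x < 2 ^ (A * w)" "A \<le> K"
  moreover have "(2::nat) ^ (A * w) \<le> 2 ^ (K * w)"
    using \<open>A \<le> K\<close> by (intro power_increasing) auto
  ultimately have "x < 2 ^ (K * w)" by linarith
  then show ?thesis by (simp add: take_bit_nat_eq_self)
qed

lemma less_pow_mono: "(x::nat) < 2 ^ (A * w) \<Longrightarrow> A \<le> K \<Longrightarrow> x < 2 ^ (K * w)"
proof -
  assume "x < 2 ^ (A * w)" "A \<le> K"
  moreover have "(2::nat) ^ (A * w) \<le> 2 ^ (K * w)"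
    using \<open>A \<le> K\<close> by (intro power_increasing) auto
  ultimately show "x < 2 ^ (K * w)" by linarith
qed

lemma const_less_pow: "1 \<le> w \<Longrightarrow> (k::nat) < 2 ^ (k * w)"
proof -
  assume "1 \<le> w"
  have "k < 2 ^ k" by (rule less_exp)
  also have "\<dots> \<le> 2 ^ (k * w)" using \<open>1 \<le> w\<close> by (intro power_increasing) auto
  finally show ?thesis .
qed

lemma reach_instr:
  assumes "code_at P a [i]" "pc f = a"
  shows "reach s w L P 1 f (exec_instr s w L i f)"
  using reach_step[OF assms reach_refl[of s w L P 0]] by simp

lemma CE_const: "CE (\<lambda>\<rho> \<sigma>. k)"
  unfolding CE_def
proof (intro allI impI)
  fix E D A :: nat assume "2 \<le> D \<and> E \<le> D"
  have "computes (\<lambda>\<rho> \<sigma>. k) E D A (\<lambda>a. [Const D k]) 1 k 1"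
    unfolding computes_def
  proof (intro conjI allI impI)
    fix K s w P a f
    assume K: "k \<le> K" and r: "ready_at E A P [Const D k] a w f"
    then have w: "1 \<le> w" "code_at P a [Const D k]" "pc f = a" by (auto simp: ready_at_def)
    show k: "k < 2 ^ (k * w)" using const_less_pow w by blast
    show "\<exists>f'. reach s w (K * w) P 1 f f' \<and> pc f' = a + 1 \<and> mem f' = mem f \<and>
       emitted f' = emitted f \<and> (\<forall>i<D. regs f' i = regs f i) \<and> regs f' D = k"
      by (rule exI, intro conjI, rule reach_instr[OF w(2,3)])
        (use w take_bit_small[OF k K] in auto)
  qed simp
  then show "\<exists>code len K0 T. computes (\<lambda>\<rho> \<sigma>. k) E D A code len K0 T" by blast
qed

text \<open>Variables outside the environment have the value 0 by the definition of
  \<open>env\<close>; hence the second alternative.\<close>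

lemma CE_reg:
  assumes r: "\<And>E. r E < max 2 E \<and> (\<forall>f s. F (env E f) (snap s f) = regs f (r E)) \<or>
    (\<forall>f s. F (env E f) (snap s f) = 0)"
  shows "CE F"
  unfolding CE_def
proof (intro allI impI)
  fix E D A :: nat assume ED: "2 \<le> D \<and> E \<le> D"
  show "\<exists>code len K0 T. computes F E D A code len K0 T"
  proof (cases "\<forall>f s. F (env E f) (snap s f) = 0")
    case True
    obtain code len K0 T where c: "computes (\<lambda>\<rho> \<sigma>. 0) E D A code len K0 T"
      using CE_E[OF CE_const[of 0]] ED by metis
    have "computes F E D A code len K0 T"
      using c unfolding computes_def True[rule_format] .
    then show ?thesis by blast
  next
    case F: False
  \<comment> \<open>There is no instruction that copies a register; adding 0 does it.\<close>
  let ?c = "[Const D 0, Op Add D (r E) D]"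
  have rE: "r E < max 2 E" "\<And>f s. F (env E f) (snap s f) = regs f (r E)" using r[of E] F by auto
  have "computes F E D A (\<lambda>a. ?c) 2 A 2"
    unfolding computes_def
  proof (intro conjI allI impI)
    fix K s w P a f
    assume K: "A \<le> K" and rd: "ready_at E A P ?c a w f"
    then have w: "1 \<le> w" "code_at P a ?c" "pc f = a" by (auto simp: ready_at_def)
    show b: "F (env E f) (snap s f) < 2 ^ (A * w)" using rE rd by (auto simp: ready_at_def)
    have c: "code_at P a [Const D 0]" "code_at P (Suc a) [Op Add D (r E) D]"
      using code_at_nth[OF w(2), of 0] code_at_nth[OF w(2), of 1] by simp_all
    show "\<exists>f'. reach s w (K * w) P 2 f f' \<and> pc f' = a + 2 \<and> mem f' = mem f \<and>
       emitted f' = emitted f \<and> (\<forall>i<D. regs f' i = regs f i) \<and> regs f' D = F (env E f) (snap s f)"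
      unfolding numeral_2_eq_2
      by (rule exI, intro conjI, rule reach_step[OF c(1) w(3)], rule reach_step[OF c(2)], simp add: w(3),
          rule reach_refl) (use w rE ED take_bit_small[OF b K] in auto)
  qed simp
  then show ?thesis by blast
  qed
qed

text \<open>The code for \<open>E - 1\<close> variables serves for \<open>E\<close> as well: it
  leaves the registers below \<open>D\<close> alone, and \<open>E \<le> D\<close>.\<close>

lemma CE_shift:
  assumes "CE F"
  shows "CE (\<lambda>\<rho> \<sigma>. F (\<lambda>i. \<rho> (Suc i)) \<sigma>)"
  unfolding CE_def
proof (intro allI impI)
  fix E D A :: nat assume ED: "2 \<le> D \<and> E \<le> D"
  have e: "(\<lambda>i. env E f (Suc i)) = env (E - 1) f" for f
    by (cases E) (auto simp: env_def intro!: ext)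
  obtain code len K0 T where c: "computes F (E - 1) D A code len K0 T"
    using CE_E[OF assms, of D "E - 1" A] ED by (metis diff_le_self le_trans)
  have "ready_at (E - 1) A P c a w f" if "ready_at E A P c a w f" for P c a w f
    using that unfolding ready_at_def by auto
  then have "computes (\<lambda>\<rho> \<sigma>. F (\<lambda>i. \<rho> (Suc i)) \<sigma>) E D A code len K0 T"
    using c unfolding computes_def e by blast
  then show "\<exists>code len K0 T. computes (\<lambda>\<rho> \<sigma>. F (\<lambda>i. \<rho> (Suc i)) \<sigma>) E D A code len K0 T" by blast
qed

lemma CE_univ: "CE (\<lambda>\<rho> \<sigma>. univ \<sigma>)"
  by (rule CE_reg[where r = "\<lambda>E. 0"]) (auto simp: snap_def)

lemma CE_wid: "CE (\<lambda>\<rho> \<sigma>. wid \<sigma>)"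
  by (rule CE_reg[where r = "\<lambda>E. 1"]) (auto simp: snap_def)

text \<open>Common shape of the binary operations: the operands are put into the registers
  \<open>D\<close> and \<open>Suc D\<close>, where a fixed \<open>tail\<close> combines them.
  \<open>Q\<close> is what is known about the operands (a shift, for instance, needs a bounded
  amount), and \<open>bound\<close> says that the result still fits into constantly many
  words.\<close>

lemma CE_tail:
  assumes F1: "CE F1" and F2: "CE F2"
    and len: "\<And>a D. length (tail a D) = n"
    and tail: "\<And>K s w P a D f. 1 \<le> w \<Longrightarrow> code_at P a (tail a D) \<Longrightarrow> pc f = a \<Longrightarrow>
      Q w (regs f D) (regs f (Suc D)) \<Longrightarrow> h w (regs f D) (regs f (Suc D)) < 2 ^ (K * w) \<Longrightarrow>
      regs f D < 2 ^ (K * w) \<Longrightarrow> regs f (Suc D) < 2 ^ (K * w) \<Longrightarrow>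
      \<exists>f'. reach s w (K * w) P n f f' \<and> pc f' = a + n \<and> mem f' = mem f \<and>
         emitted f' = emitted f \<and> (\<forall>i<D. regs f' i = regs f i) \<and>
         regs f' D = h w (regs f D) (regs f (Suc D))"
    and Q: "\<And>\<rho> \<sigma>. Q (wid \<sigma>) (F1 \<rho> \<sigma>) (F2 \<rho> \<sigma>)"
    and bound: "\<And>A. \<exists>B. \<forall>w\<ge>1. \<forall>x y. x < 2 ^ (A * w) \<longrightarrow> y < 2 ^ (A * w) \<longrightarrow> Q w x y \<longrightarrow> h w x y < 2 ^ (B * w)"
    and G: "G = (\<lambda>\<rho> \<sigma>. h (wid \<sigma>) (F1 \<rho> \<sigma>) (F2 \<rho> \<sigma>))"
  shows "CE G"
  unfolding CE_def
proof (intro allI impI)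
  fix E D A :: nat assume ED: "2 \<le> D \<and> E \<le> D"
  obtain c1 l1 K1 T1 where c1: "computes F1 E D A c1 l1 K1 T1"
    using CE_E[OF F1] ED by blast
  obtain c2 l2 K2 T2 where c2: "computes F2 E (Suc D) A c2 l2 K2 T2"
    using CE_E[OF F2, of "Suc D" E A] ED by (metis le_SucI)
  obtain B where B: "\<forall>w\<ge>1. \<forall>x y. x < 2 ^ ((K1 + K2) * w) \<longrightarrow> y < 2 ^ ((K1 + K2) * w) \<longrightarrow> Q w x y \<longrightarrow>
      h w x y < 2 ^ (B * w)"
    using bound by blast
  define code where "code a = c1 a @ c2 (a + l1) @ tail (a + l1 + l2) D" for a
  have l: "length (c1 a) = l1" "length (c2 a) = l2" for a
    using c1 c2 by (auto dest: computes_len)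
  have "computes G E D A code (l1 + l2 + n) (K1 + K2 + B) (T1 + T2 + n)"
    unfolding computes_def
  proof (intro conjI allI impI)
    fix a show "length (code a) = l1 + l2 + n"
      using l len by (simp add: code_def)
  next
    fix K s w P a f
    assume K: "K1 + K2 + B \<le> K" and rd: "ready_at E A P (code a) a w f"
    then have w: "1 \<le> w" "code_at P a (code a)" "pc f = a" "regs f 1 = w" by (auto simp: ready_at_def)
    have ca: "code_at P a (c1 a)" "code_at P (a + l1) (c2 (a + l1))"
      "code_at P (a + l1 + l2) (tail (a + l1 + l2) D)"
      using w(2) l unfolding code_def code_at_append by auto
    have "ready_at E A P (c1 a) a w f"
      using rd ca(1) unfolding ready_at_def by auto
    from computes_run[OF c1 _ this, of K s] K obtain f1 where f1:
      "reach s w (K * w) P T1 f f1" "pc f1 = a + l1" "mem f1 = mem f"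
      "emitted f1 = emitted f" "\<forall>i<D. regs f1 i = regs f i"
      "regs f1 D = F1 (env E f) (snap s f)" "F1 (env E f) (snap s f) < 2 ^ (K1 * w)"
      by (metis add_leE)
    have eq1: "env E f1 = env E f" "snap s f1 = snap s f"
      using f1 ED by (auto intro!: env_cong snap_cong[of D])
    have "ready_at E A P (c2 (a + l1)) (a + l1) w f1"
      by (rule ready_at_cong[OF rd _ _ f1(5) ca(2) f1(2)]) (use ED in auto)
    from computes_run[OF c2 _ this, of K s] K obtain f2 where f2:
      "reach s w (K * w) P T2 f1 f2" "pc f2 = a + l1 + l2" "mem f2 = mem f1"
      "emitted f2 = emitted f1" "\<forall>i<Suc D. regs f2 i = regs f1 i"
      "regs f2 (Suc D) = F2 (env E f) (snap s f)" "F2 (env E f) (snap s f) < 2 ^ (K2 * w)"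
      unfolding eq1 by (metis add_leE)
    have v: "regs f2 D = F1 (env E f) (snap s f)"
      using f1 f2 by auto
    have q: "Q w (regs f2 D) (regs f2 (Suc D))"
      using Q[of "snap s f" "env E f"] v f2 w by (simp add: snap_def)
    have h: "h w (regs f2 D) (regs f2 (Suc D)) = G (env E f) (snap s f)"
      using v f2 w by (simp add: G snap_def)
    have xy: "regs f2 D < 2 ^ ((K1 + K2) * w)" "regs f2 (Suc D) < 2 ^ ((K1 + K2) * w)"
      using v f1(7) f2(6,7) by (auto intro: less_pow_mono)
    then have hb: "h w (regs f2 D) (regs f2 (Suc D)) < 2 ^ (B * w)"
      using B w q by blast
    then show "G (env E f) (snap s f) < 2 ^ ((K1 + K2 + B) * w)"
      unfolding h by (rule less_pow_mono) simp
    have "h w (regs f2 D) (regs f2 (Suc D)) < 2 ^ (K * w)" "regs f2 D < 2 ^ (K * w)"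
      "regs f2 (Suc D) < 2 ^ (K * w)"
      using less_pow_mono[OF hb] less_pow_mono[OF xy(1)] less_pow_mono[OF xy(2)] K by auto
    from tail[OF w(1) ca(3) f2(2) q this, of s] obtain f3 where f3:
      "reach s w (K * w) P n f2 f3" "pc f3 = a + l1 + l2 + n" "mem f3 = mem f2"
      "emitted f3 = emitted f2" "\<forall>i<D. regs f3 i = regs f2 i"
      "regs f3 D = h w (regs f2 D) (regs f2 (Suc D))"
      by blast
    show "\<exists>f'. reach s w (K * w) P (T1 + T2 + n) f f' \<and> pc f' = a + (l1 + l2 + n) \<and> mem f' = mem f \<and>
         emitted f' = emitted f \<and> (\<forall>i<D. regs f' i = regs f i) \<and> regs f' D = G (env E f) (snap s f)"
      by (rule exI[of _ f3], intro conjI, rule reach_trans[OF reach_trans[OF f1(1) f2(1)] f3(1)])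
        (use f1 f2 f3 h in auto)
  qed
  then show "\<exists>code len K0 T. computes G E D A code len K0 T" by blast
qed

lemma CE_op:
  assumes F1: "CE F1" and F2: "CE F2"
    and op: "\<And>L w x y. Q w x y \<Longrightarrow> h w x y < 2 ^ L \<Longrightarrow> x < 2 ^ L \<Longrightarrow> y < 2 ^ L \<Longrightarrow> apply_op L g x y = h w x y"
    and Q: "\<And>\<rho> \<sigma>. Q (wid \<sigma>) (F1 \<rho> \<sigma>) (F2 \<rho> \<sigma>)"
    and bound: "\<And>A. \<exists>B. \<forall>w\<ge>1. \<forall>x y. x < 2 ^ (A * w) \<longrightarrow> y < 2 ^ (A * w) \<longrightarrow> Q w x y \<longrightarrow> h w x y < 2 ^ (B * w)"
  shows "CE (\<lambda>\<rho> \<sigma>. h (wid \<sigma>) (F1 \<rho> \<sigma>) (F2 \<rho> \<sigma>))"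
proof (rule CE_tail[OF F1 F2, where tail = "\<lambda>a D. [Op g D D (Suc D)]" and n = 1 and Q = Q and h = h])
  fix K s w P a D and f :: config
  assume *: "1 \<le> w" "code_at P a [Op g D D (Suc D)]" "pc f = a" "Q w (regs f D) (regs f (Suc D))"
    "h w (regs f D) (regs f (Suc D)) < 2 ^ (K * w)" "regs f D < 2 ^ (K * w)" "regs f (Suc D) < 2 ^ (K * w)"
  show "\<exists>f'. reach s w (K * w) P 1 f f' \<and> pc f' = a + 1 \<and> mem f' = mem f \<and>
         emitted f' = emitted f \<and> (\<forall>i<D. regs f' i = regs f i) \<and>
         regs f' D = h w (regs f D) (regs f (Suc D))"
    by (rule exI, intro conjI, rule reach_instr[OF *(2,3)]) (use * op in auto)
qed (use Q bound in auto)

lemma CE_add: assumes "CE F1" "CE F2" shows "CE (\<lambda>\<rho> \<sigma>. F1 \<rho> \<sigma> + F2 \<rho> \<sigma>)"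
proof (rule CE_op[OF assms, where Q = "\<lambda>w x y. True" and h = "\<lambda>w x y. x + y" and g = Add])
  fix A
  have "x + y < 2 ^ (Suc A * w)" if "1 \<le> w" "x < 2 ^ (A * w)" "y < 2 ^ (A * w)" for x y w :: nat
  proof -
    have "x + y < 2 ^ Suc (A * w)" using that by simp
    also have "\<dots> \<le> 2 ^ (Suc A * w)" using that by (intro power_increasing) auto
    finally show ?thesis .
  qed
  then show "\<exists>B. \<forall>w\<ge>1. \<forall>x y :: nat. x < 2 ^ (A * w) \<longrightarrow> y < 2 ^ (A * w) \<longrightarrow> True \<longrightarrow> x + y < 2 ^ (B * w)"
    by (intro exI[of _ "Suc A"] allI impI) simp
qed (auto simp: take_bit_nat_eq_self)

lemma CE_mult: assumes "CE F1" "CE F2" shows "CE (\<lambda>\<rho> \<sigma>. F1 \<rho> \<sigma> * F2 \<rho> \<sigma>)"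
proof (rule CE_op[OF assms, where Q = "\<lambda>w x y. True" and h = "\<lambda>w x y. x * y" and g = Mul])
  fix A
  have "x * y < 2 ^ ((A + A) * w)" if "x < 2 ^ (A * w)" "y < 2 ^ (A * w)" for x y w :: nat
    unfolding add_mult_distrib power_add using that by (intro mult_strict_mono) auto
  then show "\<exists>B. \<forall>w\<ge>1. \<forall>x y :: nat. x < 2 ^ (A * w) \<longrightarrow> y < 2 ^ (A * w) \<longrightarrow> True \<longrightarrow> x * y < 2 ^ (B * w)"
    by (intro exI[of _ "A + A"] allI impI)
qed (auto simp: take_bit_nat_eq_self)

text \<open>A result that never exceeds the first operand inherits its width.\<close>

lemma CE_shrink:
  assumes "CE F1" "CE F2" and le: "\<And>x y. h x y \<le> x"
    and op: "\<And>L x y. h x y < 2 ^ L \<Longrightarrow> x < 2 ^ L \<Longrightarrow> y < 2 ^ L \<Longrightarrow> apply_op L g x y = h x y"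
  shows "CE (\<lambda>\<rho> \<sigma>. h (F1 \<rho> \<sigma>) (F2 \<rho> \<sigma>))"
proof (rule CE_op[OF assms(1,2), where Q = "\<lambda>w x y. True" and h = "\<lambda>w. h" and g = g])
  fix A show "\<exists>B. \<forall>w\<ge>1. \<forall>x y :: nat. x < 2 ^ (A * w) \<longrightarrow> y < 2 ^ (A * w) \<longrightarrow> True \<longrightarrow> h x y < 2 ^ (B * w)"
    using le le_less_trans by blast
qed (auto simp: op)

lemma CE_div: assumes "CE F1" "CE F2" shows "CE (\<lambda>\<rho> \<sigma>. F1 \<rho> \<sigma> div F2 \<rho> \<sigma>)"
  by (rule CE_shrink[OF assms, where g = Div]) (auto simp: take_bit_nat_eq_self)

lemma CE_mod: assumes "CE F1" "CE F2" shows "CE (\<lambda>\<rho> \<sigma>. F1 \<rho> \<sigma> mod F2 \<rho> \<sigma>)"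
  by (rule CE_shrink[OF assms, where g = Mod]) (auto simp: take_bit_nat_eq_self)

lemma and_le_left: "and x y \<le> (x::nat)"
  unfolding and_nat_def by (metis AND_upper1 nat_int nat_mono of_nat_0_le_iff)

lemma CE_and: assumes "CE F1" "CE F2" shows "CE (\<lambda>\<rho> \<sigma>. and (F1 \<rho> \<sigma>) (F2 \<rho> \<sigma>))"
  by (rule CE_shrink[OF assms, where g = And]) (auto simp: take_bit_nat_eq_self and_le_left)

text \<open>The machine subtracts modulo \<open>2 ^ L\<close>, while \<open>-\<close> on
  \<open>nat\<close> is truncated; hence the comparison in front.\<close>

lemma CE_diff: assumes "CE F1" "CE F2" shows "CE (\<lambda>\<rho> \<sigma>. F1 \<rho> \<sigma> - F2 \<rho> \<sigma>)"
proof (rule CE_tail[OF assms, where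
    tail = "\<lambda>a D. [Jump_less D (Suc D) (a + 3), Op Sub D D (Suc D), Jump (a + 4), Const D 0]" and n = 4
    and Q = "\<lambda>w x y. True" and h = "\<lambda>w x y. x - y"])
  fix K s w P a D and f :: config
  let ?c = "[Jump_less D (Suc D) (a + 3), Op Sub D D (Suc D), Jump (a + 4), Const D 0]"
  assume *: "1 \<le> w" "code_at P a ?c" "pc f = a"
    "regs f D - regs f (Suc D) < 2 ^ (K * w)" "regs f D < 2 ^ (K * w)" "regs f (Suc D) < 2 ^ (K * w)"
  have c: "code_at P a [?c ! 0]" "code_at P (Suc a) [?c ! 1]" "code_at P (Suc (Suc a)) [?c ! 2]"
      "code_at P (Suc (Suc (Suc a))) [?c ! 3]"
    using code_at_nth[OF *(2), of 0] code_at_nth[OF *(2), of 1] code_at_nth[OF *(2), of 2]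
      code_at_nth[OF *(2), of 3] by (simp_all add: numeral_eq_Suc)
  show "\<exists>f'. reach s w (K * w) P 4 f f' \<and> pc f' = a + 4 \<and> mem f' = mem f \<and>
         emitted f' = emitted f \<and> (\<forall>i<D. regs f' i = regs f i) \<and>
         regs f' D = regs f D - regs f (Suc D)"
  proof (cases "regs f D < regs f (Suc D)")
    case True
    have p: "pc (exec_instr s w (K * w) (?c ! 0) f) = Suc (Suc (Suc a))"
      using True *(3) by simp
    have "reach s w (K * w) P (Suc (Suc 2)) f (exec_instr s w (K * w) (?c ! 3) (exec_instr s w (K * w) (?c ! 0) f))"
      by (rule reach_step[OF c(1) *(3)], rule reach_step[OF c(4) p], rule reach_refl)
    then have "reach s w (K * w) P 4 f (exec_instr s w (K * w) (?c ! 3) (exec_instr s w (K * w) (?c ! 0) f))"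
      by (rule reach_mono) simp
    then show ?thesis
      by (intro exI conjI, assumption) (use True *(3) in auto)
  next
    case False
    have t: "take_bit (K * w) (regs f D + 2 ^ (K * w) - regs f (Suc D)) = regs f D - regs f (Suc D)"
    proof -
      have e: "regs f D + 2 ^ (K * w) - regs f (Suc D) = (regs f D - regs f (Suc D)) + 2 ^ (K * w)"
        using False by simp
      show ?thesis
        unfolding e take_bit_eq_mod mod_add_self2 using *(4) by (rule mod_less)
    qed
    have p: "pc (exec_instr s w (K * w) (?c ! 0) f) = Suc a"
      "pc (exec_instr s w (K * w) (?c ! 1) (exec_instr s w (K * w) (?c ! 0) f)) = Suc (Suc a)"
      using False *(3) by simp_all
    have "reach s w (K * w) P (Suc (Suc (Suc 1))) f (exec_instr s w (K * w) (?c ! 2) (exec_instr s w (K * w) (?c ! 1) (exec_instr s w (K * w) (?c ! 0) f)))"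
      by (rule reach_step[OF c(1) *(3)], rule reach_step[OF c(2) p(1)], rule reach_step[OF c(3) p(2)], rule reach_refl)
    then have "reach s w (K * w) P 4 f (exec_instr s w (K * w) (?c ! 2) (exec_instr s w (K * w) (?c ! 1) (exec_instr s w (K * w) (?c ! 0) f)))"
      by (rule reach_mono) simp
    then show ?thesis
      by (intro exI conjI, assumption) (use False *(3) in \<open>simp_all add: t\<close>)
  qed
next
  fix A show "\<exists>B. \<forall>w\<ge>1. \<forall>x y :: nat. x < 2 ^ (A * w) \<longrightarrow> y < 2 ^ (A * w) \<longrightarrow> True \<longrightarrow> x - y < 2 ^ (B * w)"
    by (meson diff_le_self le_less_trans)
qed auto

lemma CE_less: assumes "CE F1" "CE F2" shows "CE (\<lambda>\<rho> \<sigma>. if F1 \<rho> \<sigma> < F2 \<rho> \<sigma> then 1 else 0)"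
proof -
  have "(\<lambda>\<rho> \<sigma>. if F1 \<rho> \<sigma> < F2 \<rho> \<sigma> then 1 else 0) = (\<lambda>\<rho> \<sigma>. 1 - (1 - (F2 \<rho> \<sigma> - F1 \<rho> \<sigma>)) :: nat)"
    by (intro ext) auto
  then show ?thesis
    by (simp only:) (intro CE_diff CE_const assms)
qed

text \<open>Selection by arithmetic: under truncation \<open>1 - b\<close> tests for 0, and
  \<open>1 - (1 - b)\<close> is the opposite test. Both branches are evaluated, which is harmless
  because expressions are total and cost constant time.\<close>

lemma CE_if_zero:
  assumes B: "CE B" and X: "CE X" and Y: "CE Y"
  shows "CE (\<lambda>\<rho> \<sigma>. if B \<rho> \<sigma> = 0 then X \<rho> \<sigma> else Y \<rho> \<sigma>)"
proof -
  have "(\<lambda>\<rho> \<sigma>. if B \<rho> \<sigma> = 0 then X \<rho> \<sigma> else Y \<rho> \<sigma>) =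
      (\<lambda>\<rho> \<sigma>. (1 - B \<rho> \<sigma>) * X \<rho> \<sigma> + (1 - (1 - B \<rho> \<sigma>)) * Y \<rho> \<sigma>)"
    by (intro ext) auto
  then show ?thesis
    by (simp only:) (intro CE_diff CE_add CE_mult CE_const assms)
qed

lemma CE_var: "CE (\<lambda>\<rho> \<sigma>. \<rho> i)"
  by (rule CE_reg[where r = "\<lambda>E. E - 1 - i"]) (auto simp: env_def)

text \<open>\<open>y - (y - k * wid \<sigma>)\<close> is the minimum of \<open>y\<close> and
  \<open>k * wid \<sigma>\<close>. An expression has to stay within constantly many words on all
  arguments, also on nonsensical ones read from uninitialized memory, so the exponent is
  capped.\<close>

definition pw :: "nat \<Rightarrow> state \<Rightarrow> nat \<Rightarrow> nat" where
  "pw k \<sigma> y = 2 ^ (y - (y - k * wid \<sigma>))"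

lemma pw_eq: "y \<le> k * wid \<sigma> \<Longrightarrow> pw k \<sigma> y = 2 ^ y"
  by (simp add: pw_def)

lemma CE_pw: assumes "CE F" shows "CE (\<lambda>\<rho> \<sigma>. pw k \<sigma> (F \<rho> \<sigma>))"
  unfolding pw_def
proof (rule CE_op[where h = "\<lambda>w x y. 2 ^ y" and g = Shl and Q = "\<lambda>w x y. x = 1 \<and> y \<le> k * w",
      OF CE_const[of 1]])
  show "CE (\<lambda>\<rho> \<sigma>. F \<rho> \<sigma> - (F \<rho> \<sigma> - k * wid \<sigma>))"
    by (intro CE_diff CE_mult CE_const CE_wid assms)
  fix A
  have "2 ^ y < (2 :: nat) ^ (Suc k * w)" if "1 \<le> w" "y \<le> k * w" for y w :: nat
    using that by (intro power_strict_increasing) auto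
  then show "\<exists>B. \<forall>w\<ge>1. \<forall>x y :: nat. x < 2 ^ (A * w) \<longrightarrow> y < 2 ^ (A * w) \<longrightarrow> x = 1 \<and> y \<le> k * w \<longrightarrow> (2 :: nat) ^ y < 2 ^ (B * w)"
    by blast
qed (auto simp: CE_const take_bit_nat_eq_self push_bit_eq_mult)

lemma load_word_less: "load_word s w m a < 2 ^ w"
proof -
  have "load_word s w m a \<le> (\<Sum>b<w. 2 ^ b)"
    unfolding load_word_def by (rule sum_mono) simp
  also have "\<dots> < 2 ^ w" by (induct w) auto
  finally show ?thesis .
qed

lemma CE_ld: assumes "CE F" shows "CE (\<lambda>\<rho> \<sigma>. ld \<sigma> (F \<rho> \<sigma>))"
  unfolding CE_def
proof (intro allI impI)
  fix E D A :: nat assume ED: "2 \<le> D \<and> E \<le> D"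
  obtain c1 l1 K1 T1 where c1: "computes F E D A c1 l1 K1 T1"
    using CE_E[OF assms] ED by blast
  define code where "code a = c1 a @ [Load D D]" for a
  have "computes (\<lambda>\<rho> \<sigma>. ld \<sigma> (F \<rho> \<sigma>)) E D A code (l1 + 1) (K1 + 1) (T1 + 1)"
    unfolding computes_def
  proof (intro conjI allI impI)
    fix a show "length (code a) = l1 + 1"
      using computes_len[OF c1] by (simp add: code_def)
  next
    fix K s w P a f
    assume K: "K1 + 1 \<le> K" and rd: "ready_at E A P (code a) a w f"
    then have w: "1 \<le> w" "code_at P a (code a)" "pc f = a" "regs f 1 = w" by (auto simp: ready_at_def)
    have ca: "code_at P a (c1 a)" "code_at P (a + l1) [Load D D]"
      using w(2) computes_len[OF c1] unfolding code_def code_at_append by auto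
    have "ready_at E A P (c1 a) a w f"
      using rd ca(1) unfolding ready_at_def by auto
    from computes_run[OF c1 _ this, of K s] K obtain f1 where f1:
      "reach s w (K * w) P T1 f f1" "pc f1 = a + l1" "mem f1 = mem f"
      "emitted f1 = emitted f" "\<forall>i<D. regs f1 i = regs f i"
      "regs f1 D = F (env E f) (snap s f)"
      by (metis add_leE)
    have b: "load_word s w (mem f) (F (env E f) (snap s f)) < 2 ^ (1 * w)"
      using load_word_less by simp
    then show "ld (snap s f) (F (env E f) (snap s f)) < 2 ^ ((K1 + 1) * w)"
      using w less_pow_mono[OF b, of "K1 + 1"] by (simp add: ld_def snap_def)
    have "reach s w (K * w) P (T1 + 1) f (exec_instr s w (K * w) (Load D D) f1)"
      by (rule reach_trans[OF f1(1) reach_instr[OF ca(2) f1(2)]])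
    then show "\<exists>f'. reach s w (K * w) P (T1 + 1) f f' \<and> pc f' = a + (l1 + 1) \<and> mem f' = mem f \<and>
         emitted f' = emitted f \<and> (\<forall>i<D. regs f' i = regs f i) \<and> regs f' D = ld (snap s f) (F (env E f) (snap s f))"
      by (intro exI conjI, assumption) (use f1 w take_bit_small[OF b, of K] K in \<open>auto simp: ld_def snap_def\<close>)
  qed
  then show "\<exists>code len K0 T. computes (\<lambda>\<rho> \<sigma>. ld \<sigma> (F \<rho> \<sigma>)) E D A code len K0 T" by blast
qed

definition CB :: "((nat \<Rightarrow> nat) \<Rightarrow> state \<Rightarrow> bool) \<Rightarrow> bool" where
  "CB B \<longleftrightarrow> CE (\<lambda>\<rho> \<sigma>. if B \<rho> \<sigma> then 1 else 0)"

lemma CB_less: "CE F1 \<Longrightarrow> CE F2 \<Longrightarrow> CB (\<lambda>\<rho> \<sigma>. F1 \<rho> \<sigma> < F2 \<rho> \<sigma>)"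
  unfolding CB_def by (rule CE_less)

lemma CB_not: assumes "CB B" shows "CB (\<lambda>\<rho> \<sigma>. \<not> B \<rho> \<sigma>)"
proof -
  have "(\<lambda>\<rho> \<sigma>. if \<not> B \<rho> \<sigma> then 1 else 0) = (\<lambda>\<rho> \<sigma>. 1 - (if B \<rho> \<sigma> then 1 else 0) :: nat)"
    by (intro ext) auto
  then show ?thesis
    using assms unfolding CB_def by (simp only:) (intro CE_diff CE_const)
qed

lemma CB_conj: assumes "CB B" "CB C" shows "CB (\<lambda>\<rho> \<sigma>. B \<rho> \<sigma> \<and> C \<rho> \<sigma>)"
proof -
  have "(\<lambda>\<rho> \<sigma>. if B \<rho> \<sigma> \<and> C \<rho> \<sigma> then 1 else 0) =
    (\<lambda>\<rho> \<sigma>. (if B \<rho> \<sigma> then 1 else 0) * (if C \<rho> \<sigma> then 1 else 0) :: nat)"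
    by (intro ext) auto
  then show ?thesis
    using assms unfolding CB_def by (simp only:) (intro CE_mult)
qed

lemma CB_disj: assumes "CB B" "CB C" shows "CB (\<lambda>\<rho> \<sigma>. B \<rho> \<sigma> \<or> C \<rho> \<sigma>)"
  using CB_not[OF CB_conj[OF CB_not[OF assms(1)] CB_not[OF assms(2)]]] by simp

lemma CB_le: "CE F1 \<Longrightarrow> CE F2 \<Longrightarrow> CB (\<lambda>\<rho> \<sigma>. F1 \<rho> \<sigma> \<le> F2 \<rho> \<sigma>)"
  using CB_not[OF CB_less[of F2 F1]] by (simp add: not_less)

lemma CB_eq: assumes "CE F1" "CE F2" shows "CB (\<lambda>\<rho> \<sigma>. F1 \<rho> \<sigma> = F2 \<rho> \<sigma>)"
  using CB_conj[OF CB_le[OF assms] CB_le[OF assms(2,1)]] by (simp add: eq_iff)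

lemma CE_if:
  assumes B: "CB B" and X: "CE X" and Y: "CE Y"
  shows "CE (\<lambda>\<rho> \<sigma>. if B \<rho> \<sigma> then X \<rho> \<sigma> else Y \<rho> \<sigma>)"
proof -
  have "(\<lambda>\<rho> \<sigma>. if B \<rho> \<sigma> then X \<rho> \<sigma> else Y \<rho> \<sigma>) =
      (\<lambda>\<rho> \<sigma>. if (if B \<rho> \<sigma> then 1 else 0) = (0 :: nat) then Y \<rho> \<sigma> else X \<rho> \<sigma>)"
    by (intro ext) auto
  then show ?thesis
    using CE_if_zero[OF B[unfolded CB_def] Y X] by simp
qed

section \<open>Commands: state changes in constant time\<close>

definition commands where
  "commands H E A code len K0 T \<longleftrightarrow> (\<forall>a. length (code a) = len) \<and>
    (\<forall>K\<ge>K0. \<forall>s w P a f. ready_at E A P (code a) a w f \<longrightarrow>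
      (\<exists>f'. reach s w (K * w) P T f f' \<and> pc f' = a + len \<and>
         emitted f' = emitted f \<and> (\<forall>i<E. regs f' i = regs f i) \<and>
         snap s f' = H (env E f) (snap s f)))"

text \<open>As in \<open>CE\<close>, the constants may depend on the width \<open>A\<close> of the
  variables. A composition feeds the width of one result into the choice of the next piece of
  code.\<close>

definition CM :: "((nat \<Rightarrow> nat) \<Rightarrow> state \<Rightarrow> state) \<Rightarrow> bool" where
  "CM H \<longleftrightarrow> (\<forall>E A. 2 \<le> E \<longrightarrow>
     (\<exists>(code :: nat \<Rightarrow> program) len K0 T. commands H E A code len K0 T))"

lemma commands_len: "commands H E A code len K0 T \<Longrightarrow> length (code a) = len"
  unfolding commands_def by simp

lemma commands_run:
  assumes "commands H E A code len K0 T" "K0 \<le> K" "ready_at E A P (code a) a w f"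
  obtains f' where "reach s w (K * w) P T f f'" "pc f' = a + len"
    "emitted f' = emitted f" "\<forall>i<E. regs f' i = regs f i"
    "snap s f' = H (env E f) (snap s f)"
  using assms unfolding commands_def by meson

lemma ready_at_codeD: "ready_at E A P c a w f \<Longrightarrow> code_at P a c" "ready_at E A P c a w f \<Longrightarrow> pc f = a"
  "ready_at E A P c a w f \<Longrightarrow> regs f 1 = w" "ready_at E A P c a w f \<Longrightarrow> 1 \<le> w"
  by (auto simp: ready_at_def)

lemma CM_id: "CM (\<lambda>\<rho> \<sigma>. \<sigma>)"
  unfolding CM_def
proof (intro allI impI exI)
  fix E A show "commands (\<lambda>\<rho> \<sigma>. \<sigma>) E A (\<lambda>a. []) 0 0 0"
    unfolding commands_def by (auto simp: ready_at_def intro!: exI reach_refl)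
qed

lemma CM_st:
  assumes X: "CE X" and Y: "CE Y"
  shows "CM (\<lambda>\<rho> \<sigma>. st \<sigma> (X \<rho> \<sigma>) (Y \<rho> \<sigma>))"
  unfolding CM_def
proof (intro allI impI)
  fix E A :: nat assume E: "2 \<le> E"
  obtain c1 l1 K1 T1 where c1: "computes X E E A c1 l1 K1 T1"
    using CE_E[OF X E order_refl] by blast
  obtain c2 l2 K2 T2 where c2: "computes Y E (Suc E) A c2 l2 K2 T2"
    using CE_E[OF Y, of "Suc E" E A] E by (metis le_SucI order_refl)
  define code where "code a = c1 a @ c2 (a + l1) @ [Store E (Suc E)]" for a
  have l: "length (c1 a) = l1" "length (c2 a) = l2" for a
    using c1 c2 by (auto dest: computes_len)
  have "commands (\<lambda>\<rho> \<sigma>. st \<sigma> (X \<rho> \<sigma>) (Y \<rho> \<sigma>)) E A code (l1 + l2 + 1) (K1 + K2) (T1 + T2 + 1)"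
    unfolding commands_def
  proof (intro conjI allI impI)
    fix a show "length (code a) = l1 + l2 + 1"
      using l by (simp add: code_def)
  next
    fix K s w P a f
    assume K: "K1 + K2 \<le> K" and rd: "ready_at E A P (code a) a w f"
    have ca: "code_at P a (c1 a)" "code_at P (a + l1) (c2 (a + l1))"
      "code_at P (a + l1 + l2) [Store E (Suc E)]"
      using ready_at_codeD(1)[OF rd] l unfolding code_def code_at_append by auto
    have "ready_at E A P (c1 a) a w f"
      using rd ca(1) unfolding ready_at_def by auto
    from computes_run[OF c1 _ this, of K s] K obtain f1 where f1:
      "reach s w (K * w) P T1 f f1" "pc f1 = a + l1" "mem f1 = mem f"
      "emitted f1 = emitted f" "\<forall>i<E. regs f1 i = regs f i"
      "regs f1 E = X (env E f) (snap s f)"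
      by (metis add_leE)
    have eq1: "env E f1 = env E f" "snap s f1 = snap s f"
      using f1 E by (auto intro!: env_cong snap_cong[of E])
    have "ready_at E A P (c2 (a + l1)) (a + l1) w f1"
      by (rule ready_at_cong[OF rd E order_refl _ ca(2) f1(2)]) (use f1 in auto)
    from computes_run[OF c2 _ this, of K s] K obtain f2 where f2:
      "reach s w (K * w) P T2 f1 f2" "pc f2 = a + l1 + l2" "mem f2 = mem f1"
      "emitted f2 = emitted f1" "\<forall>i<Suc E. regs f2 i = regs f1 i"
      "regs f2 (Suc E) = Y (env E f) (snap s f)"
      unfolding eq1 by (metis add_leE)
    have r: "regs f2 E = X (env E f) (snap s f)" "regs f2 0 = regs f 0" "regs f2 (Suc 0) = regs f (Suc 0)"
      "regs f (Suc 0) = w"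
      using f1 f2 E ready_at_codeD(3)[OF rd] by auto
    show "\<exists>f'. reach s w (K * w) P (T1 + T2 + 1) f f' \<and> pc f' = a + (l1 + l2 + 1) \<and>
         emitted f' = emitted f \<and> (\<forall>i<E. regs f' i = regs f i) \<and>
         snap s f' = st (snap s f) (X (env E f) (snap s f)) (Y (env E f) (snap s f))"
      by (rule exI, intro conjI, rule reach_trans[OF reach_trans[OF f1(1) f2(1)] reach_instr[OF ca(3) f2(2)]])
        (use f1(2-5) f2(2-6) r in \<open>simp_all add: st_def snap_def\<close>)
  qed
  then show "\<exists>code len K0 T. commands (\<lambda>\<rho> \<sigma>. st \<sigma> (X \<rho> \<sigma>) (Y \<rho> \<sigma>)) E A code len K0 T" by blast
qed

lemma CM_comp:
  assumes F: "CM F" and G: "CM G"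
  shows "CM (\<lambda>\<rho> \<sigma>. G \<rho> (F \<rho> \<sigma>))"
  unfolding CM_def
proof (intro allI impI)
  fix E A :: nat assume E: "2 \<le> E"
  obtain c1 l1 K1 T1 where c1: "commands F E A c1 l1 K1 T1"
    using F E unfolding CM_def by meson
  obtain c2 l2 K2 T2 where c2: "commands G E A c2 l2 K2 T2"
    using G E unfolding CM_def by meson
  define code where "code a = c1 a @ c2 (a + l1)" for a
  have l: "length (c1 a) = l1" "length (c2 a) = l2" for a
    using c1 c2 by (auto dest: commands_len)
  have "commands (\<lambda>\<rho> \<sigma>. G \<rho> (F \<rho> \<sigma>)) E A code (l1 + l2) (K1 + K2) (T1 + T2)"
    unfolding commands_def
  proof (intro conjI allI impI)
    fix a show "length (code a) = l1 + l2"
      using l by (simp add: code_def)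
  next
    fix K s w P a f
    assume K: "K1 + K2 \<le> K" and rd: "ready_at E A P (code a) a w f"
    have ca: "code_at P a (c1 a)" "code_at P (a + l1) (c2 (a + l1))"
      using ready_at_codeD(1)[OF rd] l unfolding code_def code_at_append by auto
    have "ready_at E A P (c1 a) a w f"
      using rd ca(1) unfolding ready_at_def by auto
    from commands_run[OF c1 _ this, of K s] K obtain f1 where f1:
      "reach s w (K * w) P T1 f f1" "pc f1 = a + l1"
      "emitted f1 = emitted f" "\<forall>i<E. regs f1 i = regs f i"
      "snap s f1 = F (env E f) (snap s f)"
      by (metis add_leE)
    have eq1: "env E f1 = env E f"
      using f1 E by (auto intro!: env_cong)
    have "ready_at E A P (c2 (a + l1)) (a + l1) w f1"
      by (rule ready_at_cong[OF rd E order_refl _ ca(2) f1(2)]) (use f1 in auto)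
    from commands_run[OF c2 _ this, of K s] K obtain f2 where f2:
      "reach s w (K * w) P T2 f1 f2" "pc f2 = a + l1 + l2"
      "emitted f2 = emitted f1" "\<forall>i<E. regs f2 i = regs f1 i"
      "snap s f2 = G (env E f) (snap s f1)"
      unfolding eq1 by (metis add_leE)
    show "\<exists>f'. reach s w (K * w) P (T1 + T2) f f' \<and> pc f' = a + (l1 + l2) \<and>
         emitted f' = emitted f \<and> (\<forall>i<E. regs f' i = regs f i) \<and>
         snap s f' = G (env E f) (F (env E f) (snap s f))"
      by (rule exI[of _ f2], intro conjI, rule reach_trans[OF f1(1) f2(1)])
        (use f1(2-5) f2(2-5) in simp_all)
  qed
  then show "\<exists>code len K0 T. commands (\<lambda>\<rho> \<sigma>. G \<rho> (F \<rho> \<sigma>)) E A code len K0 T" by blast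
qed

text \<open>Sequencing in the notation of the algorithms below, so that their computability follows
  by introduction rules along their syntax.\<close>

lemma CM_state_let: "CM F \<Longrightarrow> CM G \<Longrightarrow> CM (\<lambda>\<rho> \<sigma>. let \<sigma>' = F \<rho> \<sigma> in G \<rho> \<sigma>')"
  unfolding Let_def by (rule CM_comp)

lemma ready_at_bind:
  assumes rd: "ready_at E A P c a w f" and E: "2 \<le> E" and eq: "\<forall>i<E. regs f1 i = regs f i"
    and b: "regs f1 E < 2 ^ (K1 * w)" and c: "code_at P a' c'" "pc f1 = a'"
  shows "ready_at (Suc E) (A + K1) P c' a' w f1" "env (Suc E) f1 0 = regs f1 E"
    "(\<lambda>i. env (Suc E) f1 (Suc i)) = env E f"
proof -
  have "regs f1 i < 2 ^ ((A + K1) * w)" if "i < Suc E" for i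
    using rd eq b that less_pow_mono[of "regs f i" A w "A + K1"] less_pow_mono[of "regs f1 E" K1 w "A + K1"]
    unfolding ready_at_def less_Suc_eq by auto
  then show "ready_at (Suc E) (A + K1) P c' a' w f1"
    using c rd eq E unfolding ready_at_def by auto
  show "env (Suc E) f1 0 = regs f1 E" "(\<lambda>i. env (Suc E) f1 (Suc i)) = env E f"
    using eq unfolding env_def by (auto intro!: ext)
qed

text \<open>A value of the old memory is kept in the fresh register \<open>E\<close> while
  \<open>G\<close> changes the memory.\<close>

lemma CM_let:
  assumes X: "CE X" and G: "CM (\<lambda>\<rho> \<sigma>. G (\<rho> 0) (\<lambda>i. \<rho> (Suc i)) \<sigma>)"
  shows "CM (\<lambda>\<rho> \<sigma>. G (X \<rho> \<sigma>) \<rho> \<sigma>)"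
  unfolding CM_def
proof (intro allI impI)
  fix E A :: nat assume E: "2 \<le> E"
  let ?G = "\<lambda>\<rho> \<sigma>. G (\<rho> 0) (\<lambda>i. \<rho> (Suc i)) \<sigma>"
  obtain c1 l1 K1 T1 where c1: "computes X E E A c1 l1 K1 T1"
    using CE_E[OF X E order_refl] by blast
  obtain c2 l2 K2 T2 where c2: "commands ?G (Suc E) (A + K1) c2 l2 K2 T2"
    using G[unfolded CM_def, rule_format, of "Suc E" "A + K1"] E by auto
  define code where "code a = c1 a @ c2 (a + l1)" for a
  have l: "length (c1 a) = l1" "length (c2 a) = l2" for a
    using c1 c2 by (auto dest: commands_len computes_len)
  have "commands (\<lambda>\<rho> \<sigma>. G (X \<rho> \<sigma>) \<rho> \<sigma>) E A code (l1 + l2) (K1 + K2) (T1 + T2)"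
    unfolding commands_def
  proof (intro conjI allI impI)
    fix a show "length (code a) = l1 + l2"
      using l by (simp add: code_def)
  next
    fix K s w P a f
    assume K: "K1 + K2 \<le> K" and rd: "ready_at E A P (code a) a w f"
    have ca: "code_at P a (c1 a)" "code_at P (a + l1) (c2 (a + l1))"
      using ready_at_codeD(1)[OF rd] l unfolding code_def code_at_append by auto
    have "ready_at E A P (c1 a) a w f"
      using rd ca(1) unfolding ready_at_def by auto
    from computes_run[OF c1 _ this, of K s] K obtain f1 where f1:
      "reach s w (K * w) P T1 f f1" "pc f1 = a + l1" "mem f1 = mem f"
      "emitted f1 = emitted f" "\<forall>i<E. regs f1 i = regs f i"
      "regs f1 E = X (env E f) (snap s f)" "X (env E f) (snap s f) < 2 ^ (K1 * w)"
      by (metis add_leE)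
    have eq1: "snap s f1 = snap s f"
      using f1 E by (auto intro!: snap_cong[of E])
    note b = ready_at_bind[OF rd E f1(5) _ ca(2) f1(2), of K1, unfolded f1(6), OF f1(7)]
    from commands_run[OF c2 _ b(1), of K s] K obtain f2 where f2:
      "reach s w (K * w) P T2 f1 f2" "pc f2 = a + l1 + l2"
      "emitted f2 = emitted f1" "\<forall>i<Suc E. regs f2 i = regs f1 i"
      "snap s f2 = G (X (env E f) (snap s f)) (env E f) (snap s f)"
      unfolding eq1 b(2,3) by (metis add_leE)
    show "\<exists>f'. reach s w (K * w) P (T1 + T2) f f' \<and> pc f' = a + (l1 + l2) \<and>
         emitted f' = emitted f \<and> (\<forall>i<E. regs f' i = regs f i) \<and>
         snap s f' = G (X (env E f) (snap s f)) (env E f) (snap s f)"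
      by (rule exI[of _ f2], intro conjI, rule reach_trans[OF f1(1) f2(1)])
        (use f1(2-5) f2(2-5) in simp_all)
  qed
  then show "\<exists>code len K0 T. commands (\<lambda>\<rho> \<sigma>. G (X \<rho> \<sigma>) \<rho> \<sigma>) E A code len K0 T" by blast
qed

text \<open>Arguments that depend on the state are evaluated once, so that an induction about a
  command may assume them to be plain variables.\<close>

lemma CM_let2:
  assumes "CE X" "CE Y" and G: "CM (\<lambda>\<rho> \<sigma>. G (\<rho> 1) (\<rho> 0) \<sigma>)"
  shows "CM (\<lambda>\<rho> \<sigma>. G (X \<rho> \<sigma>) (Y \<rho> \<sigma>) \<sigma>)"
proof (rule CM_let[OF assms(1), of "\<lambda>x \<rho> \<sigma>. G x (Y \<rho> \<sigma>) \<sigma>"])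
  show "CM (\<lambda>\<rho> \<sigma>. G (\<rho> 0) (Y (\<lambda>i. \<rho> (Suc i)) \<sigma>) \<sigma>)"
    by (rule CM_let[OF CE_shift[OF assms(2)], of "\<lambda>y \<rho> \<sigma>. G (\<rho> 0) y \<sigma>"]) (use G in simp)
qed

lemma CM_nat_let:
  assumes "CE X" "CM (\<lambda>\<rho> \<sigma>. G (\<rho> 0) (\<lambda>i. \<rho> (Suc i)) \<sigma>)"
  shows "CM (\<lambda>\<rho> \<sigma>. let v = X \<rho> \<sigma> in G v \<rho> \<sigma>)"
  unfolding Let_def by (rule CM_let[OF assms])

text \<open>Unlike in \<open>CE_if_zero\<close> a genuine jump is required, since only one of the
  two state changes may happen.\<close>

lemma CM_if:
  assumes B: "CB B" and F: "CM F" and G: "CM G"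
  shows "CM (\<lambda>\<rho> \<sigma>. if B \<rho> \<sigma> then F \<rho> \<sigma> else G \<rho> \<sigma>)"
  unfolding CM_def
proof (intro allI impI)
  fix E A :: nat assume E: "2 \<le> E"
  let ?B = "\<lambda>\<rho> \<sigma>. if B \<rho> \<sigma> then 1 else (0 :: nat)"
  obtain c0 l0 K0 T0 where c0: "computes ?B E E A c0 l0 K0 T0"
    using CE_E[OF B[unfolded CB_def] E order_refl] by blast
  obtain c1 l1 K1 T1 where c1: "commands F E A c1 l1 K1 T1"
    using F E unfolding CM_def by meson
  obtain c2 l2 K2 T2 where c2: "commands G E A c2 l2 K2 T2"
    using G E unfolding CM_def by meson
  \<comment> \<open>The branch for false comes first: \<open>Jump_less\<close> falls through when
    the flag is 0.\<close>
  define code where "code a = c0 a @ [Const (Suc E) 0, Jump_less (Suc E) E (a + l0 + l2 + 3)] @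
     c2 (a + l0 + 2) @ [Jump (a + l0 + l2 + l1 + 3)] @ c1 (a + l0 + l2 + 3)" for a
  have l: "length (c0 a) = l0" "length (c1 a) = l1" "length (c2 a) = l2" for a
    using c0 c1 c2 by (auto dest: commands_len computes_len)
  have "commands (\<lambda>\<rho> \<sigma>. if B \<rho> \<sigma> then F \<rho> \<sigma> else G \<rho> \<sigma>) E A code (l0 + l2 + l1 + 3)
      (K0 + K1 + K2) (T0 + 3 + (T1 + T2))"
    unfolding commands_def
  proof (intro conjI allI impI)
    fix a show "length (code a) = l0 + l2 + l1 + 3"
      using l by (simp add: code_def)
  next
    fix K s w P a f
    assume K: "K0 + K1 + K2 \<le> K" and rd: "ready_at E A P (code a) a w f"
    have ca: "code_at P a (c0 a)"
      "code_at P (a + l0) [Const (Suc E) 0, Jump_less (Suc E) E (a + l0 + l2 + 3)]"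
      "code_at P (a + l0 + 2) (c2 (a + l0 + 2))"
      "code_at P (a + l0 + l2 + 2) [Jump (a + l0 + l2 + l1 + 3)]"
      "code_at P (a + l0 + l2 + 3) (c1 (a + l0 + l2 + 3))"
      using ready_at_codeD(1)[OF rd] l unfolding code_def code_at_append
      by (auto simp: algebra_simps numeral_3_eq_3)
    have cj: "code_at P (a + l0) [Const (Suc E) 0]"
      "code_at P (Suc (a + l0)) [Jump_less (Suc E) E (a + l0 + l2 + 3)]"
      using code_at_nth[OF ca(2), of 0] code_at_nth[OF ca(2), of 1] by simp_all
    have "ready_at E A P (c0 a) a w f"
      using rd ca(1) unfolding ready_at_def by auto
    from computes_run[OF c0 _ this, of K s] K obtain f1 where f1:
      "reach s w (K * w) P T0 f f1" "pc f1 = a + l0" "mem f1 = mem f"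
      "emitted f1 = emitted f" "\<forall>i<E. regs f1 i = regs f i"
      "regs f1 E = ?B (env E f) (snap s f)"
      by (metis add_leE)
    define f2 where "f2 = exec_instr s w (K * w) (Jump_less (Suc E) E (a + l0 + l2 + 3))
      (exec_instr s w (K * w) (Const (Suc E) 0) f1)"
    have r2: "reach s w (K * w) P (T0 + 2) f f2"
      unfolding f2_def
      by (rule reach_trans[OF f1(1)], subst numeral_2_eq_2,
          rule reach_step[OF cj(1) f1(2)], rule reach_step[OF cj(2)])
        (use f1(2) in \<open>simp_all add: reach_refl\<close>)
    have f2: "pc f2 = (if B (env E f) (snap s f) then a + l0 + l2 + 3 else a + l0 + 2)"
      "mem f2 = mem f" "emitted f2 = emitted f" "\<forall>i<E. regs f2 i = regs f i"
      using f1 by (simp_all add: f2_def)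
    have eq: "env E f2 = env E f" "snap s f2 = snap s f"
      using f2 E by (auto intro!: env_cong snap_cong[of E])
    show "\<exists>f'. reach s w (K * w) P (T0 + 3 + (T1 + T2)) f f' \<and> pc f' = a + (l0 + l2 + l1 + 3) \<and>
         emitted f' = emitted f \<and> (\<forall>i<E. regs f' i = regs f i) \<and>
         snap s f' = (if B (env E f) (snap s f) then F (env E f) (snap s f) else G (env E f) (snap s f))"
    proof (cases "B (env E f) (snap s f)")
      case True
      have "ready_at E A P (c1 (a + l0 + l2 + 3)) (a + l0 + l2 + 3) w f2"
        by (rule ready_at_cong[OF rd E order_refl f2(4) ca(5)]) (use f2 True in auto)
      from commands_run[OF c1 _ this, of K s] K obtain f3 where f3:
        "reach s w (K * w) P T1 f2 f3" "pc f3 = a + l0 + l2 + 3 + l1"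
        "emitted f3 = emitted f2" "\<forall>i<E. regs f3 i = regs f2 i"
        "snap s f3 = F (env E f) (snap s f)"
        unfolding eq by (metis add_leE)
      show ?thesis
        by (rule exI[of _ f3], intro conjI, rule reach_mono[OF reach_trans[OF r2 f3(1)]])
          (use f2(2-4) f3(2-5) True in simp_all)
    next
      case False
      have "ready_at E A P (c2 (a + l0 + 2)) (a + l0 + 2) w f2"
        by (rule ready_at_cong[OF rd E order_refl f2(4) ca(3)]) (use f2 False in auto)
      from commands_run[OF c2 _ this, of K s] K obtain f3 where f3:
        "reach s w (K * w) P T2 f2 f3" "pc f3 = a + l0 + 2 + l2"
        "emitted f3 = emitted f2" "\<forall>i<E. regs f3 i = regs f2 i"
        "snap s f3 = G (env E f) (snap s f)"
        unfolding eq by (metis add_leE)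
      have p3: "pc f3 = a + l0 + l2 + 2" using f3(2) by simp
      show ?thesis
        by (rule exI, intro conjI,
            rule reach_mono[OF reach_trans[OF reach_trans[OF r2 f3(1)] reach_instr[OF ca(4) p3]]])
          (use f2(2-4) f3(2-5) False in \<open>simp_all add: snap_def\<close>)
    qed
  qed
  then show "\<exists>code len K0 T. commands (\<lambda>\<rho> \<sigma>. if B \<rho> \<sigma> then F \<rho> \<sigma> else G \<rho> \<sigma>) E A code len K0 T"
    by blast
qed

section \<open>Complete programs\<close>

definition args_ok where
  "args_ok A args w \<longleftrightarrow> 2 \<le> length args \<and> 1 \<le> w \<and> args ! 1 = w \<and> (\<forall>x\<in>set args. x < 2 ^ (A * w))"

definition args_env :: "nat list \<Rightarrow> nat \<Rightarrow> nat" where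
  "args_env args = (\<lambda>i. if i < length args then args ! (length args - 1 - i) else 0)"

definition init_state :: "nat \<Rightarrow> nat list \<Rightarrow> memory \<Rightarrow> state" where
  "init_state s args m = \<lparr>lim = s, wid = args ! 1, univ = args ! 0, store = m\<rparr>"

lemma start_ready:
  assumes a: "args_ok A args w" and K: "A \<le> K" and P: "\<exists>y. P = c @ y"
  shows "ready_at (length args) A P c 0 w (start (K * w) args m)"
    "env (length args) (start (K * w) args m) = args_env args"
    "snap s (start (K * w) args m) = init_state s args m"
proof -
  have r: "regs (start (K * w) args m) i = args ! i" if "i < length args" for i
    using that a K take_bit_small[of "args ! i" A w K] by (simp add: start_def args_ok_def)
  show "ready_at (length args) A P c 0 w (start (K * w) args m)"
    unfolding ready_at_def using a r P by (auto simp: args_ok_def start_def code_at_def)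
  have "2 \<le> length args" using a by (simp add: args_ok_def)
  then show "env (length args) (start (K * w) args m) = args_env args"
    "snap s (start (K * w) args m) = init_state s args m"
    using r by (auto simp: env_def args_env_def snap_def init_state_def start_def intro!: ext)
qed

lemma halts_withinI:
  "reach s w L P t (start L args m) f \<Longrightarrow> pc f = length P \<Longrightarrow> halts_within s w L P args m t f"
  unfolding halts_within_def reach_def halted_def by auto

lemma CM_program:
  assumes H: "CM H" and E: "2 \<le> E"
  shows "\<exists>P K0 T. \<forall>K\<ge>K0. \<forall>s w args m. length args = E \<longrightarrow> args_ok A args w \<longrightarrow>
    (\<exists>f. halts_within s w (K * w) P args m T f \<and> mem f = store (H (args_env args) (init_state s args m)))"
proof -
  obtain c l K1 T where c: "commands H E A c l K1 T"
    using H E unfolding CM_def by meson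
  have "\<exists>f. halts_within s w (K * w) (c 0) args m T f \<and> mem f = store (H (args_env args) (init_state s args m))"
    if K: "K1 + A \<le> K" and a: "length args = E" "args_ok A args w" for K s w args m
  proof -
    have AK: "A \<le> K" and K1: "K1 \<le> K" using K by auto
    have "\<exists>y. c 0 = c 0 @ y" by simp
    note st = start_ready[OF a(2) AK this, unfolded a(1)]
    from commands_run[OF c K1 st(1), of s m] obtain f where f:
      "reach s w (K * w) (c 0) T (start (K * w) args m) f" "pc f = 0 + l"
      "snap s f = H (args_env args) (init_state s args m)"
      unfolding st(2,3) by metis
    have "store (snap s f) = mem f" by (simp add: snap_def)
    then show ?thesis
      using f halts_withinI[OF f(1)] commands_len[OF c] by (intro exI[of _ f]) simp
  qed
  then show ?thesis by blast
qed

lemma CE_program: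
  assumes V: "CE V" and E: "2 \<le> E"
  shows "\<exists>P K0 T. \<forall>K\<ge>K0. \<forall>s w args m. length args = E \<longrightarrow> args_ok A args w \<longrightarrow>
    (\<exists>f. halts_within s w (K * w) P args m T f \<and> mem f = m \<and> result f = V (args_env args) (init_state s args m))"
proof -
  obtain c l K1 T where c: "computes V E E A c l K1 T"
    using CE_E[OF V E order_refl] by blast
  \<comment> \<open>Register 0 holds \<open>n\<close> during the computation and receives the result
    only at the very end.\<close>
  let ?P = "c 0 @ [Const (Suc E) 0, Op Add 0 E (Suc E)]"
  have "\<exists>f. halts_within s w (K * w) ?P args m (T + 2) f \<and> mem f = m \<and>
      result f = V (args_env args) (init_state s args m)"
    if K: "K1 + A \<le> K" and a: "length args = E" "args_ok A args w" for K s w args m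
  proof -
    have AK: "A \<le> K" and K1: "K1 \<le> K" using K by auto
    have "\<exists>y. ?P = c 0 @ y" by simp
    note st = start_ready[OF a(2) AK this, unfolded a(1)]
    have m0: "mem (start (K * w) args m) = m" by (simp add: start_def)
    obtain f where f: "reach s w (K * w) ?P T (start (K * w) args m) f" "pc f = 0 + l" "mem f = m"
      "regs f E = V (args_env args) (init_state s args m)"
      "V (args_env args) (init_state s args m) < 2 ^ (K1 * w)"
      by (rule computes_run[OF c K1 st(1), of s m, unfolded st(2,3) m0])
    have "code_at ?P l [Const (Suc E) 0, Op Add 0 E (Suc E)]"
      using computes_len[OF c, of 0] unfolding code_at_def by auto
    from code_at_nth[OF this, of 0] code_at_nth[OF this, of 1]
    have cj: "code_at ?P l [Const (Suc E) 0]" "code_at ?P (Suc l) [Op Add 0 E (Suc E)]"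
      by simp_all
    let ?f = "exec_instr s w (K * w) (Op Add 0 E (Suc E)) (exec_instr s w (K * w) (Const (Suc E) 0) f)"
    have "reach s w (K * w) ?P (T + Suc (Suc 0)) (start (K * w) args m) ?f"
      by (rule reach_trans[OF f(1)], rule reach_step[OF cj(1)], use f(2) in simp,
          rule reach_step[OF cj(2)]) (use f(2) in \<open>simp_all add: reach_refl\<close>)
    then have "halts_within s w (K * w) ?P args m (T + Suc (Suc 0)) ?f"
      by (rule halts_withinI) (use f(2) computes_len[OF c, of 0] in simp)
    then show ?thesis
      using f(3-5) take_bit_small[OF f(5) K1] by (intro exI[of _ ?f]) (simp add: numeral_2_eq_2)
  qed
  then show ?thesis by blast
qed

text \<open>
  \<open>lnk nx s xs e\<close>: following pointers from \<open>s\<close>, where 0 is NIL and \<open>Suc x\<close> points to \<open>x\<close>, one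
  runs through \<open>xs\<close> and ends with the pointer \<open>e\<close>.
\<close>

fun lnk :: "(nat \<Rightarrow> nat) \<Rightarrow> nat \<Rightarrow> nat list \<Rightarrow> nat \<Rightarrow> bool" where
  "lnk nx s [] e \<longleftrightarrow> s = e"
| "lnk nx s (x # xs) e \<longleftrightarrow> s = Suc x \<and> lnk nx (nx x) xs e"

definition push :: "nat \<Rightarrow> (nat \<Rightarrow> nat) \<Rightarrow> nat \<Rightarrow> nat" where
  "push x \<rho> = (\<lambda>i. case i of 0 \<Rightarrow> x | Suc i \<Rightarrow> \<rho> i)"

lemma push_simps [simp]: "push x \<rho> 0 = x" "push x \<rho> (Suc i) = \<rho> i"
  by (simp_all add: push_def)

lemma env_push: "env (Suc E) f = push (regs f E) (env E f)"
  by (auto simp: env_def push_def intro!: ext split: nat.split)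

text \<open>\<open>F\<close> yields the initial pointer, \<open>N\<close> the pointer after the
  current one, and \<open>B\<close> decides whether to emit. \<open>B\<close> and \<open>N\<close>
  see the pointer value \<open>Suc x\<close> as the latest variable, which is also the emitted
  element because the universe starts at 1. The memory is not written, so every round refers to the
  initial state.\<close>

lemma enum_program:
  assumes F: "CE F" and B: "CB B" and N: "CE N" and E: "2 \<le> E"
  shows "\<exists>P K0 T. \<forall>K\<ge>K0. \<forall>s w args m xs. length args = E \<longrightarrow> args_ok A args w \<longrightarrow>
    (\<forall>x\<in>set xs. Suc x < 2 ^ (A * w)) \<longrightarrow>
    lnk (\<lambda>x. N (push (Suc x) (args_env args)) (init_state s args m))
      (F (args_env args) (init_state s args m)) xs 0 \<longrightarrow>
    (\<exists>f. halts_within s w (K * w) P args m (T * (length xs + 1)) f \<and> mem f = m \<and>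
      emitted f = map Suc (filter (\<lambda>x. B (push (Suc x) (args_env args)) (init_state s args m)) xs))"
proof -
  let ?B = "\<lambda>\<rho> \<sigma>. if B \<rho> \<sigma> then 1 else (0 :: nat)"
  have E': "2 \<le> Suc E" using E by simp
  obtain c1 l1 K1 T1 where c1: "computes F E E A c1 l1 K1 T1"
    using CE_E[OF F E order_refl] by blast
  obtain cb lb Kb Tb where cb: "computes ?B (Suc E) (Suc E) A cb lb Kb Tb"
    using CE_E[OF B[unfolded CB_def] E' order_refl] by blast
  obtain cn ln Kn Tn where cn: "computes N (Suc E) (Suc E) A cn ln Kn Tn"
    using CE_E[OF N E' order_refl] by blast
  define q where "q = l1 + 3 + lb"
  define r where "r = q + 4 + ln"
  \<comment> \<open>Register \<open>E\<close> holds the current pointer. \<open>J1\<close> leaves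
    the loop at NIL, \<open>J2\<close> emits if \<open>B\<close> said so, and \<open>J3\<close>
    copies the next pointer into \<open>E\<close> and returns to \<open>J1\<close>.\<close>
  define J1 where "J1 = [Const (Suc E) 0, Jump_less (Suc E) E (l1 + 3), Jump (r + 3)]"
  define J2 where "J2 = [Const (Suc (Suc E)) 0, Jump_less (Suc (Suc E)) (Suc E) (q + 3), Jump (q + 4), Emit E]"
  define J3 where "J3 = [Const E 0, Op Add E E (Suc E), Jump l1]"
  define P where "P = c1 0 @ J1 @ cb (l1 + 3) @ J2 @ cn (q + 4) @ J3"
  have l: "length (c1 0) = l1" "length (cb (l1 + 3)) = lb" "length (cn (q + 4)) = ln"
    "length J1 = 3" "length J2 = 4" "length J3 = 3"
    using c1 cb cn by (auto dest: computes_len simp: J1_def J2_def J3_def)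
  have lP: "length P = r + 3"
    using l by (simp add: P_def r_def q_def)
  have all: "code_at P 0 (c1 0 @ J1 @ cb (l1 + 3) @ J2 @ cn (q + 4) @ J3)"
    unfolding code_at_def P_def by auto
  have at: "code_at P l1 J1" "code_at P (l1 + 3) (cb (l1 + 3))" "code_at P q J2"
      "code_at P (q + 4) (cn (q + 4))" "code_at P r J3"
    using all unfolding code_at_append by (simp_all add: l q_def r_def computes_len[OF cn])
  have i1: "code_at P l1 [Const (Suc E) 0]" "code_at P (Suc l1) [Jump_less (Suc E) E (l1 + 3)]"
    "code_at P (Suc (Suc l1)) [Jump (r + 3)]"
    using code_at_nth[OF at(1), of 0] code_at_nth[OF at(1), of 1] code_at_nth[OF at(1), of 2]
    by (simp_all add: J1_def)
  have i2: "code_at P q [Const (Suc (Suc E)) 0]"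
    "code_at P (Suc q) [Jump_less (Suc (Suc E)) (Suc E) (q + 3)]"
    "code_at P (Suc (Suc q)) [Jump (q + 4)]" "code_at P (q + 3) [Emit E]"
    using code_at_nth[OF at(3), of 0] code_at_nth[OF at(3), of 1] code_at_nth[OF at(3), of 2]
      code_at_nth[OF at(3), of 3]
    by (simp_all add: J2_def)
  have i3: "code_at P r [Const E 0]" "code_at P (Suc r) [Op Add E E (Suc E)]" "code_at P (Suc (Suc r)) [Jump l1]"
    using code_at_nth[OF at(5), of 0] code_at_nth[OF at(5), of 1] code_at_nth[OF at(5), of 2]
    by (simp_all add: J3_def)
  define T where "T = Tb + Tn + 9"
  have main: "\<exists>f. halts_within s w (K * w) P args m ((T1 + T + 3) * (length xs + 1)) f \<and> mem f = m \<and>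
      emitted f = map Suc (filter (\<lambda>x. B (push (Suc x) (args_env args)) (init_state s args m)) xs)"
    if K: "K1 + Kb + Kn + A \<le> K" and a: "length args = E" "args_ok A args w"
      and bd: "\<forall>x\<in>set xs. Suc x < 2 ^ (A * w)"
      and ln: "lnk (\<lambda>x. N (push (Suc x) (args_env args)) (init_state s args m))
        (F (args_env args) (init_state s args m)) xs 0" for K s w args m xs
  proof -
    let ?nx = "\<lambda>x. N (push (Suc x) (args_env args)) (init_state s args m)"
    let ?b = "\<lambda>x. B (push (Suc x) (args_env args)) (init_state s args m)"
    have mx: "max 2 E = E" "max 2 (Suc E) = Suc E" using E by auto
    have AK: "A \<le> K" and KK: "K1 \<le> K" "Kb \<le> K" "Kn \<le> K" using K by auto
    have "\<exists>y. P = c1 0 @ y" by (simp add: P_def)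
    note st = start_ready[OF a(2) AK this, unfolded a(1)]
    let ?f0 = "start (K * w) args m"
    let ?inv = "\<lambda>f. mem f = m \<and> (\<forall>i<E. regs f i = regs ?f0 i)"
    have invD: "ready_at (Suc E) A P c a w f \<and> env (Suc E) f = push (regs f E) (args_env args) \<and>
        snap s f = init_state s args m"
      if "?inv f" "regs f E < 2 ^ (A * w)" "code_at P a c" "pc f = a" for f a c
    proof -
      have 0: "regs f 1 = regs ?f0 1" "regs f 0 = regs ?f0 0" "mem f = mem ?f0" "\<forall>i<E. regs f i = regs ?f0 i"
        using that(1) E by (auto simp: start_def)
      have "env E f = env E ?f0" by (rule env_cong[OF 0(4)])
      then have "env E f = args_env args" by (simp only: st(2))
      moreover have "snap s f = snap s ?f0" using 0 by (simp add: snap_def)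
      ultimately show ?thesis
        using that(2-4) 0 st(1,3) unfolding ready_at_def mx by (auto simp: env_push less_Suc_eq)
    qed
    have round: "\<exists>f'. reach s w (K * w) P T f f' \<and> ?inv f' \<and> pc f' = l1 \<and> regs f' E = ?nx x \<and>
        emitted f' = emitted f @ (if ?b x then [Suc x] else [])"
      if f: "?inv f" "pc f = l1" "regs f E = Suc x" and x: "Suc x < 2 ^ (A * w)" for f x
    proof -
      let ?e = "exec_instr s w (K * w)"
      define f1 where "f1 = ?e (Jump_less (Suc E) E (l1 + 3)) (?e (Const (Suc E) 0) f)"
      have r1: "reach s w (K * w) P 2 f f1"
        unfolding f1_def numeral_2_eq_2
        by (rule reach_step[OF i1(1) f(2)], rule reach_step[OF i1(2)]) (use f(2) in \<open>simp_all add: reach_refl\<close>)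
      have f1: "?inv f1" "pc f1 = l1 + 3" "regs f1 E = Suc x" "emitted f1 = emitted f"
        using f by (simp_all add: f1_def)
      have "regs f1 E < 2 ^ (A * w)" using f1(3) x by simp
      note d1 = invD[OF f1(1) this at(2) f1(2)]
      from computes_run[OF cb KK(2), of P "l1 + 3" w f1 s] d1 obtain f2 where f2:
        "reach s w (K * w) P Tb f1 f2" "pc f2 = q" "mem f2 = mem f1" "emitted f2 = emitted f1"
        "\<forall>i<Suc E. regs f2 i = regs f1 i" "regs f2 (Suc E) = (if ?b x then 1 else 0)"
        unfolding q_def f1(3)[symmetric] by metis
      define f3 where "f3 = ?e (Jump_less (Suc (Suc E)) (Suc E) (q + 3)) (?e (Const (Suc (Suc E)) 0) f2)"
      have r3: "reach s w (K * w) P 2 f2 f3"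
        unfolding f3_def numeral_2_eq_2
        by (rule reach_step[OF i2(1) f2(2)], rule reach_step[OF i2(2)]) (use f2(2) in \<open>simp_all add: reach_refl\<close>)
      have f3: "?inv f3" "pc f3 = (if ?b x then q + 3 else q + 2)" "regs f3 E = Suc x" "emitted f3 = emitted f"
        using f1 f2 by (simp_all add: f3_def)
      define f4 where "f4 = (if ?b x then ?e (Emit E) f3 else ?e (Jump (q + 4)) f3)"
      have r4: "reach s w (K * w) P 1 f3 f4"
      proof (cases "?b x")
        case True
        then show ?thesis
          using reach_instr[OF i2(4), of f3 s w "K * w"] f3(2) unfolding f4_def by (simp only: if_True)
      next
        case False
        then show ?thesis
          using reach_instr[OF i2(3), of f3 s w "K * w"] f3(2) unfolding f4_def
          by (simp only: if_False add_2_eq_Suc')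
      qed
      have f4: "?inv f4" "pc f4 = q + 4" "regs f4 E = Suc x"
        "emitted f4 = emitted f @ (if ?b x then [Suc x] else [])"
        using f3 by (simp_all add: f4_def)
      have "regs f4 E < 2 ^ (A * w)" using f4(3) x by simp
      note d4 = invD[OF f4(1) this at(4) f4(2)]
      from computes_run[OF cn KK(3), of P "q + 4" w f4 s] d4 obtain f5 where f5:
        "reach s w (K * w) P Tn f4 f5" "pc f5 = r" "mem f5 = mem f4" "emitted f5 = emitted f4"
        "\<forall>i<Suc E. regs f5 i = regs f4 i" "regs f5 (Suc E) = ?nx x" "?nx x < 2 ^ (Kn * w)"
        unfolding r_def f4(3)[symmetric] by metis
      define f6 where "f6 = ?e (Jump l1) (?e (Op Add E E (Suc E)) (?e (Const E 0) f5))"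
      have r6: "reach s w (K * w) P (Suc (Suc (Suc 0))) f5 f6"
        unfolding f6_def
        by (rule reach_step[OF i3(1) f5(2)], rule reach_step[OF i3(2)], use f5(2) in simp,
            rule reach_step[OF i3(3)]) (use f5(2) in \<open>simp_all add: reach_refl\<close>)
      have f6: "?inv f6" "pc f6 = l1" "regs f6 E = ?nx x" "emitted f6 = emitted f4"
        using f4(1) f5 take_bit_small[OF f5(7) KK(3)] by (simp_all add: f6_def)
      have "reach s w (K * w) P T f f6"
        unfolding T_def
        by (rule reach_mono[OF reach_trans[OF reach_trans[OF reach_trans[OF reach_trans[OF
              reach_trans[OF r1 f2(1)] r3] r4] f5(1)] r6]]) simp
      then show ?thesis using f6 f4(4) by auto
    qed
    have loop: "\<exists>f'. reach s w (K * w) P (T * length ys + 3) f f' \<and> mem f' = m \<and> pc f' = r + 3 \<and>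
        emitted f' = emitted f @ map Suc (filter ?b ys)"
      if "?inv f" "pc f = l1" "lnk ?nx (regs f E) ys 0" "\<forall>x\<in>set ys. Suc x < 2 ^ (A * w)" for f ys
      using that
    proof (induction ys arbitrary: f)
      case Nil
      let ?e = "exec_instr s w (K * w)"
      let ?f' = "?e (Jump (r + 3)) (?e (Jump_less (Suc E) E (l1 + 3)) (?e (Const (Suc E) 0) f))"
      have "reach s w (K * w) P (Suc (Suc (Suc 0))) f ?f'"
        by (rule reach_step[OF i1(1) Nil(2)], rule reach_step[OF i1(2)], use Nil in simp,
            rule reach_step[OF i1(3)]) (use Nil in \<open>simp_all add: reach_refl\<close>)
      then show ?case
        using Nil by (intro exI[of _ ?f']) (simp add: numeral_3_eq_3)
    next
      case (Cons y ys)
      then obtain f1 where f1: "reach s w (K * w) P T f f1" "?inv f1" "pc f1 = l1" "regs f1 E = ?nx y"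
        "emitted f1 = emitted f @ (if ?b y then [Suc y] else [])"
        using round[of f y] by auto
      have "lnk ?nx (regs f1 E) ys 0" using Cons.prems(3) f1(4) by simp
      from Cons.IH[OF f1(2,3) this] Cons.prems(4) obtain f2 where f2:
        "reach s w (K * w) P (T * length ys + 3) f1 f2" "mem f2 = m" "pc f2 = r + 3"
        "emitted f2 = emitted f1 @ map Suc (filter ?b ys)"
        by auto
      have "reach s w (K * w) P (T * length (y # ys) + 3) f f2"
        by (rule reach_mono[OF reach_trans[OF f1(1) f2(1)]]) simp
      then show ?case
        using f2 f1(5) by (intro exI[of _ f2]) auto
    qed
    obtain f1 where f1: "reach s w (K * w) P T1 ?f0 f1" "pc f1 = 0 + l1" "mem f1 = mem ?f0"
      "emitted f1 = emitted ?f0" "\<forall>i<E. regs f1 i = regs ?f0 i"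
      "regs f1 E = F (args_env args) (init_state s args m)"
      by (rule computes_run[OF c1 KK(1) st(1), of s m, unfolded st(2,3)])
    have m0: "mem ?f0 = m" "emitted ?f0 = []" by (simp_all add: start_def)
    note f1 = f1[unfolded m0]
    have "\<exists>f'. reach s w (K * w) P (T * length xs + 3) f1 f' \<and> mem f' = m \<and> pc f' = r + 3 \<and>
        emitted f' = emitted f1 @ map Suc (filter ?b xs)"
      by (rule loop) (use f1 ln bd in auto)
    then obtain f2 where f2: "reach s w (K * w) P (T * length xs + 3) f1 f2" "mem f2 = m"
      "pc f2 = r + 3" "emitted f2 = map Suc (filter ?b xs)"
      using f1(4) by auto
    have "reach s w (K * w) P ((T1 + T + 3) * (length xs + 1)) ?f0 f2"
      by (rule reach_mono[OF reach_trans[OF f1(1) f2(1)]]) (simp add: algebra_simps)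
    then show ?thesis
      using halts_withinI[of s w "K * w" P _ args m f2] f2 lP by (intro exI[of _ f2]) simp
  qed
  then show ?thesis by blast
qed

section \<open>Bit fields of any position and length\<close>

definition fld :: "(nat \<Rightarrow> bool) \<Rightarrow> nat \<Rightarrow> nat \<Rightarrow> nat" where
  "fld B o' l = horner_sum of_bool 2 (map (\<lambda>i. B (o' + i)) [0..<l])"

lemma bit_fld: "bit (fld B o' l) i \<longleftrightarrow> i < l \<and> B (o' + i)"
  by (auto simp: fld_def bit_horner_sum_bit_iff)

lemma fld_cong: "(\<And>i. i < l \<Longrightarrow> B (o' + i) = B' (o' + i)) \<Longrightarrow> fld B o' l = fld B' o' l"
  by (auto simp: bit_eq_iff bit_fld)

lemma fld_less: "fld B o' l < 2 ^ l"
  unfolding fld_def using horner_sum_of_bool_2_less[of "map (\<lambda>i. B (o' + i)) [0..<l]"] by simp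

lemma fld_eqI: "v < 2 ^ l \<Longrightarrow> (\<And>i. i < l \<Longrightarrow> B (o' + i) = bit v i) \<Longrightarrow> fld B o' l = v"
proof -
  assume v: "v < 2 ^ l" and B: "\<And>i. i < l \<Longrightarrow> B (o' + i) = bit v i"
  have "bit v i \<Longrightarrow> i < l" for i
    using v by (metis bit_take_bit_iff take_bit_nat_eq_self)
  with B show ?thesis by (auto simp: bit_eq_iff bit_fld)
qed

text \<open>Positions past the end of the memory count as 0, in agreement with
  \<open>load_word\<close>.\<close>

definition bitv :: "state \<Rightarrow> nat \<Rightarrow> bool" where
  "bitv \<sigma> p \<longleftrightarrow> p < lim \<sigma> \<and> store \<sigma> p"

lemma ld_fld: "ld \<sigma> a = fld (bitv \<sigma>) (a * wid \<sigma>) (wid \<sigma>)"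
  unfolding ld_def load_word_def fld_def horner_sum_eq_sum
  by (intro sum.cong) (auto simp: bitv_def)

text \<open>No carry can occur, so the sum is a concatenation of bit strings.\<close>

lemma bit_add_mult_pow:
  assumes "x < 2 ^ w"
  shows "bit (x + y * 2 ^ w :: nat) t \<longleftrightarrow> (if t < w then bit x t else bit y (t - w))"
proof (cases "t < w")
  case True
  then have "(2 :: nat) ^ w = 2 ^ (w - t) * 2 ^ t"
    by (simp flip: power_add)
  then have e: "x + y * 2 ^ w = x + (y * 2 ^ (w - t)) * 2 ^ t"
    by (simp only: mult.assoc)
  have "(x + y * 2 ^ w) div 2 ^ t = x div 2 ^ t + y * 2 ^ (w - t)"
    unfolding e by simp
  with True show ?thesis by (simp add: bit_iff_odd)
next
  case False
  have "(x + y * 2 ^ w) div 2 ^ t = (x + y * 2 ^ w) div 2 ^ w div 2 ^ (t - w)"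
    unfolding div_mult2_eq[symmetric] power_add[symmetric] using False by simp
  also have "(x + y * 2 ^ w) div 2 ^ w = y" using assms by simp
  finally show ?thesis using False by (simp add: bit_iff_odd)
qed

fun win :: "nat \<Rightarrow> state \<Rightarrow> nat \<Rightarrow> nat" where
  "win 0 \<sigma> a = 0"
| "win (Suc j) \<sigma> a = ld \<sigma> a + win j \<sigma> (Suc a) * pw 1 \<sigma> (wid \<sigma>)"

lemma bit_win: "1 \<le> wid \<sigma> \<Longrightarrow> bit (win j \<sigma> a) t \<longleftrightarrow> t < j * wid \<sigma> \<and> bitv \<sigma> (a * wid \<sigma> + t)"
proof (induction j arbitrary: a t)
  case (Suc j)
  have "pw 1 \<sigma> (wid \<sigma>) = 2 ^ wid \<sigma>" by (simp add: pw_eq)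
  moreover have "ld \<sigma> a < 2 ^ wid \<sigma>" by (simp add: ld_fld fld_less)
  ultimately show ?case
    using Suc.IH[OF Suc.prems, of "Suc a" "t - wid \<sigma>"]
    by (simp add: bit_add_mult_pow) (auto simp: ld_fld bit_fld algebra_simps)
qed simp

text \<open>A field of at most \<open>k\<close> words may begin inside a word; a window of
  \<open>k + 2\<close> words covers it.\<close>

definition rd :: "nat \<Rightarrow> state \<Rightarrow> nat \<Rightarrow> nat \<Rightarrow> nat" where
  "rd k \<sigma> o' l = win (k + 2) \<sigma> (o' div wid \<sigma>) div pw 1 \<sigma> (o' mod wid \<sigma>) mod pw k \<sigma> l"

lemma bit_div_pow: "bit (x div 2 ^ a :: nat) t \<longleftrightarrow> bit x (a + t)"
  by (simp add: bit_drop_bit_eq flip: drop_bit_eq_div)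

lemma bit_mod_pow: "bit (x mod 2 ^ a :: nat) t \<longleftrightarrow> t < a \<and> bit x t"
  by (simp add: bit_take_bit_iff flip: take_bit_eq_mod)

lemma rd_eq:
  assumes w: "1 \<le> wid \<sigma>" and l: "l \<le> k * wid \<sigma>"
  shows "rd k \<sigma> o' l = fld (bitv \<sigma>) o' l"
proof -
  have "o' mod wid \<sigma> < wid \<sigma>" using w by simp
  then have "pw 1 \<sigma> (o' mod wid \<sigma>) = 2 ^ (o' mod wid \<sigma>)" "o' mod wid \<sigma> + t < (k + 2) * wid \<sigma>" if "t < l" for t
    using l that by (auto simp: pw_eq algebra_simps)
  moreover have "pw 1 \<sigma> (o' mod wid \<sigma>) = 2 ^ (o' mod wid \<sigma>)"
    using \<open>o' mod wid \<sigma> < wid \<sigma>\<close> by (simp add: pw_eq)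
  moreover have "o' div wid \<sigma> * wid \<sigma> + (o' mod wid \<sigma> + t) = o' + t" for t
    by (metis add.assoc div_mult_mod_eq)
  ultimately show ?thesis
    using w l unfolding rd_def bit_eq_iff
    by (auto simp: pw_eq bit_mod_pow bit_div_pow bit_win bit_fld simp del: win.simps)
qed

fun stw :: "nat \<Rightarrow> state \<Rightarrow> nat \<Rightarrow> nat \<Rightarrow> state" where
  "stw 0 \<sigma> a W = \<sigma>"
| "stw (Suc j) \<sigma> a W = (let \<sigma>' = st \<sigma> a (W mod pw 1 \<sigma> (wid \<sigma>)) in stw j \<sigma>' (Suc a) (W div pw 1 \<sigma>' (wid \<sigma>')))"

definition same :: "state \<Rightarrow> state \<Rightarrow> bool" where
  "same \<sigma> \<sigma>' \<longleftrightarrow> lim \<sigma>' = lim \<sigma> \<and> wid \<sigma>' = wid \<sigma> \<and> univ \<sigma>' = univ \<sigma>"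

lemma same_refl [simp]: "same \<sigma> \<sigma>" by (simp add: same_def)
lemma same_trans: "same a b \<Longrightarrow> same b d \<Longrightarrow> same a d" by (simp add: same_def)

lemma same_st: "same \<sigma> (st \<sigma> a v)"
  by (simp add: same_def st_def)

lemma same_stw: "same \<sigma> (stw j \<sigma> a W)"
proof (induction j arbitrary: \<sigma> a W)
  case (Suc j)
  show ?case
    unfolding stw.simps Let_def by (rule same_trans[OF same_st Suc.IH])
qed simp

lemma bitv_st:
  assumes "1 \<le> wid \<sigma>"
  shows "bitv (st \<sigma> a v) p \<longleftrightarrow>
    (if p < lim \<sigma> \<and> p div wid \<sigma> = a then bit v (p mod wid \<sigma>) else bitv \<sigma> p)"
  by (auto simp: bitv_def st_def store_word_def)

lemma bitv_stw:
  "1 \<le> wid \<sigma> \<Longrightarrow> bitv (stw j \<sigma> a W) p \<longleftrightarrow>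
    (if p < lim \<sigma> \<and> a * wid \<sigma> \<le> p \<and> p < (a + j) * wid \<sigma> then bit W (p - a * wid \<sigma>) else bitv \<sigma> p)"
proof (induction j arbitrary: \<sigma> a W)
  case (Suc j)
  let ?w = "wid \<sigma>"
  define \<sigma>' where "\<sigma>' = st \<sigma> a (W mod pw 1 \<sigma> ?w)"
  have s: "wid \<sigma>' = ?w" "lim \<sigma>' = lim \<sigma>" using same_st[of \<sigma>] by (auto simp: \<sigma>'_def same_def)
  have pw: "pw 1 \<sigma> ?w = 2 ^ ?w" "pw 1 \<sigma>' ?w = 2 ^ ?w" by (simp_all add: pw_eq s)
  have b: "bitv \<sigma>' p \<longleftrightarrow> (if p < lim \<sigma> \<and> p div ?w = a then bit W (p mod ?w) else bitv \<sigma> p)"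
    unfolding \<sigma>'_def bitv_st[OF Suc.prems] pw using Suc.prems by (simp add: bit_mod_pow)
  have d: "p div ?w = a \<longleftrightarrow> a * ?w \<le> p \<and> p < (a + 1) * ?w"
    using Suc.prems by (metis Suc_eq_plus1 Suc_le_eq div_nat_eqI dividend_less_div_times div_times_less_eq_dividend One_nat_def less_eq_Suc_le mult.commute mult_Suc)
  have m: "p mod ?w = p - a * ?w" if "p div ?w = a"
    using that by (metis minus_div_mult_eq_mod)
  have IH: "bitv (stw j \<sigma>' (Suc a) (W div 2 ^ ?w)) p \<longleftrightarrow>
     (if p < lim \<sigma> \<and> Suc a * ?w \<le> p \<and> p < (Suc a + j) * ?w then bit W (?w + (p - Suc a * ?w)) else bitv \<sigma>' p)"
    using Suc.IH[of \<sigma>' "Suc a" "W div 2 ^ ?w"] Suc.prems by (simp add: s bit_div_pow)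
  have "bitv (stw (Suc j) \<sigma> a W) p = bitv (stw j \<sigma>' (Suc a) (W div 2 ^ ?w)) p"
    unfolding stw.simps Let_def unfolding \<sigma>'_def[symmetric] unfolding s pw ..
  also have "\<dots> \<longleftrightarrow> (if p < lim \<sigma> \<and> a * ?w \<le> p \<and> p < (a + Suc j) * ?w then bit W (p - a * ?w) else bitv \<sigma> p)"
  proof (cases "Suc a * ?w \<le> p")
    case True
    then have "?w + (p - Suc a * ?w) = p - a * ?w" "a * ?w \<le> p" "p div ?w \<noteq> a"
      using d by auto
    then show ?thesis using True by (simp add: IH b)
  next
    case False
    have "p < (a + Suc j) * ?w" using False Suc.prems by (simp add: algebra_simps)
    then show ?thesis using False d m by (auto simp: IH b)
  qed
  finally show ?case .
qed auto

text \<open>Fields ignore word boundaries, so the whole window is read, the field is spliced in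
  between the bits below and above it, and the window is written back.\<close>

definition wr :: "nat \<Rightarrow> state \<Rightarrow> nat \<Rightarrow> nat \<Rightarrow> nat \<Rightarrow> state" where
  "wr k \<sigma> o' l v = stw (k + 2) \<sigma> (o' div wid \<sigma>)
     (let W = win (k + 2) \<sigma> (o' div wid \<sigma>); e = pw 1 \<sigma> (o' mod wid \<sigma>); g = pw k \<sigma> l
      in W mod e + (v mod g + W div e div g * g) * e)"

lemma same_wr: "same \<sigma> (wr k \<sigma> o' l v)"
  unfolding wr_def by (rule same_stw)

lemma same_wr' [simp]: "wid (wr k \<sigma> o' l v) = wid \<sigma>" "lim (wr k \<sigma> o' l v) = lim \<sigma>" "univ (wr k \<sigma> o' l v) = univ \<sigma>"
  using same_wr[of \<sigma> k o' l v] by (auto simp: same_def)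

lemma bitv_wr:
  assumes w: "1 \<le> wid \<sigma>" and l: "l \<le> k * wid \<sigma>"
  shows "bitv (wr k \<sigma> o' l v) p \<longleftrightarrow> (if p < lim \<sigma> \<and> o' \<le> p \<and> p < o' + l then bit v (p - o') else bitv \<sigma> p)"
proof -
  let ?w = "wid \<sigma>" let ?a = "o' div ?w" let ?r = "o' mod ?w"
  define W where "W = win (k + 2) \<sigma> ?a"
  have r: "?r < ?w" using w by simp
  have ar: "?a * ?w + ?r = o'" by simp
  have "W mod 2 ^ ?r < 2 ^ ?r" by simp
  then have bW: "bit (W mod 2 ^ ?r + (v mod 2 ^ l + W div 2 ^ ?r div 2 ^ l * 2 ^ l) * 2 ^ ?r) t \<longleftrightarrow>
     (if t < ?r then bit W t else if t - ?r < l then bit v (t - ?r) else bit W t)" for t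
    by (auto simp: bit_add_mult_pow bit_mod_pow bit_div_pow)
  have e: "wr k \<sigma> o' l v = stw (k + 2) \<sigma> ?a (W mod 2 ^ ?r + (v mod 2 ^ l + W div 2 ^ ?r div 2 ^ l * 2 ^ l) * 2 ^ ?r)"
    using r l by (simp add: wr_def W_def Let_def pw_eq del: win.simps stw.simps)
  have kw: "?r + l < (k + 2) * ?w" using r l by (simp add: algebra_simps)
  show ?thesis
  proof (cases "p < lim \<sigma> \<and> ?a * ?w \<le> p \<and> p < (?a + (k + 2)) * ?w")
    case True
    define t where "t = p - ?a * ?w"
    have p: "p = ?a * ?w + t" using True by (simp add: t_def)
    have t: "t < (k + 2) * ?w" using True p by (simp add: algebra_simps)
    have "bit W t = bitv \<sigma> p" using t w by (simp add: W_def bit_win p del: win.simps)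
    moreover have "t < ?r \<longleftrightarrow> p < o'" "?r \<le> t \<Longrightarrow> t - ?r < l \<longleftrightarrow> p < o' + l"
      using ar p by linarith+
    moreover have "t - ?r = p - o'"
      using ar p by (metis add_diff_cancel_left)
    ultimately show ?thesis
      unfolding e bitv_stw[OF w] using True bW[of t] by (auto simp flip: t_def)
  next
    case False
    have "\<not> (p < lim \<sigma> \<and> o' \<le> p \<and> p < o' + l)"
    proof
      assume p: "p < lim \<sigma> \<and> o' \<le> p \<and> p < o' + l"
      have "?a * ?w \<le> p" "p < ?a * ?w + (k + 2) * ?w" using p ar kw by linarith+
      then show False using p False unfolding add_mult_distrib by blast
    qed
    then show ?thesis
      unfolding e bitv_stw[OF w] using False by auto
  qed
qed

lemmas CE_basic = CE_const CE_var CE_univ CE_wid CE_add CE_mult CE_diff CE_div CE_mod CE_and CE_pw CE_ld CE_if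
  CB_less CB_le CB_eq CB_not CB_conj CB_disj

lemma CE_Suc: "CE F \<Longrightarrow> CE (\<lambda>\<rho> \<sigma>. Suc (F \<rho> \<sigma>))"
  using CE_add[OF _ CE_const[of 1]] by simp

lemma CE_win: "CE F \<Longrightarrow> CE (\<lambda>\<rho> \<sigma>. win j \<sigma> (F \<rho> \<sigma>))"
  by (induction j arbitrary: F) (auto intro!: CE_basic CE_Suc)

lemma CE_rd: "CE X \<Longrightarrow> CE Y \<Longrightarrow> CE (\<lambda>\<rho> \<sigma>. rd k \<sigma> (X \<rho> \<sigma>) (Y \<rho> \<sigma>))"
  unfolding rd_def by (intro CE_basic CE_win)

lemma CM_stw: "CE X \<Longrightarrow> CE Y \<Longrightarrow> CM (\<lambda>\<rho> \<sigma>. stw j \<sigma> (X \<rho> \<sigma>) (Y \<rho> \<sigma>))"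
proof (induction j arbitrary: X Y)
  case 0
  show ?case by (simp add: CM_id)
next
  case (Suc j)
  have "CM (\<lambda>\<rho> \<sigma>. stw (Suc j) \<sigma> (\<rho> 1) (\<rho> 0))"
    unfolding stw.simps by (rule CM_state_let) (intro CM_st CE_basic CE_Suc Suc.IH)+
  from CM_let2[OF Suc.prems this] show ?case .
qed

lemma CM_wr: "CE X \<Longrightarrow> CE Y \<Longrightarrow> CE Z \<Longrightarrow> CM (\<lambda>\<rho> \<sigma>. wr k \<sigma> (X \<rho> \<sigma>) (Y \<rho> \<sigma>) (Z \<rho> \<sigma>))"
  unfolding wr_def Let_def by (intro CM_stw CE_basic CE_win)

section \<open>Parallel arithmetic on packed cells\<close>

definition pack :: "nat \<Rightarrow> (nat \<Rightarrow> nat) \<Rightarrow> nat \<Rightarrow> nat" where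
  "pack g f k = (\<Sum>i<k. f i * 2 ^ (g * i))"

lemma pack_0 [simp]: "pack g f 0 = 0" by (simp add: pack_def)
lemma pack_Suc: "pack g f (Suc k) = pack g f k + f k * 2 ^ (g * k)" by (simp add: pack_def)

lemma pack_cong: "(\<And>i. i < k \<Longrightarrow> f i = f' i) \<Longrightarrow> pack g f k = pack g f' k"
  by (auto simp: pack_def)

lemma pack_less: "(\<And>i. i < k \<Longrightarrow> f i < 2 ^ g) \<Longrightarrow> pack g f k < 2 ^ (g * k)"
proof (induction k)
  case (Suc k)
  have "pack g f k < 2 ^ (g * k)" using Suc by simp
  moreover have "(f k + 1) * 2 ^ (g * k) \<le> 2 ^ g * 2 ^ (g * k)"
    using Suc.prems[of k] by (intro mult_right_mono) auto
  ultimately show ?case by (simp add: pack_Suc power_add)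
qed simp

lemma bit_pack:
  assumes "0 < g" "\<And>i. i < k \<Longrightarrow> f i < 2 ^ g"
  shows "bit (pack g f k) t \<longleftrightarrow> t div g < k \<and> bit (f (t div g)) (t mod g)"
  using assms(2)
proof (induction k)
  case (Suc k)
  have IH: "bit (pack g f k) t \<longleftrightarrow> t div g < k \<and> bit (f (t div g)) (t mod g)"
    using Suc by simp
  have "bit (pack g f (Suc k)) t \<longleftrightarrow> (if t < g * k then bit (pack g f k) t else bit (f k) (t - g * k))"
    unfolding pack_Suc using pack_less[of k f g] Suc.prems by (intro bit_add_mult_pow) simp
  also have "\<dots> \<longleftrightarrow> t div g < Suc k \<and> bit (f (t div g)) (t mod g)"
  proof (cases "t < g * k")
    case True
    then have "t div g < k" using assms(1) by (simp add: div_less_iff_less_mult mult.commute)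
    with True IH show ?thesis by simp
  next
    case False
    show ?thesis
    proof (cases "t < g * Suc k")
      case True
      with False have "t div g = k" by (intro div_nat_eqI) (auto simp: mult.commute)
      moreover from this have "t mod g = t - g * k" by (metis minus_mult_div_eq_mod)
      ultimately show ?thesis using False by simp
    next
      case F: False
      have "\<not> t div g < Suc k" using F assms(1) by (simp add: div_less_iff_less_mult mult.commute)
      moreover have "\<not> bit (f k) (t - g * k)"
      proof
        assume "bit (f k) (t - g * k)"
        then have "t - g * k < g"
          using Suc.prems[of k] by (metis bit_take_bit_iff lessI take_bit_nat_eq_self)
        then show False using F by simp
      qed
      ultimately show ?thesis using False by simp
    qed
  qed
  finally show ?case .
qed simp

lemma pack_cell:
  assumes "\<And>i. i < k \<Longrightarrow> f i < 2 ^ g" "i < k"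
  shows "pack g f k div 2 ^ (g * i) mod 2 ^ g = f i"
proof (cases "g = 0")
  case True
  then show ?thesis using assms by simp
next
  case False
  have "bit (pack g f k div 2 ^ (g * i) mod 2 ^ g) t = bit (f i) t" for t
  proof (cases "t < g")
    case True
    then show ?thesis using False assms by (simp add: bit_mod_pow bit_div_pow bit_pack)
  next
    case F: False
    then have "\<not> bit (f i) t"
      using assms by (metis bit_take_bit_iff take_bit_nat_eq_self)
    then show ?thesis using F by (simp add: bit_mod_pow)
  qed
  then show ?thesis by (simp add: bit_eq_iff)
qed

lemma pack_append: "pack g f (n + l) = pack g f n + pack g (\<lambda>t. f (n + t)) l * 2 ^ (g * n)"
  by (induction l) (simp_all add: pack_Suc algebra_simps power_add)

lemma pack_shift:
  assumes "\<And>i. i < k \<Longrightarrow> f i < 2 ^ g" "i \<le> k"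
  shows "pack g f k div 2 ^ (g * i) = pack g (\<lambda>t. f (i + t)) (k - i)"
proof -
  from pack_append[of g f i "k - i"] pack_less[of i f g] assms show ?thesis by simp
qed

lemma pack_trunc:
  assumes "\<And>i. i < k \<Longrightarrow> f i < 2 ^ g" "n \<le> k"
  shows "pack g f k mod 2 ^ (g * n) = pack g f n"
proof -
  from pack_append[of g f n "k - n"] pack_less[of n f g] assms show ?thesis by simp
qed

lemma and_pack:
  assumes "0 < g" "\<And>i. i < k \<Longrightarrow> f i < 2 ^ g" "\<And>i. i < k \<Longrightarrow> f' i < 2 ^ g"
  shows "and (pack g f k) (pack g f' k) = pack g (\<lambda>i. and (f i) (f' i)) k"
proof -
  have "and (f i) (f' i) < 2 ^ g" if "i < k" for i
    using assms(2)[OF that] and_le_left le_less_trans by blast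
  then show ?thesis
    using assms by (auto simp: bit_eq_iff bit_and_iff bit_pack)
qed

lemma pack_mult: "a * pack g f k = pack g (\<lambda>i. a * f i) k"
  by (simp add: pack_def sum_distrib_left mult.assoc)

lemma pack_add: "pack g f k + pack g f' k = pack g (\<lambda>i. f i + f' i) k"
  by (simp add: pack_def sum.distrib add_mult_distrib)

lemma pack_diff: "(\<And>i. i < k \<Longrightarrow> f' i \<le> f i) \<Longrightarrow> pack g f k - pack g f' k = pack g (\<lambda>i. f i - f' i) k"
proof -
  assume "\<And>i. i < k \<Longrightarrow> f' i \<le> f i"
  then have "pack g (\<lambda>i. f i - f' i) k + pack g f' k = pack g f k"
    unfolding pack_add by (intro pack_cong) simp
  then show ?thesis by linarith
qed

text \<open>\<open>geo (a ^ k) a\<close> is the sum of \<open>a ^ i\<close> over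
  \<open>i < k\<close> in closed form. Taking the power instead of the exponent leaves its
  computation to the caller.\<close>

definition geo :: "nat \<Rightarrow> nat \<Rightarrow> nat" where
  "geo ak a = (ak - 1) div (a - 1)"

lemma geo_eq:
  assumes "2 \<le> a"
  shows "geo (a ^ k) a = (\<Sum>i<k. a ^ i)"
proof -
  have "a ^ k - 1 = (a - 1) * (\<Sum>i<k. a ^ i)"
  proof (induction k)
    case (Suc k)
    have "a ^ Suc k - 1 = (a ^ k - 1) + (a - 1) * a ^ k"
      using assms by (simp add: algebra_simps)
    then show ?case using Suc by (simp add: algebra_simps)
  qed simp
  then show ?thesis using assms unfolding geo_def by simp
qed

text \<open>A geometric sum with ratio \<open>a * 2 ^ g\<close> lists the powers of \<open>a\<close>
  in cells; for \<open>a = 1\<close> it is the multiplier that copies a value into every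
  cell.\<close>

lemma geo_pack: "1 \<le> g \<Longrightarrow> 1 \<le> a \<Longrightarrow> geo (a ^ k * 2 ^ (g * k)) (a * 2 ^ g) = pack g (\<lambda>i. a ^ i) k"
proof -
  assume "1 \<le> g" "1 \<le> a"
  moreover have "(2::nat) ^ 1 \<le> 2 ^ g" using \<open>1 \<le> g\<close> by (intro power_increasing) auto
  ultimately have "2 \<le> a * 2 ^ g"
    using mult_le_mono[of 1 a 2 "2 ^ g"] by simp
  from geo_eq[OF this, of k] show ?thesis
    by (simp add: pack_def power_mult power_mult_distrib)
qed

lemma geo_ones: "1 \<le> g \<Longrightarrow> geo (2 ^ (g * k)) (2 ^ g) = pack g (\<lambda>i. 1) k"
  using geo_pack[of g 1 k] by simp

definition lowbit :: "nat \<Rightarrow> nat" where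
  "lowbit x = x - and x (x - 1)"

text \<open>Subtracting 1 changes exactly the bits up to the lowest set bit, so the conjunction
  deletes that bit alone.\<close>

lemma lowbit_eq: "lowbit (2 ^ t * (2 * x + 1)) = 2 ^ t"
proof -
  let ?y = "2 ^ t * (2 * x + 1)"
  have e: "?y = 2 ^ t + x * 2 ^ Suc t" "?y - 1 = (2 ^ t - 1) + x * 2 ^ Suc t"
    by (simp_all add: algebra_simps)
  have "bit (and ?y (?y - 1)) i = bit (x * 2 ^ Suc t :: nat) i" for i
  proof -
    have 1: "bit ?y i = (if i < Suc t then bit (2 ^ t :: nat) i else bit x (i - Suc t))"
      unfolding e(1) by (rule bit_add_mult_pow) simp
    have "(2 :: nat) ^ t - 1 < 2 ^ Suc t" by (simp add: less_imp_diff_less)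
    then have 2: "bit (?y - 1) i = (if i < Suc t then bit (2 ^ t - 1 :: nat) i else bit x (i - Suc t))"
      unfolding e(2) by (rule bit_add_mult_pow)
    have 3: "bit (x * 2 ^ Suc t) i = (if i < Suc t then bit (0 :: nat) i else bit x (i - Suc t))"
      using bit_add_mult_pow[of 0 "Suc t" x i] by simp
    have "bit (2 ^ t - 1 :: nat) i \<longleftrightarrow> i < t"
      using bit_mask_iff[of t i, where 'a = nat] unfolding mask_eq_exp_minus_1 by simp
    then have "\<not> (bit (2 ^ t :: nat) i \<and> bit (2 ^ t - 1 :: nat) i)"
      by (auto simp: bit_exp_iff)
    then show ?thesis unfolding bit_and_iff 1 2 3 by auto
  qed
  then have "and ?y (?y - 1) = x * 2 ^ Suc t" by (simp add: bit_eq_iff)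
  then show ?thesis unfolding lowbit_def e(1) by simp
qed

text \<open>The exponent of a power of \<open>G\<close> without a loop: modulo the square of
  \<open>G - 1\<close>, the power \<open>G ^ i\<close> is congruent to
  \<open>1 + i * (G - 1)\<close> by the binomial theorem.\<close>

definition ilog :: "nat \<Rightarrow> nat \<Rightarrow> nat" where
  "ilog G y = y mod ((G - 1) * (G - 1)) div (G - 1)"

lemma ilog_eq:
  assumes "i + 2 < G"
  shows "ilog G (G ^ i) = i"
proof -
  obtain m where m: "G = Suc m" using assms by (cases G) auto
  have "\<exists>q. Suc m ^ i = i * m + 1 + q * (m * m)" for i
  proof (induction i)
    case (Suc i)
    then obtain q where "Suc m ^ i = i * m + 1 + q * (m * m)" by blast
    then have "Suc m ^ Suc i = Suc i * m + 1 + (i + q * Suc m) * (m * m)"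
      by (simp add: algebra_simps)
    then show ?case by blast
  qed simp
  then obtain q where "G ^ i = i * m + 1 + q * (m * m)" using m by blast
  \<comment> \<open>The bound \<open>i + 2 < G\<close> keeps \<open>i * m + 1\<close> from being
    reduced any further.\<close>
  moreover have "i * m + 1 < m * m"
  proof -
    have "i * m + 1 < (i + 1) * m" using assms m by simp
    also have "\<dots> \<le> m * m" using assms m by (intro mult_right_mono) auto
    finally show ?thesis .
  qed
  ultimately have "G ^ i mod (m * m) = i * m + 1" by simp
  moreover have "(i * m + 1) div m = i" using assms m by (intro div_nat_eqI) auto
  ultimately show ?thesis by (simp add: ilog_def m)
qed

text \<open>\<open>X\<close> is congruent to \<open>c\<close> modulo \<open>X - c\<close>. With a
  power of 2 for \<open>X\<close>, this computes \<open>c ^ i\<close> by one division.\<close>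

lemma pow_mod: "(c::nat) ^ i < X - c \<Longrightarrow> X ^ i mod (X - c) = c ^ i"
proof -
  assume a: "c ^ i < X - c"
  then have X: "X = c + (X - c)" by linarith
  have "X mod (X - c) = (c + (X - c)) mod (X - c)" using X by (rule arg_cong)
  also have "\<dots> = c mod (X - c)" by (rule mod_add_self2)
  finally have "X ^ i mod (X - c) = c ^ i mod (X - c)"
    by (metis power_mod)
  also have "\<dots> = c ^ i" using a by (rule mod_less)
  finally show ?thesis .
qed

text \<open>Modulo \<open>2 ^ b - 2 ^ b'\<close> the two radices agree, so one division turns cells
  of \<open>b\<close> bits into cells of \<open>b'\<close> bits. The repacked number is below the
  modulus, hence not only congruent but equal.\<close>

lemma repack:
  assumes f: "\<And>i. i < k \<Longrightarrow> f i < 2 ^ b'" and b: "b' * k < b" "b' < b"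
  shows "pack b f k mod (2 ^ b - 2 ^ b') = pack b' f k"
proof -
  let ?m = "(2::nat) ^ b - 2 ^ b'"
  have lt: "(2::nat) ^ b' < 2 ^ b" using b(2) by (intro power_strict_increasing) auto
  then have "2 ^ b mod ?m = (2 ^ b' + ?m) mod ?m" by simp
  then have e: "2 ^ b mod ?m = 2 ^ b' mod ?m" by (simp only: mod_add_self2)
  have "pack b f k mod ?m = pack b' f k mod ?m"
  proof (induction k)
    case (Suc k)
    have "2 ^ (b * k) mod ?m = 2 ^ (b' * k) mod ?m"
      unfolding power_mult by (metis e power_mod)
    then have "f k * 2 ^ (b * k) mod ?m = f k * 2 ^ (b' * k) mod ?m"
      by (rule mod_mult_cong[OF refl])
    with Suc show ?case unfolding pack_Suc by (intro mod_add_cong) auto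
  qed simp
  moreover have "pack b' f k < ?m"
  proof (cases k)
    case 0 then show ?thesis using lt by simp
  next
    case (Suc n)
    have "pack b' f k < 2 ^ (b' * k)" using f by (rule pack_less)
    moreover have "(2::nat) ^ (b' * k) * 2 \<le> 2 ^ b"
      using b(1) power_increasing[of "Suc (b' * k)" b "2::nat"] by simp
    moreover have "(2::nat) ^ b' * 2 \<le> 2 ^ b"
      using b(2) power_increasing[of "Suc b'" b "2::nat"] by simp
    ultimately show ?thesis by linarith
  qed
  ultimately show ?thesis by simp
qed

text \<open>In every cell the top bit \<open>H\<close> is lent before the cell of \<open>Q\<close>
  is subtracted, so no borrow leaves a cell, and the top bit survives exactly where the cell of
  \<open>P\<close> is at least that of \<open>Q\<close>. \<open>O1\<close> has a 1 in every
  cell.\<close>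

definition gem :: "nat \<Rightarrow> nat \<Rightarrow> nat \<Rightarrow> nat \<Rightarrow> nat" where
  "gem H O1 P Q = and (P + (O1 * H - Q)) (O1 * H)"

lemma gem_eq:
  assumes g: "1 \<le> g" and f: "\<And>i. i < k \<Longrightarrow> f i < 2 ^ (g - 1)" "\<And>i. i < k \<Longrightarrow> f' i < 2 ^ (g - 1)"
  shows "gem (2 ^ (g - 1)) (pack g (\<lambda>i. 1) k) (pack g f k) (pack g f' k) =
    pack g (\<lambda>i. if f' i \<le> f i then 2 ^ (g - 1) else 0) k"
proof -
  let ?H = "2 ^ (g - 1) :: nat"
  have H: "2 * ?H = 2 ^ g" using g by (simp flip: power_Suc)
  have 1: "pack g (\<lambda>i. 1) k * ?H = pack g (\<lambda>i. ?H) k"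
    using pack_mult[of ?H g "\<lambda>i. 1" k] by (simp add: mult.commute)
  have 2: "pack g f k + (pack g (\<lambda>i. ?H) k - pack g f' k) = pack g (\<lambda>i. f i + (?H - f' i)) k"
    using f by (subst pack_diff) (auto simp: pack_add less_imp_le)
  have b: "f i + (?H - f' i) < 2 ^ g" "?H < 2 ^ g" if "i < k" for i
    using f[OF that] H g by auto
  have "and (f i + (?H - f' i)) ?H = (if f' i \<le> f i then ?H else 0)" if "i < k" for i
  proof -
    have *: "f i + (?H - f' i) < 2 * ?H" using f[OF that] by linarith
    have "and (f i + (?H - f' i)) ?H = (if bit (f i + (?H - f' i)) (g - 1) then ?H else 0)"
      by (rule bit_eqI) (auto simp: bit_and_iff bit_exp_iff)
    also have "bit (f i + (?H - f' i)) (g - 1) \<longleftrightarrow> ?H \<le> f i + (?H - f' i)"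
    proof -
      have "(f i + (?H - f' i)) div ?H = (if ?H \<le> f i + (?H - f' i) then 1 else 0)"
        using * by (auto intro: div_nat_eqI)
      then show ?thesis by (auto simp: bit_iff_odd)
    qed
    also have "\<dots> \<longleftrightarrow> f' i \<le> f i" using f[OF that] by linarith
    finally show ?thesis .
  qed
  then show ?thesis
    unfolding gem_def 1 2 using g b by (subst and_pack) (auto intro!: pack_cong)
qed

text \<open>In the sequel \<open>e\<close> computes powers of 2, but only up to some bound.\<close>

definition ffrom :: "(nat \<Rightarrow> nat) \<Rightarrow> nat \<Rightarrow> nat \<Rightarrow> nat \<Rightarrow> nat" where
  "ffrom e g x i = (if x div e (g * i) = 0 then 0 else Suc (i + ilog (e g) (lowbit (x div e (g * i)) div e (g - 1))))"

text \<open>The answer is a pointer in the sense of \<open>lnk\<close>: \<open>Suc\<close> of the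
  index, or 0.\<close>

definition first_from :: "nat \<Rightarrow> nat \<Rightarrow> (nat \<Rightarrow> bool) \<Rightarrow> nat" where
  "first_from i k Q = (if \<exists>t\<ge>i. t < k \<and> Q t then Suc (LEAST t. i \<le> t \<and> t < k \<and> Q t) else 0)"

text \<open>With the cells before \<open>i\<close> shifted out, the lowest set bit is the mark at
  the top of some cell \<open>m\<close>. Divided by \<open>2 ^ (g - 1)\<close> it is the power
  \<open>(2 ^ g) ^ m\<close>, from which \<open>ilog\<close> reads \<open>m\<close>; this is why
  \<open>k + 2 < 2 ^ g\<close> is assumed.\<close>

lemma ffrom_eq:
  assumes g: "1 \<le> g" and k: "k + 2 < 2 ^ g" and i: "i \<le> k" and e: "\<And>x. x \<le> g * (k + 1) \<Longrightarrow> e x = 2 ^ x"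
  shows "ffrom e g (pack g (\<lambda>i. if Q i then 2 ^ (g - 1) else 0) k) i = first_from i k Q"
proof -
  let ?H = "2 ^ (g - 1) :: nat"
  have H: "2 * ?H = 2 ^ g" using g by (simp flip: power_Suc)
  let ?f = "\<lambda>i. if Q i then ?H else 0"
  have f: "?f i < 2 ^ g" for i using g by simp
  have "g * i \<le> g * (k + 1)" using i by (intro mult_left_mono) auto
  then have ee: "e (g * i) = 2 ^ (g * i)" "e g = 2 ^ g" "e (g - 1) = ?H"
    using e by (simp_all add: algebra_simps)
  have sh: "pack g ?f k div 2 ^ (g * i) = pack g (\<lambda>t. ?f (i + t)) (k - i)"
    using f i by (rule pack_shift)
  have P: "pack g (\<lambda>t. if Q' t then ?H else 0) n = 0" if "\<And>t. t < n \<Longrightarrow> \<not> Q' t" for Q' n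
    using that by (simp add: pack_def)
  show ?thesis
  proof (cases "\<exists>t\<ge>i. t < k \<and> Q t")
    case False
    then have "pack g (\<lambda>t. ?f (i + t)) (k - i) = 0" by (intro P) auto
    then show ?thesis using False by (simp add: ffrom_def ee sh first_from_def)
  next
    case True
    define t where "t = (LEAST t. i \<le> t \<and> t < k \<and> Q t)"
    have t: "i \<le> t" "t < k" "Q t" using LeastI_ex[of "\<lambda>t. i \<le> t \<and> t < k \<and> Q t"] True by (auto simp: t_def)
    have less: "\<not> Q s" if "i \<le> s" "s < t" for s
      using not_less_Least[of s "\<lambda>t. i \<le> t \<and> t < k \<and> Q t"] that t by (auto simp: t_def)
    define m where "m = t - i"
    have m: "t = i + m" using t by (simp add: m_def)
    have "pack g (\<lambda>t. ?f (i + t)) (k - i) =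
        pack g (\<lambda>t. ?f (i + t)) (Suc m) + pack g (\<lambda>s. ?f (i + Suc m + s)) (k - i - Suc m) * 2 ^ (g * Suc m)"
    proof -
      have "Suc m + (k - i - Suc m) = k - i" using t m by simp
      then show ?thesis
        using pack_append[of g "\<lambda>t. ?f (i + t)" "Suc m" "k - i - Suc m"] by (simp only: add.assoc)
    qed
    also have "pack g (\<lambda>t. ?f (i + t)) (Suc m) = ?H * 2 ^ (g * m)"
      unfolding pack_Suc using less m t P[of m "\<lambda>t. Q (i + t)"] by simp
    also have "2 ^ (g * Suc m) = 2 * (?H * 2 ^ (g * m))"
      using H by (simp add: power_add)
    finally have x: "pack g (\<lambda>t. ?f (i + t)) (k - i) =
        2 ^ (g - 1 + g * m) * (2 * pack g (\<lambda>s. ?f (i + Suc m + s)) (k - i - Suc m) + 1)"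
      by (simp add: algebra_simps power_add)
    have low: "lowbit (pack g (\<lambda>t. ?f (i + t)) (k - i)) div ?H = (2 ^ g) ^ m"
      unfolding x lowbit_eq by (simp add: power_add power_mult)
    have "ilog (2 ^ g) ((2 ^ g) ^ m) = m"
      using k t m by (intro ilog_eq) auto
    moreover have "pack g (\<lambda>t. ?f (i + t)) (k - i) \<noteq> 0" unfolding x by simp
    ultimately have "ffrom e g (pack g ?f k) i = Suc t"
      unfolding ffrom_def ee sh low by (simp add: m)
    then show ?thesis using True by (simp add: first_from_def t_def)
  qed
qed

text \<open>Equality is tested as two inequalities against \<open>y\<close> copied into all cells.
  The remainder discards whatever follows the \<open>k\<close> cells of \<open>P\<close>.\<close>

definition pfind :: "(nat \<Rightarrow> nat) \<Rightarrow> nat \<Rightarrow> nat \<Rightarrow> nat \<Rightarrow> nat \<Rightarrow> nat \<Rightarrow> nat" where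
  "pfind e g P k y i =
    (let O1 = geo (e (g * k)) (e g); H = e (g - 1); P' = P mod e (g * k)
     in ffrom e g (and (gem H O1 P' (y * O1)) (gem H O1 (y * O1) P')) i)"

lemma pfind_eq:
  assumes g: "1 \<le> g" and k: "k + 2 < 2 ^ g" and i: "i \<le> k" and e: "\<And>x. x \<le> g * (k + 1) \<Longrightarrow> e x = 2 ^ x"
    and f: "\<And>i. i < k \<Longrightarrow> f i < 2 ^ (g - 1)" and y: "y < 2 ^ (g - 1)"
    and P: "P mod 2 ^ (g * k) = pack g f k"
  shows "pfind e g P k y i = first_from i k (\<lambda>t. f t = y)"
proof -
  let ?H = "2 ^ (g - 1) :: nat"
  have ee: "e (g * k) = 2 ^ (g * k)" "e g = 2 ^ g" "e (g - 1) = ?H"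
    using e by (simp_all add: algebra_simps)
  have yO: "y * pack g (\<lambda>i. 1) k = pack g (\<lambda>i. y) k" by (simp add: pack_mult)
  have H: "?H < 2 ^ g" using g by simp
  have "and (if y \<le> f t then ?H else 0) (if f t \<le> y then ?H else 0) = (if f t = y then ?H else 0)" for t
    by auto
  then have "and (pack g (\<lambda>i. if y \<le> f i then ?H else 0) k) (pack g (\<lambda>i. if f i \<le> y then ?H else 0) k) =
      pack g (\<lambda>i. if f i = y then ?H else 0) k"
    using g H by (subst and_pack) (auto intro!: pack_cong)
  moreover have "gem ?H (pack g (\<lambda>i. 1) k) (pack g f k) (pack g (\<lambda>i. y) k) =
      pack g (\<lambda>i. if y \<le> f i then ?H else 0) k"
    "gem ?H (pack g (\<lambda>i. 1) k) (pack g (\<lambda>i. y) k) (pack g f k) =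
      pack g (\<lambda>i. if f i \<le> y then ?H else 0) k"
    using f y by (intro gem_eq[OF g]; simp)+
  ultimately show ?thesis
    unfolding pfind_def Let_def ee P geo_ones[OF g] yO
    by (simp only: ffrom_eq[OF g k i e, of "\<lambda>t. f t = y"])
qed

subsection \<open>Blocks of digits\<close>

text \<open>The digit with index 0 is the most significant one, so a prefix of the digits is a
  quotient by a power of \<open>c\<close>.\<close>

fun vl :: "nat \<Rightarrow> (nat \<Rightarrow> nat) \<Rightarrow> nat \<Rightarrow> nat" where
  "vl c x 0 = 0"
| "vl c x (Suc B) = vl c x B * c + x B"

text \<open>Width of the cells for \<open>B\<close> digits to base \<open>c\<close>. As
  \<open>c\<close> is constant, \<open>c \<le> 2 ^ c\<close> replaces logarithms:
  \<open>c * B\<close> bits are allowed for \<open>c ^ i\<close>, another \<open>c * B + 1\<close>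
  for the fixed point factor, and \<open>c\<close> for a digit.\<close>

definition gw :: "nat \<Rightarrow> nat \<Rightarrow> nat" where "gw c B = 2 * (c * B) + c + 2"

text \<open>The \<open>X\<close> of \<open>pow_mod\<close> is \<open>2 ^ gw c B\<close>
  here.\<close>

definition cpow :: "(nat \<Rightarrow> nat) \<Rightarrow> nat \<Rightarrow> nat \<Rightarrow> nat \<Rightarrow> nat" where
  "cpow e c B i = e (gw c B * i) mod (e (gw c B) - c)"

text \<open>
  All digits of a number \<open>v < c ^ B\<close> at once: the multiples \<open>c ^ i * F\<close> of a sufficiently precise
  approximation \<open>F / 2 ^ h\<close> of \<open>v / c ^ B\<close> are formed in parallel, their integral parts are cut off, and
  multiplication by \<open>c\<close> moves the next digit in front of the point.
\<close>

definition digits :: "(nat \<Rightarrow> nat) \<Rightarrow> nat \<Rightarrow> nat \<Rightarrow> nat \<Rightarrow> nat" where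
  "digits e c B v =
    (let g = gw c B; h = c * B + 1; G = e g; O1 = geo (e (g * B)) G; C = cpow e c B B;
         F = v * e h div C + 1;
         Y = and (F * geo (C * e (g * B)) (c * G)) ((e h - 1) * O1)
     in and (c * Y div e h) ((e c - 1) * O1))"

lemma vl_less: "1 \<le> c \<Longrightarrow> (\<And>i. i < B \<Longrightarrow> x i < c) \<Longrightarrow> vl c x B < c ^ B"
proof (induction B)
  case (Suc B)
  have "vl c x B + 1 \<le> c ^ B" using Suc by simp
  then have "(vl c x B + 1) * c \<le> c ^ B * c" by (rule mult_right_mono) simp
  then show ?case using Suc.prems(2)[of B] by (simp add: mult.commute)
qed simp

lemma vl_split: "\<exists>r. vl c x (i + n) = vl c x i * c ^ n + r \<and> (1 \<le> c \<longrightarrow> (\<forall>t<i + n. x t < c) \<longrightarrow> r < c ^ n)"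
proof (induction n)
  case (Suc n)
  then obtain r where r: "vl c x (i + n) = vl c x i * c ^ n + r"
    "1 \<le> c \<longrightarrow> (\<forall>t<i + n. x t < c) \<longrightarrow> r < c ^ n" by blast
  have "r * c + x (i + n) < c ^ Suc n" if "1 \<le> c" "\<forall>t<i + Suc n. x t < c"
  proof -
    have "r + 1 \<le> c ^ n" using r(2) that by simp
    then have "(r + 1) * c \<le> c ^ n * c" by (rule mult_right_mono) simp
    then show ?thesis using that(2)[rule_format, of "i + n"] by (simp add: mult.commute)
  qed
  then show ?case
    by (intro exI[of _ "r * c + x (i + n)"]) (simp add: r(1) algebra_simps)
qed simp

lemma vl_div:
  assumes "1 \<le> c" "\<And>t. t < B \<Longrightarrow> x t < c" "i \<le> B"
  shows "vl c x B div c ^ (B - i) = vl c x i"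
  using vl_split[of c x i "B - i"] assms by auto

lemma c_pow_le: "(c::nat) ^ i \<le> 2 ^ (c * i)"
  unfolding power_mult by (intro power_mono) (auto simp: less_imp_le less_exp)

lemma cpow_eq:
  assumes "i \<le> B" "\<And>x. x \<le> gw c B * (B + 1) \<Longrightarrow> e x = 2 ^ x"
  shows "cpow e c B i = c ^ i"
proof -
  have "gw c B * i \<le> gw c B * (B + 1)" using assms(1) by (intro mult_left_mono) auto
  then have e: "e (gw c B * i) = (2 ^ gw c B) ^ i" "e (gw c B) = 2 ^ gw c B"
    using assms(2) by (simp_all flip: power_mult)
  have "c ^ i \<le> 2 ^ (c * B)"
    using c_pow_le[of c i] power_increasing[of "c * i" "c * B" "2::nat"] assms(1) by (simp add: le_trans)
  moreover have "c < 2 ^ c" by (rule less_exp)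
  moreover have "2 ^ (c * B) * 2 ^ 1 \<le> (2 :: nat) ^ gw c B" "(2 :: nat) ^ c * 2 ^ 1 \<le> 2 ^ gw c B"
    unfolding power_add[symmetric] by (intro power_increasing; simp add: gw_def)+
  ultimately have "c ^ i < 2 ^ gw c B - c" unfolding power_one_right by linarith
  then show ?thesis unfolding cpow_def e by (rule pow_mod)
qed

text \<open>\<open>F / 2 ^ h\<close> exceeds \<open>v / c ^ B\<close> by at most
  \<open>1 / 2 ^ h\<close>. Multiplied by \<open>c ^ i\<close> this stays below
  \<open>1 / c ^ (B - i)\<close>, the least possible distance of \<open>v / c ^ (B - i)\<close> to
  the next integer, because \<open>c ^ B < 2 ^ h\<close>. Rounding up keeps exact multiples from
  falling short. So all integral parts are those of the exact fractions.\<close>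

lemma digits_eq:
  assumes c: "1 \<le> c" and x: "\<And>i. i < B \<Longrightarrow> x i < c"
    and e: "\<And>x. x \<le> gw c B * (B + 1) \<Longrightarrow> e x = 2 ^ x"
  shows "digits e c B (vl c x B) = pack (gw c B) x B"
proof -
  define g where "g = gw c B"
  define h where "h = c * B + 1"
  define v where "v = vl c x B"
  define F where "F = v * 2 ^ h div c ^ B + 1"
  have g: "1 \<le> g" "h + c * B \<le> g" "h + c \<le> g" "h \<le> g" "c \<le> g" by (simp_all add: g_def h_def gw_def)
  have "h \<le> g * (B + 1)" "c \<le> g * (B + 1)" using g by auto
  then have ee: "e g = 2 ^ g" "e (g * B) = 2 ^ (g * B)" "e h = 2 ^ h" "e c = 2 ^ c"
    using e by (simp_all add: g_def algebra_simps)
  have cB: "c ^ B < 2 ^ h" by (rule le_less_trans[OF c_pow_le]) (simp add: h_def)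
  have cB0: "0 < c ^ B" using c by simp
  have vB: "v < c ^ B" unfolding v_def using c x by (rule vl_less)
  have "v * 2 ^ h div c ^ B < 2 ^ h" using vB cB0 by (simp add: div_less_iff_less_mult mult.commute)
  then have F: "F \<le> 2 ^ h" by (simp add: F_def)
  have F1: "v * 2 ^ h < F * c ^ B" "(F - 1) * c ^ B \<le> v * 2 ^ h"
    using dividend_less_div_times[OF cB0, of "v * 2 ^ h"]
    by (simp_all add: F_def add_mult_distrib add.commute)
  have int: "c ^ i * F div 2 ^ h = vl c x i" if i: "i \<le> B" for i
  proof (rule div_nat_eqI)
    obtain r where r: "v = vl c x i * c ^ (B - i) + r" "r < c ^ (B - i)"
      using vl_split[of c x i "B - i"] i c x by (auto simp: v_def)
    have ci: "c ^ i * c ^ (B - i) = c ^ B" using i by (simp flip: power_add)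
    have "vl c x i * 2 ^ h * c ^ (B - i) \<le> v * 2 ^ h" using r(1) by simp
    also have "\<dots> < c ^ i * F * c ^ (B - i)" using F1(1) by (simp add: ci[symmetric] ac_simps)
    finally show "2 ^ h * vl c x i \<le> c ^ i * F" by (simp add: mult.commute)
    have "v + 1 \<le> (vl c x i + 1) * c ^ (B - i)" using r by simp
    then have "(v + 1) * 2 ^ h \<le> (vl c x i + 1) * c ^ (B - i) * 2 ^ h" by (rule mult_right_mono) simp
    moreover have "F * c ^ B \<le> v * 2 ^ h + c ^ B"
    proof -
      have "F = (F - 1) + 1" by (simp add: F_def)
      then show ?thesis using F1(2) by (metis add_le_cancel_right add_mult_distrib nat_mult_1)
    qed
    ultimately have "F * c ^ B < (vl c x i + 1) * c ^ (B - i) * 2 ^ h"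
      using cB by (simp add: algebra_simps)
    then have "c ^ i * F * c ^ (B - i) < (2 ^ h * Suc (vl c x i)) * c ^ (B - i)"
      by (simp only: ci[symmetric] Suc_eq_plus1 ac_simps)
    then show "c ^ i * F < 2 ^ h * Suc (vl c x i)" by (rule mult_right_less_imp_less) simp
  qed
  have cle: "c ^ i \<le> 2 ^ (c * B)" if "i \<le> B" for i
    using c_pow_le[of c i] power_increasing[of "c * i" "c * B" "2::nat"] that by (simp add: le_trans)
  have a: "c ^ i * F < 2 ^ g" if "i < B" for i
  proof -
    have "c ^ i * F \<le> 2 ^ (c * B) * 2 ^ h" using cle[of i] that F by (intro mult_mono) auto
    also have "\<dots> < 2 ^ g" unfolding power_add[symmetric] by (intro power_strict_increasing) (auto simp: g_def gw_def h_def)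
    finally show ?thesis .
  qed
  have le: "(2::nat) ^ h \<le> 2 ^ g" "(2::nat) ^ c \<le> 2 ^ g" using g by (auto intro: power_increasing)
  have p0: "(0::nat) < 2 ^ h" "(0::nat) < 2 ^ c" by simp_all
  have h1: "2 ^ h - 1 < (2::nat) ^ g" "2 ^ c - 1 < (2::nat) ^ g" using le p0 by linarith+
  have amask: "and n (2 ^ k - 1) = n mod 2 ^ k" for n k :: nat
    using take_bit_eq_mask[of k n] by (simp add: mask_eq_exp_minus_1 take_bit_eq_mod)
  have O: "geo (2 ^ (g * B)) (2 ^ g) = pack g (\<lambda>i. 1) B" by (rule geo_ones[OF g(1)])
  have O': "a * pack g (\<lambda>i. 1) B = pack g (\<lambda>i. a) B" for a by (simp add: pack_mult)
  have Y: "and (F * pack g (\<lambda>i. c ^ i) B) ((2 ^ h - 1) * pack g (\<lambda>i. 1) B) = pack g (\<lambda>i. c ^ i * F mod 2 ^ h) B"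
    unfolding O' pack_mult using g(1) a h1 by (subst and_pack) (auto simp: mult.commute amask simp del: One_nat_def intro!: pack_cong)
  define y where "y i = c ^ i * F mod 2 ^ h" for i
  have cy: "c * y i < 2 ^ g" for i
  proof -
    have "c * y i < 2 ^ c * 2 ^ h" unfolding y_def by (intro mult_strict_mono) auto
    also have "\<dots> \<le> 2 ^ g" unfolding power_add[symmetric] using g by (intro power_increasing) auto
    finally show ?thesis .
  qed
  \<comment> \<open>Times \<open>c\<close>, the fractional part of step \<open>i\<close> gains an
    integral part, namely the difference between \<open>vl c x (Suc i)\<close> and
    \<open>c * vl c x i\<close>.\<close>
  have dig: "c * y i div 2 ^ h = x i" if "i < B" for i
  proof -
    have "c ^ i * F = vl c x i * 2 ^ h + y i"
      using int[of i] that by (metis div_mult_mod_eq less_imp_le y_def)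
    then have "c ^ Suc i * F = c * vl c x i * 2 ^ h + c * y i"
      by (metis add_mult_distrib2 mult.assoc power_Suc)
    then have "c ^ Suc i * F div 2 ^ h = c * vl c x i + c * y i div 2 ^ h" by simp
    then show ?thesis using int[of "Suc i"] that by simp
  qed
  have xc: "x i < 2 ^ c" if "i < B" for i using x[OF that] less_exp[of c] by (rule less_trans)
  \<comment> \<open>The shift by \<open>h\<close> moves the low bits of each cell into the top of
    the cell below; the mask of \<open>c\<close> bits per cell removes them.\<close>
  have "and (c * pack g y B div 2 ^ h) ((2 ^ c - 1) * pack g (\<lambda>i. 1) B) = pack g x B"
  proof -
    have "bit (and (c * pack g y B div 2 ^ h) ((2 ^ c - 1) * pack g (\<lambda>i. 1) B)) t = bit (pack g x B) t" for t
    proof -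
      have b2: "bit ((2 ^ c - 1) * pack g (\<lambda>i. 1) B) t \<longleftrightarrow> t div g < B \<and> t mod g < c"
        unfolding O' using g(1) h1(2) bit_mask_iff[of c "t mod g", where 'a = nat]
        by (subst bit_pack) (auto simp: mask_eq_exp_minus_1)
      have b3: "bit (pack g x B) t \<longleftrightarrow> t div g < B \<and> bit (x (t div g)) (t mod g)"
        using g(1) xc le(2) by (intro bit_pack) (auto intro: less_le_trans[OF xc le(2)])
      have b3': "bit (x (t div g)) (t mod g) \<Longrightarrow> t div g < B \<Longrightarrow> t mod g < c"
        using xc[of "t div g"] by (metis bit_take_bit_iff take_bit_nat_eq_self)
      have b1: "bit (c * pack g y B div 2 ^ h) t \<longleftrightarrow> bit (x (t div g)) (t mod g)"
        if "t div g < B" "t mod g < c"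
      proof -
        have "h + t = (h + t mod g) + t div g * g" by simp
        moreover have "h + t mod g < g" using that g by linarith
        ultimately have "(h + t) div g = t div g" "(h + t) mod g = h + t mod g"
          by (metis add.commute add_0 div_less div_mult_self1 less_nat_zero_code, metis mod_less mod_mult_self1)
        moreover have "bit (c * y (t div g)) (h + t mod g) = bit (x (t div g)) (t mod g)"
          using dig[OF that(1)] by (metis bit_div_pow)
        ultimately show ?thesis
          using g(1) cy that by (simp add: bit_div_pow pack_mult bit_pack)
      qed
      show ?thesis unfolding bit_and_iff b2 b3 using b1 b3' by blast
    qed
    then show ?thesis by (simp add: bit_eq_iff)
  qed
  moreover have "geo (c ^ B * 2 ^ (g * B)) (c * 2 ^ g) = pack g (\<lambda>i. c ^ i) B"
    by (rule geo_pack[OF g(1) c])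
  moreover have "cpow e c B B = c ^ B" using e by (intro cpow_eq) auto
  ultimately show ?thesis
    unfolding digits_def Let_def g_def[symmetric] h_def[symmetric] v_def[symmetric] ee O
    by (simp only: F_def[symmetric] Y y_def[symmetric])
qed

text \<open>The rounded up binary logarithm of \<open>c ^ B\<close>: all powers \<open>2 ^ i\<close>
  with \<open>i \<le> c * B\<close> are compared with it at once. The final \<open>- 1\<close> turns
  the pointer of \<open>ffrom\<close> into an index.\<close>

definition blen :: "(nat \<Rightarrow> nat) \<Rightarrow> nat \<Rightarrow> nat \<Rightarrow> nat" where
  "blen e c B = (let g = gw c B; n = c * B + 1; G = e g; O1 = geo (e (g * n)) G
     in ffrom e g (gem (e (g - 1)) O1 (geo (e n * e (g * n)) (2 * G)) (cpow e c B B * O1)) 0 - 1)"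

lemma blen_eq:
  assumes e: "\<And>x. x \<le> gw c B * (c * B + 2) \<Longrightarrow> e x = 2 ^ x" and c: "1 \<le> c"
  shows "blen e c B = (LEAST i. c ^ B \<le> 2 ^ i)"
proof -
  define g where "g = gw c B"
  define n where "n = c * B + 1"
  have g: "1 \<le> g" "n \<le> g - 1" "n + 2 < 2 ^ g"
  proof -
    show "1 \<le> g" "n \<le> g - 1" by (simp_all add: g_def gw_def n_def)
    have "n + 2 \<le> g" using c by (simp add: g_def gw_def n_def)
    then show "n + 2 < 2 ^ g" using less_exp[of g] by linarith
  qed
  have M: "g * (n + 1) = gw c B * (c * B + 2)" by (simp add: g_def n_def)
  have "n \<le> g" using g(2) by simp
  then have "n \<le> g * (n + 1)" "g * n \<le> g * (n + 1)" "g \<le> g * (n + 1)" by (auto intro: trans_le_add1)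
  then have ee: "e g = 2 ^ g" "e n = 2 ^ n" "e (g * n) = 2 ^ (g * n)" "e (g - 1) = 2 ^ (g - 1)"
    using e M by simp_all
  have le: "gw c B * (B + 1) \<le> gw c B * (c * B + 2)"
  proof (rule mult_le_mono2)
    have "1 * B \<le> c * B" using c by (rule mult_le_mono1)
    then show "B + 1 \<le> c * B + 2" by linarith
  qed
  have cp: "cpow e c B B = c ^ B" by (rule cpow_eq) (use e le in auto)
  have 1: "geo (2 ^ n * 2 ^ (g * n)) (2 * 2 ^ g) = pack g (\<lambda>i. 2 ^ i) n"
    using geo_pack[of g 2 n] g by simp
  have 2: "c ^ B * pack g (\<lambda>i. 1) n = pack g (\<lambda>i. c ^ B) n" by (simp add: pack_mult)
  have cl: "c ^ B \<le> 2 ^ (c * B)" by (rule c_pow_le)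
  have gm: "gem (2 ^ (g - 1)) (pack g (\<lambda>i. 1) n) (pack g (\<lambda>i. 2 ^ i) n) (pack g (\<lambda>i. c ^ B) n) =
      pack g (\<lambda>i. if c ^ B \<le> 2 ^ i then 2 ^ (g - 1) else 0) n"
  proof (rule gem_eq[OF g(1)])
    fix i assume "i < n"
    then show "(2::nat) ^ i < 2 ^ (g - 1)" using g by (intro power_strict_increasing) auto
    have "(2::nat) ^ (c * B) < 2 ^ (g - 1)" using g by (intro power_strict_increasing) (auto simp: n_def)
    then show "c ^ B < 2 ^ (g - 1)" using cl by linarith
  qed
  have ff: "ffrom e g (pack g (\<lambda>i. if c ^ B \<le> 2 ^ i then 2 ^ (g - 1) else 0) n) 0 = first_from 0 n (\<lambda>i. c ^ B \<le> 2 ^ i)"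
    by (rule ffrom_eq[OF g(1,3)]) (use e M in auto)
  let ?P = "\<lambda>i. c ^ B \<le> 2 ^ i"
  have ex: "\<exists>t\<ge>0. t < n \<and> ?P t" using cl by (intro exI[of _ "c * B"]) (simp add: n_def)
  have L: "(LEAST i. ?P i) < n" "?P (LEAST i. ?P i)"
    using Least_le[of ?P "c * B", OF cl] LeastI[of ?P "c * B", OF cl] by (auto simp: n_def)
  have "(LEAST t. 0 \<le> t \<and> t < n \<and> ?P t) = (LEAST i. ?P i)"
    by (rule Least_equality) (use L in \<open>auto intro: Least_le\<close>)
  then show ?thesis
    unfolding blen_def Let_def g_def[symmetric] n_def[symmetric] ee geo_ones[OF g(1)] 1 cp 2 gm ff
    using ex by (simp add: first_from_def)
qed

text \<open>The third fact says that a block wastes less than one bit.\<close>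

lemma blen_props:
  assumes "\<And>x. x \<le> gw c B * (c * B + 2) \<Longrightarrow> e x = 2 ^ x" "1 \<le> c"
  shows "c ^ B \<le> 2 ^ blen e c B" "blen e c B \<le> c * B" "blen e c B = 0 \<or> 2 ^ (blen e c B - 1) < c ^ B"
proof -
  note cl = c_pow_le[of c B]
  have b: "blen e c B = (LEAST i. c ^ B \<le> 2 ^ i)" by (rule blen_eq) (fact assms)+
  show "c ^ B \<le> 2 ^ blen e c B"
    unfolding b using cl by (rule LeastI[of "\<lambda>i. c ^ B \<le> 2 ^ i"])
  show "blen e c B \<le> c * B"
    unfolding b using cl by (rule Least_le[of "\<lambda>i. c ^ B \<le> 2 ^ i"])
  show "blen e c B = 0 \<or> 2 ^ (blen e c B - 1) < c ^ B"
    unfolding b using not_less_Least[of "(LEAST i. c ^ B \<le> 2 ^ i) - 1" "\<lambda>i. c ^ B \<le> 2 ^ i"]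
    by (metis One_nat_def diff_less gr0I lessI not_le)
qed

section \<open>Structures\<close>

text \<open>
  A structure in the bits \<open>FP\<close> of the memory represents a map from \<open>{..<sz}\<close> to the colours \<open>{..<c}\<close>.
  All memories have the parameters of \<open>\<sigma>0\<close>.
\<close>

definition frame :: "nat set \<Rightarrow> state \<Rightarrow> state \<Rightarrow> bool" where
  "frame FP \<sigma> \<sigma>' \<longleftrightarrow> same \<sigma> \<sigma>' \<and> (\<forall>p. p \<notin> FP \<longrightarrow> bitv \<sigma>' p = bitv \<sigma> p)"

lemma frame_refl: "frame FP \<sigma> \<sigma>" by (simp add: frame_def)
lemma frame_trans: "frame FP \<sigma> \<sigma>' \<Longrightarrow> frame FP \<sigma>' \<sigma>'' \<Longrightarrow> frame FP \<sigma> \<sigma>''"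
  unfolding frame_def by (metis same_trans)
lemma frame_mono: "frame FP \<sigma> \<sigma>' \<Longrightarrow> FP \<subseteq> FP' \<Longrightarrow> frame FP' \<sigma> \<sigma>'"
  unfolding frame_def by blast
lemma frame_same: "frame FP \<sigma> \<sigma>' \<Longrightarrow> same \<sigma>0 \<sigma> \<Longrightarrow> same \<sigma>0 \<sigma>'"
  unfolding frame_def using same_trans by blast

lemma frame_wr: "1 \<le> wid \<sigma> \<Longrightarrow> l \<le> k * wid \<sigma> \<Longrightarrow> {o'..<o' + l} \<subseteq> FP \<Longrightarrow> frame FP \<sigma> (wr k \<sigma> o' l v)"
  unfolding frame_def using same_wr by (auto simp: bitv_wr subset_iff)

locale struct =
  fixes c d :: nat and \<sigma>0 :: state and FP :: "nat set" and sz :: nat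
    and get :: "state \<Rightarrow> nat \<Rightarrow> nat" and first :: "state \<Rightarrow> nat \<Rightarrow> nat"
    and nxt :: "state \<Rightarrow> nat \<Rightarrow> nat \<Rightarrow> nat" and set' :: "state \<Rightarrow> nat \<Rightarrow> nat \<Rightarrow> state"
    and ini :: "state \<Rightarrow> state" and R :: "state \<Rightarrow> (nat \<Rightarrow> nat) \<Rightarrow> bool"
  assumes stable: "\<And>\<sigma> \<sigma>' f. same \<sigma>0 \<sigma> \<Longrightarrow> same \<sigma>0 \<sigma>' \<Longrightarrow> R \<sigma> f \<Longrightarrow> (\<And>p. p \<in> FP \<Longrightarrow> bitv \<sigma>' p = bitv \<sigma> p) \<Longrightarrow> R \<sigma>' f"
    and ext: "\<And>\<sigma> f f'. same \<sigma>0 \<sigma> \<Longrightarrow> R \<sigma> f \<Longrightarrow> (\<And>x. x < sz \<Longrightarrow> f' x = f x) \<Longrightarrow> R \<sigma> f'"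
    and get: "\<And>\<sigma> f x. same \<sigma>0 \<sigma> \<Longrightarrow> R \<sigma> f \<Longrightarrow> x < sz \<Longrightarrow> get \<sigma> x = f x \<and> f x < c"
    and enum: "\<And>\<sigma> f j. same \<sigma>0 \<sigma> \<Longrightarrow> R \<sigma> f \<Longrightarrow> j < c \<Longrightarrow>
      \<exists>xs. distinct xs \<and> set xs = {x. x < sz \<and> f x = j} \<and> lnk (nxt \<sigma> j) (first \<sigma> j) xs 0"
    and set': "\<And>\<sigma> f x j. same \<sigma>0 \<sigma> \<Longrightarrow> R \<sigma> f \<Longrightarrow> x < sz \<Longrightarrow> j < c \<Longrightarrow>
      R (set' \<sigma> x j) (f(x := j)) \<and> frame FP \<sigma> (set' \<sigma> x j)"
    and ini: "\<And>\<sigma>. same \<sigma>0 \<sigma> \<Longrightarrow> R (ini \<sigma>) (\<lambda>_. d) \<and> frame FP \<sigma> (ini \<sigma>)"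

lemma lnk_append: "lnk nx s (xs @ ys) e \<longleftrightarrow> (\<exists>t. lnk nx s xs t \<and> lnk nx t ys e)"
  by (induction xs arbitrary: s) auto

text \<open>Embeds the list of an item into that of the whole: \<open>\<phi>\<close> translates
  positions, and the NIL of the item becomes the pointer \<open>t\<close> to what comes after
  it.\<close>

lemma lnk_map:
  assumes "lnk inx s L 0" "\<And>r. r \<in> set L \<Longrightarrow> nx (\<phi> r) = (if inx r = 0 then t else Suc (\<phi> (inx r - 1)))"
  shows "lnk nx (if s = 0 then t else Suc (\<phi> (s - 1))) (map \<phi> L) t"
  using assms by (induction L arbitrary: s) auto

text \<open>Searching again behind each hit runs through all hits; the distance to \<open>k\<close>
  decreases.\<close>

lemma lnk_first_from:
  assumes nx: "\<And>i. i < k \<Longrightarrow> nx i = first_from (Suc i) k Q"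
  shows "i \<le> k \<Longrightarrow> \<exists>xs. distinct xs \<and> set xs = {x. i \<le> x \<and> x < k \<and> Q x} \<and> lnk nx (first_from i k Q) xs 0"
proof (induction "k - i" arbitrary: i rule: less_induct)
  case less
  show ?case
  proof (cases "\<exists>t\<ge>i. t < k \<and> Q t")
    case False
    then show ?thesis by (intro exI[of _ "[]"]) (auto simp: first_from_def)
  next
    case True
    define t where "t = (LEAST t. i \<le> t \<and> t < k \<and> Q t)"
    have t: "i \<le> t" "t < k" "Q t" using LeastI_ex[of "\<lambda>t. i \<le> t \<and> t < k \<and> Q t"] True by (auto simp: t_def)
    have less': "\<not> Q s" if "i \<le> s" "s < t" for s
      using not_less_Least[of s "\<lambda>t. i \<le> t \<and> t < k \<and> Q t"] that t by (auto simp: t_def)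
    have "k - Suc t < k - i" "Suc t \<le> k" using t by auto
    from less.hyps[OF this] obtain xs where xs: "distinct xs" "set xs = {x. Suc t \<le> x \<and> x < k \<and> Q x}"
      "lnk nx (first_from (Suc t) k Q) xs 0"
      by blast
    have "first_from i k Q = Suc t" using True by (simp add: first_from_def t_def)
    moreover have "set (t # xs) = {x. i \<le> x \<and> x < k \<and> Q x}"
      using xs(2) t less' by (auto simp: not_less_eq_eq[symmetric])
    moreover have "distinct (t # xs)" using xs by auto
    ultimately show ?thesis using xs(3) nx[OF t(2)] by (intro exI[of _ "t # xs"]) simp
  qed
qed

subsection \<open>Blocks\<close>

text \<open>A block has \<open>p * p\<close> digits because the table of its level spends
  O(\<open>p\<close>) bits on it, which is O(1 / \<open>p\<close>) bits per digit.\<close>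

definition baddr where "baddr k c \<sigma> a p t = a + t * blen (pw k \<sigma>) c (p * p)"
definition bval where "bval k c \<sigma> a p t = rd k \<sigma> (baddr k c \<sigma> a p t) (blen (pw k \<sigma>) c (p * p))"
definition bget where
  "bget k c \<sigma> a p t (sz :: nat) x = bval k c \<sigma> a p t div cpow (pw k \<sigma>) c (p * p) (p * p - 1 - x) mod c"
definition bfind where
  "bfind k c \<sigma> a p t sz j x = pfind (pw k \<sigma>) (gw c (p * p)) (digits (pw k \<sigma>) c (p * p) (bval k c \<sigma> a p t)) sz j x"
definition bfirst where "bfirst k c \<sigma> a p t sz j = bfind k c \<sigma> a p t sz j 0"
definition bnext where "bnext k c \<sigma> a p t sz j x = bfind k c \<sigma> a p t sz j (Suc x)"
definition bset where
  "bset k c \<sigma> a p t (sz :: nat) x j = wr k \<sigma> (baddr k c \<sigma> a p t) (blen (pw k \<sigma>) c (p * p))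
     (let q = cpow (pw k \<sigma>) c (p * p) (p * p - 1 - x)
      in bval k c \<sigma> a p t - bget k c \<sigma> a p t sz x * q + j * q)"
definition bini where
  "bini k c d \<sigma> a p t (sz :: nat) = wr k \<sigma> (baddr k c \<sigma> a p t) (blen (pw k \<sigma>) c (p * p))
     (d * geo (cpow (pw k \<sigma>) c (p * p) (p * p)) c)"

text \<open>The stored number always has \<open>p * p\<close> digits, even if only \<open>sz\<close>
  of them are used; the others are arbitrary digits below \<open>c\<close>.\<close>

definition blk where
  "blk k c \<sigma>0 a p t sz \<sigma> f \<longleftrightarrow> (\<exists>x. (\<forall>i<p * p. x i < c) \<and> (\<forall>i<sz. f i = x i) \<and>
     bval k c \<sigma> a p t = vl c x (p * p))"

lemma pw_same: "same \<sigma> \<sigma>' \<Longrightarrow> pw k \<sigma>' = pw k \<sigma>"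
  by (auto simp: pw_def same_def)

text \<open>Written as a balance, to avoid truncated subtraction.\<close>

lemma vl_upd:
  assumes "\<And>i. i \<noteq> r \<Longrightarrow> y i = x i"
  shows "r < B \<Longrightarrow> vl c y B + x r * c ^ (B - 1 - r) = vl c x B + y r * c ^ (B - 1 - r)"
proof (induction B)
  case (Suc B)
  show ?case
  proof (cases "r = B")
    case True
    have "vl c y n = vl c x n" if "n \<le> B" for n
      using that assms True by (induction n) auto
    from this[of B] show ?thesis using True by simp
  next
    case False
    then have "r < B" and Br: "B - r = Suc (B - 1 - r)" using Suc.prems by simp_all
    from Suc.IH[OF this(1)] have "(vl c y B + x r * c ^ (B - 1 - r)) * c = (vl c x B + y r * c ^ (B - 1 - r)) * c"
      by (rule arg_cong)
    then show ?thesis using False Br assms[of B] by (simp add: algebra_simps)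
  qed
qed simp

lemma vl_const: "1 \<le> c \<Longrightarrow> d < c \<Longrightarrow> vl c (\<lambda>_. d) B = d * geo (c ^ B) c"
proof (cases "c = 1")
  case True
  assume "d < c"
  then have "vl c (\<lambda>_. 0) B = 0" for B by (induction B) auto
  with True \<open>d < c\<close> show ?thesis by simp
next
  case False
  assume "1 \<le> c"
  with False have c: "2 \<le> c" by simp
  have "vl c (\<lambda>_. d) B = d * (\<Sum>i<B. c ^ i)"
  proof (induction B)
    case (Suc B)
    have "(\<Sum>i<Suc B. c ^ i) = c * (\<Sum>i<B. c ^ i) + 1"
      by (subst sum.lessThan_Suc_shift) (simp add: sum_distrib_left)
    with Suc show ?case by (simp add: algebra_simps)
  qed simp
  then show ?thesis by (simp add: geo_eq[OF c])
qed

text \<open>\<open>big\<close> makes the capped powers \<open>pw k\<close> exact on every argument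
  that occurs.\<close>

lemma block_struct:
  assumes w: "1 \<le> wid \<sigma>0" and c: "1 \<le> c" "d < c" and sz: "sz \<le> p * p"
    and big: "gw c (p * p) * (c * (p * p) + 2) \<le> k * wid \<sigma>0"
    and lim: "baddr k c \<sigma>0 a p t + blen (pw k \<sigma>0) c (p * p) \<le> lim \<sigma>0"
  shows "struct c d \<sigma>0 {baddr k c \<sigma>0 a p t..<baddr k c \<sigma>0 a p t + blen (pw k \<sigma>0) c (p * p)} sz
     (\<lambda>\<sigma>. bget k c \<sigma> a p t sz) (\<lambda>\<sigma>. bfirst k c \<sigma> a p t sz) (\<lambda>\<sigma>. bnext k c \<sigma> a p t sz)
     (\<lambda>\<sigma>. bset k c \<sigma> a p t sz) (\<lambda>\<sigma>. bini k c d \<sigma> a p t sz) (blk k c \<sigma>0 a p t sz)"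
proof -
  define B where "B = p * p"
  define e where "e = pw k \<sigma>0"
  define g where "g = gw c B"
  define l where "l = blen e c B"
  define A where "A = a + t * l"
  have e2: "e x = 2 ^ x" if "x \<le> g * (c * B + 2)" for x
    using that big unfolding e_def g_def B_def by (intro pw_eq) linarith
  have eg: "\<And>x. x \<le> gw c B * (c * B + 2) \<Longrightarrow> e x = 2 ^ x" using e2 by (simp add: g_def)
  have "1 * B \<le> c * B" using c(1) by (rule mult_le_mono1)
  then have cB: "B + 1 \<le> c * B + 2" by linarith
  have le: "g * (B + 1) \<le> g * (c * B + 2)" using cB by (intro mult_left_mono) auto
  have eg1: "\<And>x. x \<le> gw c B * (B + 1) \<Longrightarrow> e x = 2 ^ x" using e2 le by (simp add: g_def)
  note bl = blen_props[of c B e, OF eg c(1), folded l_def]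
  have "l \<le> g" using bl(2) by (simp add: g_def gw_def)
  also have "g \<le> g * (c * B + 2)" by simp
  also have "\<dots> \<le> k * wid \<sigma>0" using big by (simp add: g_def B_def)
  finally have lk: "l \<le> k * wid \<sigma>0" .
  have par: "pw k \<sigma> = e" "wid \<sigma> = wid \<sigma>0" "lim \<sigma> = lim \<sigma>0" if "same \<sigma>0 \<sigma>" for \<sigma>
    using that pw_same[OF that] by (auto simp: e_def same_def)
  have ad: "baddr k c \<sigma> a p t = A" "blen (pw k \<sigma>) c (p * p) = l" if "same \<sigma>0 \<sigma>" for \<sigma>
    using par[OF that] by (simp_all add: baddr_def A_def l_def B_def)
  have bv: "bval k c \<sigma> a p t = fld (bitv \<sigma>) A l" if "same \<sigma>0 \<sigma>" for \<sigma>
    using ad[OF that] rd_eq[of \<sigma> l k A] par[OF that] w lk by (simp add: bval_def)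
  have cp: "cpow e c B i = c ^ i" if "i \<le> B" for i
    using that eg1 by (intro cpow_eq) auto
  have wrv: "bval k c (wr k \<sigma> A l v) a p t = v" if "same \<sigma>0 \<sigma>" "v < c ^ B" for \<sigma> v
  proof -
    have "same \<sigma>0 (wr k \<sigma> A l v)" using that(1) same_wr same_trans by blast
    moreover have "v < 2 ^ l" using that(2) bl(1) by linarith
    moreover have "bitv (wr k \<sigma> A l v) (A + i) = bit v i" if "i < l" for i
      using that lim ad[OF same_refl] par[OF \<open>same \<sigma>0 \<sigma>\<close>] w lk by (simp add: bitv_wr)
    ultimately show ?thesis using bv by (auto intro: fld_eqI)
  qed
  have frm: "frame {A..<A + l} \<sigma> (wr k \<sigma> A l v)" if "same \<sigma>0 \<sigma>" for \<sigma> v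
    using par[OF that] w lk by (intro frame_wr) auto
  have digs: "digits e c B (vl c x B) = pack g x B" if "\<forall>i<B. x i < c" for x
    unfolding g_def using that by (intro digits_eq[OF c(1) _ eg1]) auto
  have g1: "1 \<le> g" "sz + 2 < 2 ^ g" "c \<le> 2 ^ (g - 1)"
  proof -
    show "1 \<le> g" by (simp add: g_def gw_def)
    have "sz \<le> c * B" using sz \<open>1 * B \<le> c * B\<close> unfolding B_def by linarith
    then have "sz + 2 < g + 1" using c by (simp add: g_def gw_def)
    then show "sz + 2 < 2 ^ g" using less_exp[of g] by linarith
    have "c \<le> g - 1" by (simp add: g_def gw_def)
    then show "c \<le> 2 ^ (g - 1)" using less_exp[of "g - 1"] by linarith
  qed
  have gx: "bget k c \<sigma> a p t sz i = x i" if s: "same \<sigma>0 \<sigma>" and x: "\<forall>i<B. x i < c" "bval k c \<sigma> a p t = vl c x B" "i < B" for \<sigma> x i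
  proof -
    have "vl c x B div c ^ (B - 1 - i) = vl c x (Suc i)"
      using vl_div[of c B x "Suc i"] c x by simp
    then show ?thesis
      unfolding bget_def x(2) using cp[of "B - 1 - i"] par(1)[OF s] x by (simp add: B_def)
  qed
  have bf: "bfind k c \<sigma> a p t sz j i = first_from i sz (\<lambda>t. x t = j)"
    if s: "same \<sigma>0 \<sigma>" and x: "\<forall>i<B. x i < c" "bval k c \<sigma> a p t = vl c x B" "i \<le> sz" and j: "j < c" for \<sigma> x i j
  proof -
    have xg: "x i < 2 ^ (g - 1)" "x i < 2 ^ g" if "i < B" for i
    proof -
      show "x i < 2 ^ (g - 1)" using x(1) that g1(3) by (meson less_le_trans)
      also have "\<dots> \<le> 2 ^ g" by (intro power_increasing) auto
      finally show "x i < 2 ^ g" .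
    qed
    have "sz \<le> B" using sz by (simp add: B_def)
    then have "g * (sz + 1) \<le> g * (c * B + 2)" using cB by (intro mult_left_mono) auto
    then show ?thesis
      unfolding bfind_def x(2) par(1)[OF s] B_def[symmetric] g_def[symmetric] digs[OF x(1)]
      using g1 x(3) j xg e2 \<open>sz \<le> B\<close> by (intro pfind_eq) (auto intro: pack_trunc)
  qed
  show ?thesis
    unfolding ad[OF same_refl]
  proof (unfold_locales, goal_cases)
    case (1 \<sigma> \<sigma>' f)
    then have "fld (bitv \<sigma>') A l = fld (bitv \<sigma>) A l" by (intro fld_cong) auto
    with 1 show ?case by (simp add: blk_def bv)
  next
    case (2 \<sigma> f f')
    then show ?case by (auto simp: blk_def)
  next
    case (3 \<sigma> f i)
    then obtain x where "\<forall>i<B. x i < c" "\<forall>i<sz. f i = x i" "bval k c \<sigma> a p t = vl c x B" by (auto simp: blk_def B_def)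
    with 3 sz gx[of \<sigma> x i] show ?case by (simp add: B_def)
  next
    case (4 \<sigma> f j)
    then obtain x where x: "\<forall>i<B. x i < c" "\<forall>i<sz. f i = x i" "bval k c \<sigma> a p t = vl c x B" by (auto simp: blk_def B_def)
    have "\<exists>xs. distinct xs \<and> set xs = {y. 0 \<le> y \<and> y < sz \<and> x y = j} \<and>
        lnk (bnext k c \<sigma> a p t sz j) (first_from 0 sz (\<lambda>t. x t = j)) xs 0"
      using 4 x by (intro lnk_first_from) (auto simp: bnext_def bf)
    moreover have "{y. 0 \<le> y \<and> y < sz \<and> x y = j} = {y. y < sz \<and> f y = j}" using x(2) by auto
    ultimately show ?case using 4 x by (simp add: bfirst_def bf)
  next
    case (5 \<sigma> f i j)
    then obtain x where x: "\<forall>i<B. x i < c" "\<forall>i<sz. f i = x i" "bval k c \<sigma> a p t = vl c x B" by (auto simp: blk_def B_def)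
    have i: "i < B" using 5 sz by (simp add: B_def)
    have "vl c (x(i := j)) B + x i * c ^ (B - 1 - i) = vl c x B + j * c ^ (B - 1 - i)"
      using vl_upd[of i "x(i := j)" x B c] i by simp
    moreover have "x i * c ^ (B - 1 - i) \<le> vl c x B"
    proof -
      obtain r where "vl c x (Suc i + (B - 1 - i)) = vl c x (Suc i) * c ^ (B - 1 - i) + r"
        using vl_split by blast
      moreover have "Suc i + (B - 1 - i) = B" using i by simp
      ultimately show ?thesis by (simp add: add_mult_distrib)
    qed
    ultimately have u: "vl c x B - x i * c ^ (B - 1 - i) + j * c ^ (B - 1 - i) = vl c (x(i := j)) B" by linarith
    have "bset k c \<sigma> a p t sz i j = wr k \<sigma> A l (vl c (x(i := j)) B)"
      unfolding bset_def ad[OF 5(1)] gx[OF 5(1) x(1,3) i] x(3) Let_def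
      unfolding par(1)[OF 5(1)] B_def[symmetric] using cp[of "B - 1 - i"] u by simp
    moreover have "\<forall>t<B. (x(i := j)) t < c" using x 5 by auto
    moreover have "vl c (x(i := j)) B < c ^ B" using c x 5 by (intro vl_less) auto
    ultimately show ?case
      using wrv[OF 5(1)] frm[OF 5(1)] x(2) unfolding blk_def B_def[symmetric]
      by (auto intro!: exI[of _ "x(i := j)"])
  next
    case (6 \<sigma>)
    have "bini k c d \<sigma> a p t sz = wr k \<sigma> A l (vl c (\<lambda>_. d) B)"
      unfolding bini_def ad[OF 6] vl_const[OF c] par(1)[OF 6] B_def[symmetric] using cp by (simp add: l_def)
    moreover have "vl c (\<lambda>_. d) B < c ^ B" using c by (intro vl_less) auto
    ultimately show ?case
      using wrv[OF 6] frm[OF 6] c unfolding blk_def B_def[symmetric] by (auto intro!: exI[of _ "\<lambda>_. d"])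
  qed
qed

lemma lnk_det: "lnk nx s xs 0 \<Longrightarrow> lnk nx s ys 0 \<Longrightarrow> xs = ys"
proof (induction xs arbitrary: s ys)
  case Nil then show ?case by (cases ys) auto
next
  case (Cons x xs) then show ?case by (cases ys) auto
qed

text \<open>An element determines the remainder of the list. If it occurred twice, a finite list
  would equal a proper suffix of itself.\<close>

lemma lnk_distinct: "lnk nx s xs 0 \<Longrightarrow> distinct xs"
proof (induction xs arbitrary: s)
  case (Cons x xs)
  have "x \<notin> set xs"
  proof
    assume "x \<in> set xs"
    then obtain ys zs where xs: "xs = ys @ x # zs" by (meson split_list)
    have a: "lnk nx (nx x) xs 0" using Cons.prems by simp
    then obtain t where "lnk nx t (x # zs) 0" unfolding xs lnk_append by blast
    then have "lnk nx (nx x) zs 0" by simp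
    from lnk_det[OF a this] xs show False by simp
  qed
  then show ?case using Cons by auto
qed simp

subsection \<open>Sparse sets and virtual permutations in uninitialized arrays\<close>

text \<open>The sparse set of Briggs and Torczon: \<open>A\<close> lists the members, and
  \<open>pos\<close> claims their indices. A claim counts only if \<open>A\<close> confirms it, so
  arbitrary initial contents do no harm.\<close>

definition sset :: "nat \<Rightarrow> (nat \<Rightarrow> nat) \<Rightarrow> (nat \<Rightarrow> nat) \<Rightarrow> nat set \<Rightarrow> bool" where
  "sset n A pos S \<longleftrightarrow> (\<forall>i<n. A i \<in> S \<and> pos (A i) = i) \<and> (\<forall>x\<in>S. pos x < n \<and> A (pos x) = x)"

lemma sset_mem: "sset n A pos S \<Longrightarrow> pos x < n \<and> A (pos x) = x \<longleftrightarrow> x \<in> S"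
  unfolding sset_def by metis

lemma sset_card: "sset n A pos S \<Longrightarrow> card S = n \<and> finite S"
proof -
  assume s: "sset n A pos S"
  have "inj_on A {..<n}" using s unfolding sset_def by (metis inj_onI lessThan_iff)
  moreover have "A ` {..<n} = S" using s unfolding sset_def by (force simp: image_iff)
  ultimately show ?thesis using card_image[of A "{..<n}"] by auto
qed

lemma sset_add: "sset n A pos S \<Longrightarrow> x \<notin> S \<Longrightarrow> sset (Suc n) (A(n := x)) (pos(x := n)) (insert x S)"
  unfolding sset_def by (auto simp: less_Suc_eq)

text \<open>The last member fills the gap, also if it is \<open>x\<close> itself.\<close>

lemma sset_remove:
  assumes "sset n A pos S" "x \<in> S"
  shows "sset (n - 1) (A(pos x := A (n - 1))) (pos(A (n - 1) := pos x)) (S - {x})"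
proof -
  have n: "pos x < n" "A (pos x) = x" using assms unfolding sset_def by auto
  have A: "A i \<in> S" "pos (A i) = i" if "i < n" for i using assms that unfolding sset_def by auto
  have P: "pos y < n" "A (pos y) = y" if "y \<in> S" for y using assms that unfolding sset_def by auto
  define q where "q = pos x"
  define l where "l = A (n - 1)"
  have l: "l \<in> S" "pos l = n - 1" using A[of "n - 1"] n by (auto simp: l_def)
  have q: "q < n" "A q = x" using n by (auto simp: q_def)
  have xl: "x = l \<longleftrightarrow> q = n - 1" using l q A(2)[of q] by (auto simp: l_def q_def)
  show ?thesis
    unfolding sset_def q_def[symmetric] l_def[symmetric]
  proof (intro conjI allI ballI impI)
    fix i assume i: "i < n - 1"
    have "i < n" using i by simp
    have "A i \<noteq> x" if "i \<noteq> q" using that A(2)[of i] i q by (auto simp: q_def)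
    moreover have "A i \<noteq> l" using A(2)[OF \<open>i < n\<close>] i l by auto
    moreover have "l \<noteq> x" if "i = q" using xl i that by auto
    ultimately show "(A(q := l)) i \<in> S - {x}" "(pos(l := q)) ((A(q := l)) i) = i"
      using A[of i] i l(1) by auto
  next
    fix y assume y: "y \<in> S - {x}"
    have 1: "q < n - 1" if "y = l" using that y xl q(1) by (metis DiffE insertI1 less_Suc_eq Suc_pred' less_nat_zero_code neq0_conv)
    have 2: "pos y \<noteq> n - 1" if "y \<noteq> l" using that P(2)[of y] y by (auto simp: l_def)
    have 3: "pos y \<noteq> q" using P(2)[of y] y q by auto
    have 4: "pos y < n" "A (pos y) = y" using P[of y] y by auto
    show "(pos(l := q)) y < n - 1"
      using 1 2 4 by (cases "y = l") auto
    show "(A(q := l)) ((pos(l := q)) y) = y"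
      using 3 4 by (cases "y = l") auto
  qed
qed

text \<open>
  \<open>\<pi>\<close> lists the touched items first. The untouched ones are in their own places, unless those are
  among the first \<open>u\<close>; then \<open>A\<close> and \<open>pos\<close> hold the places that they have been moved to.
\<close>

definition vperm :: "nat \<Rightarrow> (nat \<Rightarrow> nat) \<Rightarrow> (nat \<Rightarrow> nat) \<Rightarrow> (nat \<Rightarrow> nat) \<Rightarrow> nat \<Rightarrow> bool" where
  "vperm u A pos \<pi> N \<longleftrightarrow> u \<le> N \<and> bij_betw \<pi> {..<N} {..<N} \<and>
    (\<forall>i<u. A i = \<pi> i \<and> pos (\<pi> i) = i) \<and>
    (\<forall>q. u \<le> q \<and> q < N \<longrightarrow> (\<pi> q < u \<longrightarrow> A q = \<pi> q \<and> pos (\<pi> q) = q) \<and> (u \<le> \<pi> q \<longrightarrow> \<pi> q = q))"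

context
  fixes u A pos \<pi> N
  assumes v: "vperm u A pos \<pi> N"
begin

lemma vperm_inj: "i < N \<Longrightarrow> j < N \<Longrightarrow> \<pi> i = \<pi> j \<longleftrightarrow> i = j"
  using v unfolding vperm_def bij_betw_def inj_on_def by auto

lemma vperm_less: "i < N \<Longrightarrow> \<pi> i < N"
  using v unfolding vperm_def bij_betw_def by auto

lemma vperm_surj: "x < N \<Longrightarrow> \<exists>i<N. \<pi> i = x"
proof -
  assume "x < N"
  then have "x \<in> \<pi> ` {..<N}" using v unfolding vperm_def bij_betw_def by auto
  then show ?thesis by auto
qed

lemma vperm_touched: "pos x < u \<and> A (pos x) = x \<longleftrightarrow> x \<in> \<pi> ` {..<u}"
  using v unfolding vperm_def image_iff by (metis lessThan_iff)

lemma vperm_untouched: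
  assumes "x < N" "x \<notin> \<pi> ` {..<u}"
  shows "u \<le> (if x < u then pos x else x)" "(if x < u then pos x else x) < N"
    "\<pi> (if x < u then pos x else x) = x"
proof -
  obtain q where q: "q < N" "\<pi> q = x" using vperm_surj[OF assms(1)] by blast
  with assms have "u \<le> q" by (metis imageI lessThan_iff not_le)
  with q v have "(if x < u then pos x else x) = q" unfolding vperm_def by auto
  with q \<open>u \<le> q\<close> show "u \<le> (if x < u then pos x else x)" "(if x < u then pos x else x) < N"
    "\<pi> (if x < u then pos x else x) = x" by simp_all
qed

lemma vperm_at:
  assumes q: "u \<le> q" "q < N"
  shows "(if q \<in> \<pi> ` {..<u} then A q else q) = \<pi> q"
proof (cases "q \<in> \<pi> ` {..<u}")
  case True
  then obtain i where i: "i < u" "q = \<pi> i" by auto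
  then have "\<pi> q \<noteq> q" using vperm_inj[of i q] q by auto
  then show ?thesis using True q v unfolding vperm_def by (metis not_le)
next
  case False
  then show ?thesis using vperm_untouched[OF q(2) False] q(1) by simp
qed

text \<open>\<open>x\<close> and the item \<open>y\<close> at place \<open>u\<close> exchange their
  places. \<open>y \<le> u\<close> holds because an untouched item with a number of at least
  \<open>u\<close> stands in its own place.\<close>

lemma vperm_touch:
  assumes x: "x < N" "x \<notin> \<pi> ` {..<u}" and q: "q = (if x < u then pos x else x)" and y: "y = \<pi> u"
  shows "vperm (Suc u) (A(q := y, u := x)) (pos(y := q, x := u)) (\<pi>(q := y, u := x)) N"
    "(\<pi>(q := y, u := x)) ` {..<Suc u} = insert x (\<pi> ` {..<u})" "u < N" "y \<le> u"
proof -
  note Q = vperm_untouched[OF x, folded q]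
  show uN: "u < N" using Q by simp
  let ?\<pi> = "\<pi>(q := y, u := x)"
  have yu: "y \<le> u" using v uN unfolding y vperm_def by (metis le_refl linear not_le order_less_imp_le)
  then show "y \<le> u" .
  \<comment> \<open>The new permutation is the old one composed with the transposition of
    \<open>u\<close> and \<open>q\<close>.\<close>
  define \<tau> where "\<tau> i = (if i = u then q else if i = q then u else i)" for i
  have "?\<pi> = \<pi> \<circ> \<tau>"
    using Q(3) by (auto simp: fun_eq_iff y \<tau>_def)
  moreover have "bij_betw \<tau> {..<N} {..<N}"
    using uN Q(2) by (intro bij_betw_byWitness[where f' = \<tau>]) (auto simp: \<tau>_def)
  ultimately have bij: "bij_betw ?\<pi> {..<N} {..<N}"
    using v unfolding vperm_def by (auto intro: bij_betw_trans)
  have img: "?\<pi> ` {..<u} = \<pi> ` {..<u}"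
    using Q(1) by (intro image_cong) auto
  then show "?\<pi> ` {..<Suc u} = insert x (\<pi> ` {..<u})"
    unfolding lessThan_Suc image_insert img by simp
  have P: "\<pi> i \<noteq> x" if "i < N" "i \<noteq> q" for i using vperm_inj[OF that(1) Q(2)] Q(3) that by auto
  have P': "\<pi> i \<noteq> y" if "i < N" "i \<noteq> u" for i using vperm_inj[OF that(1) uN] that by (simp add: y)
  have 1: "(A(q := y, u := x)) i = ?\<pi> i \<and> (pos(y := q, x := u)) (?\<pi> i) = i" if "i < Suc u" for i
  proof (cases "i = u")
    case False
    then have "i < u" using that by simp
    then show ?thesis using P[of i] P'[of i] Q(1) uN v unfolding vperm_def by auto
  qed simp
  have 2: "(?\<pi> r < Suc u \<longrightarrow> (A(q := y, u := x)) r = ?\<pi> r \<and> (pos(y := q, x := u)) (?\<pi> r) = r) \<and>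
      (Suc u \<le> ?\<pi> r \<longrightarrow> ?\<pi> r = r)" if r: "Suc u \<le> r" "r < N" for r
  proof (cases "r = q")
    case True
    have "y \<noteq> x" using P[of u] uN True r by (auto simp: y)
    then show ?thesis using True r yu by auto
  next
    case False
    have "\<pi> r \<noteq> u" using v r unfolding vperm_def by (metis Suc_leD Suc_n_not_le_n le_refl)
    then show ?thesis using P[of r] P'[of r] False r v unfolding vperm_def
      by (auto simp: less_Suc_eq)
  qed
  show "vperm (Suc u) (A(q := y, u := x)) (pos(y := q, x := u)) ?\<pi> N"
    unfolding vperm_def using uN bij 1 2 by auto
qed

end

lemma vperm_0: "vperm 0 A pos id N"
  unfolding vperm_def by (simp add: bij_betw_def)

subsection \<open>Levels\<close>

text \<open>Behind the state, the arguments are the start of the area of the items, the parameter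
  \<open>p\<close>, the number of the item and its size, followed by an element, a colour or both.
  With this common interface a level works on blocks as well as on groups.\<close>

record iops =
  ig :: "state \<Rightarrow> nat \<Rightarrow> nat \<Rightarrow> nat \<Rightarrow> nat \<Rightarrow> nat \<Rightarrow> nat"
  ifi :: "state \<Rightarrow> nat \<Rightarrow> nat \<Rightarrow> nat \<Rightarrow> nat \<Rightarrow> nat \<Rightarrow> nat"
  ine :: "state \<Rightarrow> nat \<Rightarrow> nat \<Rightarrow> nat \<Rightarrow> nat \<Rightarrow> nat \<Rightarrow> nat \<Rightarrow> nat"
  ise :: "state \<Rightarrow> nat \<Rightarrow> nat \<Rightarrow> nat \<Rightarrow> nat \<Rightarrow> nat \<Rightarrow> nat \<Rightarrow> state"
  iin :: "state \<Rightarrow> nat \<Rightarrow> nat \<Rightarrow> nat \<Rightarrow> nat \<Rightarrow> state"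

text \<open>
  A level combines \<open>N\<close> structures, the items, of size \<open>B\<close> (except for the last one). Its cells of \<open>p\<close> bits
  form a table. Column 0 is the virtual permutation of the items that have been
  initialized; column \<open>Suc j\<close> is the sparse set of the initialized items that contain colour \<open>j\<close>.
  Items without content of their own consist of the default colour \<open>d\<close>.
\<close>

definition cad :: "nat \<Rightarrow> nat \<Rightarrow> nat \<Rightarrow> nat \<Rightarrow> nat \<Rightarrow> nat \<Rightarrow> nat" where
  "cad c o' p i a f = o' + ((i * (c + 1) + a) * 2 + f) * p"
text \<open>Row 0 of a column holds its counter in field 0. Row \<open>Suc i\<close> holds the array
  entry of \<open>i\<close> in field 0 and the index claimed for \<open>i\<close> in field
  1.\<close>

definition cel where "cel k c \<sigma> o' p i a f = rd k \<sigma> (cad c o' p i a f) p"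
definition wce where "wce k c \<sigma> o' p i a f v = wr k \<sigma> (cad c o' p i a f) p v"
definition larea where "larea c o' p N = o' + (N + 1) * (c + 1) * 2 * (p :: nat)"
text \<open>The last item takes the remainder: at most \<open>B\<close> elements for blocks, whose
  number is rounded up, but up to nearly \<open>2 * B\<close> for groups, whose number is rounded
  down. Hence \<open>lit\<close> stops at \<open>N - 1\<close>.\<close>

definition lsz :: "nat \<Rightarrow> nat \<Rightarrow> nat \<Rightarrow> nat \<Rightarrow> nat" where
  "lsz B N tot t = (if Suc t = N then tot - t * B else B)"
definition lit :: "nat \<Rightarrow> nat \<Rightarrow> nat \<Rightarrow> nat" where
  "lit B N x = (if x div B < N then x div B else N - 1)"
definition ltst where
  "ltst k c \<sigma> o' p a x \<longleftrightarrow> cel k c \<sigma> o' p (Suc x) a 1 < cel k c \<sigma> o' p 0 a 0 \<and>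
     cel k c \<sigma> o' p (Suc (cel k c \<sigma> o' p (Suc x) a 1)) a 0 = x"
definition lat where
  "lat k c \<sigma> o' p q = (if ltst k c \<sigma> o' p 0 q then cel k c \<sigma> o' p (Suc q) 0 0 else q)"
definition lidx where
  "lidx k c \<sigma> o' p t = (if t < cel k c \<sigma> o' p 0 0 0 then cel k c \<sigma> o' p (Suc t) 0 1 else t)"
text \<open>\<open>q\<close> is a place of the virtual permutation. Untouched items matter only for
  colour \<open>d\<close>, and such an item is entered at its first element.\<close>

definition ufrom where
  "ufrom k c d \<sigma> o' p B N j q = (if j = d \<and> q < N then Suc (lat k c \<sigma> o' p q * B) else 0)"
definition lfrom where
  "lfrom k c d it \<sigma> o' p B N tot j i =
    (if i < cel k c \<sigma> o' p 0 (Suc j) 0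
     then Suc (cel k c \<sigma> o' p (Suc i) (Suc j) 0 * B + (ifi it \<sigma> (larea c o' p N) p (cel k c \<sigma> o' p (Suc i) (Suc j) 0)
       (lsz B N tot (cel k c \<sigma> o' p (Suc i) (Suc j) 0)) j - 1))
     else ufrom k c d \<sigma> o' p B N j (cel k c \<sigma> o' p 0 0 0))"
definition lv_first where "lv_first k c d it \<sigma> o' p B N tot j = lfrom k c d it \<sigma> o' p B N tot j 0"
definition lv_get where
  "lv_get k c d it \<sigma> o' p B N tot x =
    (if ltst k c \<sigma> o' p 0 (lit B N x)
     then ig it \<sigma> (larea c o' p N) p (lit B N x) (lsz B N tot (lit B N x)) (x - lit B N x * B) else d)"
definition lv_next where
  "lv_next k c d it \<sigma> o' p B N tot j x =
    (if ltst k c \<sigma> o' p 0 (lit B N x)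
     then (if ine it \<sigma> (larea c o' p N) p (lit B N x) (lsz B N tot (lit B N x)) j (x - lit B N x * B) = 0
       then lfrom k c d it \<sigma> o' p B N tot j (Suc (cel k c \<sigma> o' p (Suc (lit B N x)) (Suc j) 1))
       else Suc (lit B N x * B + (ine it \<sigma> (larea c o' p N) p (lit B N x) (lsz B N tot (lit B N x)) j (x - lit B N x * B) - 1)))
     else if Suc (x - lit B N x * B) < lsz B N tot (lit B N x) then Suc (Suc x)
     else ufrom k c d \<sigma> o' p B N j (Suc (lidx k c \<sigma> o' p (lit B N x))))"

definition lv_touch where
  "lv_touch k c it \<sigma> o' p B N tot t =
    (if ltst k c \<sigma> o' p 0 t then \<sigma> else
     let u = cel k c \<sigma> o' p 0 0 0; q = lidx k c \<sigma> o' p t; y = lat k c \<sigma> o' p u;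
       \<sigma>' = wce k c \<sigma> o' p (Suc q) 0 0 y; \<sigma>' = wce k c \<sigma>' o' p (Suc y) 0 1 q;
       \<sigma>' = wce k c \<sigma>' o' p (Suc u) 0 0 t; \<sigma>' = wce k c \<sigma>' o' p (Suc t) 0 1 u;
       \<sigma>' = wce k c \<sigma>' o' p 0 0 0 (Suc u)
     in iin it \<sigma>' (larea c o' p N) p t (lsz B N tot t))"

text \<open>Adapts the sparse set of colour \<open>a\<close> to the actual contents of item
  \<open>t\<close>. After a change this is done for all \<open>c\<close> colours, which takes
  constant time and saves a distinction between the old and the new colour.\<close>

definition lv_fix where
  "lv_fix k c it \<sigma> o' p B N tot t a =
    (let n = cel k c \<sigma> o' p 0 (Suc a) 0
     in if ifi it \<sigma> (larea c o' p N) p t (lsz B N tot t) a = 0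
       then if ltst k c \<sigma> o' p (Suc a) t
         then let q = cel k c \<sigma> o' p (Suc t) (Suc a) 1; l = cel k c \<sigma> o' p n (Suc a) 0;
           \<sigma>' = wce k c \<sigma> o' p (Suc q) (Suc a) 0 l; \<sigma>' = wce k c \<sigma>' o' p (Suc l) (Suc a) 1 q
           in wce k c \<sigma>' o' p 0 (Suc a) 0 (n - 1)
         else \<sigma>
       else if ltst k c \<sigma> o' p (Suc a) t then \<sigma>
         else let \<sigma>' = wce k c \<sigma> o' p (Suc n) (Suc a) 0 t; \<sigma>' = wce k c \<sigma>' o' p (Suc t) (Suc a) 1 n
           in wce k c \<sigma>' o' p 0 (Suc a) 0 (Suc n))"

fun lv_fixes where
  "lv_fixes k c it \<sigma> o' p B N tot t 0 = \<sigma>"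
| "lv_fixes k c it \<sigma> o' p B N tot t (Suc a) =
    (let \<sigma>' = lv_fixes k c it \<sigma> o' p B N tot t a in lv_fix k c it \<sigma>' o' p B N tot t a)"

definition lv_set where
  "lv_set k c it \<sigma> o' p B N tot x j =
    (let t = lit B N x; \<sigma>' = lv_touch k c it \<sigma> o' p B N tot t;
       \<sigma>' = ise it \<sigma>' (larea c o' p N) p t (lsz B N tot t) (x - t * B) j
     in lv_fixes k c it \<sigma>' o' p B N tot t c)"

fun lv_zero where
  "lv_zero k c \<sigma> o' p 0 = \<sigma>"
| "lv_zero k c \<sigma> o' p (Suc a) = (let \<sigma>' = lv_zero k c \<sigma> o' p a in wce k c \<sigma>' o' p 0 a 0 0)"

lemma vperm_cong:
  assumes "vperm u A pos \<pi> N" "\<And>i. i < N \<Longrightarrow> A' i = A i" "\<And>i. i < N \<Longrightarrow> pos' i = pos i"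
  shows "vperm u A' pos' \<pi> N"
  using assms vperm_less[OF assms(1)] unfolding vperm_def by auto

lemma sset_cong:
  assumes s: "sset n A pos S" and S: "S \<subseteq> {..<N}"
    and eq: "\<And>i. i < N \<Longrightarrow> A' i = A i" "\<And>i. i < N \<Longrightarrow> pos' i = pos i"
  shows "sset n A' pos' S"
proof -
  have "n \<le> N" using sset_card[OF s] card_mono[OF _ S] by simp
  have 1: "A' i \<in> S \<and> pos' (A' i) = i" if "i < n" for i
  proof -
    have "A i \<in> S" "pos (A i) = i" using s that unfolding sset_def by auto
    then show ?thesis using eq(1)[of i] eq(2)[of "A i"] that S \<open>n \<le> N\<close> by auto
  qed
  have 2: "pos' x < n \<and> A' (pos' x) = x" if "x \<in> S" for x
  proof -
    have "pos x < n" "A (pos x) = x" using s that unfolding sset_def by auto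
    then show ?thesis using eq(1)[of "pos x"] eq(2)[of x] that S \<open>n \<le> N\<close> by auto
  qed
  show ?thesis unfolding sset_def using 1 2 by blast
qed

lemma struct_first_0:
  assumes "struct c d \<sigma>0 FP sz get first nxt se ini R" "same \<sigma>0 \<sigma>" "R \<sigma> f" "j < c"
  shows "first \<sigma> j = 0 \<longleftrightarrow> \<not> (\<exists>r<sz. f r = j)"
proof -
  obtain xs where "set xs = {x. x < sz \<and> f x = j}" "lnk (nxt \<sigma> j) (first \<sigma> j) xs 0"
    using struct.enum[OF assms] by blast
  then show ?thesis by (cases xs) auto
qed

text \<open>\<open>pN\<close> lets a cell of \<open>p\<close> bits hold every item number and every
  counter. The lower bound on \<open>tot\<close> makes the last item nonempty, on which the
  enumeration relies.\<close>

locale level =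
  fixes c d k :: nat and \<sigma>0 :: state and o' p B N tot :: nat and it :: iops
    and FPi :: "nat \<Rightarrow> nat set" and Ri :: "nat \<Rightarrow> state \<Rightarrow> (nat \<Rightarrow> nat) \<Rightarrow> bool"
  assumes w: "1 \<le> wid \<sigma>0" and pk: "p \<le> k * wid \<sigma>0" and pN: "N < 2 ^ p" and N1: "1 \<le> N" and B1: "1 \<le> B"
    and tot: "(N - 1) * B < tot"
    and dc: "d < c" and lim: "larea c o' p N \<le> lim \<sigma>0"
    and items: "\<And>t. t < N \<Longrightarrow> struct c d \<sigma>0 (FPi t) (lsz B N tot t)
      (\<lambda>\<sigma>. ig it \<sigma> (larea c o' p N) p t (lsz B N tot t)) (\<lambda>\<sigma>. ifi it \<sigma> (larea c o' p N) p t (lsz B N tot t))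
      (\<lambda>\<sigma>. ine it \<sigma> (larea c o' p N) p t (lsz B N tot t)) (\<lambda>\<sigma>. ise it \<sigma> (larea c o' p N) p t (lsz B N tot t))
      (\<lambda>\<sigma>. iin it \<sigma> (larea c o' p N) p t (lsz B N tot t)) (Ri t)"
    and disj: "\<And>t t'. t < N \<Longrightarrow> t' < N \<Longrightarrow> t \<noteq> t' \<Longrightarrow> FPi t \<inter> FPi t' = {}"
      "\<And>t. t < N \<Longrightarrow> FPi t \<inter> {o'..<larea c o' p N} = {}"
begin

abbreviation "L \<equiv> larea c o' p N"
abbreviation "sz \<equiv> lsz B N tot"
abbreviation "C \<sigma> \<equiv> cel k c \<sigma> o' p"
abbreviation "W \<sigma> \<equiv> wce k c \<sigma> o' p"

lemma cad_le:
  assumes "i \<le> N" "a \<le> c" "f \<le> 1"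
  shows "o' \<le> cad c o' p i a f" "cad c o' p i a f + p \<le> L"
proof -
  have "(i * (c + 1) + a) * 2 + f + 1 \<le> (N + 1) * (c + 1) * 2"
  proof -
    have "i * (c + 1) \<le> N * (c + 1)" using assms(1) by (rule mult_le_mono1)
    then show ?thesis using assms by simp
  qed
  then have "((i * (c + 1) + a) * 2 + f + 1) * p \<le> (N + 1) * (c + 1) * 2 * p" by (rule mult_le_mono1)
  then show "cad c o' p i a f + p \<le> L" by (simp add: cad_def larea_def algebra_simps)
qed (simp add: cad_def)

text \<open>Row, column and field are recovered from the index of a cell by division with
  remainder.\<close>

lemma cad_disj:
  assumes "a \<le> c" "f \<le> 1" "a' \<le> c" "f' \<le> 1" "(i, a, f) \<noteq> (i', a', f')"
  shows "{cad c o' p i a f..<cad c o' p i a f + p} \<inter> {cad c o' p i' a' f'..<cad c o' p i' a' f' + p} = {}"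
proof -
  define x where "x i a f = (i * (c + 1) + a) * 2 + (f :: nat)" for i a f
  have "(y * 2 + f) div 2 = y" "(y * 2 + f) mod 2 = f" if "f \<le> 1" for y f :: nat
    using that by presburger+
  then have "x i a f div 2 = i * (c + 1) + a" "x i a f mod 2 = f" if "f \<le> 1" for i a f
    using that unfolding x_def by blast+
  moreover have "(i * (c + 1) + a) div (c + 1) = i" "(i * (c + 1) + a) mod (c + 1) = a" if "a \<le> c" for i a
  proof -
    show "(i * (c + 1) + a) div (c + 1) = i" using that by (intro div_nat_eqI) auto
    show "(i * (c + 1) + a) mod (c + 1) = a" unfolding mod_mult_self3 using that by (intro mod_less) simp
  qed
  ultimately have ne: "x i a f \<noteq> x i' a' f'"
    using assms by (metis prod.inject)
  have disj: "{o' + y * p..<o' + y * p + p} \<inter> {o' + z * p..<o' + z * p + p} = {}" if "y < z" for y z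
  proof -
    have "(y + 1) * p \<le> z * p" using that by (intro mult_le_mono1) simp
    then show ?thesis by auto
  qed
  have "cad c o' p i a f = o' + x i a f * p" for i a f by (simp add: cad_def x_def)
  then show ?thesis using ne disj[of "x i a f" "x i' a' f'"] disj[of "x i' a' f'" "x i a f"]
    by (cases "x i a f < x i' a' f'") auto
qed

lemma par: "same \<sigma>0 \<sigma> \<Longrightarrow> wid \<sigma> = wid \<sigma>0 \<and> lim \<sigma> = lim \<sigma>0"
  by (simp add: same_def)

lemma C_fld: "same \<sigma>0 \<sigma> \<Longrightarrow> C \<sigma> i a f = fld (bitv \<sigma>) (cad c o' p i a f) p"
  unfolding cel_def using par[of \<sigma>] w pk by (intro rd_eq) auto

lemma same_W: "same \<sigma>0 \<sigma> \<Longrightarrow> same \<sigma>0 (W \<sigma> i a f v)"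
  unfolding wce_def using same_wr same_trans by blast

lemma C_W:
  assumes s: "same \<sigma>0 \<sigma>" and i: "i \<le> N" "a \<le> c" "f \<le> 1" and i': "a' \<le> c" "f' \<le> 1" and v: "v \<le> N"
  shows "C (W \<sigma> i a f v) i' a' f' = (if i' = i \<and> a' = a \<and> f' = f then v else C \<sigma> i' a' f')"
proof -
  have "v < 2 ^ p" using v pN by simp
  moreover have "cad c o' p i a f + p \<le> lim \<sigma>0" using cad_le[OF i] lim by simp
  moreover have b: "bitv (W \<sigma> i a f v) q \<longleftrightarrow> (if q < lim \<sigma>0 \<and> cad c o' p i a f \<le> q \<and> q < cad c o' p i a f + p
      then bit v (q - cad c o' p i a f) else bitv \<sigma> q)" for q
    unfolding wce_def using par[OF s] w pk by (simp add: bitv_wr)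
  ultimately have 1: "C (W \<sigma> i a f v) i a f = v"
    unfolding C_fld[OF same_W[OF s]] by (intro fld_eqI) auto
  have 2: "C (W \<sigma> i a f v) i' a' f' = C \<sigma> i' a' f'" if "(i, a, f) \<noteq> (i', a', f')"
    unfolding C_fld[OF same_W[OF s]] C_fld[OF s]
  proof (rule fld_cong)
    fix t assume "t < p"
    then show "bitv (W \<sigma> i a f v) (cad c o' p i' a' f' + t) = bitv \<sigma> (cad c o' p i' a' f' + t)"
      using cad_disj[OF i(2,3) i' that] by (auto simp: b)
  qed
  show ?thesis using 1 2 by auto
qed

lemma frame_W: "same \<sigma>0 \<sigma> \<Longrightarrow> i \<le> N \<Longrightarrow> a \<le> c \<Longrightarrow> f \<le> 1 \<Longrightarrow> frame {o'..<L} \<sigma> (W \<sigma> i a f v)"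
  unfolding wce_def using par[of \<sigma>] w pk cad_le[of i a f] by (intro frame_wr) auto

lemma C_frame:
  assumes "same \<sigma>0 \<sigma>" "frame FP \<sigma> \<sigma>'" "FP \<inter> {o'..<L} = {}" "i \<le> N" "a \<le> c" "f \<le> 1"
  shows "C \<sigma>' i a f = C \<sigma> i a f"
  unfolding C_fld[OF assms(1)] C_fld[OF frame_same[OF assms(2,1)]]
proof (rule fld_cong)
  fix t assume "t < p"
  then have "cad c o' p i a f + t \<notin> FP" using cad_le[OF assms(4-6)] assms(3) by auto
  then show "bitv \<sigma>' (cad c o' p i a f + t) = bitv \<sigma> (cad c o' p i a f + t)"
    using assms(2) by (simp add: frame_def)
qed

lemma Ri_frame:
  assumes "t < N" "same \<sigma>0 \<sigma>" "frame FP \<sigma> \<sigma>'" "FP \<inter> FPi t = {}" "Ri t \<sigma> g"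
  shows "Ri t \<sigma>' g"
  using struct.stable[OF items[OF assms(1)] assms(2) frame_same[OF assms(3,2)] assms(5)] assms(3,4)
  unfolding frame_def by blast

definition VP where "VP \<sigma> \<pi> \<longleftrightarrow> vperm (C \<sigma> 0 0 0) (\<lambda>i. C \<sigma> (Suc i) 0 0) (\<lambda>i. C \<sigma> (Suc i) 0 1) \<pi> N"
definition SS where "SS \<sigma> a S \<longleftrightarrow> sset (C \<sigma> 0 a 0) (\<lambda>i. C \<sigma> (Suc i) a 0) (\<lambda>i. C \<sigma> (Suc i) a 1) S"
abbreviation "T \<sigma> \<pi> \<equiv> \<pi> ` {..<C \<sigma> 0 0 0}"

text \<open>The sets of the colours contain touched items only, and untouched items carry no data.
  So the counters are all that initialization has to write.\<close>

definition R where
  "R \<sigma> f \<longleftrightarrow> (\<exists>\<pi>. VP \<sigma> \<pi> \<and>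
     (\<forall>j<c. SS \<sigma> (Suc j) {t \<in> T \<sigma> \<pi>. \<exists>r<sz t. f (t * B + r) = j}) \<and>
     (\<forall>t\<in>T \<sigma> \<pi>. Ri t \<sigma> (\<lambda>r. f (t * B + r))) \<and>
     (\<forall>t<N. t \<notin> T \<sigma> \<pi> \<longrightarrow> (\<forall>r<sz t. f (t * B + r) = d)))"

definition FP where "FP = {o'..<L} \<union> (\<Union>t<N. FPi t)"

lemma VP_ltst: "VP \<sigma> \<pi> \<Longrightarrow> ltst k c \<sigma> o' p 0 t \<longleftrightarrow> t \<in> T \<sigma> \<pi>"
  unfolding VP_def ltst_def using vperm_touched by fastforce

lemma SS_ltst: "SS \<sigma> a S \<Longrightarrow> ltst k c \<sigma> o' p a t \<longleftrightarrow> t \<in> S"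
  unfolding SS_def ltst_def using sset_mem by fastforce

lemma VP_T: "VP \<sigma> \<pi> \<Longrightarrow> T \<sigma> \<pi> \<subseteq> {..<N}"
proof
  fix t assume v: "VP \<sigma> \<pi>" and "t \<in> T \<sigma> \<pi>"
  then obtain i where i: "i < C \<sigma> 0 0 0" "t = \<pi> i" by blast
  have "C \<sigma> 0 0 0 \<le> N" using v unfolding VP_def vperm_def by (rule conjunct1)
  with i vperm_less[OF v[unfolded VP_def], of i] show "t \<in> {..<N}" by simp
qed

lemma VP_at:
  assumes v: "VP \<sigma> \<pi>" and q: "C \<sigma> 0 0 0 \<le> q" "q < N"
  shows "lat k c \<sigma> o' p q = \<pi> q"
  unfolding lat_def VP_ltst[OF v] by (rule vperm_at[OF v[unfolded VP_def] q])

lemma VP_cong: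
  assumes "VP \<sigma> \<pi>" "\<And>i f. i \<le> N \<Longrightarrow> f \<le> 1 \<Longrightarrow> C \<sigma>' i 0 f = C \<sigma> i 0 f"
  shows "VP \<sigma>' \<pi>" "T \<sigma>' \<pi> = T \<sigma> \<pi>"
proof -
  have 0: "C \<sigma>' 0 0 0 = C \<sigma> 0 0 0" by (rule assms(2)) simp_all
  then show "T \<sigma>' \<pi> = T \<sigma> \<pi>" by simp
  show "VP \<sigma>' \<pi>"
    unfolding VP_def 0 by (rule vperm_cong[OF assms(1)[unfolded VP_def]]) (simp_all add: assms(2))
qed

lemma SS_cong:
  assumes "SS \<sigma> a S" "S \<subseteq> {..<N}" "\<And>i f. i \<le> N \<Longrightarrow> f \<le> 1 \<Longrightarrow> C \<sigma>' i a f = C \<sigma> i a f"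
  shows "SS \<sigma>' a S"
proof -
  have 0: "C \<sigma>' 0 a 0 = C \<sigma> 0 a 0" by (rule assms(3)) simp_all
  show ?thesis
    unfolding SS_def 0 by (rule sset_cong[OF assms(1)[unfolded SS_def] assms(2)]) (simp_all add: assms(3))
qed

lemma touch:
  assumes s: "same \<sigma>0 \<sigma>" and v: "VP \<sigma> \<pi>" and t: "t < N"
  obtains \<pi>' where "VP (lv_touch k c it \<sigma> o' p B N tot t) \<pi>'"
    "T (lv_touch k c it \<sigma> o' p B N tot t) \<pi>' = insert t (T \<sigma> \<pi>)"
    "\<And>i a f. i \<le> N \<Longrightarrow> 1 \<le> a \<Longrightarrow> a \<le> c \<Longrightarrow> f \<le> 1 \<Longrightarrow> C (lv_touch k c it \<sigma> o' p B N tot t) i a f = C \<sigma> i a f"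
    "t \<in> T \<sigma> \<pi> \<Longrightarrow> lv_touch k c it \<sigma> o' p B N tot t = \<sigma>"
    "t \<notin> T \<sigma> \<pi> \<Longrightarrow> Ri t (lv_touch k c it \<sigma> o' p B N tot t) (\<lambda>_. d)"
    "frame ({o'..<L} \<union> FPi t) \<sigma> (lv_touch k c it \<sigma> o' p B N tot t)"
proof (cases "t \<in> T \<sigma> \<pi>")
  case True
  then have "lv_touch k c it \<sigma> o' p B N tot t = \<sigma>" using VP_ltst[OF v] by (simp add: lv_touch_def)
  with True v show ?thesis by (intro that[of \<pi>]) (auto simp: frame_refl)
next
  case False
  define u where "u = C \<sigma> 0 0 0"
  define q where "q = lidx k c \<sigma> o' p t"
  define y where "y = lat k c \<sigma> o' p u"
  note V = v[unfolded VP_def, folded u_def]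
  have q: "q = (if t < u then C \<sigma> (Suc t) 0 1 else t)" by (simp add: q_def lidx_def u_def)
  have T: "t \<notin> \<pi> ` {..<u}" using False by (simp add: u_def)
  note un = vperm_untouched[OF V t T, folded q]
  have "u < N" using un by simp
  then have y: "y = \<pi> u" using VP_at[OF v, of u] by (simp add: y_def u_def)
  note vt = vperm_touch[OF V t T q y]
  define \<sigma>1 where "\<sigma>1 = W \<sigma> (Suc q) 0 0 y"
  define \<sigma>2 where "\<sigma>2 = W \<sigma>1 (Suc y) 0 1 q"
  define \<sigma>3 where "\<sigma>3 = W \<sigma>2 (Suc u) 0 0 t"
  define \<sigma>4 where "\<sigma>4 = W \<sigma>3 (Suc t) 0 1 u"
  define \<sigma>5 where "\<sigma>5 = W \<sigma>4 0 0 0 (Suc u)"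
  define \<sigma>6 where "\<sigma>6 = iin it \<sigma>5 L p t (sz t)"
  have touch: "lv_touch k c it \<sigma> o' p B N tot t = \<sigma>6"
    using VP_ltst[OF v] False
    by (simp add: lv_touch_def Let_def \<sigma>6_def \<sigma>5_def \<sigma>4_def \<sigma>3_def \<sigma>2_def \<sigma>1_def u_def q_def y_def)
  have sm: "same \<sigma>0 \<sigma>1" "same \<sigma>0 \<sigma>2" "same \<sigma>0 \<sigma>3" "same \<sigma>0 \<sigma>4" "same \<sigma>0 \<sigma>5"
    unfolding \<sigma>5_def \<sigma>4_def \<sigma>3_def \<sigma>2_def \<sigma>1_def using s by (auto intro!: same_W)
  have yN: "y < N" using vt(4) \<open>u < N\<close> by simp
  \<comment> \<open>Some of the five writes may hit the same cell. The case distinction names the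
    latest write first, in agreement with the order of the updates in
    \<open>vperm_touch\<close>.\<close>
  have C5: "C \<sigma>5 i a f = (if a \<noteq> 0 then C \<sigma> i a f else if i = 0 \<and> f = 0 then Suc u
      else if i = Suc t \<and> f = 1 then u else if i = Suc u \<and> f = 0 then t
      else if i = Suc y \<and> f = 1 then q else if i = Suc q \<and> f = 0 then y else C \<sigma> i a f)"
    if "a \<le> c" "f \<le> 1" for i a f
  proof -
    have 5: "C \<sigma>5 i a f = (if i = 0 \<and> a = 0 \<and> f = 0 then Suc u else C \<sigma>4 i a f)"
      unfolding \<sigma>5_def using sm \<open>u < N\<close> that by (intro C_W) auto
    have 4: "C \<sigma>4 i a f = (if i = Suc t \<and> a = 0 \<and> f = 1 then u else C \<sigma>3 i a f)"
      unfolding \<sigma>4_def using sm \<open>u < N\<close> t that by (intro C_W) auto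
    have 3: "C \<sigma>3 i a f = (if i = Suc u \<and> a = 0 \<and> f = 0 then t else C \<sigma>2 i a f)"
      unfolding \<sigma>3_def using sm \<open>u < N\<close> t that by (intro C_W) auto
    have 2: "C \<sigma>2 i a f = (if i = Suc y \<and> a = 0 \<and> f = 1 then q else C \<sigma>1 i a f)"
      unfolding \<sigma>2_def using sm un yN that by (intro C_W) auto
    have 1: "C \<sigma>1 i a f = (if i = Suc q \<and> a = 0 \<and> f = 0 then y else C \<sigma> i a f)"
      unfolding \<sigma>1_def using s un yN that by (intro C_W) auto
    show ?thesis unfolding 5 4 3 2 1 by simp
  qed
  let ?\<pi> = "\<pi>(q := y, u := t)"
  have c0: "C \<sigma>5 0 0 0 = Suc u" using C5[of 0 0 0] by simp
  have VP5: "VP \<sigma>5 ?\<pi>"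
    unfolding VP_def c0 by (rule vperm_cong[OF vt(1)]) (simp_all add: C5)
  have st: "Ri t \<sigma>6 (\<lambda>_. d)" "frame (FPi t) \<sigma>5 \<sigma>6"
    unfolding \<sigma>6_def using struct.ini[OF items[OF t] sm(5)] by auto
  have C6: "C \<sigma>6 i a f = C \<sigma>5 i a f" if "i \<le> N" "a \<le> c" "f \<le> 1" for i a f
    by (rule C_frame[OF sm(5) st(2) disj(2)[OF t] that])
  have fr: "frame {o'..<L} \<sigma> \<sigma>5"
  proof -
    have "frame {o'..<L} \<sigma> \<sigma>1" unfolding \<sigma>1_def using s un by (intro frame_W) auto
    moreover have "frame {o'..<L} \<sigma>1 \<sigma>2" unfolding \<sigma>2_def using sm yN by (intro frame_W) auto
    moreover have "frame {o'..<L} \<sigma>2 \<sigma>3" unfolding \<sigma>3_def using sm \<open>u < N\<close> by (intro frame_W) auto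
    moreover have "frame {o'..<L} \<sigma>3 \<sigma>4" unfolding \<sigma>4_def using sm t by (intro frame_W) auto
    moreover have "frame {o'..<L} \<sigma>4 \<sigma>5" unfolding \<sigma>5_def using sm by (intro frame_W) auto
    ultimately show ?thesis by (meson frame_trans)
  qed
  have VP6: "VP \<sigma>6 ?\<pi>" "T \<sigma>6 ?\<pi> = T \<sigma>5 ?\<pi>"
    using VP_cong[OF VP5, of \<sigma>6] C6 by auto
  show ?thesis
  proof (rule that[of ?\<pi>], unfold touch)
    show "VP \<sigma>6 ?\<pi>" "T \<sigma>6 ?\<pi> = insert t (T \<sigma> \<pi>)"
      using VP6 vt(2) C5[of 0 0 0] by (simp_all add: u_def)
    show "C \<sigma>6 i a f = C \<sigma> i a f" if "i \<le> N" "1 \<le> a" "a \<le> c" "f \<le> 1" for i a f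
      using that C6 C5 by simp
    show "frame ({o'..<L} \<union> FPi t) \<sigma> \<sigma>6"
      by (rule frame_trans[OF frame_mono[OF fr] frame_mono[OF st(2)]]) auto
  qed (use False st in auto)
qed

lemma fix_list:
  assumes s: "same \<sigma>0 \<sigma>" and S: "SS \<sigma> (Suc a) S" "S \<subseteq> {..<N}" and a: "a < c" and t: "t < N"
  defines "\<sigma>' \<equiv> lv_fix k c it \<sigma> o' p B N tot t a"
  shows "SS \<sigma>' (Suc a) (if ifi it \<sigma> L p t (sz t) a = 0 then S - {t} else insert t S)"
    "\<And>i a' f. a' \<le> c \<Longrightarrow> f \<le> 1 \<Longrightarrow> a' \<noteq> Suc a \<Longrightarrow> C \<sigma>' i a' f = C \<sigma> i a' f"
    "frame {o'..<L} \<sigma> \<sigma>'"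
proof -
  define n where "n = C \<sigma> 0 (Suc a) 0"
  note SS = S(1)[unfolded SS_def, folded n_def]
  have nN: "n \<le> N" using sset_card[OF SS] card_mono[OF _ S(2)] by simp
  let ?h = "ifi it \<sigma> L p t (sz t) a = 0"
  have m: "ltst k c \<sigma> o' p (Suc a) t \<longleftrightarrow> t \<in> S" by (rule SS_ltst[OF S(1)])
  have "SS \<sigma>' (Suc a) (if ?h then S - {t} else insert t S) \<and>
    (\<forall>i a' f. a' \<le> c \<longrightarrow> f \<le> 1 \<longrightarrow> a' \<noteq> Suc a \<longrightarrow> C \<sigma>' i a' f = C \<sigma> i a' f) \<and> frame {o'..<L} \<sigma> \<sigma>'"
  \<comment> \<open>In the case \<open>True\<close> the sparse set and the item contradict each
    other, and a repair is due.\<close>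
  proof (cases "?h \<longleftrightarrow> t \<in> S")
    case False
    then have "\<sigma>' = \<sigma>" "(if ?h then S - {t} else insert t S) = S"
      using m by (auto simp: \<sigma>'_def lv_fix_def Let_def)
    then show ?thesis using S(1) by (simp add: frame_refl)
  next
    case True
    show ?thesis
    proof (cases "t \<in> S")
      case tS: True
      define q where "q = C \<sigma> (Suc t) (Suc a) 1"
      define l where "l = C \<sigma> n (Suc a) 0"
      have q: "q < n" using SS tS by (auto simp: sset_def q_def)
      then have n: "Suc (n - 1) = n" by simp
      have l: "l \<in> S" using SS q n unfolding sset_def l_def by (metis lessI)
      then have lN: "l < N" using S(2) by auto
      define \<sigma>1 where "\<sigma>1 = W \<sigma> (Suc q) (Suc a) 0 l"
      define \<sigma>2 where "\<sigma>2 = W \<sigma>1 (Suc l) (Suc a) 1 q"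
      have \<sigma>': "\<sigma>' = W \<sigma>2 0 (Suc a) 0 (n - 1)"
        using True tS m by (simp add: \<sigma>'_def lv_fix_def Let_def \<sigma>2_def \<sigma>1_def q_def l_def n_def)
      have sm: "same \<sigma>0 \<sigma>1" "same \<sigma>0 \<sigma>2" unfolding \<sigma>2_def \<sigma>1_def using s by (auto intro!: same_W)
      have C': "C \<sigma>' i a' f = (if a' \<noteq> Suc a then C \<sigma> i a' f else if i = 0 \<and> f = 0 then n - 1
        else if i = Suc l \<and> f = 1 then q else if i = Suc q \<and> f = 0 then l else C \<sigma> i a' f)"
        if "a' \<le> c" "f \<le> 1" for i a' f
      proof -
        have 3: "C \<sigma>' i a' f = (if i = 0 \<and> a' = Suc a \<and> f = 0 then n - 1 else C \<sigma>2 i a' f)"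
          unfolding \<sigma>' using sm a nN that by (intro C_W) auto
        have 2: "C \<sigma>2 i a' f = (if i = Suc l \<and> a' = Suc a \<and> f = 1 then q else C \<sigma>1 i a' f)"
          unfolding \<sigma>2_def using sm a nN q lN that by (intro C_W) auto
        have 1: "C \<sigma>1 i a' f = (if i = Suc q \<and> a' = Suc a \<and> f = 0 then l else C \<sigma> i a' f)"
          unfolding \<sigma>1_def using s a nN q lN that by (intro C_W) auto
        show ?thesis unfolding 3 2 1 by simp
      qed
      have c0: "C \<sigma>' 0 (Suc a) 0 = n - 1" using C'[of "Suc a" 0 0] a by simp
      have rem: "sset (n - 1) ((\<lambda>i. C \<sigma> (Suc i) (Suc a) 0)(q := l)) ((\<lambda>i. C \<sigma> (Suc i) (Suc a) 1)(l := q)) (S - {t})"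
        using sset_remove[OF SS tS] unfolding n q_def l_def .
      have "SS \<sigma>' (Suc a) (S - {t})"
        unfolding SS_def c0 by (rule sset_cong[OF rem, of N]) (use S(2) a in \<open>auto simp: C'\<close>)
      moreover have "frame {o'..<L} \<sigma> \<sigma>'"
      proof -
        have "frame {o'..<L} \<sigma> \<sigma>1" unfolding \<sigma>1_def using s q nN a by (intro frame_W) auto
        moreover have "frame {o'..<L} \<sigma>1 \<sigma>2" unfolding \<sigma>2_def using sm lN a by (intro frame_W) auto
        moreover have "frame {o'..<L} \<sigma>2 \<sigma>'" unfolding \<sigma>' using sm a by (intro frame_W) auto
        ultimately show ?thesis by (meson frame_trans)
      qed
      ultimately show ?thesis using True tS C' by auto
    next
      case tS: False
      \<comment> \<open>\<open>t\<close> itself is not yet listed, so a slot is free.\<close>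
      have "n < N"
      proof -
        have "card (insert t S) \<le> N" using card_mono[of "{..<N}" "insert t S"] S(2) t by auto
        then show ?thesis using sset_card[OF SS] tS by simp
      qed
      define \<sigma>1 where "\<sigma>1 = W \<sigma> (Suc n) (Suc a) 0 t"
      define \<sigma>2 where "\<sigma>2 = W \<sigma>1 (Suc t) (Suc a) 1 n"
      have \<sigma>': "\<sigma>' = W \<sigma>2 0 (Suc a) 0 (Suc n)"
        using True tS m by (simp add: \<sigma>'_def lv_fix_def Let_def \<sigma>2_def \<sigma>1_def n_def)
      have sm: "same \<sigma>0 \<sigma>1" "same \<sigma>0 \<sigma>2" unfolding \<sigma>2_def \<sigma>1_def using s by (auto intro!: same_W)
      have C': "C \<sigma>' i a' f = (if a' \<noteq> Suc a then C \<sigma> i a' f else if i = 0 \<and> f = 0 then Suc n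
        else if i = Suc t \<and> f = 1 then n else if i = Suc n \<and> f = 0 then t else C \<sigma> i a' f)"
        if "a' \<le> c" "f \<le> 1" for i a' f
      proof -
        have 3: "C \<sigma>' i a' f = (if i = 0 \<and> a' = Suc a \<and> f = 0 then Suc n else C \<sigma>2 i a' f)"
          unfolding \<sigma>' using sm a \<open>n < N\<close> that by (intro C_W) auto
        have 2: "C \<sigma>2 i a' f = (if i = Suc t \<and> a' = Suc a \<and> f = 1 then n else C \<sigma>1 i a' f)"
          unfolding \<sigma>2_def using sm a t \<open>n < N\<close> that by (intro C_W) auto
        have 1: "C \<sigma>1 i a' f = (if i = Suc n \<and> a' = Suc a \<and> f = 0 then t else C \<sigma> i a' f)"
          unfolding \<sigma>1_def using s a t \<open>n < N\<close> that by (intro C_W) auto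
        show ?thesis unfolding 3 2 1 by simp
      qed
      have c0: "C \<sigma>' 0 (Suc a) 0 = Suc n" using C'[of "Suc a" 0 0] a by simp
      have "SS \<sigma>' (Suc a) (insert t S)"
        unfolding SS_def c0 by (rule sset_cong[OF sset_add[OF SS tS], of N]) (use S(2) a t in \<open>auto simp: C'\<close>)
      moreover have "frame {o'..<L} \<sigma> \<sigma>'"
      proof -
        have "frame {o'..<L} \<sigma> \<sigma>1" unfolding \<sigma>1_def using s \<open>n < N\<close> a by (intro frame_W) auto
        moreover have "frame {o'..<L} \<sigma>1 \<sigma>2" unfolding \<sigma>2_def using sm t a by (intro frame_W) auto
        moreover have "frame {o'..<L} \<sigma>2 \<sigma>'" unfolding \<sigma>' using sm a by (intro frame_W) auto
        ultimately show ?thesis by (meson frame_trans)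
      qed
      ultimately show ?thesis using True tS C' by auto
    qed
  qed
  then show "SS \<sigma>' (Suc a) (if ?h then S - {t} else insert t S)"
    "\<And>i a' f. a' \<le> c \<Longrightarrow> f \<le> 1 \<Longrightarrow> a' \<noteq> Suc a \<Longrightarrow> C \<sigma>' i a' f = C \<sigma> i a' f"
    "frame {o'..<L} \<sigma> \<sigma>'" by blast+
qed

end

lemma lnk_upt: "a \<le> n \<Longrightarrow> lnk (\<lambda>r. if Suc r < n then Suc (Suc r) else 0) (if a < n then Suc a else 0) [a..<n] 0"
proof (induction rule: inc_induct)
  case (step a)
  then show ?case by (simp add: upt_conv_Cons)
qed simp

context level
begin

lemma R_E:
  assumes "R \<sigma> f"
  obtains \<pi> where "VP \<sigma> \<pi>" "\<And>j. j < c \<Longrightarrow> SS \<sigma> (Suc j) {t \<in> T \<sigma> \<pi>. \<exists>r<sz t. f (t * B + r) = j}"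
    "\<And>t. t \<in> T \<sigma> \<pi> \<Longrightarrow> Ri t \<sigma> (\<lambda>r. f (t * B + r))"
    "\<And>t r. t < N \<Longrightarrow> t \<notin> T \<sigma> \<pi> \<Longrightarrow> r < sz t \<Longrightarrow> f (t * B + r) = d"
proof -
  obtain \<pi> where v: "VP \<sigma> \<pi>" and b: "\<forall>j<c. SS \<sigma> (Suc j) {t \<in> T \<sigma> \<pi>. \<exists>r<sz t. f (t * B + r) = j}"
    and e: "\<forall>t\<in>T \<sigma> \<pi>. Ri t \<sigma> (\<lambda>r. f (t * B + r))"
    and h: "\<forall>t<N. t \<notin> T \<sigma> \<pi> \<longrightarrow> (\<forall>r<sz t. f (t * B + r) = d)"
    using assms unfolding R_def by (elim exE conjE) (rule that)
  show ?thesis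
    by (rule that[OF v b[rule_format] e[rule_format] h[rule_format]])
qed

lemma sz_pos: "t < N \<Longrightarrow> 0 < sz t"
  using tot B1 by (auto simp: lsz_def)

lemma lit_less: "lit B N x < N"
  using N1 by (simp add: lit_def)

lemma lit_split:
  assumes "x < tot"
  shows "lit B N x * B \<le> x" "x - lit B N x * B < sz (lit B N x)"
proof -
  have 1: "lit B N x * B \<le> x"
  proof (cases "x div B < N")
    case False
    then have "(N - 1) * B \<le> x div B * B" by (intro mult_right_mono) auto
    also have "\<dots> \<le> x" by simp
    finally show ?thesis using False by (simp add: lit_def)
  qed (simp add: lit_def)
  then show "lit B N x * B \<le> x" .
  show "x - lit B N x * B < sz (lit B N x)"
  proof (cases "Suc (lit B N x) = N")
    case True
    then show ?thesis using assms 1 by (simp add: lsz_def diff_less_mono)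
  next
    case False
    then have "lit B N x = x div B" using N1 by (auto simp: lit_def split: if_splits)
    then show ?thesis using False B1 by (simp add: lsz_def minus_div_mult_eq_mod)
  qed
qed

lemma lit_comb:
  assumes "t < N" "r < sz t"
  shows "t * B + r < tot" "lit B N (t * B + r) = t"
proof -
  have "t * B + r < tot \<and> lit B N (t * B + r) = t"
  proof (cases "Suc t = N")
    case True
    have "t \<le> (t * B + r) div B" using B1 by (simp add: div_mult_self1)
    then show ?thesis using True assms(2) by (auto simp: lsz_def lit_def)
  next
    case False
    then have r: "r < B" using assms by (simp add: lsz_def)
    have "(t + 1) * B \<le> (N - 1) * B" using False assms(1) by (intro mult_le_mono1) simp
    then show ?thesis using r tot assms(1) by (simp add: lit_def)
  qed
  then show "t * B + r < tot" "lit B N (t * B + r) = t" by auto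
qed

lemma R_get:
  assumes s: "same \<sigma>0 \<sigma>" and R: "R \<sigma> f" and x: "x < tot"
  shows "lv_get k c d it \<sigma> o' p B N tot x = f x \<and> f x < c"
proof -
  obtain \<pi> where v: "VP \<sigma> \<pi>" and r: "\<And>t. t \<in> T \<sigma> \<pi> \<Longrightarrow> Ri t \<sigma> (\<lambda>r. f (t * B + r))"
    "\<And>t r. t < N \<Longrightarrow> t \<notin> T \<sigma> \<pi> \<Longrightarrow> r < sz t \<Longrightarrow> f (t * B + r) = d"
    by (rule R_E[OF R]) blast
  let ?t = "lit B N x"
  note sp = lit_split[OF x]
  have e: "?t * B + (x - ?t * B) = x" using sp by simp
  show ?thesis
  proof (cases "?t \<in> T \<sigma> \<pi>")
    case True
    then have "Ri ?t \<sigma> (\<lambda>r. f (?t * B + r))" by (rule r(1))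
    from struct.get[OF items[OF lit_less[of x]], OF s this sp(2)] show ?thesis
      using True VP_ltst[OF v] by (simp add: lv_get_def e)
  next
    case False
    then have "f (?t * B + (x - ?t * B)) = d" using r(2)[OF lit_less[of x] _ sp(2)] by simp
    then show ?thesis using False VP_ltst[OF v] dc by (simp add: lv_get_def e)
  qed
qed

text \<open>The lists of the items in the set of colour \<open>j\<close> are concatenated and
  followed, for \<open>j = d\<close>, by all elements of the untouched items. No step is spent on an
  item without a hit: listed items contain \<open>j\<close>, and untouched ones are nonempty and
  consist of \<open>d\<close>.\<close>

lemma R_enum:
  assumes s: "same \<sigma>0 \<sigma>" and R: "R \<sigma> f" and j: "j < c"
  shows "\<exists>xs. distinct xs \<and> set xs = {x. x < tot \<and> f x = j} \<and>
    lnk (lv_next k c d it \<sigma> o' p B N tot j) (lv_first k c d it \<sigma> o' p B N tot j) xs 0"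
proof -
  obtain \<pi> where v: "VP \<sigma> \<pi>" and SSj: "SS \<sigma> (Suc j) {t \<in> T \<sigma> \<pi>. \<exists>r<sz t. f (t * B + r) = j}"
    and r: "\<And>t. t \<in> T \<sigma> \<pi> \<Longrightarrow> Ri t \<sigma> (\<lambda>r. f (t * B + r))"
    "\<And>t r. t < N \<Longrightarrow> t \<notin> T \<sigma> \<pi> \<Longrightarrow> r < sz t \<Longrightarrow> f (t * B + r) = d"
    by (rule R_E[OF R]) (use j in blast)
  define u where "u = C \<sigma> 0 0 0"
  note V = v[unfolded VP_def, folded u_def]
  define S where "S = {t \<in> T \<sigma> \<pi>. \<exists>r<sz t. f (t * B + r) = j}"
  define n where "n = C \<sigma> 0 (Suc j) 0"
  define A where "A i = C \<sigma> (Suc i) (Suc j) 0" for i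
  have uN: "u \<le> N" using V unfolding vperm_def by (rule conjunct1)
  have SSn: "sset n A (\<lambda>i. C \<sigma> (Suc i) (Suc j) 1) S"
    using SSj unfolding SS_def n_def A_def S_def .
  have AS: "A i \<in> S" "C \<sigma> (Suc (A i)) (Suc j) 1 = i" if "i < n" for i
    using SSn that unfolding sset_def by auto
  have SN: "y < N" "y \<in> T \<sigma> \<pi>" if "y \<in> S" for y using that VP_T[OF v] by (auto simp: S_def)
  let ?fi = "\<lambda>y. ifi it \<sigma> L p y (sz y) j" let ?ne = "\<lambda>y. ine it \<sigma> L p y (sz y) j"
  let ?nx = "lv_next k c d it \<sigma> o' p B N tot j"
  let ?lf = "lfrom k c d it \<sigma> o' p B N tot j"
  let ?uf = "ufrom k c d \<sigma> o' p B N j"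
  have "\<forall>y\<in>S. \<exists>l. set l = {r. r < sz y \<and> f (y * B + r) = j} \<and> lnk (?ne y) (?fi y) l 0"
  proof
    fix y assume "y \<in> S"
    from struct.enum[OF items[OF SN(1)[OF this]], OF s r(1)[OF SN(2)[OF this]] j]
    show "\<exists>l. set l = {r. r < sz y \<and> f (y * B + r) = j} \<and> lnk (?ne y) (?fi y) l 0" by blast
  qed
  from bchoice[OF this] obtain LL where LL: "\<And>y. y \<in> S \<Longrightarrow> set (LL y) = {r. r < sz y \<and> f (y * B + r) = j}"
    "\<And>y. y \<in> S \<Longrightarrow> lnk (?ne y) (?fi y) (LL y) 0"
    by blast
  \<comment> \<open>From index \<open>i\<close> of the sparse set to its end, where the untouched
    items take over.\<close>
  have c1: "i \<le> n \<Longrightarrow> lnk ?nx (?lf i) (concat (map (\<lambda>i. map (\<lambda>r. A i * B + r) (LL (A i))) [i..<n])) (?uf u)" for i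
  proof (induction rule: inc_induct)
    case base
    then show ?case by (simp add: lfrom_def n_def u_def)
  next
    case (step i)
    define y where "y = A i"
    have y: "y \<in> S" "y < N" "y \<in> T \<sigma> \<pi>" and pos: "C \<sigma> (Suc y) (Suc j) 1 = i"
      using AS[of i] SN step by (auto simp: y_def)
    have "?fi y \<noteq> 0"
    proof
      assume "?fi y = 0"
      then have "LL y = []" using LL(2)[OF y(1)] by (cases "LL y") auto
      then show False using LL(1)[OF y(1)] y(1) by (auto simp: S_def)
    qed
    moreover have "lnk ?nx (if ?fi y = 0 then ?lf (Suc i) else Suc (y * B + (?fi y - 1)))
        (map (\<lambda>r. y * B + r) (LL y)) (?lf (Suc i))"
    proof (rule lnk_map[OF LL(2)[OF y(1)]])
      fix r assume "r \<in> set (LL y)"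
      then have "lit B N (y * B + r) = y" using LL(1)[OF y(1)] lit_comb[OF y(2)] by auto
      then show "?nx (y * B + r) = (if ?ne y r = 0 then ?lf (Suc i) else Suc (y * B + (?ne y r - 1)))"
        using y(3) VP_ltst[OF v] by (simp add: lv_next_def pos[unfolded One_nat_def])
    qed
    moreover have "?lf i = Suc (y * B + (?fi y - 1))"
      using step(2) by (simp add: lfrom_def n_def[symmetric] y_def A_def)
    ultimately have "lnk ?nx (?lf i) (map (\<lambda>r. y * B + r) (LL y)) (?lf (Suc i))" by simp
    then show ?case
      using step by (auto simp: upt_conv_Cons lnk_append y_def)
  qed
  \<comment> \<open>From place \<open>q\<close> of the permutation to its end; the untouched items
    are those at the places from \<open>u\<close> on.\<close>
  have c2: "q \<le> N \<Longrightarrow> u \<le> q \<Longrightarrow> lnk ?nx (?uf q) (concat (map (\<lambda>i. map (\<lambda>r. \<pi> i * B + r) [0..<sz (\<pi> i)]) [q..<N])) 0"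
    if "j = d" for q
  proof (induction rule: inc_induct)
    case base
    then show ?case by (simp add: ufrom_def)
  next
    case (step q)
    define y where "y = \<pi> q"
    have yN: "y < N" using vperm_less[OF V, of q] step by (simp add: y_def)
    have yT: "y \<notin> T \<sigma> \<pi>"
    proof
      assume "y \<in> T \<sigma> \<pi>"
      then obtain i where i: "i < u" "\<pi> i = \<pi> q" unfolding y_def u_def by (elim imageE) simp
      then have "i = q" using vperm_inj[OF V, of i q] step uN by simp
      with i step show False by simp
    qed
    \<comment> \<open>Given only an element, the enumeration has to find the place of its item
      again.\<close>
    have idx: "lidx k c \<sigma> o' p y = q"
    proof -
      note un = vperm_untouched[OF V yN yT[folded u_def]]
      have "\<pi> (if y < u then C \<sigma> (Suc y) 0 1 else y) = \<pi> q" using un(3) unfolding y_def .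
      then show ?thesis
        unfolding lidx_def u_def[symmetric] using vperm_inj[OF V un(2), of q] step by simp
    qed
    have "lnk ?nx (if 1 = (0 :: nat) then ?uf (Suc q) else Suc (y * B + (1 - 1))) (map (\<lambda>r. y * B + r) [0..<sz y]) (?uf (Suc q))"
    proof (rule lnk_map[where inx = "\<lambda>r. if Suc r < sz y then Suc (Suc r) else 0"])
      show "lnk (\<lambda>r. if Suc r < sz y then Suc (Suc r) else 0) 1 [0..<sz y] 0"
        using lnk_upt[of 0 "sz y"] sz_pos[OF yN] by simp
      fix r assume "r \<in> set [0..<sz y]"
      then have "lit B N (y * B + r) = y" using lit_comb[OF yN] by auto
      then show "?nx (y * B + r) = (if (if Suc r < sz y then Suc (Suc r) else 0) = 0 then ?uf (Suc q)
          else Suc (y * B + ((if Suc r < sz y then Suc (Suc r) else 0) - 1)))"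
        using yT VP_ltst[OF v] by (simp add: lv_next_def idx)
    qed
    moreover have "?uf q = Suc (y * B)"
      using that step VP_at[OF v, of q] by (simp add: ufrom_def y_def u_def)
    ultimately have "lnk ?nx (?uf q) (map (\<lambda>r. y * B + r) [0..<sz y]) (?uf (Suc q))" by simp
    then show ?case
      using step by (auto simp: upt_conv_Cons lnk_append y_def)
  qed
  define X1 where "X1 = concat (map (\<lambda>i. map (\<lambda>r. A i * B + r) (LL (A i))) [0..<n])"
  define X2 where "X2 = (if j = d then concat (map (\<lambda>i. map (\<lambda>r. \<pi> i * B + r) [0..<sz (\<pi> i)]) [u..<N]) else [])"
  have "lnk ?nx (?uf u) X2 0"
    using c2[of u] uN by (auto simp: X2_def ufrom_def)
  then have lk: "lnk ?nx (lv_first k c d it \<sigma> o' p B N tot j) (X1 @ X2) 0"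
    using c1[of 0] unfolding lnk_append X1_def lv_first_def by auto
  have iS: "\<exists>i<n. A i = y" if "y \<in> S" for y using SSn that unfolding sset_def by metis
  have X1: "x \<in> set X1 \<longleftrightarrow> (\<exists>y\<in>S. \<exists>r<sz y. f (y * B + r) = j \<and> x = y * B + r)" for x
  proof -
    have "x \<in> set X1 \<longleftrightarrow> (\<exists>i<n. \<exists>r\<in>set (LL (A i)). x = A i * B + r)" by (auto simp: X1_def)
    also have "\<dots> \<longleftrightarrow> (\<exists>y\<in>S. \<exists>r\<in>set (LL y). x = y * B + r)" using iS AS(1) by metis
    finally show ?thesis using LL(1) by auto
  qed
  have X2: "x \<in> set X2 \<longleftrightarrow> j = d \<and> (\<exists>y<N. y \<notin> T \<sigma> \<pi> \<and> (\<exists>r<sz y. x = y * B + r))" for x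
  proof -
    have "(\<exists>i. u \<le> i \<and> i < N \<and> \<pi> i = y) \<longleftrightarrow> y < N \<and> y \<notin> T \<sigma> \<pi>" for y
    proof
      assume "\<exists>i. u \<le> i \<and> i < N \<and> \<pi> i = y"
      then show "y < N \<and> y \<notin> T \<sigma> \<pi>"
        using vperm_inj[OF V] vperm_less[OF V] uN by (auto simp: u_def[symmetric])
    next
      assume "y < N \<and> y \<notin> T \<sigma> \<pi>"
      then show "\<exists>i. u \<le> i \<and> i < N \<and> \<pi> i = y"
        using vperm_untouched[OF V, of y] unfolding u_def by blast
    qed
    moreover have "set X2 = (if j = d then \<Union>i\<in>{u..<N}. (\<lambda>r. \<pi> i * B + r) ` {0..<sz (\<pi> i)} else {})"
      by (auto simp: X2_def)
    then have s2: "set X2 = (if j = d then \<Union>i\<in>{u..<N}. (\<lambda>r. \<pi> i * B + r) ` {0..<sz (\<pi> i)} else {})" .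
    have "x \<in> set X2 \<longleftrightarrow> j = d \<and> (\<exists>y. (\<exists>i. u \<le> i \<and> i < N \<and> \<pi> i = y) \<and> (\<exists>r<sz y. x = y * B + r))"
    proof
      assume "x \<in> set X2"
      then obtain i r where "j = d" "u \<le> i" "i < N" "r < sz (\<pi> i)" "x = \<pi> i * B + r"
        unfolding s2 by (auto split: if_splits simp del: image_add_atLeastLessThan)
      then show "j = d \<and> (\<exists>y. (\<exists>i. u \<le> i \<and> i < N \<and> \<pi> i = y) \<and> (\<exists>r<sz y. x = y * B + r))" by blast
    next
      assume "j = d \<and> (\<exists>y. (\<exists>i. u \<le> i \<and> i < N \<and> \<pi> i = y) \<and> (\<exists>r<sz y. x = y * B + r))"
      then obtain i r where *: "j = d" "u \<le> i" "i < N" "r < sz (\<pi> i)" "x = \<pi> i * B + r" by blast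
      then have "x \<in> (\<Union>i\<in>{u..<N}. (\<lambda>r. \<pi> i * B + r) ` {0..<sz (\<pi> i)})"
        by (intro UN_I[of i] image_eqI[of _ _ r]) auto
      then show "x \<in> set X2" unfolding s2 using *(1) by simp
    qed
    ultimately show ?thesis by metis
  qed
  have "set (X1 @ X2) = {x. x < tot \<and> f x = j}"
  proof (intro equalityI subsetI)
    fix x assume "x \<in> set (X1 @ X2)"
    then show "x \<in> {x. x < tot \<and> f x = j}"
      using X1 X2 SN r(2) lit_comb(1) by (auto; blast)
  next
    fix x assume x: "x \<in> {x. x < tot \<and> f x = j}"
    define y where "y = lit B N x" define t where "t = x - y * B"
    have y: "y < N" "t < sz y" "x = y * B + t"
      using lit_split[of x] lit_less x by (auto simp: y_def t_def)
    show "x \<in> set (X1 @ X2)"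
    proof (cases "y \<in> T \<sigma> \<pi>")
      case True
      then have "y \<in> S" using x y by (auto simp: S_def)
      then show ?thesis using X1 x y by auto
    next
      case False
      then have "j = d" using r(2) x y by auto
      then show ?thesis using X2 False y by auto
    qed
  qed
  with lk lnk_distinct[OF lk] show ?thesis by blast
qed

lemma R_set:
  assumes s: "same \<sigma>0 \<sigma>" and R: "R \<sigma> f" and x: "x < tot" and j: "j < c"
  shows "R (lv_set k c it \<sigma> o' p B N tot x j) (f(x := j)) \<and> frame FP \<sigma> (lv_set k c it \<sigma> o' p B N tot x j)"
proof -
  obtain \<pi> where v: "VP \<sigma> \<pi>" and SSj: "\<And>j. j < c \<Longrightarrow> SS \<sigma> (Suc j) {t \<in> T \<sigma> \<pi>. \<exists>r<sz t. f (t * B + r) = j}"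
    and r: "\<And>t. t \<in> T \<sigma> \<pi> \<Longrightarrow> Ri t \<sigma> (\<lambda>r. f (t * B + r))"
    "\<And>t r. t < N \<Longrightarrow> t \<notin> T \<sigma> \<pi> \<Longrightarrow> r < sz t \<Longrightarrow> f (t * B + r) = d"
    by (rule R_E[OF R]) blast
  define t where "t = lit B N x"
  define r' where "r' = x - t * B"
  define g where "g = f(x := j)"
  have t: "t < N" "r' < sz t" "x = t * B + r'"
    using lit_split[OF x] lit_less by (auto simp: t_def r'_def)
  have g: "g (y * B + r) = (if y = t \<and> r = r' then j else f (y * B + r))" if "y < N" "r < sz y" for y r
  proof -
    have "y * B + r = x \<Longrightarrow> y = t" using lit_comb(2)[OF that] by (simp add: t_def)
    then show ?thesis using t(3) by (auto simp: g_def)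
  qed
  obtain \<pi>' where A: "VP (lv_touch k c it \<sigma> o' p B N tot t) \<pi>'"
    "T (lv_touch k c it \<sigma> o' p B N tot t) \<pi>' = insert t (T \<sigma> \<pi>)"
    "\<And>i a f. i \<le> N \<Longrightarrow> 1 \<le> a \<Longrightarrow> a \<le> c \<Longrightarrow> f \<le> 1 \<Longrightarrow> C (lv_touch k c it \<sigma> o' p B N tot t) i a f = C \<sigma> i a f"
    "t \<in> T \<sigma> \<pi> \<Longrightarrow> lv_touch k c it \<sigma> o' p B N tot t = \<sigma>"
    "t \<notin> T \<sigma> \<pi> \<Longrightarrow> Ri t (lv_touch k c it \<sigma> o' p B N tot t) (\<lambda>_. d)"
    "frame ({o'..<L} \<union> FPi t) \<sigma> (lv_touch k c it \<sigma> o' p B N tot t)"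
    using touch[OF s v t(1)] by blast
  define \<sigma>1 where "\<sigma>1 = lv_touch k c it \<sigma> o' p B N tot t"
  note A = A[folded \<sigma>1_def]
  have s1: "same \<sigma>0 \<sigma>1" by (rule frame_same[OF A(6) s])
  have TN: "insert t (T \<sigma> \<pi>) \<subseteq> {..<N}" using VP_T[OF v] t(1) by auto
  \<comment> \<open>A freshly touched item is filled with \<open>d\<close>, which is what
    \<open>f\<close> already had there.\<close>
  have R1t: "Ri t \<sigma>1 (\<lambda>r. f (t * B + r))"
  proof (cases "t \<in> T \<sigma> \<pi>")
    case True then show ?thesis using A(4) r(1) by simp
  next
    case False
    show ?thesis by (rule struct.ext[OF items[OF t(1)], OF s1 A(5)[OF False]]) (use r(2) t False in auto)
  qed
  have R1: "Ri y \<sigma>1 (\<lambda>r. f (y * B + r))" if "y \<in> T \<sigma> \<pi>" "y \<noteq> t" for y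
  proof (rule Ri_frame[OF _ s A(6)])
    have "y < N" using that TN by auto
    then show "y < N" "({o'..<L} \<union> FPi t) \<inter> FPi y = {}" using disj t(1) that by blast+
  qed (use r(1) that in auto)
  define \<sigma>2 where "\<sigma>2 = ise it \<sigma>1 L p t (sz t) r' j"
  have st: "Ri t \<sigma>2 ((\<lambda>r. f (t * B + r))(r' := j))" "frame (FPi t) \<sigma>1 \<sigma>2"
    unfolding \<sigma>2_def using struct.set'[OF items[OF t(1)], OF s1 R1t t(2) j] by auto
  have s2: "same \<sigma>0 \<sigma>2" by (rule frame_same[OF st(2) s1])
  have R2: "Ri y \<sigma>2 (\<lambda>r. g (y * B + r))" if "y \<in> insert t (T \<sigma> \<pi>)" for y
  proof (cases "y = t")
    case True
    show ?thesis unfolding True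
      by (rule struct.ext[OF items[OF t(1)], OF s2 st(1)]) (use g[of t] t in auto)
  next
    case False
    have yN: "y < N" using that TN by auto
    have "Ri y \<sigma>2 (\<lambda>r. f (y * B + r))"
    proof (rule Ri_frame[OF yN s1 st(2)])
      show "FPi t \<inter> FPi y = {}" using disj(1)[OF t(1) yN] False by auto
    qed (use R1 that False in auto)
    then show ?thesis
      by (rule struct.ext[OF items[OF yN], OF s2]) (use g[of y] False yN in auto)
  qed
  have C2: "C \<sigma>2 i a f = C \<sigma>1 i a f" if "i \<le> N" "a \<le> c" "f \<le> 1" for i a f
    by (rule C_frame[OF s1 st(2) disj(2)[OF t(1)] that])
  note V2 = VP_cong[OF A(1), of \<sigma>2, OF C2, simplified]
  let ?S = "\<lambda>j. {t \<in> T \<sigma> \<pi>. \<exists>r<sz t. f (t * B + r) = j}"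
  let ?S' = "\<lambda>j. {y \<in> insert t (T \<sigma> \<pi>). \<exists>r<sz y. g (y * B + r) = j}"
  have SN: "?S j \<subseteq> {..<N}" "?S' j \<subseteq> {..<N}" for j
    by (rule subset_trans[OF _ TN], rule subsetI, elim CollectE conjE, erule insertI2)
      (rule subset_trans[OF _ TN], rule subsetI, elim CollectE conjE, assumption)
  have S2: "SS \<sigma>2 (Suc j) (?S j)" if "j < c" for j
    by (rule SS_cong[OF SSj[OF that] SN(1)]) (use A(3) C2 that in simp)
  \<comment> \<open>Items other than \<open>t\<close> contain the same colours as before; only the
    status of \<open>t\<close> is in question.\<close>
  have SS': "?S j - {t} = ?S' j - {t}" for j
  proof -
    define TT where "TT = T \<sigma> \<pi>"
    have "TT \<subseteq> {..<N}" unfolding TT_def by (rule VP_T[OF v])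
    then show ?thesis unfolding TT_def[symmetric] using g by fastforce
  qed
  define F where "F a = lv_fixes k c it \<sigma>2 o' p B N tot t a" for a
  \<comment> \<open>Colours below \<open>a\<close> have been repaired, the others are still listed
    according to \<open>f\<close>.\<close>
  have F: "same \<sigma>0 (F a) \<and> frame {o'..<L} \<sigma>2 (F a) \<and> (\<forall>i f. f \<le> 1 \<longrightarrow> C (F a) i 0 f = C \<sigma>2 i 0 f) \<and>
      (\<forall>j<c. SS (F a) (Suc j) (if j < a then ?S' j else ?S j))" if "a \<le> c" for a
    using that
  proof (induction a)
    case 0
    then show ?case using s2 S2 by (simp add: F_def frame_refl)
  next
    case (Suc a)
    then have IH: "same \<sigma>0 (F a)" "frame {o'..<L} \<sigma>2 (F a)" "\<And>i f. f \<le> 1 \<Longrightarrow> C (F a) i 0 f = C \<sigma>2 i 0 f"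
      "\<And>j. j < c \<Longrightarrow> SS (F a) (Suc j) (if j < a then ?S' j else ?S j)" by auto
    have a: "a < c" using Suc by simp
    have FS: "F (Suc a) = lv_fix k c it (F a) o' p B N tot t a" by (simp add: F_def Let_def)
    have "SS (F a) (Suc a) (?S a)" using IH(4)[OF a] by simp
    note fx = fix_list[OF IH(1) this SN(1) a t(1), folded FS]
    have "Ri t (F a) (\<lambda>r. g (t * B + r))"
      by (rule Ri_frame[OF t(1) s2 IH(2)]) (use disj(2)[OF t(1)] R2[of t] in auto)
    from struct_first_0[OF items[OF t(1)], OF IH(1) this a]
    have "(if ifi it (F a) L p t (sz t) a = 0 then ?S a - {t} else insert t (?S a)) = ?S' a"
      using SS'[of a] by auto
    then have 1: "SS (F (Suc a)) (Suc a) (?S' a)" using fx(1) by simp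
    have 2: "SS (F (Suc a)) (Suc j) (if j < Suc a then ?S' j else ?S j)" if "j < c" for j
    proof (cases "j = a")
      case True then show ?thesis using 1 by simp
    next
      case False
      have "SS (F (Suc a)) (Suc j) (if j < a then ?S' j else ?S j)"
        by (rule SS_cong[OF IH(4)[OF that]]) (use SN fx(2) False that in auto)
      moreover have "(j < Suc a) = (j < a)" using False by auto
      ultimately show ?thesis by simp
    qed
    show ?case
      using frame_same[OF fx(3) IH(1)] frame_trans[OF IH(2) fx(3)] fx(2)[of 0] IH(3) 2 by simp
  qed
  define \<sigma>3 where "\<sigma>3 = F c"
  have F3: "same \<sigma>0 \<sigma>3" "frame {o'..<L} \<sigma>2 \<sigma>3" "\<And>i f. f \<le> 1 \<Longrightarrow> C \<sigma>3 i 0 f = C \<sigma>2 i 0 f"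
    "\<And>j. j < c \<Longrightarrow> SS \<sigma>3 (Suc j) (?S' j)" using F[of c] by (auto simp: \<sigma>3_def)
  have eq: "lv_set k c it \<sigma> o' p B N tot x j = \<sigma>3"
    by (simp add: lv_set_def Let_def t_def r'_def \<sigma>1_def \<sigma>2_def \<sigma>3_def F_def)
  have V3: "VP \<sigma>3 \<pi>'" "T \<sigma>3 \<pi>' = insert t (T \<sigma> \<pi>)"
    using VP_cong[OF V2(1), of \<sigma>3] F3(3) V2(2) A(2) by auto
  have R3: "Ri y \<sigma>3 (\<lambda>r. g (y * B + r))" if "y \<in> insert t (T \<sigma> \<pi>)" for y
    by (rule Ri_frame[OF _ s2 F3(2)]) (use R2[OF that] TN that disj(2)[of y] in auto)
  have "R \<sigma>3 g"
    unfolding R_def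
  proof (intro exI[of _ \<pi>'] conjI allI ballI impI)
    fix y i assume "y < N" "y \<notin> T \<sigma>3 \<pi>'" "i < sz y"
    then show "g (y * B + i) = d" using g[of y i] r(2)[of y i] V3(2) by auto
  qed (use V3 F3(4) R3 in auto)
  moreover have "frame FP \<sigma> \<sigma>3"
  proof -
    have "frame FP \<sigma> \<sigma>1" by (rule frame_mono[OF A(6)]) (use t in \<open>auto simp: FP_def\<close>)
    moreover have "frame FP \<sigma>1 \<sigma>2" by (rule frame_mono[OF st(2)]) (use t in \<open>auto simp: FP_def\<close>)
    moreover have "frame FP \<sigma>2 \<sigma>3" by (rule frame_mono[OF F3(2)]) (auto simp: FP_def)
    ultimately show ?thesis by (meson frame_trans)
  qed
  ultimately show ?thesis unfolding eq g_def by simp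
qed

text \<open>Zero counters make the identity a valid virtual permutation and all sparse sets empty,
  whatever the other cells contain.\<close>

lemma R_ini:
  assumes s: "same \<sigma>0 \<sigma>"
  shows "R (lv_zero k c \<sigma> o' p (Suc c)) (\<lambda>_. d) \<and> frame FP \<sigma> (lv_zero k c \<sigma> o' p (Suc c))"
proof -
  have z: "same \<sigma>0 (lv_zero k c \<sigma> o' p a) \<and> frame {o'..<L} \<sigma> (lv_zero k c \<sigma> o' p a) \<and>
      (\<forall>a'<a. C (lv_zero k c \<sigma> o' p a) 0 a' 0 = 0)" if "a \<le> Suc c" for a
    using that
  proof (induction a)
    case 0 then show ?case using s by (simp add: frame_refl)
  next
    case (Suc a)
    then have IH: "same \<sigma>0 (lv_zero k c \<sigma> o' p a)" "frame {o'..<L} \<sigma> (lv_zero k c \<sigma> o' p a)"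
      "\<forall>a'<a. C (lv_zero k c \<sigma> o' p a) 0 a' 0 = 0" by auto
    have "frame {o'..<L} (lv_zero k c \<sigma> o' p a) (W (lv_zero k c \<sigma> o' p a) 0 a 0 0)"
      using IH(1) Suc.prems by (intro frame_W) auto
    then show ?case
      using IH same_W[OF IH(1)] C_W[OF IH(1), of 0 a 0 _ 0 0] Suc.prems
      by (auto simp: Let_def less_Suc_eq intro: frame_trans)
  qed
  define \<sigma>' where "\<sigma>' = lv_zero k c \<sigma> o' p (Suc c)"
  have C0: "C \<sigma>' 0 a 0 = 0" if "a \<le> c" for a using z[of "Suc c"] that by (simp add: \<sigma>'_def less_Suc_eq_le del: lv_zero.simps)
  have "R \<sigma>' (\<lambda>_. d)"
    unfolding R_def VP_def SS_def
    by (rule exI[of _ id]) (use C0 vperm_0 in \<open>auto simp: sset_def\<close>)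
  moreover have "frame FP \<sigma> \<sigma>'"
    using z[of "Suc c"] by (auto simp: \<sigma>'_def FP_def simp del: lv_zero.simps intro: frame_mono)
  ultimately show ?thesis unfolding \<sigma>'_def by simp
qed

lemma level_struct:
  "struct c d \<sigma>0 FP tot (\<lambda>\<sigma>. lv_get k c d it \<sigma> o' p B N tot) (\<lambda>\<sigma>. lv_first k c d it \<sigma> o' p B N tot)
    (\<lambda>\<sigma>. lv_next k c d it \<sigma> o' p B N tot) (\<lambda>\<sigma>. lv_set k c it \<sigma> o' p B N tot)
    (\<lambda>\<sigma>. lv_zero k c \<sigma> o' p (Suc c)) R"
proof (unfold_locales, goal_cases)
  case (1 \<sigma> \<sigma>' f)
  obtain \<pi> where v: "VP \<sigma> \<pi>" "\<And>j. j < c \<Longrightarrow> SS \<sigma> (Suc j) {t \<in> T \<sigma> \<pi>. \<exists>r<sz t. f (t * B + r) = j}"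
    "\<And>t. t \<in> T \<sigma> \<pi> \<Longrightarrow> Ri t \<sigma> (\<lambda>r. f (t * B + r))"
    "\<And>t r. t < N \<Longrightarrow> t \<notin> T \<sigma> \<pi> \<Longrightarrow> r < sz t \<Longrightarrow> f (t * B + r) = d"
    by (rule R_E[OF 1(3)]) blast
  have CC: "C \<sigma>' i a f = C \<sigma> i a f" if "i \<le> N" "a \<le> c" "f \<le> 1" for i a f
    unfolding C_fld[OF 1(1)] C_fld[OF 1(2)]
    by (rule fld_cong) (use 1(4) cad_le[OF that] in \<open>auto simp: FP_def\<close>)
  note v' = VP_cong[OF v(1), of \<sigma>', OF CC, simplified]
  have "SS \<sigma>' (Suc j) {t \<in> T \<sigma> \<pi>. \<exists>r<sz t. f (t * B + r) = j}" if "j < c" for j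
    by (rule SS_cong[OF v(2)[OF that]]) (use VP_T[OF v(1)] CC that in auto)
  moreover have "Ri t \<sigma>' (\<lambda>r. f (t * B + r))" if "t \<in> T \<sigma> \<pi>" for t
  proof -
    have "t < N" using that VP_T[OF v(1)] by auto
    from struct.stable[OF items[OF this], OF 1(1,2) v(3)[OF that]] show ?thesis
      using 1(4) \<open>t < N\<close> by (auto simp: FP_def)
  qed
  ultimately show ?case using v' v(4) unfolding R_def by (intro exI[of _ \<pi>]) simp
next
  case (2 \<sigma> f f')
  obtain \<pi> where v: "VP \<sigma> \<pi>" "\<And>j. j < c \<Longrightarrow> SS \<sigma> (Suc j) {t \<in> T \<sigma> \<pi>. \<exists>r<sz t. f (t * B + r) = j}"
    "\<And>t. t \<in> T \<sigma> \<pi> \<Longrightarrow> Ri t \<sigma> (\<lambda>r. f (t * B + r))"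
    "\<And>t r. t < N \<Longrightarrow> t \<notin> T \<sigma> \<pi> \<Longrightarrow> r < sz t \<Longrightarrow> f (t * B + r) = d"
    by (rule R_E[OF 2(2)]) blast
  have e: "f' (t * B + r) = f (t * B + r)" if "t < N" "r < sz t" for t r
    using 2(3) lit_comb(1)[OF that] by simp
  have TN: "t < N" if "t \<in> T \<sigma> \<pi>" for t using that VP_T[OF v(1)] by auto
  have "{t \<in> T \<sigma> \<pi>. \<exists>r<sz t. f' (t * B + r) = j} = {t \<in> T \<sigma> \<pi>. \<exists>r<sz t. f (t * B + r) = j}" for j
    using e TN by (intro Collect_cong) metis
  moreover have "Ri t \<sigma> (\<lambda>r. f' (t * B + r))" if "t \<in> T \<sigma> \<pi>" for t
    by (rule struct.ext[OF items[OF TN[OF that]], OF 2(1) v(3)[OF that]]) (use e TN that in auto)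
  ultimately show ?case using v e unfolding R_def by (intro exI[of _ \<pi>]) simp
qed (use R_get R_enum R_set R_ini in blast)+

end

subsection \<open>Short lists of touched elements in one number\<close>

text \<open>
  The factor \<open>2 ^ b\<close> makes the number self-delimiting: its lowest set bit reveals the width \<open>b\<close> of
  the cells. The list \<open>I\<close> holds the first \<open>m\<close> values of a permutation \<open>\<pi>\<close> as in \<open>vperm\<close>, \<open>D\<close> the values at
  the places that the touched elements have left, and \<open>C\<close> colours.
\<close>

definition enc :: "(nat \<Rightarrow> nat) \<Rightarrow> nat \<Rightarrow> nat \<Rightarrow> nat \<Rightarrow> nat \<Rightarrow> nat \<Rightarrow> nat \<Rightarrow> nat" where
  "enc e b m a I D C = e b * (1 + 2 * (b + e b * (m + e b * (a + e b * (I + e (m * b) * (D + e (m * b) * C))))))"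

text \<open>The lowest set bit of the code is \<open>2 ^ b\<close>. Dividing by twice this number
  removes it along with the zeros below, and \<open>2 ^ b\<close> is also the radix of the three
  header fields.\<close>

definition hY where "hY X = X div (2 * lowbit X)"
definition hb where "hb X = hY X mod lowbit X"
definition hm where "hm X = hY X div lowbit X mod lowbit X"
definition ha where "ha X = hY X div lowbit X div lowbit X mod lowbit X"
definition hZ where "hZ X = hY X div lowbit X div lowbit X div lowbit X"
definition hI where "hI e X = hZ X mod e (hm X * hb X)"
definition hD where "hD e X = hZ X div e (hm X * hb X) mod e (hm X * hb X)"
definition hC where "hC e X = hZ X div e (hm X * hb X) div e (hm X * hb X) mod e (hm X * hb X)"
definition hfind where "hfind e X P y i = pfind e (hb X) P (hm X) y i"
definition hcell where "hcell e X P i = P div e (hb X * i) mod e (hb X)"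
text \<open>Meant for places from \<open>m\<close> on. If the place is that of a listed element, its
  owner has left and \<open>D\<close> tells who moved in; otherwise the owner stands there.\<close>

definition hat where
  "hat e X q = (if hfind e X (hI e X) q 0 = 0 then q else hcell e X (hD e X) (hfind e X (hI e X) q 0 - 1))"
text \<open>The inverse permutation. No array of indices is stored; searches in \<open>I\<close> and
  \<open>D\<close> replace it.\<close>

definition hidx where
  "hidx e X x = (if hfind e X (hI e X) x 0 \<noteq> 0 then hfind e X (hI e X) x 0 - 1
     else if hm X \<le> x then x else hcell e X (hI e X) (hfind e X (hD e X) x 0 - 1))"
definition hput where "hput e X P i v = P - hcell e X P i * e (hb X * i) + v * e (hb X * i)"

text \<open>If a listed element is below \<open>m\<close>, its own place is held by a listed element
  too, so nobody outside the list has moved in. The filler \<open>\<pi> i\<close> is itself listed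
  and cannot be mistaken for an unlisted element in a search.\<close>

definition dis :: "nat \<Rightarrow> (nat \<Rightarrow> nat) \<Rightarrow> nat \<Rightarrow> nat" where
  "dis m \<pi> i = (if m \<le> \<pi> i then \<pi> (\<pi> i) else \<pi> i)"

text \<open>The arrays of \<open>vperm\<close> are replaced by \<open>\<pi>\<close> and its exact
  inverse, so that its lemmas carry over although these arrays are not in memory.\<close>

abbreviation eperm :: "nat \<Rightarrow> (nat \<Rightarrow> nat) \<Rightarrow> nat \<Rightarrow> bool" where
  "eperm m \<pi> sz \<equiv> vperm m \<pi> (inv_into {..<sz} \<pi>) \<pi> sz"

lemma eperm_iff:
  "eperm m \<pi> sz \<longleftrightarrow> m \<le> sz \<and> bij_betw \<pi> {..<sz} {..<sz} \<and> (\<forall>q. m \<le> q \<and> q < sz \<and> m \<le> \<pi> q \<longrightarrow> \<pi> q = q)"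
proof -
  have "inv_into {..<sz} \<pi> (\<pi> i) = i" if "bij_betw \<pi> {..<sz} {..<sz}" "i < sz" for i
    using that by (intro inv_into_f_f) (auto simp: bij_betw_def)
  then show ?thesis unfolding vperm_def by (auto simp: bij_betw_def)
qed

lemma pack_put:
  assumes "i < m" "\<And>t. t < m \<Longrightarrow> f t < 2 ^ b"
  shows "pack b (f(i := v)) m = pack b f m - f i * 2 ^ (b * i) + v * 2 ^ (b * i)"
proof -
  have "pack b (f(i := v)) m + f i * 2 ^ (b * i) = pack b f m + v * 2 ^ (b * i)"
  proof -
    have r: "(\<Sum>t<m. F t) = F i + (\<Sum>t\<in>{..<m} - {i}. F t)" for F :: "nat \<Rightarrow> nat"
      using assms(1) by (intro sum.remove) auto
    have "(\<Sum>t\<in>{..<m} - {i}. (f(i := v)) t * 2 ^ (b * t)) = (\<Sum>t\<in>{..<m} - {i}. f t * 2 ^ (b * t))"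
      by (rule sum.cong) auto
    then show ?thesis unfolding pack_def r by simp
  qed
  moreover have "f i * 2 ^ (b * i) \<le> pack b f m"
    unfolding pack_def using assms(1) by (intro member_le_sum) auto
  ultimately show ?thesis by linarith
qed

lemma dec3:
  fixes W :: nat
  assumes "P < W" "Q < W" "R < W"
  shows "(P + W * (Q + W * (R + W * g))) mod W = P \<and> (P + W * (Q + W * (R + W * g))) div W mod W = Q \<and>
    (P + W * (Q + W * (R + W * g))) div W div W mod W = R"
proof -
  have "(P + W * y) div W = y" "(P + W * y) mod W = P" "(Q + W * y) div W = y" "(Q + W * y) mod W = Q"
    "(R + W * y) mod W = R" for y
    using assms by auto
  then show ?thesis by simp
qed

text \<open>\<open>g\<close> stands for bits behind the code, which are fetched with it because its
  length is not known in advance.\<close>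

locale elist =
  fixes e :: "nat \<Rightarrow> nat" and X b m a sz g :: nat and \<pi> col :: "nat \<Rightarrow> nat"
  assumes X: "X = enc (\<lambda>x. 2 ^ x) b m a (pack b \<pi> m) (pack b (dis m \<pi>) m) (pack b col m + 2 ^ (m * b) * g)"
    and perm: "eperm m \<pi> sz" and b1: "1 \<le> b" and mb: "m + 2 < 2 ^ b" and szb: "sz < 2 ^ (b - 1)"
    and ab: "a < 2 ^ b" and colb: "\<And>i. i < m \<Longrightarrow> col i < 2 ^ (b - 1)"
    and e: "\<And>x. x \<le> b * (m + 1) \<Longrightarrow> e x = 2 ^ x"
begin

lemma msz: "m \<le> sz"
  using perm unfolding eperm_iff by simp

lemma pi_less: "i < sz \<Longrightarrow> \<pi> i < sz"
  by (rule vperm_less[OF perm])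

lemma dis_less: "i < m \<Longrightarrow> dis m \<pi> i < sz"
  using msz pi_less by (auto simp: dis_def)

lemma half: "x < 2 ^ (b - 1) \<Longrightarrow> x < (2::nat) ^ b"
  by (meson less_le_trans power_increasing diff_le_self one_le_numeral)

lemma bounds:
  assumes "i < m"
  shows "\<pi> i < 2 ^ b" "dis m \<pi> i < 2 ^ b" "col i < 2 ^ b"
proof -
  have "\<pi> i < 2 ^ (b - 1)" "dis m \<pi> i < 2 ^ (b - 1)"
    using pi_less[of i] dis_less[of i] msz assms szb by linarith+
  then show "\<pi> i < 2 ^ b" "dis m \<pi> i < 2 ^ b" "col i < 2 ^ b"
    using colb[OF assms] by (auto intro: half)
qed

lemma header: "lowbit X = 2 ^ b" "hb X = b" "hm X = m" "ha X = a"
  "hZ X = pack b \<pi> m + 2 ^ (m * b) * (pack b (dis m \<pi>) m + 2 ^ (m * b) * (pack b col m + 2 ^ (m * b) * g))"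
proof -
  have m: "m < 2 ^ b" using mb by simp
  let ?Z = "pack b \<pi> m + 2 ^ (m * b) * (pack b (dis m \<pi>) m + 2 ^ (m * b) * (pack b col m + 2 ^ (m * b) * g))"
  have X': "X = 2 ^ b * (2 * (b + 2 ^ b * (m + 2 ^ b * (a + 2 ^ b * ?Z))) + 1)"
    unfolding X enc_def by (simp add: add.commute)
  show l: "lowbit X = 2 ^ b" unfolding X' by (rule lowbit_eq)
  have gen: "(W * (2 * R + 1)) div (2 * W) = R" if "0 < W" for W R :: nat
    by (rule div_nat_eqI) (use that in \<open>simp_all add: algebra_simps\<close>)
  have "hY X = X div (2 * 2 ^ b)" unfolding hY_def l ..
  also have "\<dots> = b + 2 ^ b * (m + 2 ^ b * (a + 2 ^ b * ?Z))"
    unfolding X' by (rule gen) simp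
  finally have Y: "hY X = b + 2 ^ b * (m + 2 ^ b * (a + 2 ^ b * ?Z))" .
  have bb: "b < 2 ^ b" by (rule less_exp)
  show "hb X = b" unfolding hb_def l Y using bb by simp
  have 1: "hY X div 2 ^ b = m + 2 ^ b * (a + 2 ^ b * ?Z)" unfolding Y using bb by simp
  show "hm X = m" unfolding hm_def l 1 using m by simp
  have 2: "hY X div 2 ^ b div 2 ^ b = a + 2 ^ b * ?Z" unfolding 1 using m by simp
  show "ha X = a" unfolding ha_def l 2 using ab by simp
  show "hZ X = ?Z" unfolding hZ_def l 2 using ab by simp
qed

lemma lists: "hI e X = pack b \<pi> m" "hD e X = pack b (dis m \<pi>) m" "hC e X = pack b col m"
proof -
  have ee: "e (m * b) = 2 ^ (m * b)" by (rule e) simp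
  have "pack b \<pi> m < 2 ^ (b * m)" "pack b (dis m \<pi>) m < 2 ^ (b * m)" "pack b col m < 2 ^ (b * m)"
    using bounds by (auto intro!: pack_less)
  then have lt: "pack b \<pi> m < 2 ^ (m * b)" "pack b (dis m \<pi>) m < 2 ^ (m * b)" "pack b col m < 2 ^ (m * b)"
    by (simp_all add: mult.commute)
  show "hI e X = pack b \<pi> m" "hD e X = pack b (dis m \<pi>) m" "hC e X = pack b col m"
    unfolding hI_def hD_def hC_def header ee using dec3[OF lt] by blast+
qed

lemma find:
  assumes "y < 2 ^ (b - 1)" "i \<le> m"
  shows "hfind e X (hI e X) y i = first_from i m (\<lambda>t. \<pi> t = y)"
    "hfind e X (hD e X) y i = first_from i m (\<lambda>t. dis m \<pi> t = y)"
    "hfind e X (hC e X) y i = first_from i m (\<lambda>t. col t = y)"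
proof -
  have P: "pack b f m mod 2 ^ (b * m) = pack b f m" if "\<And>i. i < m \<Longrightarrow> f i < 2 ^ (b - 1)" for f
    using pack_less[of m f b] that half by simp
  have f: "\<pi> i < 2 ^ (b - 1)" "dis m \<pi> i < 2 ^ (b - 1)" if "i < m" for i
    using pi_less[of i] dis_less[of i] msz that szb by auto
  show "hfind e X (hI e X) y i = first_from i m (\<lambda>t. \<pi> t = y)"
    unfolding hfind_def header lists by (rule pfind_eq[OF b1 mb assms(2) e f(1) assms(1) P[OF f(1)]])
  show "hfind e X (hD e X) y i = first_from i m (\<lambda>t. dis m \<pi> t = y)"
    unfolding hfind_def header lists by (rule pfind_eq[OF b1 mb assms(2) e f(2) assms(1) P[OF f(2)]])
  show "hfind e X (hC e X) y i = first_from i m (\<lambda>t. col t = y)"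
    unfolding hfind_def header lists by (rule pfind_eq[OF b1 mb assms(2) e colb assms(1) P[OF colb]])
qed

lemma cell_gen:
  assumes "i < m" "\<And>i. i < m \<Longrightarrow> f i < 2 ^ b"
  shows "hcell e X (pack b f m) i = f i"
proof -
  have "b * i \<le> b * (m + 1)" "b \<le> b * (m + 1)" using assms(1) by (auto intro!: mult_left_mono simp del: mult_Suc_right add_mult_distrib2)
  then show ?thesis unfolding hcell_def header by (simp add: e pack_cell[OF assms(2,1)])
qed

lemma cell:
  assumes "i < m"
  shows "hcell e X (hI e X) i = \<pi> i" "hcell e X (hD e X) i = dis m \<pi> i" "hcell e X (hC e X) i = col i"
  unfolding lists using assms bounds by (auto intro!: cell_gen)

lemma put:
  assumes "i < m" "\<And>i. i < m \<Longrightarrow> f i < 2 ^ b"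
  shows "hput e X (pack b f m) i v = pack b (f(i := v)) m"
proof -
  have "b * i \<le> b * (m + 1)" using assms(1) by (intro mult_left_mono) auto
  moreover have "hcell e X (pack b f m) i = f i" by (rule cell_gen) (fact assms)+
  moreover have "pack b (f(i := v)) m = pack b f m - f i * 2 ^ (b * i) + v * 2 ^ (b * i)"
    by (rule pack_put) (fact assms)+
  ultimately show ?thesis
    unfolding hput_def header by (simp add: e)
qed

lemma first_from_unique:
  assumes "i0 < m" "Q i0" and u: "\<And>i. i < m \<Longrightarrow> Q i \<Longrightarrow> i = i0"
  shows "first_from 0 m Q = Suc i0"
proof -
  have "(LEAST t. 0 \<le> t \<and> t < m \<and> Q t) = i0"
  proof (rule Least_equality)
    show "i0 \<le> t" if "0 \<le> t \<and> t < m \<and> Q t" for t using u[of t] that by blast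
  qed (use assms(1,2) in simp)
  moreover have "\<exists>t\<ge>0. t < m \<and> Q t" using assms(1,2) by blast
  ultimately show ?thesis by (simp add: first_from_def)
qed

lemma findI:
  "x < sz \<Longrightarrow> hfind e X (hI e X) x 0 = (if x \<in> \<pi> ` {..<m} then Suc (inv_into {..<sz} \<pi> x) else 0)"
proof -
  assume x: "x < sz"
  have F: "hfind e X (hI e X) x 0 = first_from 0 m (\<lambda>t. \<pi> t = x)"
    using x szb by (intro find) auto
  show ?thesis
  proof (cases "x \<in> \<pi> ` {..<m}")
    case True
    then obtain i where i: "i < m" "\<pi> i = x" by auto
    then have "inv_into {..<sz} \<pi> x = i" using perm unfolding vperm_def by auto
    moreover have "first_from 0 m (\<lambda>t. \<pi> t = x) = Suc i"
      using i vperm_inj[OF perm] msz by (intro first_from_unique) auto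
    ultimately show ?thesis using F True by simp
  next
    case False
    then show ?thesis unfolding F by (auto simp: first_from_def)
  qed
qed

lemma at: "m \<le> q \<Longrightarrow> q < sz \<Longrightarrow> hat e X q = \<pi> q"
proof -
  assume q: "m \<le> q" "q < sz"
  have a: "(if q \<in> \<pi> ` {..<m} then \<pi> q else q) = \<pi> q" by (rule vperm_at[OF perm q])
  show ?thesis
  proof (cases "q \<in> \<pi> ` {..<m}")
    case True
    then obtain i where i: "i < m" "\<pi> i = q" by auto
    then have "inv_into {..<sz} \<pi> q = i" using perm unfolding vperm_def by auto
    then show ?thesis using True q i cell(2)[of i] by (simp add: hat_def findI dis_def)
  next
    case False
    then show ?thesis using q a by (simp add: hat_def findI)
  qed
qed

lemma idx: "q < sz \<Longrightarrow> hidx e X (\<pi> q) = q"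
proof -
  assume q: "q < sz"
  show ?thesis
  proof (cases "q < m")
    case True
    then have "inv_into {..<sz} \<pi> (\<pi> q) = q" using perm unfolding vperm_def by auto
    then show ?thesis using True pi_less[OF q] by (simp add: hidx_def findI)
  next
    case False
    have nt: "\<pi> q \<notin> \<pi> ` {..<m}" using vperm_inj[OF perm] q False msz by auto
    show ?thesis
    proof (cases "m \<le> \<pi> q")
      case True
      then have "\<pi> q = q" using perm False q unfolding eperm_iff by auto
      then show ?thesis using nt True pi_less[OF q] False by (simp add: hidx_def findI header)
    next
      case lt: False
      have "q \<in> \<pi> ` {..<m}" using vperm_at[OF perm, of q] False q lt by (auto split: if_splits)
      then obtain i where i: "i < m" "\<pi> i = q" by auto
      \<comment> \<open>The unlisted element stands in the place of a listed one, and
        \<open>D\<close> contains it exactly once.\<close>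
      have "first_from 0 m (\<lambda>t. dis m \<pi> t = \<pi> q) = Suc i"
      proof (rule first_from_unique[OF i(1)])
        show "dis m \<pi> i = \<pi> q" using i False by (simp add: dis_def)
        fix t assume t: "t < m" "dis m \<pi> t = \<pi> q"
        have "\<pi> t \<in> \<pi> ` {..<m}" using t(1) by simp
        with nt t(2) have "m \<le> \<pi> t" unfolding dis_def by (metis (full_types))
        then have "\<pi> (\<pi> t) = \<pi> q" using t by (simp add: dis_def)
        then have "\<pi> t = q" using vperm_inj[OF perm pi_less q] t msz by auto
        then show "t = i" using i vperm_inj[OF perm, of t i] t msz by auto
      qed
      moreover have "\<pi> q < 2 ^ (b - 1)" using pi_less[OF q] szb by simp
      ultimately show ?thesis
        using nt lt pi_less[OF q] find(2)[of "\<pi> q" 0] cell(1)[OF i(1)] i by (simp add: hidx_def findI header)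
    qed
  qed
qed

lemma idx': "x < sz \<Longrightarrow> \<exists>q<sz. x = \<pi> q \<and> hidx e X x = q"
  using vperm_surj[OF perm] idx by metis

text \<open>\<open>vperm_touch\<close> on the packed lists. Two old entries of \<open>D\<close> may
  become wrong: the one for the place \<open>m\<close>, which now belongs to the list and gets the
  filler (\<open>D1\<close>), and the one for the place \<open>q\<close>, into which
  \<open>y\<close> moves (\<open>D2\<close>).\<close>

lemma append:
  assumes x: "x < sz" and q: "q = hidx e X x" "m \<le> q" and y: "y = hat e X m"
  defines "i0 \<equiv> hfind e X (hI e X) m 0" and "i1 \<equiv> hfind e X (hI e X) q 0" and "\<pi>' \<equiv> \<pi>(q := y, m := x)"
  defines "D1 \<equiv> (if i0 = 0 then hD e X else hput e X (hD e X) (i0 - 1) m)"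
  defines "D2 \<equiv> (if q = m \<or> i1 = 0 then D1 else hput e X D1 (i1 - 1) y)"
  shows "eperm (Suc m) \<pi>' sz" "m < sz" "q < sz" "\<pi> q = x" "y = \<pi> m"
    "hI e X + x * 2 ^ (b * m) = pack b \<pi>' (Suc m)"
    "D2 + (if m < x then y else x) * 2 ^ (b * m) = pack b (dis (Suc m) \<pi>') (Suc m)"
proof -
  obtain q' where q': "q' < sz" "x = \<pi> q'" "hidx e X x = q'" using idx'[OF x] by blast
  then show qs: "q < sz" and xq: "\<pi> q = x" using q by auto
  show ms: "m < sz" using q qs by simp
  show y': "y = \<pi> m" using at[of m] ms y by simp
  have nt: "x \<notin> \<pi> ` {..<m}" using vperm_inj[OF perm] qs q xq ms by (auto simp: image_iff)
  have qx: "q = (if x < m then inv_into {..<sz} \<pi> x else x)"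
  proof -
    have "\<pi> (if x < m then inv_into {..<sz} \<pi> x else x) = \<pi> q" "(if x < m then inv_into {..<sz} \<pi> x else x) < sz"
      using vperm_untouched[OF perm x nt] xq by auto
    then show ?thesis using vperm_inj[OF perm _ qs] by blast
  qed
  note vt = vperm_touch[OF perm x nt qx y', folded \<pi>'_def]
  then show ep: "eperm (Suc m) \<pi>' sz" unfolding eperm_iff unfolding vperm_def by auto
  have old: "\<pi>' i = \<pi> i" if "i < m" for i using that q by (simp add: \<pi>'_def)
  show "hI e X + x * 2 ^ (b * m) = pack b \<pi>' (Suc m)"
    unfolding lists pack_Suc using old by (simp add: \<pi>'_def cong: pack_cong)
  have bd: "dis m \<pi> i < 2 ^ b" if "i < m" for i using dis_less[OF that] szb by (intro half) simp
  define f1 where "f1 i = (if i < m \<and> \<pi> i = m then m else dis m \<pi> i)" for i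
  have f1b: "f1 i < 2 ^ b" if "i < m" for i
    using bd[OF that] ms szb half[of m] by (auto simp: f1_def)
  have D1: "D1 = pack b f1 m"
  proof (cases "m \<in> \<pi> ` {..<m}")
    case True
    then obtain i where i: "i < m" "\<pi> i = m" by auto
    then have "inv_into {..<sz} \<pi> m = i" using perm unfolding vperm_def by auto
    then have "i0 = Suc i" using True ms by (simp add: i0_def findI)
    then have "D1 = pack b ((dis m \<pi>)(i := m)) m" unfolding D1_def lists using put[OF i(1) bd] by simp
    also have "\<dots> = pack b f1 m"
      using i vperm_inj[OF perm, of _ i] msz by (intro pack_cong) (auto simp: f1_def)
    finally show ?thesis .
  next
    case False
    then have "i0 = 0" using ms by (simp add: i0_def findI)
    moreover have "pack b (dis m \<pi>) m = pack b f1 m" using False by (intro pack_cong) (auto simp: f1_def)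
    ultimately show ?thesis unfolding D1_def lists by simp
  qed
  have D2: "D2 = pack b (\<lambda>i. if q \<noteq> m \<and> i < m \<and> \<pi> i = q then y else f1 i) m"
  proof (cases "q \<noteq> m \<and> q \<in> \<pi> ` {..<m}")
    case True
    then obtain i where i: "i < m" "\<pi> i = q" by auto
    then have "inv_into {..<sz} \<pi> q = i" using perm unfolding vperm_def by auto
    then have "i1 = Suc i" using True qs by (simp add: i1_def findI)
    then have "D2 = pack b (f1(i := y)) m" unfolding D2_def D1 using put[OF i(1) f1b] True by simp
    also have "\<dots> = pack b (\<lambda>i. if q \<noteq> m \<and> i < m \<and> \<pi> i = q then y else f1 i) m"
      using i True vperm_inj[OF perm, of _ i] msz by (intro pack_cong) auto
    finally show ?thesis .
  next
    case False
    then have "q = m \<or> i1 = 0" using qs by (auto simp: i1_def findI)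
    moreover have "pack b f1 m = pack b (\<lambda>i. if q \<noteq> m \<and> i < m \<and> \<pi> i = q then y else f1 i) m"
      using False by (intro pack_cong) auto
    ultimately show ?thesis unfolding D2_def D1 by simp
  qed
  have "dis (Suc m) \<pi>' m = (if m < x then y else x)"
    using qx by (auto simp: dis_def \<pi>'_def)
  moreover have "dis (Suc m) \<pi>' i = (if q \<noteq> m \<and> i < m \<and> \<pi> i = q then y else f1 i)" if "i < m" for i
    using that old[OF that] q by (auto simp: dis_def f1_def \<pi>'_def)
  ultimately show "D2 + (if m < x then y else x) * 2 ^ (b * m) = pack b (dis (Suc m) \<pi>') (Suc m)"
    unfolding D2 pack_Suc by (simp cong: pack_cong)
qed

end

subsection \<open>Groups\<close>

text \<open>In this order: the number of colours, the default colour, the number of words of a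
  field, the threshold below which \<open>zz\<close> counts as tiny, the cell width and the length
  of the list in the tiny case, and the factor in the condition \<open>rdy\<close>.\<close>

record par =
  cP :: nat
  dP :: nat
  kP :: nat
  nP :: nat
  bP :: nat
  lP :: nat
  rP :: nat

definition zz :: "state \<Rightarrow> nat" where "zz \<sigma> = (if univ \<sigma> < wid \<sigma> then univ \<sigma> else wid \<sigma>)"
text \<open>In a tiny instance the list has cells of a fixed width, and no blocks are ever
  made.\<close>

definition tiny where "tiny P \<sigma> \<longleftrightarrow> zz \<sigma> < nP P"
text \<open>The arithmetic on a block takes O(\<open>b ^ 4\<close>) bits, and the space bound wants
  \<open>b ^ 3\<close> to be at most the size of the group; the eighth power covers both.\<close>

definition rdy where "rdy P \<sigma> b \<longleftrightarrow> \<not> tiny P \<sigma> \<and> rP P * b ^ 8 \<le> zz \<sigma>"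
text \<open>All lists are read with this length, since the width of their cells is known only
  afterwards.\<close>

definition elen where "elen P \<sigma> = (if tiny P \<sigma> then lP P else zz \<sigma> div 4)"
definition small where "small P \<sigma> \<longleftrightarrow> univ \<sigma> \<le> wid \<sigma> * wid \<sigma> \<or> tiny P \<sigma>"
definition nblk :: "nat \<Rightarrow> nat \<Rightarrow> nat" where "nblk b n = (n + b * b - 1) div (b * b)"
definition flen where
  "flen P \<sigma> b n = larea (cP P) 0 b (nblk b n) + nblk b n * blen (pw (kP P) \<sigma>) (cP P) (b * b)"
definition ew :: "nat \<Rightarrow> nat \<Rightarrow> nat" where "ew b m = 1 + 4 * b + 3 * (m * b)"
definition gE :: "state \<Rightarrow> nat \<Rightarrow> nat \<Rightarrow> nat" where "gE \<sigma> a t = a + t * wid \<sigma>"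
text \<open>A single group puts its blocks right behind the list. Several groups have their lists in
  front, \<open>wid \<sigma>\<close> bits each, and their blocks with a common stride; this
  presupposes that all groups hand over at the same \<open>b\<close> and \<open>m\<close>.\<close>

definition gF where
  "gF P \<sigma> a t b m = (if small P \<sigma> then a + ew b m
     else a + univ \<sigma> div (wid \<sigma> * wid \<sigma>) * wid \<sigma> + t * flen P \<sigma> b (wid \<sigma> * wid \<sigma> - m))"
definition gX where "gX P \<sigma> a t = rd (kP P) \<sigma> (gE \<sigma> a t) (elen P \<sigma>)"
definition ewr where
  "ewr P \<sigma> a t b m v I D C = wr (kP P) \<sigma> (gE \<sigma> a t) (ew b m) (enc (pw (kP P) \<sigma>) b m v I D C)"

definition bops :: "par \<Rightarrow> iops" where
  "bops P = \<lparr>ig = bget (kP P) (cP P), ifi = bfirst (kP P) (cP P), ine = bnext (kP P) (cP P),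
     ise = bset (kP P) (cP P), iin = bini (kP P) (cP P) (dP P)\<rparr>"

definition fget where
  "fget P \<sigma> a t b m sz x = lv_get (kP P) (cP P) (dP P) (bops P) \<sigma> (gF P \<sigma> a t b m) b (b * b) (nblk b (sz - m)) (sz - m) x"
definition ffirst where
  "ffirst P \<sigma> a t b m sz j = lv_first (kP P) (cP P) (dP P) (bops P) \<sigma> (gF P \<sigma> a t b m) b (b * b) (nblk b (sz - m)) (sz - m) j"
definition fnext where
  "fnext P \<sigma> a t b m sz j x = lv_next (kP P) (cP P) (dP P) (bops P) \<sigma> (gF P \<sigma> a t b m) b (b * b) (nblk b (sz - m)) (sz - m) j x"
definition fset where
  "fset P \<sigma> a t b m sz x j = lv_set (kP P) (cP P) (bops P) \<sigma> (gF P \<sigma> a t b m) b (b * b) (nblk b (sz - m)) (sz - m) x j"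
definition fini where
  "fini P \<sigma> a t b m = lv_zero (kP P) (cP P) \<sigma> (gF P \<sigma> a t b m) b (Suc (cP P))"

text \<open>
  A group keeps the elements that are touched first in a short list, for ever. As soon as the cells of
  the list are narrow enough, all other elements are handed over to a level of blocks.
\<close>

definition gtail where
  "gtail P \<sigma> a t sz X j =
    (if rdy P \<sigma> (hb X)
     then if ffirst P \<sigma> a t (hb X) (hm X) sz j = 0 then 0
       else Suc (hat (pw (kP P) \<sigma>) X (hm X + (ffirst P \<sigma> a t (hb X) (hm X) sz j - 1)))
     else if j = dP P \<and> hm X < sz then Suc (hat (pw (kP P) \<sigma>) X (hm X)) else 0)"
definition gfrom where
  "gfrom P \<sigma> a t sz X j i =
    (if hfind (pw (kP P) \<sigma>) X (hC (pw (kP P) \<sigma>) X) j i = 0 then gtail P \<sigma> a t sz X j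
     else Suc (hcell (pw (kP P) \<sigma>) X (hI (pw (kP P) \<sigma>) X) (hfind (pw (kP P) \<sigma>) X (hC (pw (kP P) \<sigma>) X) j i - 1)))"
definition gfirst where
  "gfirst P \<sigma> a (p :: nat) t sz j = gfrom P \<sigma> a t sz (gX P \<sigma> a t) j 0"
definition gget' where
  "gget' P \<sigma> a t sz X q =
    (if q < hm X then hcell (pw (kP P) \<sigma>) X (hC (pw (kP P) \<sigma>) X) q
     else if rdy P \<sigma> (hb X) then fget P \<sigma> a t (hb X) (hm X) sz (q - hm X) else dP P)"
definition gget where
  "gget P \<sigma> a (p :: nat) t sz x = gget' P \<sigma> a t sz (gX P \<sigma> a t) (hidx (pw (kP P) \<sigma>) (gX P \<sigma> a t) x)"
definition gnext' where
  "gnext' P \<sigma> a t sz X j q =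
    (if q < hm X then gfrom P \<sigma> a t sz X j (Suc q)
     else if rdy P \<sigma> (hb X)
     then if fnext P \<sigma> a t (hb X) (hm X) sz j (q - hm X) = 0 then 0
       else Suc (hat (pw (kP P) \<sigma>) X (hm X + (fnext P \<sigma> a t (hb X) (hm X) sz j (q - hm X) - 1)))
     else if Suc q < sz then Suc (hat (pw (kP P) \<sigma>) X (Suc q)) else 0)"
definition gnext where
  "gnext P \<sigma> a (p :: nat) t sz j x = gnext' P \<sigma> a t sz (gX P \<sigma> a t) j (hidx (pw (kP P) \<sigma>) (gX P \<sigma> a t) x)"

definition gD where
  "gD e X x q = (let y = hat e X (hm X); i0 = hfind e X (hI e X) (hm X) 0; i1 = hfind e X (hI e X) q 0;
     D1 = (if i0 = 0 then hD e X else hput e X (hD e X) (i0 - 1) (hm X));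
     D2 = (if q = hm X \<or> i1 = 0 then D1 else hput e X D1 (i1 - 1) y)
   in D2 + (if hm X < x then y else x) * e (hb X * hm X))"
text \<open>\<open>m + 9\<close> new cells fit into one old cell, so that \<open>repack\<close>
  applies to the \<open>m + 1\<close> entries and the header has room too. A factor of at least 9
  per step also makes the number of steps logarithmic.\<close>

definition gb' where "gb' P \<sigma> X = (if tiny P \<sigma> then hb X else hb X div (hm X + 9))"
definition grp where
  "grp P \<sigma> X L = (if tiny P \<sigma> then L else L mod (pw (kP P) \<sigma> (hb X) - pw (kP P) \<sigma> (gb' P \<sigma> X)))"
definition gappend where
  "gappend P \<sigma> a t X x j q =
    (let b = gb' P \<sigma> X; m = Suc (hm X);
       \<sigma>' = ewr P \<sigma> a t b m (ha X) (grp P \<sigma> X (hI (pw (kP P) \<sigma>) X + x * pw (kP P) \<sigma> (hb X * hm X)))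
         (grp P \<sigma> X (gD (pw (kP P) \<sigma>) X x q)) (grp P \<sigma> X (hC (pw (kP P) \<sigma>) X + j * pw (kP P) \<sigma> (hb X * hm X)))
     in if rdy P \<sigma>' b then fini P \<sigma>' a t b m else \<sigma>')"
definition gset where
  "gset P \<sigma> a (p :: nat) t sz x j =
    (let X = gX P \<sigma> a t; q = hidx (pw (kP P) \<sigma>) X x
     in if q < hm X then ewr P \<sigma> a t (hb X) (hm X) (ha X) (hI (pw (kP P) \<sigma>) X) (hD (pw (kP P) \<sigma>) X)
         (hput (pw (kP P) \<sigma>) X (hC (pw (kP P) \<sigma>) X) q j)
       else if rdy P \<sigma> (hb X) then fset P \<sigma> a t (hb X) (hm X) sz (q - hm X) j
       else if j = dP P then \<sigma>
       else gappend P \<sigma> a t X x j q)"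
text \<open>A list takes \<open>1 + 4 * b + 3 * (m * b)\<close> bits; starting with a fortieth keeps
  it within \<open>zz \<sigma> div 4\<close> throughout.\<close>

definition gb0 where "gb0 P \<sigma> = (if tiny P \<sigma> then bP P else zz \<sigma> div 40)"
definition gini where
  "gini P \<sigma> a (p :: nat) t (sz :: nat) = ewr P \<sigma> a t (gb0 P \<sigma>) 0 0 0 0 0"
definition gav where "gav P \<sigma> a t = ha (gX P \<sigma> a t)"
definition gsetav where
  "gsetav P \<sigma> a t v = (let X = gX P \<sigma> a t in
     ewr P \<sigma> a t (hb X) (hm X) v (hI (pw (kP P) \<sigma>) X) (hD (pw (kP P) \<sigma>) X) (hC (pw (kP P) \<sigma>) X))"

text \<open>The width is a function of the length of the list alone, so all groups run through the
  same widths.\<close>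

fun bseq where
  "bseq P \<sigma> 0 = gb0 P \<sigma>"
| "bseq P \<sigma> (Suc m) = (if tiny P \<sigma> then bseq P \<sigma> m else bseq P \<sigma> m div (m + 9))"

definition greach where "greach P \<sigma> sz m \<longleftrightarrow> m \<le> sz \<and> (\<forall>i<m. \<not> rdy P \<sigma> (bseq P \<sigma> i))"

lemma fld_split: "fld B o' (l1 + l2) = fld B o' l1 + fld B (o' + l1) l2 * 2 ^ l1"
proof -
  have "bit (fld B o' (l1 + l2)) i = bit (fld B o' l1 + fld B (o' + l1) l2 * 2 ^ l1) i" for i
    unfolding bit_add_mult_pow[OF fld_less] bit_fld by auto
  then show ?thesis by (simp add: bit_eq_iff)
qed

lemma enc_less:
  assumes "m < 2 ^ b" "v < 2 ^ b" "I < 2 ^ (m * b)" "D < 2 ^ (m * b)" "C < 2 ^ (m * b)"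
  shows "enc (\<lambda>x. 2 ^ x) b m v I D C < 2 ^ ew b m"
proof -
  have step: "x + 2 ^ s * y < 2 ^ (s + r)" if "x < 2 ^ s" "y < 2 ^ r" for x y s r :: nat
  proof -
    have "2 ^ s * (y + 1) \<le> 2 ^ s * (2 :: nat) ^ r" using that by (intro mult_left_mono) auto
    then show ?thesis using that by (simp add: power_add)
  qed
  have "b < 2 ^ b" by (rule less_exp)
  then have "b + 2 ^ b * (m + 2 ^ b * (v + 2 ^ b * (I + 2 ^ (m * b) * (D + 2 ^ (m * b) * C))))
      < 2 ^ (b + (b + (b + (m * b + (m * b + m * b)))))"
    using assms by (intro step)
  from step[OF _ this, of 1 1] have "1 + 2 * (b + 2 ^ b * (m + 2 ^ b * (v + 2 ^ b * (I + 2 ^ (m * b) * (D + 2 ^ (m * b) * C)))))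
      < 2 ^ (1 + (b + (b + (b + (m * b + (m * b + m * b))))))" by simp
  then have "enc (\<lambda>x. 2 ^ x) b m v I D C < 2 ^ b * 2 ^ (1 + (b + (b + (b + (m * b + (m * b + m * b))))))"
    unfolding enc_def by (intro mult_strict_left_mono) auto
  also have "\<dots> = 2 ^ ew b m" unfolding power_add[symmetric] by (simp add: ew_def)
  finally show ?thesis .
qed

text \<open>Bits behind the code only enlarge its last component.\<close>

lemma enc_garbage:
  "enc (\<lambda>x. 2 ^ x) b m v I D (C + 2 ^ (m * b) * g) = enc (\<lambda>x. 2 ^ x) b m v I D C + g * 2 ^ ew b m"
proof -
  have "2 ^ ew b m = (2::nat) ^ b * 2 * 2 ^ b * 2 ^ b * 2 ^ b * 2 ^ (m * b) * 2 ^ (m * b) * 2 ^ (m * b)"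
    unfolding ew_def by (simp add: power_add[symmetric] mult.commute flip: power_Suc)
  then show ?thesis unfolding enc_def by (simp add: algebra_simps)
qed

lemma par_same:
  assumes "same \<sigma>0 \<sigma>"
  shows "pw k \<sigma> = pw k \<sigma>0" "rdy P \<sigma> = rdy P \<sigma>0" "tiny P \<sigma> = tiny P \<sigma>0" "elen P \<sigma> = elen P \<sigma>0"
    "gE \<sigma> a t = gE \<sigma>0 a t" "gF P \<sigma> a t b m = gF P \<sigma>0 a t b m" "gb0 P \<sigma> = gb0 P \<sigma>0" "wid \<sigma> = wid \<sigma>0"
    "lim \<sigma> = lim \<sigma>0" "gb' P \<sigma> = gb' P \<sigma>0" "grp P \<sigma> = grp P \<sigma>0"
proof -
  have e: "wid \<sigma> = wid \<sigma>0" "univ \<sigma> = univ \<sigma>0" "lim \<sigma> = lim \<sigma>0" using assms by (auto simp: same_def)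
  show pw: "pw k \<sigma> = pw k \<sigma>0" for k by (rule pw_same[OF assms])
  show t: "tiny P \<sigma> = tiny P \<sigma>0" by (simp add: tiny_def zz_def e)
  show "rdy P \<sigma> = rdy P \<sigma>0" by (intro ext) (simp add: rdy_def t zz_def e)
  show "elen P \<sigma> = elen P \<sigma>0" "gE \<sigma> a t = gE \<sigma>0 a t" "gb0 P \<sigma> = gb0 P \<sigma>0" "wid \<sigma> = wid \<sigma>0" "lim \<sigma> = lim \<sigma>0"
    by (simp_all add: elen_def gE_def gb0_def t zz_def e)
  show "gF P \<sigma> a t b m = gF P \<sigma>0 a t b m" by (simp add: gF_def small_def flen_def t e pw)
  show g: "gb' P \<sigma> = gb' P \<sigma>0" by (intro ext) (simp add: gb'_def t)
  show "grp P \<sigma> = grp P \<sigma>0" by (intro ext) (simp add: grp_def t pw g)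
qed

text \<open>The assumptions concern only lengths \<open>m\<close> that a list can reach.
  \<open>FPF m\<close> and \<open>RF m\<close> belong to the level of blocks that is set up if the
  list is frozen at length \<open>m\<close>.\<close>

locale group =
  fixes P :: par and \<sigma>0 :: state and a t sz :: nat and FPg :: "nat set"
    and FPF :: "nat \<Rightarrow> nat set" and RF :: "nat \<Rightarrow> state \<Rightarrow> (nat \<Rightarrow> nat) \<Rightarrow> bool"
  assumes w: "1 \<le> wid \<sigma>0" and dc: "dP P < cP P" and r0: "\<not> rdy P \<sigma>0 (gb0 P \<sigma>0)"
    and el: "elen P \<sigma>0 \<le> kP P * wid \<sigma>0" and lim: "\<And>p. p \<in> FPg \<Longrightarrow> p < lim \<sigma>0"
    and num: "\<And>m. greach P \<sigma>0 sz m \<Longrightarrow> 1 \<le> bseq P \<sigma>0 m \<and> m + 2 < 2 ^ bseq P \<sigma>0 m \<and> sz < 2 ^ (bseq P \<sigma>0 m - 1) \<and>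
      cP P \<le> 2 ^ (bseq P \<sigma>0 m - 1) \<and> bseq P \<sigma>0 m * (m + 1) \<le> kP P * wid \<sigma>0 \<and> ew (bseq P \<sigma>0 m) m \<le> elen P \<sigma>0"
    and area: "\<And>m. greach P \<sigma>0 sz m \<Longrightarrow> {gE \<sigma>0 a t..<gE \<sigma>0 a t + ew (bseq P \<sigma>0 m) m} \<subseteq> FPg"
    and F: "\<And>m. greach P \<sigma>0 sz m \<Longrightarrow> rdy P \<sigma>0 (bseq P \<sigma>0 m) \<Longrightarrow>
      struct (cP P) (dP P) \<sigma>0 (FPF m) (sz - m)
        (\<lambda>\<sigma>. fget P \<sigma> a t (bseq P \<sigma>0 m) m sz) (\<lambda>\<sigma>. ffirst P \<sigma> a t (bseq P \<sigma>0 m) m sz)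
        (\<lambda>\<sigma>. fnext P \<sigma> a t (bseq P \<sigma>0 m) m sz) (\<lambda>\<sigma>. fset P \<sigma> a t (bseq P \<sigma>0 m) m sz)
        (\<lambda>\<sigma>. fini P \<sigma> a t (bseq P \<sigma>0 m) m) (RF m) \<and>
      FPF m \<subseteq> FPg \<and> FPF m \<inter> {gE \<sigma>0 a t..<gE \<sigma>0 a t + ew (bseq P \<sigma>0 m) m} = {}"
begin

abbreviation "bm m \<equiv> bseq P \<sigma>0 m"
abbreviation "eo \<equiv> gE \<sigma>0 a t"
abbreviation "e \<equiv> pw (kP P) \<sigma>0"
abbreviation "rch m \<equiv> greach P \<sigma>0 sz m"

definition EN where
  "EN \<sigma> m v \<pi> col \<longleftrightarrow> fld (bitv \<sigma>) eo (ew (bm m) m) =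
     enc (\<lambda>x. 2 ^ x) (bm m) m v (pack (bm m) \<pi> m) (pack (bm m) (dis m \<pi>) m) (pack (bm m) col m)"

text \<open>The level of blocks is addressed by places: its argument \<open>q\<close> means the
  element at place \<open>m + q\<close>, so the listed elements leave no holes. \<open>v\<close> is
  a number kept in the header, which will denote the missing element.\<close>

definition RG where
  "RG \<sigma> f v \<longleftrightarrow> (\<exists>m \<pi>. rch m \<and> EN \<sigma> m v \<pi> (\<lambda>i. f (\<pi> i)) \<and> eperm m \<pi> sz \<and> v \<le> sz \<and> (\<forall>x<sz. f x < cP P) \<and>
     (if rdy P \<sigma>0 (bm m) then RF m \<sigma> (\<lambda>q. f (\<pi> (m + q))) else \<forall>q. m \<le> q \<and> q < sz \<longrightarrow> f (\<pi> q) = dP P))"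

lemma RG_E:
  assumes "RG \<sigma> f v"
  obtains m \<pi> where "rch m" "EN \<sigma> m v \<pi> (\<lambda>i. f (\<pi> i))" "eperm m \<pi> sz" "v \<le> sz" "\<And>x. x < sz \<Longrightarrow> f x < cP P"
    "rdy P \<sigma>0 (bm m) \<Longrightarrow> RF m \<sigma> (\<lambda>q. f (\<pi> (m + q)))"
    "\<And>q. \<not> rdy P \<sigma>0 (bm m) \<Longrightarrow> m \<le> q \<Longrightarrow> q < sz \<Longrightarrow> f (\<pi> q) = dP P"
proof -
  obtain m \<pi> where "rch m" "EN \<sigma> m v \<pi> (\<lambda>i. f (\<pi> i))" "eperm m \<pi> sz" "v \<le> sz" and 1: "\<forall>x<sz. f x < cP P"
    and 2: "if rdy P \<sigma>0 (bm m) then RF m \<sigma> (\<lambda>q. f (\<pi> (m + q))) else \<forall>q. m \<le> q \<and> q < sz \<longrightarrow> f (\<pi> q) = dP P"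
    using assms unfolding RG_def by (elim exE conjE) (rule that)
  then show ?thesis by (intro that[of m \<pi>]) (simp_all split: if_splits)
qed

lemma EN_elist:
  assumes s: "same \<sigma>0 \<sigma>" and m: "rch m" and E: "EN \<sigma> m v \<pi> col" and p: "eperm m \<pi> sz" and v: "v \<le> sz"
    and col: "\<And>i. i < m \<Longrightarrow> col i < cP P"
  obtains g where "elist e (gX P \<sigma> a t) (bm m) m v sz g \<pi> col"
proof -
  note n = num[OF m]
  define g where "g = fld (bitv \<sigma>) (eo + ew (bm m) m) (elen P \<sigma>0 - ew (bm m) m)"
  have "gX P \<sigma> a t = fld (bitv \<sigma>) eo (elen P \<sigma>0)"
    unfolding gX_def par_same[OF s] using w el par_same(8)[OF s] by (intro rd_eq) auto
  also have "\<dots> = fld (bitv \<sigma>) eo (ew (bm m) m) + g * 2 ^ ew (bm m) m"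
    unfolding g_def using n by (subst fld_split[symmetric]) simp
  finally have X: "gX P \<sigma> a t = enc (\<lambda>x. 2 ^ x) (bm m) m v (pack (bm m) \<pi> m) (pack (bm m) (dis m \<pi>) m)
      (pack (bm m) col m + 2 ^ (m * bm m) * g)"
    unfolding enc_garbage E[unfolded EN_def] .
  have "(2 :: nat) ^ (bm m - 1) \<le> 2 ^ bm m" by (intro power_increasing) auto
  then have "v < 2 ^ bm m" using n v by linarith
  moreover have "pw (kP P) \<sigma>0 x = 2 ^ x" if "x \<le> bm m * (m + 1)" for x
    using that n by (intro pw_eq) linarith
  ultimately have "elist e (gX P \<sigma> a t) (bm m) m v sz g \<pi> col"
    using X p n col by unfold_locales (auto intro: less_le_trans)
  then show ?thesis by (rule that)
qed

lemma EN_write: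
  assumes s: "same \<sigma>0 \<sigma>" and m: "rch m" and p: "eperm m \<pi> sz" and v: "v \<le> sz"
    and col: "\<And>i. i < m \<Longrightarrow> col i < cP P"
    and ID: "I = pack (bm m) \<pi> m" "D = pack (bm m) (dis m \<pi>) m" "C = pack (bm m) col m"
  shows "EN (ewr P \<sigma> a t (bm m) m v I D C) m v \<pi> col"
    "frame {eo..<eo + ew (bm m) m} \<sigma> (ewr P \<sigma> a t (bm m) m v I D C)"
proof -
  note n = num[OF m]
  let ?b = "bm m"
  have half: "(2 :: nat) ^ (?b - 1) \<le> 2 ^ ?b" by (intro power_increasing) auto
  have pl: "\<pi> i < sz" if "i < sz" for i using vperm_less[OF p that] .
  have ms: "m \<le> sz" using p unfolding eperm_iff by simp
  have b: "\<pi> i < 2 ^ ?b" "dis m \<pi> i < 2 ^ ?b" "col i < 2 ^ ?b" if "i < m" for i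
  proof -
    have "sz \<le> 2 ^ ?b" "cP P \<le> 2 ^ ?b" using n half by linarith+
    moreover have "\<pi> i < sz" using pl[of i] ms that by simp
    ultimately show "\<pi> i < 2 ^ ?b" "dis m \<pi> i < 2 ^ ?b" "col i < 2 ^ ?b"
      using pl[of "\<pi> i"] col[OF that] unfolding dis_def by simp_all
  qed
  have lt: "I < 2 ^ (m * ?b)" "D < 2 ^ (m * ?b)" "C < 2 ^ (m * ?b)"
    unfolding ID using pack_less[of m _ ?b] b by (simp_all add: mult.commute)
  have v': "v < 2 ^ ?b" "m < 2 ^ ?b" using v n half by linarith+
  have pw: "pw (kP P) \<sigma>0 x = 2 ^ x" if "x \<le> ?b * (m + 1)" for x
    using that n by (intro pw_eq) linarith
  have e: "enc e ?b m v I D C = enc (\<lambda>x. 2 ^ x) ?b m v I D C"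
    unfolding enc_def using pw[of ?b] pw[of "m * ?b"] by (simp add: algebra_simps)
  have ek: "ew ?b m \<le> kP P * wid \<sigma>0" using n el by linarith
  have W: "ewr P \<sigma> a t ?b m v I D C = wr (kP P) \<sigma> eo (ew ?b m) (enc (\<lambda>x. 2 ^ x) ?b m v I D C)"
    unfolding ewr_def par_same[OF s] e ..
  note ps = par_same(8,9)[OF s]
  show "frame {eo..<eo + ew (bm m) m} \<sigma> (ewr P \<sigma> a t (bm m) m v I D C)"
    unfolding W using w ek ps by (intro frame_wr) auto
  have "fld (bitv (ewr P \<sigma> a t ?b m v I D C)) eo (ew ?b m) = enc (\<lambda>x. 2 ^ x) ?b m v I D C"
  proof (rule fld_eqI[OF enc_less[OF v'(2,1) lt]])
    fix i assume "i < ew ?b m"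
    moreover have "eo + i \<in> FPg" by (rule subsetD[OF area[OF m]]) (use \<open>i < ew ?b m\<close> in simp)
    then have "eo + i < lim \<sigma>0" by (rule lim)
    ultimately show "bitv (ewr P \<sigma> a t ?b m v I D C) (eo + i) = bit (enc (\<lambda>x. 2 ^ x) ?b m v I D C) i"
      unfolding W using w ek ps by (simp add: bitv_wr)
  qed
  then show "EN (ewr P \<sigma> a t (bm m) m v I D C) m v \<pi> col" unfolding EN_def ID .
qed

lemma EN_frame:
  assumes "EN \<sigma> m v \<pi> col" "\<And>p. eo \<le> p \<Longrightarrow> p < eo + ew (bm m) m \<Longrightarrow> bitv \<sigma>' p = bitv \<sigma> p"
  shows "EN \<sigma>' m v \<pi> col"
proof -
  have "fld (bitv \<sigma>') eo (ew (bm m) m) = fld (bitv \<sigma>) eo (ew (bm m) m)"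
    by (rule fld_cong) (rule assms(2); simp)
  then show ?thesis using assms(1) unfolding EN_def by simp
qed

lemma RG_stable:
  assumes "same \<sigma>0 \<sigma>" "same \<sigma>0 \<sigma>'" "RG \<sigma> f v" and b: "\<And>p. p \<in> FPg \<Longrightarrow> bitv \<sigma>' p = bitv \<sigma> p"
  shows "RG \<sigma>' f v"
proof -
  obtain m \<pi> where R: "rch m" "EN \<sigma> m v \<pi> (\<lambda>i. f (\<pi> i))" "eperm m \<pi> sz" "v \<le> sz" "\<And>x. x < sz \<Longrightarrow> f x < cP P"
    "rdy P \<sigma>0 (bm m) \<Longrightarrow> RF m \<sigma> (\<lambda>q. f (\<pi> (m + q)))"
    "\<And>q. \<not> rdy P \<sigma>0 (bm m) \<Longrightarrow> m \<le> q \<Longrightarrow> q < sz \<Longrightarrow> f (\<pi> q) = dP P"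
    by (rule RG_E[OF assms(3)]) blast
  have "EN \<sigma>' m v \<pi> (\<lambda>i. f (\<pi> i))"
    by (rule EN_frame[OF R(2)]) (use area[OF R(1)] b in auto)
  moreover have "RF m \<sigma>' (\<lambda>q. f (\<pi> (m + q)))" if "rdy P \<sigma>0 (bm m)"
    by (rule struct.stable[OF conjunct1[OF F[OF R(1) that]], OF assms(1,2) R(6)[OF that]])
      (use F[OF R(1) that] b in auto)
  ultimately show ?thesis using R unfolding RG_def by (intro exI[of _ m] exI[of _ \<pi>]) simp
qed

lemma RG_ext:
  assumes "same \<sigma>0 \<sigma>" "RG \<sigma> f v" and f': "\<And>x. x < sz \<Longrightarrow> f' x = f x"
  shows "RG \<sigma> f' v"
proof -
  obtain m \<pi> where R: "rch m" "EN \<sigma> m v \<pi> (\<lambda>i. f (\<pi> i))" "eperm m \<pi> sz" "v \<le> sz" "\<And>x. x < sz \<Longrightarrow> f x < cP P"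
    "rdy P \<sigma>0 (bm m) \<Longrightarrow> RF m \<sigma> (\<lambda>q. f (\<pi> (m + q)))"
    "\<And>q. \<not> rdy P \<sigma>0 (bm m) \<Longrightarrow> m \<le> q \<Longrightarrow> q < sz \<Longrightarrow> f (\<pi> q) = dP P"
    by (rule RG_E[OF assms(2)]) blast
  have ms: "m \<le> sz" using R(3) unfolding eperm_iff by simp
  have fp: "f' (\<pi> i) = f (\<pi> i)" if "i < sz" for i using f' vperm_less[OF R(3) that] by simp
  have "pack (bm m) (\<lambda>i. f' (\<pi> i)) m = pack (bm m) (\<lambda>i. f (\<pi> i)) m"
    using fp ms by (intro pack_cong) auto
  then have "EN \<sigma> m v \<pi> (\<lambda>i. f' (\<pi> i))" using R(2) unfolding EN_def by simp
  moreover have "RF m \<sigma> (\<lambda>q. f' (\<pi> (m + q)))" if "rdy P \<sigma>0 (bm m)"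
    by (rule struct.ext[OF conjunct1[OF F[OF R(1) that]], OF assms(1) R(6)[OF that]]) (use fp in auto)
  ultimately show ?thesis using R f' fp unfolding RG_def by (intro exI[of _ m] exI[of _ \<pi>]) simp
qed

lemma RG_get:
  assumes s: "same \<sigma>0 \<sigma>" and R: "RG \<sigma> f v" and x: "x < sz"
  shows "gget P \<sigma> a p t sz x = f x \<and> f x < cP P" "gav P \<sigma> a t = v"
proof -
  obtain m \<pi> where R: "rch m" "EN \<sigma> m v \<pi> (\<lambda>i. f (\<pi> i))" "eperm m \<pi> sz" "v \<le> sz" "\<And>x. x < sz \<Longrightarrow> f x < cP P"
    "rdy P \<sigma>0 (bm m) \<Longrightarrow> RF m \<sigma> (\<lambda>q. f (\<pi> (m + q)))"
    "\<And>q. \<not> rdy P \<sigma>0 (bm m) \<Longrightarrow> m \<le> q \<Longrightarrow> q < sz \<Longrightarrow> f (\<pi> q) = dP P"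
    by (rule RG_E[OF R]) blast
  have ms: "m \<le> sz" using R(3) unfolding eperm_iff by simp
  have "f (\<pi> i) < cP P" if "i < m" for i using R(5)[OF vperm_less[OF R(3)], of i] ms that by simp
  then obtain g where "elist e (gX P \<sigma> a t) (bm m) m v sz g \<pi> (\<lambda>i. f (\<pi> i))"
    by (rule EN_elist[OF s R(1,2,3,4)])
  then interpret elist e "gX P \<sigma> a t" "bm m" m v sz g \<pi> "\<lambda>i. f (\<pi> i)" .
  show "gav P \<sigma> a t = v" unfolding gav_def by (rule header)
  obtain q where q: "q < sz" "x = \<pi> q" "hidx e (gX P \<sigma> a t) x = q" using idx'[OF x] by blast
  note d = gget_def gget'_def par_same[OF s] q(3) header
  show "gget P \<sigma> a p t sz x = f x \<and> f x < cP P"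
  proof (cases "q < m")
    case True
    then show ?thesis unfolding d using cell(3)[OF True] q R(5)[OF x] by simp
  next
    case False
    show ?thesis
    proof (cases "rdy P \<sigma>0 (bm m)")
      case True
      from struct.get[OF conjunct1[OF F[OF R(1) True]], OF s R(6)[OF True], of "q - m"]
      have "fget P \<sigma> a t (bm m) m sz (q - m) = f x" using False q by simp
      then show ?thesis unfolding d using False True R(5)[OF x] by simp
    next
      case nr: False
      then show ?thesis unfolding d using False R(7)[OF nr, of q] q dc by simp
    qed
  qed
qed

text \<open>The hits in the list are followed by the places from \<open>m\<close> on: those that the
  level of blocks reports, if there is one, or else all of them for \<open>j = dP P\<close>, as
  unlisted elements have the default colour before the blocks exist.\<close>

lemma RG_enum:
  assumes s: "same \<sigma>0 \<sigma>" and R: "RG \<sigma> f v" and j: "j < cP P"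
  shows "\<exists>xs. distinct xs \<and> set xs = {x. x < sz \<and> f x = j} \<and>
    lnk (gnext P \<sigma> a p t sz j) (gfirst P \<sigma> a p t sz j) xs 0"
proof -
  obtain m \<pi> where R: "rch m" "EN \<sigma> m v \<pi> (\<lambda>i. f (\<pi> i))" "eperm m \<pi> sz" "v \<le> sz" "\<And>x. x < sz \<Longrightarrow> f x < cP P"
    "rdy P \<sigma>0 (bm m) \<Longrightarrow> RF m \<sigma> (\<lambda>q. f (\<pi> (m + q)))"
    "\<And>q. \<not> rdy P \<sigma>0 (bm m) \<Longrightarrow> m \<le> q \<Longrightarrow> q < sz \<Longrightarrow> f (\<pi> q) = dP P"
    by (rule RG_E[OF R]) blast
  have ms: "m \<le> sz" using R(3) unfolding eperm_iff by simp
  have "f (\<pi> i) < cP P" if "i < m" for i using R(5)[OF vperm_less[OF R(3)], of i] ms that by simp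
  then obtain g where "elist e (gX P \<sigma> a t) (bm m) m v sz g \<pi> (\<lambda>i. f (\<pi> i))"
    by (rule EN_elist[OF s R(1,2,3,4)])
  then interpret elist e "gX P \<sigma> a t" "bm m" m v sz g \<pi> "\<lambda>i. f (\<pi> i)" .
  let ?X = "gX P \<sigma> a t"
  let ?nx = "gnext P \<sigma> a p t sz j" let ?tl = "gtail P \<sigma> a t sz ?X j" let ?gf = "gfrom P \<sigma> a t sz ?X j"
  note ps = par_same[OF s] and d = gnext_def gnext'_def gfrom_def gtail_def
  have jb: "j < 2 ^ (bm m - 1)" using j num[OF R(1)] by auto
  let ?Q = "\<lambda>i. f (\<pi> i) = j"
  have gf: "?gf i = (if first_from i m ?Q = 0 then ?tl else Suc (\<pi> (first_from i m ?Q - 1)))" if "i \<le> m" for i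
  proof -
    have "first_from i m ?Q = 0 \<or> first_from i m ?Q - 1 < m"
      unfolding first_from_def using LeastI_ex[of "\<lambda>t. i \<le> t \<and> t < m \<and> ?Q t"] by auto
    then show ?thesis
      unfolding gfrom_def ps find(3)[OF jb that] using cell(1)[of "first_from i m ?Q - 1"] by auto
  qed
  define inx where "inx i = first_from (Suc i) m ?Q" for i
  obtain ps1 where p1: "set ps1 = {i. 0 \<le> i \<and> i < m \<and> ?Q i}" "lnk inx (first_from 0 m ?Q) ps1 0"
    using lnk_first_from[of m inx ?Q 0] by (auto simp: inx_def)
  have l1: "lnk ?nx (gfirst P \<sigma> a p t sz j) (map \<pi> ps1) ?tl"
  proof -
    have "lnk ?nx (if first_from 0 m ?Q = 0 then ?tl else Suc (\<pi> (first_from 0 m ?Q - 1))) (map \<pi> ps1) ?tl"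
    proof (rule lnk_map[OF p1(2)])
      fix i assume "i \<in> set ps1"
      then have i: "i < m" using p1(1) by auto
      then have "hidx e ?X (\<pi> i) = i" using idx[of i] ms by simp
      then show "?nx (\<pi> i) = (if inx i = 0 then ?tl else Suc (\<pi> (inx i - 1)))"
        unfolding gnext_def gnext'_def ps header using i gf[of "Suc i"] by (simp add: inx_def)
    qed
    then show ?thesis unfolding gfirst_def gf[of 0, simplified] .
  qed
  have "\<exists>qs. set qs = {q. m \<le> q \<and> q < sz \<and> ?Q q} \<and> lnk ?nx ?tl (map \<pi> qs) 0"
  proof (cases "rdy P \<sigma>0 (bm m)")
    case True
    obtain rs where rs: "set rs = {r. r < sz - m \<and> f (\<pi> (m + r)) = j}"
      "lnk (fnext P \<sigma> a t (bm m) m sz j) (ffirst P \<sigma> a t (bm m) m sz j) rs 0"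
      using struct.enum[OF conjunct1[OF F[OF R(1) True]], OF s R(6)[OF True] j] by blast
    let ?ff = "ffirst P \<sigma> a t (bm m) m sz j" let ?fn = "fnext P \<sigma> a t (bm m) m sz j"
    \<comment> \<open>\<open>hat\<close> is known to be correct only at places below
      \<open>sz\<close>, so the pointers have to be shown to stay within the list.\<close>
    have le: "ss = 0 \<or> ss - 1 \<in> set l" if "lnk nx ss l 0" for nx ss l using that by (cases l) auto
    have le': "nx r = 0 \<or> nx r - 1 \<in> set l" if "lnk nx ss l 0" "r \<in> set l" for nx ss l r
      using that
    proof (induction l arbitrary: ss)
      case (Cons x l)
      show ?case
      proof (cases "r = x")
        case True
        have "lnk nx (nx x) l 0" using Cons.prems(1) by simp
        from le[OF this] True show ?thesis by auto
      next
        case False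
        then show ?thesis using Cons.IH[of "nx x"] Cons.prems by auto
      qed
    qed simp
    have at': "hat e ?X (m + r) = \<pi> (m + r)" if "r \<in> set rs" for r
    proof (rule at)
      have "r < sz - m" using that unfolding rs(1) by blast
      then show "m + r < sz" by linarith
    qed simp
    have "lnk ?nx (if ?ff = 0 then 0 else Suc (\<pi> (m + (?ff - 1)))) (map (\<lambda>r. \<pi> (m + r)) rs) 0"
    proof (rule lnk_map[OF rs(2)])
      fix r assume r: "r \<in> set rs"
      then have "r < sz - m" unfolding rs(1) by blast
      then have "m + r < sz" by linarith
      then have i: "hidx e ?X (\<pi> (m + r)) = m + r" by (rule idx)
      have nm: "\<not> m + r < m" "m + r - m = r" by auto
      have "hat e ?X (m + (?fn r - 1)) = \<pi> (m + (?fn r - 1))" if "?fn r \<noteq> 0"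
        using le'[OF rs(2) r] that by (intro at') blast
      then show "?nx (\<pi> (m + r)) = (if ?fn r = 0 then 0 else Suc (\<pi> (m + (?fn r - 1))))"
        unfolding gnext_def gnext'_def ps header i if_not_P[OF nm(1)] if_P[OF True] nm(2) by (rule if_cong[OF refl refl arg_cong])
    qed
    moreover have "?tl = (if ?ff = 0 then 0 else Suc (\<pi> (m + (?ff - 1))))"
    proof -
      have "hat e ?X (m + (?ff - 1)) = \<pi> (m + (?ff - 1))" if "?ff \<noteq> 0"
        using le[OF rs(2)] that by (intro at') blast
      then show ?thesis
        unfolding gtail_def ps header if_P[OF True] by (rule if_cong[OF refl refl arg_cong])
    qed
    moreover have "set (map (\<lambda>r. m + r) rs) = {q. m \<le> q \<and> q < sz \<and> ?Q q}"
    proof (intro equalityI subsetI)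
      fix q assume "q \<in> {q. m \<le> q \<and> q < sz \<and> ?Q q}"
      then have "q - m \<in> set rs" "q = m + (q - m)" unfolding rs(1) by auto
      then show "q \<in> set (map (\<lambda>r. m + r) rs)" unfolding set_map by blast
    next
      fix q assume "q \<in> set (map (\<lambda>r. m + r) rs)"
      then obtain r where r: "r \<in> set rs" "q = m + r" unfolding set_map by blast
      then have "r < sz - m" "f (\<pi> (m + r)) = j" unfolding rs(1) by blast+
      moreover from this have "m + r < sz" by linarith
      ultimately show "q \<in> {q. m \<le> q \<and> q < sz \<and> ?Q q}" unfolding r(2) by simp
    qed
    ultimately show ?thesis by (intro exI[of _ "map (\<lambda>r. m + r) rs"]) (simp add: comp_def)
  next
    case nr: False
    show ?thesis
    proof (cases "j = dP P \<and> m < sz")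
      case False
      then have "?tl = 0" unfolding gtail_def ps header using nr by auto
      moreover have "{q. m \<le> q \<and> q < sz \<and> ?Q q} = {}" using False R(7)[OF nr] by auto
      ultimately show ?thesis by (intro exI[of _ "[]"]) simp
    next
      case True
      have "lnk ?nx (if (if m < sz then Suc m else 0) = 0 then 0 else Suc (\<pi> ((if m < sz then Suc m else 0) - 1)))
          (map \<pi> [m..<sz]) 0"
      proof (rule lnk_map[OF lnk_upt[OF ms]])
        fix q assume q: "q \<in> set [m..<sz]"
        then have "hidx e ?X (\<pi> q) = q" using idx[of q] by auto
        then show "?nx (\<pi> q) = (if (if Suc q < sz then Suc (Suc q) else 0) = 0 then 0
            else Suc (\<pi> ((if Suc q < sz then Suc (Suc q) else 0) - 1)))"
          unfolding gnext_def gnext'_def ps header if_not_P[OF nr] using q at[of "Suc q"] by simp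
      qed
      moreover have "?tl = Suc (\<pi> m)" unfolding gtail_def ps header using nr True at[of m] by auto
      moreover have "set [m..<sz] = {q. m \<le> q \<and> q < sz \<and> ?Q q}" using True R(7)[OF nr] by auto
      ultimately show ?thesis using True by (intro exI[of _ "[m..<sz]"]) simp
    qed
  qed
  then obtain qs where qs: "set qs = {q. m \<le> q \<and> q < sz \<and> ?Q q}" "lnk ?nx ?tl (map \<pi> qs) 0" by blast
  have lk: "lnk ?nx (gfirst P \<sigma> a p t sz j) (map \<pi> ps1 @ map \<pi> qs) 0"
    using l1 qs(2) unfolding lnk_append by blast
  have "set (map \<pi> ps1 @ map \<pi> qs) = \<pi> ` {q. q < sz \<and> ?Q q}"
  proof -
    have "{i. 0 \<le> i \<and> i < m \<and> ?Q i} \<union> {q. m \<le> q \<and> q < sz \<and> ?Q q} = {q. q < sz \<and> ?Q q}"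
      using ms by auto
    then show ?thesis unfolding set_append set_map p1(1) qs(1) image_Un[symmetric] by simp
  qed
  also have "\<dots> = {x. x < sz \<and> f x = j}"
    using vperm_surj[OF R(3)] pi_less by auto
  finally show ?thesis using lk lnk_distinct[OF lk] by blast
qed

end

context group
begin

lemma RF_frame:
  assumes "rch m" "rdy P \<sigma>0 (bm m)" "same \<sigma>0 \<sigma>" "frame FP \<sigma> \<sigma>'" "FPF m \<inter> FP = {}" "RF m \<sigma> h"
    "\<And>r. r < sz - m \<Longrightarrow> h' r = h r"
  shows "RF m \<sigma>' h'"
proof -
  note st = conjunct1[OF F[OF assms(1,2)]]
  have s': "same \<sigma>0 \<sigma>'" by (rule frame_same[OF assms(4,3)])
  have "RF m \<sigma>' h"
    by (rule struct.stable[OF st, OF assms(3) s' assms(6)]) (use assms(4,5) in \<open>auto simp: frame_def\<close>)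
  then show ?thesis by (rule struct.ext[OF st, OF s']) (rule assms(7))
qed

lemma EN_frame':
  assumes "EN \<sigma> m v \<pi> col" "frame FP \<sigma> \<sigma>'" "FP \<inter> {eo..<eo + ew (bm m) m} = {}"
  shows "EN \<sigma>' m v \<pi> col"
  by (rule EN_frame[OF assms(1)]) (use assms(2,3) in \<open>auto simp: frame_def\<close>)

lemma RG_setav:
  assumes s: "same \<sigma>0 \<sigma>" and R: "RG \<sigma> f v" and v': "v' \<le> sz"
  shows "RG (gsetav P \<sigma> a t v') f v' \<and> frame FPg \<sigma> (gsetav P \<sigma> a t v')"
proof -
  obtain m \<pi> where R: "rch m" "EN \<sigma> m v \<pi> (\<lambda>i. f (\<pi> i))" "eperm m \<pi> sz" "v \<le> sz" "\<And>x. x < sz \<Longrightarrow> f x < cP P"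
    "rdy P \<sigma>0 (bm m) \<Longrightarrow> RF m \<sigma> (\<lambda>q. f (\<pi> (m + q)))"
    "\<And>q. \<not> rdy P \<sigma>0 (bm m) \<Longrightarrow> m \<le> q \<Longrightarrow> q < sz \<Longrightarrow> f (\<pi> q) = dP P"
    by (rule RG_E[OF R]) blast
  have ms: "m \<le> sz" using R(3) unfolding eperm_iff by simp
  have col: "f (\<pi> i) < cP P" if "i < m" for i using R(5)[OF vperm_less[OF R(3)], of i] ms that by simp
  obtain g where "elist e (gX P \<sigma> a t) (bm m) m v sz g \<pi> (\<lambda>i. f (\<pi> i))"
    by (rule EN_elist[OF s R(1,2,3,4) col])
  then interpret elist e "gX P \<sigma> a t" "bm m" m v sz g \<pi> "\<lambda>i. f (\<pi> i)" .
  have eq: "gsetav P \<sigma> a t v' = ewr P \<sigma> a t (bm m) m v' (pack (bm m) \<pi> m) (pack (bm m) (dis m \<pi>) m) (pack (bm m) (\<lambda>i. f (\<pi> i)) m)"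
    unfolding gsetav_def Let_def par_same[OF s] header lists ..
  have W: "EN (gsetav P \<sigma> a t v') m v' \<pi> (\<lambda>i. f (\<pi> i))" "frame {eo..<eo + ew (bm m) m} \<sigma> (gsetav P \<sigma> a t v')"
    unfolding eq using EN_write[OF s R(1,3) v' col refl refl refl] by simp_all
  have "RF m (gsetav P \<sigma> a t v') (\<lambda>q. f (\<pi> (m + q)))" if r: "rdy P \<sigma>0 (bm m)"
    by (rule RF_frame[OF R(1) r s W(2) _ R(6)[OF r]]) (use F[OF R(1) r] in auto)
  then have "RG (gsetav P \<sigma> a t v') f v'"
    using R v' W(1) unfolding RG_def by (intro exI[of _ m] exI[of _ \<pi>]) simp
  then show ?thesis using frame_mono[OF W(2) area[OF R(1)]] by simp
qed

lemma RG_ini: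
  assumes s: "same \<sigma>0 \<sigma>"
  shows "RG (gini P \<sigma> a p t sz) (\<lambda>_. dP P) 0 \<and> frame FPg \<sigma> (gini P \<sigma> a p t sz)"
proof -
  have r: "rch 0" by (simp add: greach_def)
  have p: "eperm 0 id sz" unfolding eperm_iff by (simp add: bij_betw_def)
  have "EN (ewr P \<sigma> a t (bm 0) 0 0 0 0 0) 0 0 id (\<lambda>_. dP P)"
    "frame {eo..<eo + ew (bm 0) 0} \<sigma> (ewr P \<sigma> a t (bm 0) 0 0 0 0 0)"
    by (rule EN_write[OF s r p]; simp)+
  moreover have "gini P \<sigma> a p t sz = ewr P \<sigma> a t (bm 0) 0 0 0 0 0"
    by (simp add: gini_def par_same[OF s])
  ultimately show ?thesis
    using r p r0 dc frame_mono[OF _ area[OF r]] unfolding RG_def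
    by (auto intro!: exI[of _ 0] exI[of _ id])
qed

lemma RG_set:
  assumes s: "same \<sigma>0 \<sigma>" and R: "RG \<sigma> f v" and x: "x < sz" and j: "j < cP P"
  shows "RG (gset P \<sigma> a p t sz x j) (f(x := j)) v \<and> frame FPg \<sigma> (gset P \<sigma> a p t sz x j)"
proof -
  obtain m \<pi> where R: "rch m" "EN \<sigma> m v \<pi> (\<lambda>i. f (\<pi> i))" "eperm m \<pi> sz" "v \<le> sz" "\<And>x. x < sz \<Longrightarrow> f x < cP P"
    "rdy P \<sigma>0 (bm m) \<Longrightarrow> RF m \<sigma> (\<lambda>q. f (\<pi> (m + q)))"
    "\<And>q. \<not> rdy P \<sigma>0 (bm m) \<Longrightarrow> m \<le> q \<Longrightarrow> q < sz \<Longrightarrow> f (\<pi> q) = dP P"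
    using R by (rule RG_E) blast
  have ms: "m \<le> sz" using R(3) unfolding eperm_iff by simp
  have col: "f (\<pi> i) < cP P" if "i < m" for i using R(5)[OF vperm_less[OF R(3)], of i] ms that by simp
  obtain g where "elist e (gX P \<sigma> a t) (bm m) m v sz g \<pi> (\<lambda>i. f (\<pi> i))"
    by (rule EN_elist[OF s R(1,2,3,4) col])
  then interpret elist e "gX P \<sigma> a t" "bm m" m v sz g \<pi> "\<lambda>i. f (\<pi> i)" .
  let ?X = "gX P \<sigma> a t"
  obtain q where q: "q < sz" "x = \<pi> q" "hidx e ?X x = q" using idx'[OF x] by blast
  define f' where "f' = f(x := j)"
  have f'c: "f' y < cP P" if "y < sz" for y using R(5)[OF that] j by (simp add: f'_def)
  have f': "f' (\<pi> i) = (if i = q then j else f (\<pi> i))" if "i < sz" for i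
    using vperm_inj[OF R(3) that q(1)] by (simp add: f'_def q(2))
  note d = gset_def Let_def par_same[OF s] q(3) header
  \<comment> \<open>The element is listed; or it lies in a block; or it is unlisted and assigned the
    default colour, which it has already; or it has to be appended to the list.\<close>
  consider (1) "q < m" | (2) "\<not> q < m" "rdy P \<sigma>0 (bm m)" | (3) "\<not> q < m" "\<not> rdy P \<sigma>0 (bm m)" "j = dP P"
    | (4) "\<not> q < m" "\<not> rdy P \<sigma>0 (bm m)" "j \<noteq> dP P" by blast
  then have "RG (gset P \<sigma> a p t sz x j) f' v \<and> frame FPg \<sigma> (gset P \<sigma> a p t sz x j)"
  proof cases
    case 1
    have "pack (bm m) ((\<lambda>i. f (\<pi> i))(q := j)) m = pack (bm m) (\<lambda>i. f' (\<pi> i)) m"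
      using f' ms by (intro pack_cong) simp
    moreover have "hput e ?X (pack (bm m) (\<lambda>i. f (\<pi> i)) m) q j = pack (bm m) ((\<lambda>i. f (\<pi> i))(q := j)) m"
      by (rule put[OF 1]) (rule bounds)
    ultimately have "gset P \<sigma> a p t sz x j = ewr P \<sigma> a t (bm m) m v (pack (bm m) \<pi> m) (pack (bm m) (dis m \<pi>) m)
        (pack (bm m) (\<lambda>i. f' (\<pi> i)) m)"
      unfolding d lists if_P[OF 1] by simp
    moreover have "f' (\<pi> i) < cP P" if "i < m" for i using f'c vperm_less[OF R(3), of i] ms that by simp
    ultimately have W: "EN (gset P \<sigma> a p t sz x j) m v \<pi> (\<lambda>i. f' (\<pi> i))"
      "frame {eo..<eo + ew (bm m) m} \<sigma> (gset P \<sigma> a p t sz x j)"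
      using EN_write[OF s R(1,3,4) _ refl refl refl, of "\<lambda>i. f' (\<pi> i)"] by simp_all
    have "RF m (gset P \<sigma> a p t sz x j) (\<lambda>r. f' (\<pi> (m + r)))" if r: "rdy P \<sigma>0 (bm m)"
      by (rule RF_frame[OF R(1) r s W(2) _ R(6)[OF r]]) (use F[OF R(1) r] f' 1 in auto)
    moreover have "f' (\<pi> i) = dP P" if "\<not> rdy P \<sigma>0 (bm m)" "m \<le> i" "i < sz" for i
      using R(7)[OF that] f' 1 that by simp
    ultimately show ?thesis
      using R W f'c frame_mono[OF W(2) area[OF R(1)]] unfolding RG_def
      by (intro conjI exI[of _ m] exI[of _ \<pi>]) simp_all
  next
    case 2
    have eq: "gset P \<sigma> a p t sz x j = fset P \<sigma> a t (bm m) m sz (q - m) j"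
      unfolding d using 2 by simp
    have "q - m < sz - m" using 2 q by linarith
    note S = struct.set'[OF conjunct1[OF F[OF R(1) 2(2)]], OF s R(6)[OF 2(2)] this j, folded eq]
    note S' = frame_same[OF conjunct2[OF S] s]
    have W: "EN (gset P \<sigma> a p t sz x j) m v \<pi> (\<lambda>i. f (\<pi> i))"
      by (rule EN_frame'[OF R(2) conjunct2[OF S]]) (use F[OF R(1) 2(2)] in blast)
    have "pack (bm m) (\<lambda>i. f (\<pi> i)) m = pack (bm m) (\<lambda>i. f' (\<pi> i)) m"
      using f' ms 2 by (intro pack_cong) auto
    then have "EN (gset P \<sigma> a p t sz x j) m v \<pi> (\<lambda>i. f' (\<pi> i))" using W unfolding EN_def by simp
    moreover have "RF m (gset P \<sigma> a p t sz x j) (\<lambda>r. f' (\<pi> (m + r)))"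
      by (rule struct.ext[OF conjunct1[OF F[OF R(1) 2(2)]], OF S' conjunct1[OF S]]) (use f' 2 in auto)
    ultimately show ?thesis
      using R 2 f'c frame_mono[OF conjunct2[OF S]] F[OF R(1) 2(2)] unfolding RG_def
      by (intro conjI exI[of _ m] exI[of _ \<pi>]) simp_all
  next
    case 3
    have "f x = j" using R(7)[OF 3(2), of q] 3 q by simp
    then have "f' = f" unfolding f'_def by auto
    moreover have "gset P \<sigma> a p t sz x j = \<sigma>" unfolding d using 3 by simp
    ultimately show ?thesis
      using R 3 unfolding RG_def by (auto simp: frame_refl intro!: exI[of _ m] exI[of _ \<pi>])
  next
    case 4
    have mq: "m \<le> q" using 4 by simp
    define y where "y = hat e ?X m"
    define \<pi>' where "\<pi>' = \<pi>(q := y, m := x)"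
    note ap = append[OF x q(3)[symmetric] mq y_def, folded \<pi>'_def]
    define m' where "m' = Suc m"
    have r': "rch m'" using R(1) 4(2) ap(2) by (auto simp: greach_def m'_def less_Suc_eq)
    note n = num[OF R(1)] and n' = num[OF r']
    have pi': "\<pi>' i = (if i = m then x else if i = q then y else \<pi> i)" for i by (simp add: \<pi>'_def)
    have f2: "f' (\<pi>' i) = (if i < m then f (\<pi> i) else if i = m then j else dP P)" if i: "i < sz" for i
    proof -
      have "f' x = j" by (simp add: f'_def)
      moreover have "f' y = dP P" if "q \<noteq> m"
        using f'[of m] R(7)[OF 4(2), of m] ap(2,5) that by simp
      moreover have "f' (\<pi> i) = dP P" if "m < i" "i \<noteq> q"
        using f'[OF i] R(7)[OF 4(2) _ i] that by simp
      ultimately show ?thesis using f'[OF i] mq by (auto simp: pi')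
    qed
    have pl': "\<pi>' i < sz" if "i < sz" for i using vperm_less[OF ap(1) that] .
    have e: "e z = 2 ^ z" if "z \<le> bm m * (m + 1)" for z using that n by (intro pw_eq) linarith
    have "bm m * m \<le> bm m * (m + 1)" by simp
    note em = e[OF this]
    have gb: "gb' P \<sigma>0 ?X = bm m'" by (simp add: gb'_def header m'_def)
    \<comment> \<open>Unless the instance is tiny, \<open>bm m' * (m + 9) \<le> bm m\<close>, which
      leaves room for all \<open>m'\<close> cells as \<open>repack\<close> demands.\<close>
    have rp: "grp P \<sigma>0 ?X (pack (bm m) h m') = pack (bm m') h m'" if h: "\<And>i. i < m' \<Longrightarrow> h i < 2 ^ bm m'" for h
    proof (cases "tiny P \<sigma>0")
      case True
      then show ?thesis by (simp add: grp_def m'_def)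
    next
      case False
      then have "bm m' = bm m div (m + 9)" by (simp add: m'_def)
      then have "bm m' * (m + 9) \<le> bm m" by simp
      then have le: "bm m' * m' + bm m' * 8 \<le> bm m" by (simp add: m'_def algebra_simps)
      have 1: "1 \<le> bm m'" using n' by simp
      have lt: "bm m' * m' < bm m" "bm m' < bm m" using le 1 by (simp, linarith)
      have "bm m \<le> bm m * (m + 1)" "bm m' \<le> bm m * (m + 1)" using lt(2) by (auto intro: le_trans[of _ "bm m"])
      then show ?thesis
        unfolding grp_def gb header using False repack[of m' h "bm m'" "bm m", OF h lt] e by simp
    qed
    have half: "(2 :: nat) ^ (bm m' - 1) \<le> 2 ^ bm m'" by (intro power_increasing) auto
    have szb: "sz \<le> 2 ^ bm m'" "cP P \<le> 2 ^ bm m'" using n' half by linarith+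
    have m's: "m' \<le> sz" using ap(2) by (simp add: m'_def)
    have b1: "\<pi>' i < 2 ^ bm m'" if "i < m'" for i using pl'[of i] that m's szb by simp
    have b2: "dis m' \<pi>' i < 2 ^ bm m'" if "i < m'" for i
      using pl'[of i] pl'[of "\<pi>' i"] that m's szb unfolding dis_def by simp
    have colc: "f' (\<pi>' i) < cP P" if "i < m'" for i using f'c pl'[of i] that m's by simp
    then have b3: "f' (\<pi>' i) < 2 ^ bm m'" if "i < m'" for i using szb that by (meson less_le_trans)
    have L1: "hI e ?X + x * e (bm m * m) = pack (bm m) \<pi>' m'" unfolding em m'_def by (rule ap(6))
    have L2: "gD e ?X x q = pack (bm m) (dis m' \<pi>') m'"
      unfolding gD_def Let_def header em m'_def y_def[symmetric] by (rule ap(7))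
    have "pack (bm m) (\<lambda>i. f (\<pi> i)) m = pack (bm m) (\<lambda>i. f' (\<pi>' i)) m"
      using f2 ap(2) by (intro pack_cong) simp
    then have L3: "hC e ?X + j * e (bm m * m) = pack (bm m) (\<lambda>i. f' (\<pi>' i)) m'"
      unfolding lists em m'_def pack_Suc using f2[OF ap(2)] by simp
    have rps: "grp P \<sigma>0 ?X (pack (bm m) \<pi>' m') = pack (bm m') \<pi>' m'"
      "grp P \<sigma>0 ?X (pack (bm m) (dis m' \<pi>') m') = pack (bm m') (dis m' \<pi>') m'"
      "grp P \<sigma>0 ?X (pack (bm m) (\<lambda>i. f' (\<pi>' i)) m') = pack (bm m') (\<lambda>i. f' (\<pi>' i)) m'"
      by (rule rp, rule b1, assumption) (rule rp, rule b2, assumption, rule rp, rule b3)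
    define \<sigma>1 where "\<sigma>1 = ewr P \<sigma> a t (bm m') m' v (pack (bm m') \<pi>' m') (pack (bm m') (dis m' \<pi>') m') (pack (bm m') (\<lambda>i. f' (\<pi>' i)) m')"
    have W: "EN \<sigma>1 m' v \<pi>' (\<lambda>i. f' (\<pi>' i))" "frame {eo..<eo + ew (bm m') m'} \<sigma> \<sigma>1"
      unfolding \<sigma>1_def using EN_write[OF s r' ap(1)[folded m'_def] R(4) colc refl refl refl] by auto
    have s1: "same \<sigma>0 \<sigma>1" by (rule frame_same[OF W(2) s])
    have "gset P \<sigma> a p t sz x j = gappend P \<sigma> a t ?X x j q"
      unfolding d using 4 by simp
    also have "\<dots> = (if rdy P \<sigma>0 (bm m') then fini P \<sigma>1 a t (bm m') m' else \<sigma>1)"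
      unfolding gappend_def Let_def par_same[OF s] header gb L1 L2 L3 rps
      unfolding m'_def[symmetric] \<sigma>1_def[symmetric] par_same[OF s1] ..
    finally have eq: "gset P \<sigma> a p t sz x j = (if rdy P \<sigma>0 (bm m') then fini P \<sigma>1 a t (bm m') m' else \<sigma>1)" .
    show ?thesis
    proof (cases "rdy P \<sigma>0 (bm m')")
      case True
      note FF = F[OF r' True]
      note I = struct.ini[OF conjunct1[OF FF], OF s1]
      have W': "EN (fini P \<sigma>1 a t (bm m') m') m' v \<pi>' (\<lambda>i. f' (\<pi>' i))"
        by (rule EN_frame'[OF W(1) conjunct2[OF I]]) (use FF in blast)
      \<comment> \<open>A new level has the default colour everywhere, and so have the unlisted
        elements up to this moment.\<close>
      have "RF m' (fini P \<sigma>1 a t (bm m') m') (\<lambda>r. f' (\<pi>' (m' + r)))"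
        by (rule struct.ext[OF conjunct1[OF FF], OF frame_same[OF conjunct2[OF I] s1] conjunct1[OF I]])
          (use f2 in \<open>auto simp: m'_def\<close>)
      moreover have "frame FPg \<sigma> (fini P \<sigma>1 a t (bm m') m')"
        by (rule frame_trans[OF frame_mono[OF W(2) area[OF r']] frame_mono[OF conjunct2[OF I]]]) (use FF in blast)
      ultimately show ?thesis
        unfolding eq if_P[OF True] RG_def using r' W' ap(1) R(4) f'c True
        by (intro conjI exI[of _ m'] exI[of _ \<pi>']) (simp_all add: m'_def)
    next
      case False
      have "f' (\<pi>' i) = dP P" if "m' \<le> i" "i < sz" for i using f2[OF that(2)] that by (simp add: m'_def)
      then show ?thesis
        unfolding eq if_not_P[OF False] RG_def using r' W ap(1) R(4) f'c False frame_mono[OF W(2) area[OF r']]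
        by (intro conjI exI[of _ m'] exI[of _ \<pi>']) (simp_all add: m'_def)
    qed
  qed
  then show ?thesis unfolding f'_def .
qed

lemma group_struct:
  "struct (cP P) (dP P) \<sigma>0 FPg sz (\<lambda>\<sigma>. gget P \<sigma> a p t sz) (\<lambda>\<sigma>. gfirst P \<sigma> a p t sz)
    (\<lambda>\<sigma>. gnext P \<sigma> a p t sz) (\<lambda>\<sigma>. gset P \<sigma> a p t sz) (\<lambda>\<sigma>. gini P \<sigma> a p t sz) (\<lambda>\<sigma> f. \<exists>v. RG \<sigma> f v)"
proof (unfold_locales, goal_cases)
  case (1 \<sigma> \<sigma>' f)
  then show ?case using RG_stable by blast
next
  case (2 \<sigma> f f')
  then show ?case using RG_ext by blast
next
  case (3 \<sigma> f x)
  then show ?case using RG_get by blast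
next
  case (4 \<sigma> f j)
  then show ?case using RG_enum by blast
next
  case (5 \<sigma> f x j)
  then show ?case using RG_set by blast
next
  case (6 \<sigma>)
  then show ?case using RG_ini by blast
qed

end

subsection \<open>Computability in constant time\<close>

lemma CM_lets:
  assumes "length As = n" "\<And>A. A \<in> set As \<Longrightarrow> CE A"
    and "CM (\<lambda>\<rho> \<sigma>. G (\<lambda>i. \<rho> (i + n)) (map \<rho> (rev [0..<n])) \<sigma>)"
  shows "CM (\<lambda>\<rho> \<sigma>. G \<rho> (map (\<lambda>A. A \<rho> \<sigma>) As) \<sigma>)"
  using assms
proof (induction n arbitrary: As G)
  case 0
  then show ?case by simp
next
  case (Suc n)
  then obtain A As' where As: "As = A # As'" "length As' = n" by (cases As) auto
  let ?As = "map (\<lambda>A \<rho> \<sigma>. A (\<lambda>i. \<rho> (Suc i)) \<sigma>) As'"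
  have "CM (\<lambda>\<rho> \<sigma>. (\<lambda>\<rho> ys \<sigma>. G (\<lambda>i. \<rho> (Suc i)) (\<rho> 0 # ys) \<sigma>) \<rho> (map (\<lambda>A. A \<rho> \<sigma>) ?As) \<sigma>)"
    by (rule Suc.IH) (use As Suc.prems in \<open>auto intro: CE_shift\<close>)
  then have "CM (\<lambda>\<rho> \<sigma>. G (\<lambda>i. \<rho> (Suc i)) (\<rho> 0 # map (\<lambda>A. A (\<lambda>i. \<rho> (Suc i)) \<sigma>) As') \<sigma>)"
    by (simp add: comp_def)
  from CM_let[of A "\<lambda>x \<rho> \<sigma>. G \<rho> (x # map (\<lambda>A. A \<rho> \<sigma>) As') \<sigma>", OF _ this] show ?case
    using Suc.prems(2) As by simp
qed

text \<open>A command changes the state on which its arguments depend, so the arguments are fixed in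
  registers beforehand. Seven are enough for \<open>lv_set\<close>.\<close>

lemma CM_bind7:
  assumes "CE A1" "CE A2" "CE A3" "CE A4" "CE A5" "CE A6" "CE A7"
    and "\<And>i1 i2 i3 i4 i5 i6 i7. CM (\<lambda>\<rho> \<sigma>. G \<sigma> (\<rho> i1) (\<rho> i2) (\<rho> i3) (\<rho> i4) (\<rho> i5) (\<rho> i6) (\<rho> i7))"
  shows "CM (\<lambda>\<rho> \<sigma>. G \<sigma> (A1 \<rho> \<sigma>) (A2 \<rho> \<sigma>) (A3 \<rho> \<sigma>) (A4 \<rho> \<sigma>) (A5 \<rho> \<sigma>) (A6 \<rho> \<sigma>) (A7 \<rho> \<sigma>))"
proof -
  have "CM (\<lambda>\<rho> \<sigma>. (\<lambda>\<rho> ys \<sigma>. G \<sigma> (ys ! 0) (ys ! 1) (ys ! 2) (ys ! 3) (ys ! 4) (ys ! 5) (ys ! 6)) \<rho>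
      (map (\<lambda>A. A \<rho> \<sigma>) [A1, A2, A3, A4, A5, A6, A7]) \<sigma>)"
    by (rule CM_lets[where n = 7]) (use assms in \<open>auto simp: upt_rec\<close>)
  then show ?thesis by simp
qed

lemmas CE_b = CE_const CE_var CE_univ CE_wid CE_add CE_mult CE_diff CE_div CE_mod CE_and CE_pw CE_if CE_Suc CE_rd
  CB_less CB_le CB_eq CB_not CB_conj CB_disj

lemma CE_pow: "CE F \<Longrightarrow> CE (\<lambda>\<rho> \<sigma>. F \<rho> \<sigma> ^ n)"
  by (induction n) (auto intro!: CE_b)

lemma CE_geo: "CE F \<Longrightarrow> CE G \<Longrightarrow> CE (\<lambda>\<rho> \<sigma>. geo (F \<rho> \<sigma>) (G \<rho> \<sigma>))"
  unfolding geo_def by (intro CE_b)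
lemma CE_lowbit: "CE F \<Longrightarrow> CE (\<lambda>\<rho> \<sigma>. lowbit (F \<rho> \<sigma>))"
  unfolding lowbit_def by (intro CE_b)
lemma CE_ilog: "CE F \<Longrightarrow> CE G \<Longrightarrow> CE (\<lambda>\<rho> \<sigma>. ilog (F \<rho> \<sigma>) (G \<rho> \<sigma>))"
  unfolding ilog_def by (intro CE_b)
lemma CE_gem: "CE F \<Longrightarrow> CE G \<Longrightarrow> CE H \<Longrightarrow> CE I \<Longrightarrow> CE (\<lambda>\<rho> \<sigma>. gem (F \<rho> \<sigma>) (G \<rho> \<sigma>) (H \<rho> \<sigma>) (I \<rho> \<sigma>))"
  unfolding gem_def by (intro CE_b)
lemma CE_ffrom: "CE F \<Longrightarrow> CE G \<Longrightarrow> CE H \<Longrightarrow> CE (\<lambda>\<rho> \<sigma>. ffrom (pw k \<sigma>) (F \<rho> \<sigma>) (G \<rho> \<sigma>) (H \<rho> \<sigma>))"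
  unfolding ffrom_def by (intro CE_b CE_lowbit CE_ilog)
lemma CE_pfind: "CE A \<Longrightarrow> CE F \<Longrightarrow> CE G \<Longrightarrow> CE H \<Longrightarrow> CE I \<Longrightarrow>
    CE (\<lambda>\<rho> \<sigma>. pfind (pw k \<sigma>) (A \<rho> \<sigma>) (F \<rho> \<sigma>) (G \<rho> \<sigma>) (H \<rho> \<sigma>) (I \<rho> \<sigma>))"
  unfolding pfind_def Let_def by (intro CE_b CE_ffrom CE_gem CE_geo)
lemma CE_gw: "CE B \<Longrightarrow> CE (\<lambda>\<rho> \<sigma>. gw c (B \<rho> \<sigma>))"
  unfolding gw_def by (intro CE_b)
lemma CE_cpow: "CE F \<Longrightarrow> CE G \<Longrightarrow> CE (\<lambda>\<rho> \<sigma>. cpow (pw k \<sigma>) c (F \<rho> \<sigma>) (G \<rho> \<sigma>))"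
  unfolding cpow_def by (intro CE_b CE_gw)
lemma CE_digits: "CE F \<Longrightarrow> CE G \<Longrightarrow> CE (\<lambda>\<rho> \<sigma>. digits (pw k \<sigma>) c (F \<rho> \<sigma>) (G \<rho> \<sigma>))"
  unfolding digits_def Let_def by (intro CE_b CE_gw CE_geo CE_cpow)
lemma CE_blen: "CE F \<Longrightarrow> CE (\<lambda>\<rho> \<sigma>. blen (pw k \<sigma>) c (F \<rho> \<sigma>))"
  unfolding blen_def Let_def by (intro CE_b CE_gw CE_geo CE_cpow CE_gem CE_ffrom)

lemma CE_baddr: "CE A \<Longrightarrow> CE B \<Longrightarrow> CE C \<Longrightarrow> CE (\<lambda>\<rho> \<sigma>. baddr k c \<sigma> (A \<rho> \<sigma>) (B \<rho> \<sigma>) (C \<rho> \<sigma>))"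
  unfolding baddr_def by (intro CE_b CE_blen)
lemma CE_bval: "CE A \<Longrightarrow> CE B \<Longrightarrow> CE C \<Longrightarrow> CE (\<lambda>\<rho> \<sigma>. bval k c \<sigma> (A \<rho> \<sigma>) (B \<rho> \<sigma>) (C \<rho> \<sigma>))"
  unfolding bval_def by (intro CE_b CE_blen CE_baddr)
lemma CE_bget: "CE A \<Longrightarrow> CE B \<Longrightarrow> CE C \<Longrightarrow> CE D \<Longrightarrow> CE E \<Longrightarrow>
    CE (\<lambda>\<rho> \<sigma>. bget k c \<sigma> (A \<rho> \<sigma>) (B \<rho> \<sigma>) (C \<rho> \<sigma>) (D \<rho> \<sigma>) (E \<rho> \<sigma>))"
  unfolding bget_def by (intro CE_b CE_bval CE_cpow)
lemma CE_bfind: "CE A \<Longrightarrow> CE B \<Longrightarrow> CE C \<Longrightarrow> CE D \<Longrightarrow> CE E \<Longrightarrow> CE F \<Longrightarrow>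
    CE (\<lambda>\<rho> \<sigma>. bfind k c \<sigma> (A \<rho> \<sigma>) (B \<rho> \<sigma>) (C \<rho> \<sigma>) (D \<rho> \<sigma>) (E \<rho> \<sigma>) (F \<rho> \<sigma>))"
  unfolding bfind_def by (intro CE_b CE_bval CE_digits CE_gw CE_pfind)

lemma CE_cel: "CE A \<Longrightarrow> CE B \<Longrightarrow> CE C \<Longrightarrow> CE D \<Longrightarrow> CE (\<lambda>\<rho> \<sigma>. cel k c \<sigma> (A \<rho> \<sigma>) (B \<rho> \<sigma>) (C \<rho> \<sigma>) (D \<rho> \<sigma>) f)"
  unfolding cel_def cad_def by (intro CE_b)
lemma CM_wce: "CE A \<Longrightarrow> CE B \<Longrightarrow> CE C \<Longrightarrow> CE D \<Longrightarrow> CE E \<Longrightarrow>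
    CM (\<lambda>\<rho> \<sigma>. wce k c \<sigma> (A \<rho> \<sigma>) (B \<rho> \<sigma>) (C \<rho> \<sigma>) (D \<rho> \<sigma>) f (E \<rho> \<sigma>))"
  unfolding wce_def cad_def by (intro CE_b CM_wr)
lemma CB_ltst: "CE A \<Longrightarrow> CE B \<Longrightarrow> CE C \<Longrightarrow> CE D \<Longrightarrow> CB (\<lambda>\<rho> \<sigma>. ltst k c \<sigma> (A \<rho> \<sigma>) (B \<rho> \<sigma>) (C \<rho> \<sigma>) (D \<rho> \<sigma>))"
  unfolding ltst_def by (intro CE_b CE_cel)
lemma CE_lat: "CE A \<Longrightarrow> CE B \<Longrightarrow> CE C \<Longrightarrow> CE (\<lambda>\<rho> \<sigma>. lat k c \<sigma> (A \<rho> \<sigma>) (B \<rho> \<sigma>) (C \<rho> \<sigma>))"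
  unfolding lat_def by (intro CE_b CE_cel CB_ltst)
lemma CE_lidx: "CE A \<Longrightarrow> CE B \<Longrightarrow> CE C \<Longrightarrow> CE (\<lambda>\<rho> \<sigma>. lidx k c \<sigma> (A \<rho> \<sigma>) (B \<rho> \<sigma>) (C \<rho> \<sigma>))"
  unfolding lidx_def by (intro CE_b CE_cel)
lemma CE_larea: "CE A \<Longrightarrow> CE B \<Longrightarrow> CE C \<Longrightarrow> CE (\<lambda>\<rho> \<sigma>. larea c (A \<rho> \<sigma>) (B \<rho> \<sigma>) (C \<rho> \<sigma>))"
  unfolding larea_def by (intro CE_b)
lemma CE_lsz: "CE A \<Longrightarrow> CE B \<Longrightarrow> CE C \<Longrightarrow> CE D \<Longrightarrow> CE (\<lambda>\<rho> \<sigma>. lsz (A \<rho> \<sigma>) (B \<rho> \<sigma>) (C \<rho> \<sigma>) (D \<rho> \<sigma>))"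
  unfolding lsz_def by (intro CE_b)
lemma CE_lit: "CE A \<Longrightarrow> CE B \<Longrightarrow> CE C \<Longrightarrow> CE (\<lambda>\<rho> \<sigma>. lit (A \<rho> \<sigma>) (B \<rho> \<sigma>) (C \<rho> \<sigma>))"
  unfolding lit_def by (intro CE_b)

text \<open>A level is computable relative to its items, so one proof covers levels of blocks and
  levels of groups.\<close>

locale ops_computable =
  fixes it :: iops
  assumes CE_ig: "\<And>A B C D E. CE A \<Longrightarrow> CE B \<Longrightarrow> CE C \<Longrightarrow> CE D \<Longrightarrow> CE E \<Longrightarrow>
      CE (\<lambda>\<rho> \<sigma>. ig it \<sigma> (A \<rho> \<sigma>) (B \<rho> \<sigma>) (C \<rho> \<sigma>) (D \<rho> \<sigma>) (E \<rho> \<sigma>))"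
    and CE_ifi: "\<And>A B C D E. CE A \<Longrightarrow> CE B \<Longrightarrow> CE C \<Longrightarrow> CE D \<Longrightarrow> CE E \<Longrightarrow>
      CE (\<lambda>\<rho> \<sigma>. ifi it \<sigma> (A \<rho> \<sigma>) (B \<rho> \<sigma>) (C \<rho> \<sigma>) (D \<rho> \<sigma>) (E \<rho> \<sigma>))"
    and CE_ine: "\<And>A B C D E F. CE A \<Longrightarrow> CE B \<Longrightarrow> CE C \<Longrightarrow> CE D \<Longrightarrow> CE E \<Longrightarrow> CE F \<Longrightarrow>
      CE (\<lambda>\<rho> \<sigma>. ine it \<sigma> (A \<rho> \<sigma>) (B \<rho> \<sigma>) (C \<rho> \<sigma>) (D \<rho> \<sigma>) (E \<rho> \<sigma>) (F \<rho> \<sigma>))"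
    and CM_ise: "\<And>A B C D E F. CE A \<Longrightarrow> CE B \<Longrightarrow> CE C \<Longrightarrow> CE D \<Longrightarrow> CE E \<Longrightarrow> CE F \<Longrightarrow>
      CM (\<lambda>\<rho> \<sigma>. ise it \<sigma> (A \<rho> \<sigma>) (B \<rho> \<sigma>) (C \<rho> \<sigma>) (D \<rho> \<sigma>) (E \<rho> \<sigma>) (F \<rho> \<sigma>))"
    and CM_iin: "\<And>A B C D. CE A \<Longrightarrow> CE B \<Longrightarrow> CE C \<Longrightarrow> CE D \<Longrightarrow>
      CM (\<lambda>\<rho> \<sigma>. iin it \<sigma> (A \<rho> \<sigma>) (B \<rho> \<sigma>) (C \<rho> \<sigma>) (D \<rho> \<sigma>))"

lemma ops_computable_bops: "ops_computable (bops P)"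
  by unfold_locales
    (simp_all only: bops_def iops.select_convs bfirst_def bnext_def bset_def bini_def Let_def,
      (intro CE_bget CE_bfind CE_b CM_wr CE_baddr CE_blen CE_bval CE_cpow CE_geo; assumption)+)

context ops_computable
begin

lemmas CE_l = CE_b CE_cel CB_ltst CE_lat CE_lidx CE_larea CE_lsz CE_lit CE_ig CE_ifi CE_ine

lemma CE_ufrom: "CE A \<Longrightarrow> CE B \<Longrightarrow> CE C \<Longrightarrow> CE D \<Longrightarrow> CE E \<Longrightarrow> CE F \<Longrightarrow>
    CE (\<lambda>\<rho> \<sigma>. ufrom k c d \<sigma> (A \<rho> \<sigma>) (B \<rho> \<sigma>) (C \<rho> \<sigma>) (D \<rho> \<sigma>) (E \<rho> \<sigma>) (F \<rho> \<sigma>))"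
  unfolding ufrom_def by (intro CE_l)
lemma CE_lfrom: "CE A \<Longrightarrow> CE B \<Longrightarrow> CE C \<Longrightarrow> CE D \<Longrightarrow> CE E \<Longrightarrow> CE F \<Longrightarrow> CE G \<Longrightarrow>
    CE (\<lambda>\<rho> \<sigma>. lfrom k c d it \<sigma> (A \<rho> \<sigma>) (B \<rho> \<sigma>) (C \<rho> \<sigma>) (D \<rho> \<sigma>) (E \<rho> \<sigma>) (F \<rho> \<sigma>) (G \<rho> \<sigma>))"
  unfolding lfrom_def by (intro CE_l CE_ufrom)
lemma CE_lv_first: "CE A \<Longrightarrow> CE B \<Longrightarrow> CE C \<Longrightarrow> CE D \<Longrightarrow> CE E \<Longrightarrow> CE F \<Longrightarrow>
    CE (\<lambda>\<rho> \<sigma>. lv_first k c d it \<sigma> (A \<rho> \<sigma>) (B \<rho> \<sigma>) (C \<rho> \<sigma>) (D \<rho> \<sigma>) (E \<rho> \<sigma>) (F \<rho> \<sigma>))"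
  unfolding lv_first_def by (intro CE_lfrom CE_const)
lemma CE_lv_get: "CE A \<Longrightarrow> CE B \<Longrightarrow> CE C \<Longrightarrow> CE D \<Longrightarrow> CE E \<Longrightarrow> CE F \<Longrightarrow>
    CE (\<lambda>\<rho> \<sigma>. lv_get k c d it \<sigma> (A \<rho> \<sigma>) (B \<rho> \<sigma>) (C \<rho> \<sigma>) (D \<rho> \<sigma>) (E \<rho> \<sigma>) (F \<rho> \<sigma>))"
  unfolding lv_get_def by (intro CE_l)
lemma CE_lv_next: "CE A \<Longrightarrow> CE B \<Longrightarrow> CE C \<Longrightarrow> CE D \<Longrightarrow> CE E \<Longrightarrow> CE F \<Longrightarrow> CE G \<Longrightarrow>
    CE (\<lambda>\<rho> \<sigma>. lv_next k c d it \<sigma> (A \<rho> \<sigma>) (B \<rho> \<sigma>) (C \<rho> \<sigma>) (D \<rho> \<sigma>) (E \<rho> \<sigma>) (F \<rho> \<sigma>) (G \<rho> \<sigma>))"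
  unfolding lv_next_def by (intro CE_l CE_lfrom CE_ufrom)

lemma CM_lv_touch: "CM (\<lambda>\<rho> \<sigma>. lv_touch k c it \<sigma> (\<rho> i1) (\<rho> i2) (\<rho> i3) (\<rho> i4) (\<rho> i5) (\<rho> i6))"
  unfolding lv_touch_def
  by (intro CM_if CM_id CM_nat_let CM_state_let CM_wce CM_iin CE_l)
lemma CM_lv_fix: "CM (\<lambda>\<rho> \<sigma>. lv_fix k c it \<sigma> (\<rho> i1) (\<rho> i2) (\<rho> i3) (\<rho> i4) (\<rho> i5) (\<rho> i6) a)"
  unfolding lv_fix_def
  by (intro CM_if CM_id CM_nat_let CM_state_let CM_wce CE_l)
lemma CM_lv_fixes: "CM (\<lambda>\<rho> \<sigma>. lv_fixes k c it \<sigma> (\<rho> i1) (\<rho> i2) (\<rho> i3) (\<rho> i4) (\<rho> i5) (\<rho> i6) n)"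
proof (induction n)
  case 0
  show ?case by (simp add: CM_id)
next
  case (Suc n)
  show ?case unfolding lv_fixes.simps by (rule CM_state_let[OF Suc CM_lv_fix])
qed
lemma CM_lv_set: "CE A \<Longrightarrow> CE B \<Longrightarrow> CE C \<Longrightarrow> CE D \<Longrightarrow> CE E \<Longrightarrow> CE F \<Longrightarrow> CE G \<Longrightarrow>
    CM (\<lambda>\<rho> \<sigma>. lv_set k c it \<sigma> (A \<rho> \<sigma>) (B \<rho> \<sigma>) (C \<rho> \<sigma>) (D \<rho> \<sigma>) (E \<rho> \<sigma>) (F \<rho> \<sigma>) (G \<rho> \<sigma>))"
proof (rule CM_bind7)
  show "CM (\<lambda>\<rho> \<sigma>. lv_set k c it \<sigma> (\<rho> i1) (\<rho> i2) (\<rho> i3) (\<rho> i4) (\<rho> i5) (\<rho> i6) (\<rho> i7))" for i1 i2 i3 i4 i5 i6 i7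
    unfolding lv_set_def by (intro CM_nat_let CM_state_let CM_lv_touch CM_ise CM_lv_fixes CE_l)
qed
end

lemma CM_lv_zero': "CM (\<lambda>\<rho> \<sigma>. lv_zero k c \<sigma> (\<rho> i1) (\<rho> i2) n)"
proof (induction n)
  case 0
  show ?case by (simp add: CM_id)
next
  case (Suc n)
  show ?case unfolding lv_zero.simps
    by (rule CM_state_let[OF Suc]) (unfold wce_def cad_def, intro CM_wr CE_b)
qed

lemma CM_lv_zero: "CE A \<Longrightarrow> CE B \<Longrightarrow> CM (\<lambda>\<rho> \<sigma>. lv_zero k c \<sigma> (A \<rho> \<sigma>) (B \<rho> \<sigma>) n)"
  by (rule CM_let2[where G = "\<lambda>a b \<sigma>. lv_zero k c \<sigma> a b n"]) (assumption | rule CM_lv_zero')+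

lemma CE_zz: "CE (\<lambda>\<rho> \<sigma>. zz \<sigma>)" unfolding zz_def by (intro CE_b)
lemma CB_tiny: "CB (\<lambda>\<rho> \<sigma>. tiny P \<sigma>)" unfolding tiny_def by (intro CE_b CE_zz)
lemma CB_rdy: "CE B \<Longrightarrow> CB (\<lambda>\<rho> \<sigma>. rdy P \<sigma> (B \<rho> \<sigma>))"
  unfolding rdy_def by (intro CE_b CE_zz CE_pow CB_tiny)
lemma CE_elen: "CE (\<lambda>\<rho> \<sigma>. elen P \<sigma>)" unfolding elen_def by (intro CE_b CE_zz CB_tiny)
lemma CB_small: "CB (\<lambda>\<rho> \<sigma>. small P \<sigma>)" unfolding small_def by (intro CE_b CB_tiny)
lemma CE_nblk: "CE A \<Longrightarrow> CE B \<Longrightarrow> CE (\<lambda>\<rho> \<sigma>. nblk (A \<rho> \<sigma>) (B \<rho> \<sigma>))" unfolding nblk_def by (intro CE_b)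
lemma CE_gE: "CE A \<Longrightarrow> CE B \<Longrightarrow> CE (\<lambda>\<rho> \<sigma>. gE \<sigma> (A \<rho> \<sigma>) (B \<rho> \<sigma>))" unfolding gE_def by (intro CE_b)
lemma CE_ew: "CE A \<Longrightarrow> CE B \<Longrightarrow> CE (\<lambda>\<rho> \<sigma>. ew (A \<rho> \<sigma>) (B \<rho> \<sigma>))" unfolding ew_def by (intro CE_b)
lemma CE_gF: "CE A \<Longrightarrow> CE B \<Longrightarrow> CE C \<Longrightarrow> CE D \<Longrightarrow>
    CE (\<lambda>\<rho> \<sigma>. gF P \<sigma> (A \<rho> \<sigma>) (B \<rho> \<sigma>) (C \<rho> \<sigma>) (D \<rho> \<sigma>))"
  unfolding gF_def flen_def by (intro CE_b CB_small CE_ew CE_larea CE_nblk CE_blen)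
lemma CE_gX: "CE A \<Longrightarrow> CE B \<Longrightarrow> CE (\<lambda>\<rho> \<sigma>. gX P \<sigma> (A \<rho> \<sigma>) (B \<rho> \<sigma>))"
  unfolding gX_def by (intro CE_b CE_gE CE_elen)
lemma CM_ewr: "CE A \<Longrightarrow> CE B \<Longrightarrow> CE C \<Longrightarrow> CE D \<Longrightarrow> CE E \<Longrightarrow> CE F \<Longrightarrow> CE G \<Longrightarrow> CE H \<Longrightarrow>
    CM (\<lambda>\<rho> \<sigma>. ewr P \<sigma> (A \<rho> \<sigma>) (B \<rho> \<sigma>) (C \<rho> \<sigma>) (D \<rho> \<sigma>) (E \<rho> \<sigma>) (F \<rho> \<sigma>) (G \<rho> \<sigma>) (H \<rho> \<sigma>))"
  unfolding ewr_def enc_def by (intro CM_wr CE_b CE_gE CE_ew)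

lemma CE_hb: "CE X \<Longrightarrow> CE (\<lambda>\<rho> \<sigma>. hb (X \<rho> \<sigma>))" unfolding hb_def hY_def by (intro CE_b CE_lowbit)
lemma CE_hm: "CE X \<Longrightarrow> CE (\<lambda>\<rho> \<sigma>. hm (X \<rho> \<sigma>))" unfolding hm_def hY_def by (intro CE_b CE_lowbit)
lemma CE_ha: "CE X \<Longrightarrow> CE (\<lambda>\<rho> \<sigma>. ha (X \<rho> \<sigma>))" unfolding ha_def hY_def by (intro CE_b CE_lowbit)
lemma CE_hZ: "CE X \<Longrightarrow> CE (\<lambda>\<rho> \<sigma>. hZ (X \<rho> \<sigma>))" unfolding hZ_def hY_def by (intro CE_b CE_lowbit)
lemma CE_hI: "CE X \<Longrightarrow> CE (\<lambda>\<rho> \<sigma>. hI (pw k \<sigma>) (X \<rho> \<sigma>))" unfolding hI_def by (intro CE_b CE_hb CE_hm CE_hZ)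
lemma CE_hD: "CE X \<Longrightarrow> CE (\<lambda>\<rho> \<sigma>. hD (pw k \<sigma>) (X \<rho> \<sigma>))" unfolding hD_def by (intro CE_b CE_hb CE_hm CE_hZ)
lemma CE_hC: "CE X \<Longrightarrow> CE (\<lambda>\<rho> \<sigma>. hC (pw k \<sigma>) (X \<rho> \<sigma>))" unfolding hC_def by (intro CE_b CE_hb CE_hm CE_hZ)
lemma CE_hfind: "CE X \<Longrightarrow> CE A \<Longrightarrow> CE B \<Longrightarrow> CE C \<Longrightarrow> CE (\<lambda>\<rho> \<sigma>. hfind (pw k \<sigma>) (X \<rho> \<sigma>) (A \<rho> \<sigma>) (B \<rho> \<sigma>) (C \<rho> \<sigma>))"
  unfolding hfind_def by (intro CE_pfind CE_hb CE_hm)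
lemma CE_hcell: "CE X \<Longrightarrow> CE A \<Longrightarrow> CE B \<Longrightarrow> CE (\<lambda>\<rho> \<sigma>. hcell (pw k \<sigma>) (X \<rho> \<sigma>) (A \<rho> \<sigma>) (B \<rho> \<sigma>))"
  unfolding hcell_def by (intro CE_b CE_hb)
lemmas CE_h = CE_b CE_hb CE_hm CE_ha CE_hI CE_hD CE_hC CE_hfind CE_hcell
lemma CE_hat: "CE X \<Longrightarrow> CE A \<Longrightarrow> CE (\<lambda>\<rho> \<sigma>. hat (pw k \<sigma>) (X \<rho> \<sigma>) (A \<rho> \<sigma>))"
  unfolding hat_def by (intro CE_h)
lemma CE_hidx: "CE X \<Longrightarrow> CE A \<Longrightarrow> CE (\<lambda>\<rho> \<sigma>. hidx (pw k \<sigma>) (X \<rho> \<sigma>) (A \<rho> \<sigma>))"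
  unfolding hidx_def by (intro CE_h)
lemma CE_hput: "CE X \<Longrightarrow> CE A \<Longrightarrow> CE B \<Longrightarrow> CE C \<Longrightarrow> CE (\<lambda>\<rho> \<sigma>. hput (pw k \<sigma>) (X \<rho> \<sigma>) (A \<rho> \<sigma>) (B \<rho> \<sigma>) (C \<rho> \<sigma>))"
  unfolding hput_def by (intro CE_h)

lemma CE_fget: "CE A \<Longrightarrow> CE B \<Longrightarrow> CE C \<Longrightarrow> CE D \<Longrightarrow> CE E \<Longrightarrow> CE F \<Longrightarrow>
    CE (\<lambda>\<rho> \<sigma>. fget P \<sigma> (A \<rho> \<sigma>) (B \<rho> \<sigma>) (C \<rho> \<sigma>) (D \<rho> \<sigma>) (E \<rho> \<sigma>) (F \<rho> \<sigma>))"
  unfolding fget_def by (intro ops_computable.CE_lv_get[OF ops_computable_bops] CE_b CE_gF CE_nblk)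
lemma CE_ffirst: "CE A \<Longrightarrow> CE B \<Longrightarrow> CE C \<Longrightarrow> CE D \<Longrightarrow> CE E \<Longrightarrow> CE F \<Longrightarrow>
    CE (\<lambda>\<rho> \<sigma>. ffirst P \<sigma> (A \<rho> \<sigma>) (B \<rho> \<sigma>) (C \<rho> \<sigma>) (D \<rho> \<sigma>) (E \<rho> \<sigma>) (F \<rho> \<sigma>))"
  unfolding ffirst_def by (intro ops_computable.CE_lv_first[OF ops_computable_bops] CE_b CE_gF CE_nblk)
lemma CE_fnext: "CE A \<Longrightarrow> CE B \<Longrightarrow> CE C \<Longrightarrow> CE D \<Longrightarrow> CE E \<Longrightarrow> CE F \<Longrightarrow> CE G \<Longrightarrow>
    CE (\<lambda>\<rho> \<sigma>. fnext P \<sigma> (A \<rho> \<sigma>) (B \<rho> \<sigma>) (C \<rho> \<sigma>) (D \<rho> \<sigma>) (E \<rho> \<sigma>) (F \<rho> \<sigma>) (G \<rho> \<sigma>))"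
  unfolding fnext_def by (intro ops_computable.CE_lv_next[OF ops_computable_bops] CE_b CE_gF CE_nblk)
lemma CM_fset: "CE A \<Longrightarrow> CE B \<Longrightarrow> CE C \<Longrightarrow> CE D \<Longrightarrow> CE E \<Longrightarrow> CE F \<Longrightarrow> CE G \<Longrightarrow>
    CM (\<lambda>\<rho> \<sigma>. fset P \<sigma> (A \<rho> \<sigma>) (B \<rho> \<sigma>) (C \<rho> \<sigma>) (D \<rho> \<sigma>) (E \<rho> \<sigma>) (F \<rho> \<sigma>) (G \<rho> \<sigma>))"
  unfolding fset_def by (intro ops_computable.CM_lv_set[OF ops_computable_bops] CE_b CE_gF CE_nblk)
lemma CM_fini: "CE A \<Longrightarrow> CE B \<Longrightarrow> CE C \<Longrightarrow> CE D \<Longrightarrow>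
    CM (\<lambda>\<rho> \<sigma>. fini P \<sigma> (A \<rho> \<sigma>) (B \<rho> \<sigma>) (C \<rho> \<sigma>) (D \<rho> \<sigma>))"
  unfolding fini_def by (intro CM_lv_zero CE_gF)

lemmas CE_g = CE_h CE_hat CE_hidx CE_hput CE_fget CE_ffirst CE_fnext CB_rdy CB_tiny CE_gX

lemma CE_gtail: "CE A \<Longrightarrow> CE B \<Longrightarrow> CE C \<Longrightarrow> CE D \<Longrightarrow> CE E \<Longrightarrow>
    CE (\<lambda>\<rho> \<sigma>. gtail P \<sigma> (A \<rho> \<sigma>) (B \<rho> \<sigma>) (C \<rho> \<sigma>) (D \<rho> \<sigma>) (E \<rho> \<sigma>))"
  unfolding gtail_def by (intro CE_g)
lemma CE_gfrom: "CE A \<Longrightarrow> CE B \<Longrightarrow> CE C \<Longrightarrow> CE D \<Longrightarrow> CE E \<Longrightarrow> CE F \<Longrightarrow>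
    CE (\<lambda>\<rho> \<sigma>. gfrom P \<sigma> (A \<rho> \<sigma>) (B \<rho> \<sigma>) (C \<rho> \<sigma>) (D \<rho> \<sigma>) (E \<rho> \<sigma>) (F \<rho> \<sigma>))"
  unfolding gfrom_def by (intro CE_g CE_gtail)
lemma CE_gfirst: "CE A \<Longrightarrow> CE B \<Longrightarrow> CE C \<Longrightarrow> CE D \<Longrightarrow> CE E \<Longrightarrow>
    CE (\<lambda>\<rho> \<sigma>. gfirst P \<sigma> (A \<rho> \<sigma>) (B \<rho> \<sigma>) (C \<rho> \<sigma>) (D \<rho> \<sigma>) (E \<rho> \<sigma>))"
  unfolding gfirst_def by (intro CE_g CE_gfrom)
lemma CE_gget: "CE A \<Longrightarrow> CE B \<Longrightarrow> CE C \<Longrightarrow> CE D \<Longrightarrow> CE E \<Longrightarrow>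
    CE (\<lambda>\<rho> \<sigma>. gget P \<sigma> (A \<rho> \<sigma>) (B \<rho> \<sigma>) (C \<rho> \<sigma>) (D \<rho> \<sigma>) (E \<rho> \<sigma>))"
  unfolding gget_def gget'_def by (intro CE_g)
lemma CE_gnext: "CE A \<Longrightarrow> CE B \<Longrightarrow> CE C \<Longrightarrow> CE D \<Longrightarrow> CE E \<Longrightarrow> CE F \<Longrightarrow>
    CE (\<lambda>\<rho> \<sigma>. gnext P \<sigma> (A \<rho> \<sigma>) (B \<rho> \<sigma>) (C \<rho> \<sigma>) (D \<rho> \<sigma>) (E \<rho> \<sigma>) (F \<rho> \<sigma>))"
  unfolding gnext_def gnext'_def by (intro CE_g CE_gfrom)
lemma CE_gD: "CE X \<Longrightarrow> CE A \<Longrightarrow> CE B \<Longrightarrow> CE (\<lambda>\<rho> \<sigma>. gD (pw k \<sigma>) (X \<rho> \<sigma>) (A \<rho> \<sigma>) (B \<rho> \<sigma>))"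
  unfolding gD_def Let_def by (intro CE_g)
lemma CE_gb': "CE X \<Longrightarrow> CE (\<lambda>\<rho> \<sigma>. gb' P \<sigma> (X \<rho> \<sigma>))" unfolding gb'_def by (intro CE_g)
lemma CE_grp: "CE X \<Longrightarrow> CE A \<Longrightarrow> CE (\<lambda>\<rho> \<sigma>. grp P \<sigma> (X \<rho> \<sigma>) (A \<rho> \<sigma>))"
  unfolding grp_def by (intro CE_g CE_gb')
lemma CM_gappend: "CM (\<lambda>\<rho> \<sigma>. gappend P \<sigma> (\<rho> i1) (\<rho> i2) (\<rho> i3) (\<rho> i4) (\<rho> i5) (\<rho> i6))"
  unfolding gappend_def
  by (intro CM_nat_let CM_state_let CM_if CM_id CM_fini CM_ewr CE_g CE_gD CE_gb' CE_grp)
lemma CM_gset: "CE A \<Longrightarrow> CE B \<Longrightarrow> CE C \<Longrightarrow> CE D \<Longrightarrow> CE E \<Longrightarrow> CE F \<Longrightarrow>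
    CM (\<lambda>\<rho> \<sigma>. gset P \<sigma> (A \<rho> \<sigma>) (B \<rho> \<sigma>) (C \<rho> \<sigma>) (D \<rho> \<sigma>) (E \<rho> \<sigma>) (F \<rho> \<sigma>))"
proof (rule CM_bind7[where G = "\<lambda>\<sigma> a b c d e f g. gset P \<sigma> a b c d e f", OF _ _ _ _ _ _ CE_const[of 0]])
  show "CM (\<lambda>\<rho> \<sigma>. gset P \<sigma> (\<rho> i1) (\<rho> i2) (\<rho> i3) (\<rho> i4) (\<rho> i5) (\<rho> i6))" for i1 i2 i3 i4 i5 i6
    unfolding gset_def
    by (intro CM_nat_let CM_if CM_id CM_fset CM_ewr CM_gappend CE_g)
qed
lemma CM_gini: "CE A \<Longrightarrow> CE B \<Longrightarrow> CE C \<Longrightarrow> CE D \<Longrightarrow>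
    CM (\<lambda>\<rho> \<sigma>. gini P \<sigma> (A \<rho> \<sigma>) (B \<rho> \<sigma>) (C \<rho> \<sigma>) (D \<rho> \<sigma>))"
  unfolding gini_def gb0_def by (intro CM_ewr CE_g CE_zz)
lemma CE_gav: "CE A \<Longrightarrow> CE B \<Longrightarrow> CE (\<lambda>\<rho> \<sigma>. gav P \<sigma> (A \<rho> \<sigma>) (B \<rho> \<sigma>))"
  unfolding gav_def by (intro CE_g)
lemma CM_gsetav: "CE A \<Longrightarrow> CE B \<Longrightarrow> CE C \<Longrightarrow> CM (\<lambda>\<rho> \<sigma>. gsetav P \<sigma> (A \<rho> \<sigma>) (B \<rho> \<sigma>) (C \<rho> \<sigma>))"
  unfolding gsetav_def Let_def by (intro CM_ewr CE_g)

definition gops :: "par \<Rightarrow> iops" where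
  "gops P = \<lparr>ig = gget P, ifi = gfirst P, ine = gnext P, ise = gset P, iin = gini P\<rparr>"

lemma ops_computable_gops: "ops_computable (gops P)"
  by unfold_locales
    (simp_all only: gops_def iops.select_convs CE_gget CE_gfirst CE_gnext CM_gset CM_gini)

section \<open>Collections with a missing element\<close>

text \<open>
  Element \<open>i\<close> of the universe \<open>{1..univ}\<close> is the argument \<open>i - 1\<close> of a map to colours. It is missing
  from the partition if it is the number \<open>cav\<close>, which is 0 if there is no such element.
\<close>

record cops =
  cget :: "state \<Rightarrow> nat \<Rightarrow> nat"
  cfirst :: "state \<Rightarrow> nat \<Rightarrow> nat"
  cnext :: "state \<Rightarrow> nat \<Rightarrow> nat \<Rightarrow> nat"
  cset :: "state \<Rightarrow> nat \<Rightarrow> nat \<Rightarrow> state"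
  cini :: "state \<Rightarrow> state"
  cav :: "state \<Rightarrow> nat"
  csetav :: "state \<Rightarrow> nat \<Rightarrow> state"

locale cops_computable =
  fixes t :: cops
  assumes CE_cget: "\<And>A. CE A \<Longrightarrow> CE (\<lambda>\<rho> \<sigma>. cget t \<sigma> (A \<rho> \<sigma>))"
    and CE_cfirst: "\<And>A. CE A \<Longrightarrow> CE (\<lambda>\<rho> \<sigma>. cfirst t \<sigma> (A \<rho> \<sigma>))"
    and CE_cnext: "\<And>A B. CE A \<Longrightarrow> CE B \<Longrightarrow> CE (\<lambda>\<rho> \<sigma>. cnext t \<sigma> (A \<rho> \<sigma>) (B \<rho> \<sigma>))"
    and CM_cset: "\<And>A B. CE A \<Longrightarrow> CE B \<Longrightarrow> CM (\<lambda>\<rho> \<sigma>. cset t \<sigma> (A \<rho> \<sigma>) (B \<rho> \<sigma>))"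
    and CM_cini: "CM (\<lambda>\<rho> \<sigma>. cini t \<sigma>)"
    and CE_cav: "CE (\<lambda>\<rho> \<sigma>. cav t \<sigma>)"
    and CM_csetav: "\<And>A. CE A \<Longrightarrow> CM (\<lambda>\<rho> \<sigma>. csetav t \<sigma> (A \<rho> \<sigma>))"

locale collection =
  fixes c d :: nat and \<sigma>0 :: state and t :: cops and R :: "state \<Rightarrow> (nat \<Rightarrow> nat) \<Rightarrow> nat \<Rightarrow> bool"
  assumes get: "\<And>\<sigma> f v x. same \<sigma>0 \<sigma> \<Longrightarrow> R \<sigma> f v \<Longrightarrow> x < univ \<sigma>0 \<Longrightarrow> cget t \<sigma> x = f x \<and> f x < c"
    and av: "\<And>\<sigma> f v. same \<sigma>0 \<sigma> \<Longrightarrow> R \<sigma> f v \<Longrightarrow> cav t \<sigma> = v \<and> v \<le> univ \<sigma>0"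
    and enum: "\<And>\<sigma> f v j. same \<sigma>0 \<sigma> \<Longrightarrow> R \<sigma> f v \<Longrightarrow> j < c \<Longrightarrow>
      \<exists>xs. distinct xs \<and> set xs = {x. x < univ \<sigma>0 \<and> f x = j} \<and> lnk (cnext t \<sigma> j) (cfirst t \<sigma> j) xs 0"
    and set': "\<And>\<sigma> f v x j. same \<sigma>0 \<sigma> \<Longrightarrow> R \<sigma> f v \<Longrightarrow> x < univ \<sigma>0 \<Longrightarrow> j < c \<Longrightarrow>
      R (cset t \<sigma> x j) (f(x := j)) v \<and> same \<sigma> (cset t \<sigma> x j)"
    and setav: "\<And>\<sigma> f v v'. same \<sigma>0 \<sigma> \<Longrightarrow> R \<sigma> f v \<Longrightarrow> v' \<le> univ \<sigma>0 \<Longrightarrow>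
      R (csetav t \<sigma> v') f v' \<and> same \<sigma> (csetav t \<sigma> v')"
    and ini: "\<And>\<sigma>. same \<sigma>0 \<sigma> \<Longrightarrow> R (cini t \<sigma>) (\<lambda>_. d) 0 \<and> same \<sigma> (cini t \<sigma>)"

definition state_of :: "nat \<Rightarrow> nat \<Rightarrow> nat \<Rightarrow> memory \<Rightarrow> state" where
  "state_of s w n m = \<lparr>lim = s, wid = w, univ = n, store = m\<rparr>"

definition sets_of :: "nat \<Rightarrow> (nat \<Rightarrow> nat) \<Rightarrow> nat \<Rightarrow> nat \<Rightarrow> nat set" where
  "sets_of n f v j = {i \<in> {1..n}. f (i - 1) = j \<and> i \<noteq> v}"

lemma sets_of_insert:
  assumes "\<And>k. k < c \<Longrightarrow> S k = sets_of n f v k" "i \<in> {1..n}" "k < c"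
  shows "insert_elem j i S k = sets_of n (f(i - 1 := j)) (if v = i then 0 else v) k"
  unfolding insert_elem_def sets_of_def assms(1)[OF assms(3)] using assms(2) by auto

text \<open>One number suffices to record the missing element: if another one were missing already,
  the deletion would leave two of them, against \<open>p\<close>.\<close>

lemma sets_of_delete:
  assumes S: "\<And>k. k < c \<Longrightarrow> S k = sets_of n f v k" and i: "i \<in> {1..n}" and j: "j < c" and k: "k < c"
    and p: "partition_up_to_one n c (delete_elem j i S)" and v: "v \<le> n"
  shows "delete_elem j i S k = sets_of n f (if f (i - 1) = j \<and> v \<noteq> i then i else v) k"
proof (cases "f (i - 1) = j \<and> v \<noteq> i")
  case True
  have "v = 0"
  proof (rule ccontr)
    assume "v \<noteq> 0"
    let ?M = "{1..n} - (\<Union>k<c. delete_elem j i S k)"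
    have "delete_elem j i S k \<subseteq> sets_of n f v k - {i}" if "k < c" for k
      using S[OF that] True unfolding delete_elem_def sets_of_def by auto
    then have "i \<notin> (\<Union>k<c. delete_elem j i S k)" "v \<notin> (\<Union>k<c. delete_elem j i S k)"
      unfolding sets_of_def by blast+
    then have "{i, v} \<subseteq> ?M" using i v \<open>v \<noteq> 0\<close> by auto
    then have "card {i, v} \<le> card ?M" by (intro card_mono) auto
    moreover have "card {i, v} = 2" using True by auto
    ultimately show False using p unfolding partition_up_to_one_def by simp
  qed
  then have v': "(if f (i - 1) = j \<and> v \<noteq> i then i else v) = i" "\<And>x. x \<in> {1..n} \<Longrightarrow> x \<noteq> v" using True by auto
  show ?thesis
  proof (cases "k = j")
    case kj: True
    show ?thesis unfolding v' kj delete_elem_def fun_upd_same S[OF j] sets_of_def using v'(2) by blast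
  next
    case False
    then have "delete_elem j i S k = sets_of n f v k" using S[OF k] by (simp add: delete_elem_def)
    moreover have "x \<noteq> i" if "f (x - 1) = k" for x using that True False by blast
    ultimately show ?thesis unfolding v' sets_of_def using v'(2) by blast
  qed
next
  case False
  then have "i \<notin> sets_of n f v j" "(if f (i - 1) = j \<and> v \<noteq> i then i else v) = v"
    unfolding sets_of_def by (auto split: if_splits)
  then show ?thesis using S[OF k] S[OF j] by (cases "k = j") (simp_all add: delete_elem_def)
qed

text \<open>The missing element keeps its colour, so it may cost one fruitless step of an
  enumeration.\<close>

lemma lnk_sets_of:
  assumes "distinct xs" "set xs = {x. x < n \<and> f x = j}"
  shows "set (map Suc (filter (\<lambda>x. Suc x \<noteq> v) xs)) = sets_of n f v j"
    "length xs \<le> card (sets_of n f v j) + 1"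
proof -
  show *: "set (map Suc (filter (\<lambda>x. Suc x \<noteq> v) xs)) = sets_of n f v j"
  proof (intro equalityI subsetI)
    fix i assume "i \<in> sets_of n f v j"
    then have "i - 1 < n" "f (i - 1) = j" "Suc (i - 1) = i" "i \<noteq> v" unfolding sets_of_def by auto
    then have "i - 1 \<in> set (filter (\<lambda>x. Suc x \<noteq> v) xs)" using assms(2) by simp
    then have "Suc (i - 1) \<in> set (map Suc (filter (\<lambda>x. Suc x \<noteq> v) xs))" unfolding set_map by (rule imageI)
    then show "i \<in> set (map Suc (filter (\<lambda>x. Suc x \<noteq> v) xs))" unfolding \<open>Suc (i - 1) = i\<close> .
  next
    fix i assume "i \<in> set (map Suc (filter (\<lambda>x. Suc x \<noteq> v) xs))"
    then obtain x where x: "i = Suc x" "x \<in> set xs" "Suc x \<noteq> v" unfolding set_map set_filter by blast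
    then show "i \<in> sets_of n f v j" using assms(2) unfolding sets_of_def by simp
  qed
  have fin: "finite (sets_of n f v j)" by (simp add: sets_of_def)
  have "length xs = card (Suc ` set xs)" using assms(1) by (simp add: card_image distinct_card)
  also have "Suc ` set xs \<subseteq> insert v (sets_of n f v j)" unfolding *[symmetric] by auto
  then have "card (Suc ` set xs) \<le> card (insert v (sets_of n f v j))" by (rule card_mono[rotated]) (simp add: fin)
  also have "\<dots> \<le> card (sets_of n f v j) + 1" by (simp add: card_insert_if fin)
  finally show "length xs \<le> card (sets_of n f v j) + 1" .
qed

lemma halts_within_mono: "halts_within s w L P args m t f \<Longrightarrow> t \<le> t' \<Longrightarrow> halts_within s w L P args m t' f"
  unfolding halts_within_def using le_trans by blast

definition cinsert where
  "cinsert t i j \<sigma> = (let \<sigma>' = cset t \<sigma> (i - 1) j in if cav t \<sigma>' = i then csetav t \<sigma>' 0 else \<sigma>')"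
definition cdelete where
  "cdelete t i j \<sigma> = (if cget t \<sigma> (i - 1) = j \<and> cav t \<sigma> \<noteq> i then csetav t \<sigma> i else \<sigma>)"
definition csearch where
  "csearch t i j \<sigma> = (if cget t \<sigma> (i - 1) = j \<and> cav t \<sigma> \<noteq> i then 1 else 0 :: nat)"
text \<open>At most one element is missing, so at most one has to be skipped.\<close>

definition cfindany where
  "cfindany t j \<sigma> = (if cfirst t \<sigma> j = 0 \<or> cfirst t \<sigma> j \<noteq> cav t \<sigma> then cfirst t \<sigma> j
     else cnext t \<sigma> j (cfirst t \<sigma> j - 1))"

context cops_computable
begin

lemma CM_cinsert: "CM (\<lambda>\<rho> \<sigma>. cinsert t (\<rho> 0) (\<rho> 1) \<sigma>)"
  unfolding cinsert_def by (intro CM_state_let CM_if CM_id CM_cset CM_csetav CE_b CE_cav)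
lemma CM_cdelete: "CM (\<lambda>\<rho> \<sigma>. cdelete t (\<rho> 0) (\<rho> 1) \<sigma>)"
  unfolding cdelete_def by (intro CM_if CM_id CM_csetav CE_b CE_cav CE_cget)
lemma CE_csearch: "CE (\<lambda>\<rho> \<sigma>. csearch t (\<rho> 0) (\<rho> 1) \<sigma>)"
  unfolding csearch_def by (intro CE_b CE_cav CE_cget)
lemma CE_cfindany: "CE (\<lambda>\<rho> \<sigma>. cfindany t (\<rho> 0) \<sigma>)"
  unfolding cfindany_def by (intro CE_b CE_cav CE_cfirst CE_cnext)

end

text \<open>The programs are fixed before \<open>n\<close> and \<open>w\<close>; all they require is
  that the arguments fit into \<open>A\<close> words.\<close>

theorem maintains_collection_exists:
  assumes t: "cops_computable t"
    and A: "\<And>n w. 1 \<le> n \<Longrightarrow> 1 \<le> w \<Longrightarrow> Q n w \<Longrightarrow> n < 2 ^ (A * w) \<and> w < 2 ^ (A * w) \<and> c < 2 ^ (A * w)"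
    and col: "\<And>n w. 1 \<le> n \<Longrightarrow> 1 \<le> w \<Longrightarrow> Q n w \<Longrightarrow> \<exists>R. collection c d (state_of (s n) w n (\<lambda>_. False)) t R"
  shows "\<exists>D K T. \<forall>n\<ge>1. \<forall>w\<ge>1. Q n w \<longrightarrow> maintains_collection D K T (s n) w n c d"
proof -
  interpret cops_computable t by (rule t)
  have E: "2 \<le> (2::nat)" "2 \<le> (3::nat)" "2 \<le> (4::nat)" by simp_all
  obtain P1 K1 T1 where P1: "\<And>K s w args m. K1 \<le> K \<Longrightarrow> length args = 2 \<Longrightarrow> args_ok A args w \<Longrightarrow>
      \<exists>f. halts_within s w (K * w) P1 args m T1 f \<and> mem f = store (cini t (init_state s args m))"
    using CM_program[OF CM_cini E(1), of A] by blast
  obtain P2 K2 T2 where P2: "\<And>K s w args m. K2 \<le> K \<Longrightarrow> length args = 4 \<Longrightarrow> args_ok A args w \<Longrightarrow>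
      \<exists>f. halts_within s w (K * w) P2 args m T2 f \<and>
        mem f = store (cinsert t (args_env args 0) (args_env args 1) (init_state s args m))"
    using CM_program[OF CM_cinsert E(3), of A] by blast
  obtain P3 K3 T3 where P3: "\<And>K s w args m. K3 \<le> K \<Longrightarrow> length args = 4 \<Longrightarrow> args_ok A args w \<Longrightarrow>
      \<exists>f. halts_within s w (K * w) P3 args m T3 f \<and>
        mem f = store (cdelete t (args_env args 0) (args_env args 1) (init_state s args m))"
    using CM_program[OF CM_cdelete E(3), of A] by blast
  obtain P4 K4 T4 where P4: "\<And>K s w args m. K4 \<le> K \<Longrightarrow> length args = 4 \<Longrightarrow> args_ok A args w \<Longrightarrow>
      \<exists>f. halts_within s w (K * w) P4 args m T4 f \<and> mem f = m \<and>
        result f = csearch t (args_env args 0) (args_env args 1) (init_state s args m)"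
    using CE_program[OF CE_csearch E(3), of A] by blast
  obtain P5 K5 T5 where P5: "\<And>K s w args m. K5 \<le> K \<Longrightarrow> length args = 3 \<Longrightarrow> args_ok A args w \<Longrightarrow>
      \<exists>f. halts_within s w (K * w) P5 args m T5 f \<and> mem f = m \<and>
        result f = cfindany t (args_env args 0) (init_state s args m)"
    using CE_program[OF CE_cfindany E(2), of A] by blast
  have "CE (\<lambda>\<rho> \<sigma>. cfirst t \<sigma> (\<rho> 0))" "CB (\<lambda>\<rho> \<sigma>. \<rho> 0 \<noteq> cav t \<sigma>)" "CE (\<lambda>\<rho> \<sigma>. cnext t \<sigma> (\<rho> 1) (\<rho> 0 - 1))"
    by (intro CE_b CE_cav CE_cfirst CE_cnext)+
  note en = enum_program[OF this E(2), of A]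
  have "push x \<rho> 1 = \<rho> 0" for x \<rho> by (simp add: push_def)
  note en = en[unfolded push_simps this diff_Suc_1]
  then obtain P6 K6 T6 where P6: "\<And>K s w args m xs. K6 \<le> K \<Longrightarrow> length args = 3 \<Longrightarrow>
      args_ok A args w \<Longrightarrow> (\<forall>x\<in>set xs. Suc x < 2 ^ (A * w)) \<Longrightarrow>
      lnk (\<lambda>x. cnext t (init_state s args m) (args_env args 0) x)
        (cfirst t (init_state s args m) (args_env args 0)) xs 0 \<Longrightarrow>
      \<exists>f. halts_within s w (K * w) P6 args m (T6 * (length xs + 1)) f \<and> mem f = m \<and>
        emitted f = map Suc (filter (\<lambda>x. Suc x \<noteq> cav t (init_state s args m)) xs)"
    by blast
  define K where "K = K1 + K2 + K3 + K4 + K5 + K6"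
  \<comment> \<open>\<open>length xs + 1\<close> is at most \<open>card (S j) + 2\<close>, since the
    missing element may be visited, and hence at most twice \<open>card (S j) + 1\<close>.\<close>
  define T where "T = T1 + T2 + T3 + T4 + T5 + 2 * T6"
  let ?D = "\<lparr>init_prog = P1, insert_prog = P2, delete_prog = P3, search_prog = P4, findany_prog = P5, enum_prog = P6\<rparr>"
  have "maintains_collection ?D K T (s n) w n c d" if n: "1 \<le> n" and w: "1 \<le> w" and q: "Q n w" for n w
  proof -
    let ?s = "state_of (s n) w n"
    obtain R where "collection c d (?s (\<lambda>_. False)) t R" using col[OF n w q] by blast
    then interpret collection c d "?s (\<lambda>_. False)" t R .
    have sm: "same (?s (\<lambda>_. False)) (?s m)" for m by (simp add: same_def state_of_def)
    have u: "univ (?s (\<lambda>_. False)) = n" by (simp add: state_of_def)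
    have st: "\<sigma> = ?s (store \<sigma>)" if "same (?s m) \<sigma>" for \<sigma> :: state and m
      using that by (cases \<sigma>) (simp add: same_def state_of_def)
    \<comment> \<open>The colouring and the missing element are hidden, and only the sets with
      indices below \<open>c\<close> are constrained.\<close>
    define RM where "RM m S \<longleftrightarrow> (\<exists>f v. R (?s m) f v \<and> (\<forall>j<c. S j = sets_of n f v j))" for m S
    have RMI: "RM (store \<sigma>) S" if "R \<sigma> f v" "same (?s m) \<sigma>" "\<And>j. j < c \<Longrightarrow> S j = sets_of n f v j" for \<sigma> f v S m
      unfolding RM_def using that st[OF that(2)] by metis
    note A' = A[OF n w q]
    have ok4: "args_ok A [n, w, j, i] w" if "j < c" "i \<in> {1..n}" for j i
      using A' w that unfolding args_ok_def by auto
    have ok3: "args_ok A [n, w, j] w" if "j < c" for j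
      using A' w that unfolding args_ok_def by auto
    have ok2: "args_ok A [n, w] w" using A' w unfolding args_ok_def by auto
    have ist: "init_state (s n) (n # w # l) m = ?s m" for l m by (simp add: init_state_def state_of_def)
    have ae: "args_env [n, w, j, i] 0 = i" "args_env [n, w, j, i] 1 = j" "args_env [n, w, j] 0 = j" for j i
      by (simp_all add: args_env_def numeral_eq_Suc)
    have Ks: "K1 \<le> K" "K2 \<le> K" "K3 \<le> K" "K4 \<le> K" "K5 \<le> K" "K6 \<le> K" by (simp_all add: K_def)
    have Ts: "T1 \<le> T" "T2 \<le> T" "T3 \<le> T" "T4 \<le> T" "T5 \<le> T" by (simp_all add: T_def)
    have I: "\<exists>f. halts_within (s n) w (K * w) P1 [n, w] m T f \<and> RM (mem f) (\<lambda>j. if j = d then {1..n} else {})" for m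
    proof -
      obtain f where f: "halts_within (s n) w (K * w) P1 [n, w] m T1 f" "mem f = store (cini t (?s m))"
        using P1[OF Ks(1) _ ok2, of "s n" m] unfolding ist by auto
      have "RM (mem f) (\<lambda>j. if j = d then {1..n} else {})"
        unfolding f(2) by (rule RMI[of _ "\<lambda>_. d" 0 m]) (use ini[OF sm] in \<open>auto simp: sets_of_def\<close>)
      then show ?thesis using halts_within_mono[OF f(1) Ts(1)] by blast
    qed
    have O: "(\<exists>f. halts_within (s n) w (K * w) P2 [n, w, j, i] m T f \<and> RM (mem f) (insert_elem j i S)) \<and>
        (partition_up_to_one n c (delete_elem j i S) \<longrightarrow>
          (\<exists>f. halts_within (s n) w (K * w) P3 [n, w, j, i] m T f \<and> RM (mem f) (delete_elem j i S))) \<and>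
        (\<exists>f. halts_within (s n) w (K * w) P4 [n, w, j, i] m T f \<and> RM (mem f) S \<and>
          result f = (if i \<in> S j then 1 else 0))"
      if RM: "RM m S" and j: "j < c" and i: "i \<in> {1..n}" for m S i j
    proof -
      obtain f v where f: "R (?s m) f v" "\<And>j. j < c \<Longrightarrow> S j = sets_of n f v j" using RM unfolding RM_def by blast
      have i1: "i - 1 < univ (?s (\<lambda>_. False))" using i unfolding u by auto
      have v: "cav t (?s m) = v" "v \<le> n" using av[OF sm f(1)] unfolding u by auto
      have g: "cget t (?s m) (i - 1) = f (i - 1)" using get[OF sm f(1) i1] by simp
      have 1: "\<exists>h. halts_within (s n) w (K * w) P2 [n, w, j, i] m T h \<and> RM (mem h) (insert_elem j i S)"
      proof -
        obtain h where h: "halts_within (s n) w (K * w) P2 [n, w, j, i] m T2 h" "mem h = store (cinsert t i j (?s m))"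
          using P2[OF Ks(2) _ ok4[OF j i], of "s n" m] unfolding ist ae by auto
        let ?\<sigma> = "cset t (?s m) (i - 1) j"
        have r: "R ?\<sigma> (f(i - 1 := j)) v" "same (?s m) ?\<sigma>" using set'[OF sm f(1) i1 j] by auto
        have s': "same (?s (\<lambda>_. False)) ?\<sigma>" using r(2) sm same_trans by blast
        have av': "cav t ?\<sigma> = v" using av[OF s' r(1)] by simp
        have "R (cinsert t i j (?s m)) (f(i - 1 := j)) (if v = i then 0 else v) \<and> same (?s m) (cinsert t i j (?s m))"
          unfolding cinsert_def Let_def av' using r setav[OF s' r(1), of 0] same_trans[OF r(2)] by auto
        then have "RM (mem h) (insert_elem j i S)" unfolding h(2)
          by (intro RMI[of _ _ _ m]) (use sets_of_insert[OF f(2) i] in auto)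
        then show ?thesis using halts_within_mono[OF h(1) Ts(2)] by blast
      qed
      have 2: "\<exists>h. halts_within (s n) w (K * w) P3 [n, w, j, i] m T h \<and> RM (mem h) (delete_elem j i S)"
        if p: "partition_up_to_one n c (delete_elem j i S)"
      proof -
        obtain h where h: "halts_within (s n) w (K * w) P3 [n, w, j, i] m T3 h" "mem h = store (cdelete t i j (?s m))"
          using P3[OF Ks(3) _ ok4[OF j i], of "s n" m] unfolding ist ae by auto
        have "same (?s m) (?s m)" by (simp add: same_def)
        then have "R (cdelete t i j (?s m)) f (if f (i - 1) = j \<and> v \<noteq> i then i else v) \<and>
            same (?s m) (cdelete t i j (?s m))"
          unfolding cdelete_def v g using f(1) setav[OF sm f(1), of i] i unfolding u by auto
        then have "RM (mem h) (delete_elem j i S)" unfolding h(2)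
          by (intro RMI[of _ _ _ m]) (use sets_of_delete[OF f(2) i j _ p v(2)] in auto)
        then show ?thesis using halts_within_mono[OF h(1) Ts(3)] by blast
      qed
      have 3: "\<exists>h. halts_within (s n) w (K * w) P4 [n, w, j, i] m T h \<and> RM (mem h) S \<and> result h = (if i \<in> S j then 1 else 0)"
      proof -
        obtain h where h: "halts_within (s n) w (K * w) P4 [n, w, j, i] m T4 h" "mem h = m" "result h = csearch t i j (?s m)"
          using P4[OF Ks(4) _ ok4[OF j i], of "s n" m] unfolding ist ae by auto
        have "csearch t i j (?s m) = (if i \<in> S j then 1 else 0)"
          unfolding csearch_def v g f(2)[OF j] sets_of_def using i by auto
        then show ?thesis using halts_within_mono[OF h(1) Ts(4)] h RM by auto
      qed
      show ?thesis using 1 2 3 by blast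
    qed
    have L: "(\<exists>f. halts_within (s n) w (K * w) P5 [n, w, j] m T f \<and> RM (mem f) S \<and>
          (if S j = {} then result f = 0 else result f \<in> S j)) \<and>
        (\<exists>f. halts_within (s n) w (K * w) P6 [n, w, j] m (T * (card (S j) + 1)) f \<and>
             RM (mem f) S \<and> distinct (emitted f) \<and> set (emitted f) = S j)"
      if RM: "RM m S" and j: "j < c" for m S j
    proof -
      obtain f v where f: "R (?s m) f v" "\<And>j. j < c \<Longrightarrow> S j = sets_of n f v j" using RM unfolding RM_def by blast
      have v: "cav t (?s m) = v" using av[OF sm f(1)] by simp
      obtain xs where xs: "distinct xs" "set xs = {x. x < n \<and> f x = j}" "lnk (cnext t (?s m) j) (cfirst t (?s m) j) xs 0"
        using enum[OF sm f(1) j] unfolding u by blast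
      note so = lnk_sets_of[OF xs(1,2), of v, folded f(2)[OF j]]
      have 1: "\<exists>h. halts_within (s n) w (K * w) P5 [n, w, j] m T h \<and> RM (mem h) S \<and>
          (if S j = {} then result h = 0 else result h \<in> S j)"
      proof -
        obtain h where h: "halts_within (s n) w (K * w) P5 [n, w, j] m T5 h" "mem h = m" "result h = cfindany t j (?s m)"
          using P5[OF Ks(5) _ ok3[OF j], of "s n" m] unfolding ist ae by auto
        have "if S j = {} then cfindany t j (?s m) = 0 else cfindany t j (?s m) \<in> S j"
        proof (cases xs)
          case Nil
          then show ?thesis using xs(3) so(1) by (simp add: cfindany_def)
        next
          case (Cons x ys)
          then have fx: "cfirst t (?s m) j = Suc x" "lnk (cnext t (?s m) j) (cnext t (?s m) j x) ys 0" using xs(3) by auto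
          show ?thesis
          proof (cases "Suc x = v")
            case False
            then have "Suc x \<in> S j" unfolding so(1)[symmetric] Cons by simp
            then show ?thesis using False by (auto simp: cfindany_def fx v)
          next
            case True
            show ?thesis
            proof (cases ys)
              case Nil
              then have "S j = {}" unfolding so(1)[symmetric] Cons using True by simp
              then show ?thesis using fx Nil by (simp add: cfindany_def v True[symmetric])
            next
              case (Cons y zs)
              have "y \<noteq> x" using xs(1) Cons \<open>xs = x # ys\<close> by auto
              then have "Suc y \<in> S j" unfolding so(1)[symmetric] Cons \<open>xs = x # ys\<close> using True by auto
              moreover have "cnext t (?s m) j x = Suc y" using fx(2) Cons by simp
              ultimately show ?thesis using fx(1) by (auto simp: cfindany_def v True[symmetric])
            qed
          qed
        qed
        then show ?thesis using halts_within_mono[OF h(1) Ts(5)] h RM by (intro exI[of _ h]) simp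
      qed
      have "\<forall>x\<in>set xs. Suc x < 2 ^ (A * w)" unfolding xs(2) using A' by auto
      from P6[OF Ks(6) _ ok3[OF j] this, of "s n" m, unfolded ist ae, OF _ xs(3)] obtain h where
        h: "halts_within (s n) w (K * w) P6 [n, w, j] m (T6 * (length xs + 1)) h" "mem h = m"
          "emitted h = map Suc (filter (\<lambda>x. Suc x \<noteq> v) xs)"
        unfolding v by auto
      have "T6 * (length xs + 1) \<le> T6 * (2 * (card (S j) + 1))" using so(2) by (intro mult_le_mono2) simp
      also have "\<dots> \<le> T * (card (S j) + 1)" unfolding T_def by (simp add: algebra_simps)
      finally have "halts_within (s n) w (K * w) P6 [n, w, j] m (T * (card (S j) + 1)) h"
        by (rule halts_within_mono[OF h(1)])
      moreover have "distinct (emitted h)" "set (emitted h) = S j"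
        unfolding h(3) so(1)[symmetric] using xs(1) by (auto simp: distinct_map)
      ultimately show ?thesis using 1 h(2) RM by auto
    qed
    show ?thesis unfolding maintains_collection_def data_structure.select_convs
    proof (rule exI[of _ RM], intro conjI allI impI ballI, goal_cases)
      case (1 m)
      show ?case by (rule I)
    next
      case (2 m S j i)
      then show ?case using O by blast
    next
      case (3 m S j i)
      then show ?case using O by blast
    next
      case (4 m S j i)
      then show ?case using O by blast
    next
      case (5 m S j)
      then show ?case using L by blast
    next
      case (6 m S j)
      then show ?case using L by blast
    qed
  qed
  then show ?thesis by blast
qed

section \<open>Choice of the parameters\<close>

text \<open>Tiny universes will have at most \<open>n1\<close> elements, and \<open>bP\<close> and
  \<open>lP\<close> provide for a list of all of them. The last two bounds on \<open>z\<close> keep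
  the width at least \<open>5 * ln z + 2\<close>: one is for the initial width, the other for a
  width that was just not ready and is divided once more.\<close>

locale params =
  fixes P :: par and n1 :: nat
  assumes dc: "dP P < cP P"
    and rP: "rP P = (3 * cP P + 2) * (cP P + 2)"
    and nP: "\<And>z. nP P \<le> z \<Longrightarrow> 120 \<le> z \<and> cP P + 4 \<le> z \<and> 5 * ln (real z) + 2 \<le> real z / 40 - 1 \<and>
      5 * ln (real z) + 2 \<le> (real z / real (rP P)) powr (1 / 8) / (ln (real z) + 9) - 1"
    and bP: "1 \<le> bP P" "n1 + 2 < 2 ^ (bP P - 1)" "cP P \<le> 2 ^ (bP P - 1)"
    and lP: "lP P = 1 + 4 * bP P + 3 * (n1 * bP P)" "lP P \<le> kP P"

lemma params_exist:
  fixes \<kappa> :: real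
  assumes "d < c" and \<kappa>: "0 < \<kappa>"
  obtains P n1 where "params P n1" "cP P = c" "dP P = d"
    "\<And>n w. 1 \<le> n \<Longrightarrow> \<kappa> * log 2 (real n) \<le> real w \<Longrightarrow> 1 \<le> w \<Longrightarrow> n < 2 ^ (kP P * w)"
    "\<And>n. n1 < n \<Longrightarrow> real (nP P) \<le> \<kappa> * log 2 (real n) \<and> nP P \<le> n"
proof -
  define R where "R = real ((3 * c + 2) * (c + 2))"
  have R: "0 < R" unfolding R_def by (subst of_nat_0_less_iff) simp
  have "eventually (\<lambda>z :: real. 120 \<le> z \<and> real c + 4 \<le> z \<and> 5 * ln z + 2 \<le> z / 40 - 1 \<and>
      5 * ln z + 2 \<le> (z / R) powr (1 / 8) / (ln z + 9) - 1) at_top"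
    using R by (intro eventually_conj; real_asymp)
  from eventually_compose_filterlim[OF this filterlim_real_sequentially]
  obtain n0 :: nat where n0: "\<And>z. n0 \<le> z \<Longrightarrow> 120 \<le> real z \<and> real c + 4 \<le> real z \<and>
      5 * ln (real z) + 2 \<le> real z / 40 - 1 \<and> 5 * ln (real z) + 2 \<le> (real z / R) powr (1 / 8) / (ln (real z) + 9) - 1"
    unfolding eventually_sequentially by blast
  \<comment> \<open>Beyond \<open>n1\<close>, both \<open>n\<close> and
    \<open>\<kappa> * log 2 n\<close> reach the threshold, and so does every admissible word
    length.\<close>
  define n1 where "n1 = n0 + nat \<lceil>2 powr (real n0 / \<kappa>)\<rceil>"
  define b where "b = n1 + c + 3"
  define l where "l = 1 + 4 * b + 3 * (n1 * b)"
  \<comment> \<open>The summand \<open>1 / \<kappa>\<close> makes up for words shorter than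
    \<open>log 2 n\<close>.\<close>
  define k where "k = l + nat \<lceil>1 / \<kappa>\<rceil> + 1"
  let ?P = "\<lparr>cP = c, dP = d, kP = k, nP = n0, bP = b, lP = l, rP = (3 * c + 2) * (c + 2)\<rparr>"
  have b: "n1 + c + 2 < 2 ^ (b - 1)" using less_exp[of "n1 + c + 2"] by (simp add: b_def)
  have "params ?P n1"
  proof (unfold_locales, simp_all only: par.select_convs)
    fix z assume "n0 \<le> z"
    from n0[OF this] show "120 \<le> z \<and> c + 4 \<le> z \<and> 5 * ln (real z) + 2 \<le> real z / 40 - 1 \<and>
      5 * ln (real z) + 2 \<le> (real z / real ((3 * c + 2) * (c + 2))) powr (1 / 8) / (ln (real z) + 9) - 1"
      unfolding R_def by (auto simp del: of_nat_add of_nat_mult simp: of_nat_add[symmetric])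
  qed (use b assms in \<open>auto simp: b_def l_def k_def\<close>)
  moreover have "n < 2 ^ (k * w)" if n: "1 \<le> n" and q: "\<kappa> * log 2 (real n) \<le> real w" and w: "1 \<le> w" for n w
  proof -
    have "log 2 (real n) \<le> 1 / \<kappa> * real w" using q \<kappa> by (simp add: field_simps)
    also have "\<dots> \<le> real (nat \<lceil>1 / \<kappa>\<rceil>) * real w" by (intro mult_right_mono) (auto simp: real_nat_ceiling_ge)
    also have "\<dots> < real k * real w" using w by (intro mult_strict_right_mono) (simp_all add: k_def)
    finally have "log 2 (real n) < real (k * w)" by simp
    then have "real n < 2 powr real (k * w)" using n by (subst (asm) log_less_iff) auto
    also have "2 powr real (k * w) = real (2 ^ (k * w))" unfolding of_nat_power by (subst powr_realpow) auto
    finally show ?thesis by (simp only: of_nat_less_iff)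
  qed
  moreover have "real n0 \<le> \<kappa> * log 2 (real n) \<and> n0 \<le> n" if n: "n1 < n" for n
  proof -
    have "2 powr (real n0 / \<kappa>) \<le> real (nat \<lceil>2 powr (real n0 / \<kappa>)\<rceil>)" by (rule real_nat_ceiling_ge)
    also have "\<dots> \<le> real n" using n by (simp add: n1_def)
    finally have "real n0 / \<kappa> \<le> log 2 (real n)" using n by (subst le_log_iff) auto
    then show ?thesis using \<kappa> n by (simp add: field_simps n1_def)
  qed
  ultimately show ?thesis by (intro that[of ?P n1]) auto
qed

lemma nat_div_real: "real a / real b - 1 \<le> real (a div b)"
proof (cases "b = 0")
  case False
  have "a < (a div b + 1) * b" using False by (simp add: dividend_less_div_times)
  then have "real a < real ((a div b + 1) * b)" by (subst of_nat_less_iff)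
  then show ?thesis using False by (simp add: field_simps)
qed simp

context params
begin

lemma kP: "1 \<le> kP P" and rP1: "1 \<le> rP P" and c1: "1 \<le> cP P"
  using lP dc by (auto simp: rP)

text \<open>Every step divides by at least 9.\<close>

lemma bseq_upper: assumes "\<not> tiny P \<sigma>" shows "bseq P \<sigma> m * 9 ^ m \<le> zz \<sigma>" "bseq P \<sigma> m \<le> zz \<sigma> div 40"
proof -
  have "bseq P \<sigma> m * 9 ^ m \<le> zz \<sigma> div 40" for m
  proof (induction m)
    case (Suc m)
    have "bseq P \<sigma> m div (m + 9) * 9 \<le> bseq P \<sigma> m div (m + 9) * (m + 9)" by (rule mult_le_mono2) simp
    also have "\<dots> \<le> bseq P \<sigma> m" by simp
    finally have "bseq P \<sigma> m div (m + 9) * 9 * 9 ^ m \<le> bseq P \<sigma> m * 9 ^ m" by (rule mult_le_mono1)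
    also note Suc
    finally show ?case using assms by (simp add: mult.assoc)
  qed (simp add: gb0_def assms)
  note h = this[of m]
  then show "bseq P \<sigma> m * 9 ^ m \<le> zz \<sigma>" using div_le_dividend[of "zz \<sigma>" 40] by linarith
  have "bseq P \<sigma> m * 1 \<le> bseq P \<sigma> m * 9 ^ m" by (rule mult_le_mono2) simp
  then show "bseq P \<sigma> m \<le> zz \<sigma> div 40" using h by linarith
qed

text \<open>The core of the choice of \<open>b\<close>. The preceding width was not ready, so its
  eighth power exceeds \<open>zz \<sigma> / rP P\<close>; and at most
  \<open>ln (zz \<sigma>)\<close> steps led to it, as each divides by at least 9. One more division,
  by at most \<open>ln (zz \<sigma>) + 9\<close>, leaves a width that is still at least
  logarithmic.\<close>

lemma bseq_bounds:
  assumes nt: "\<not> tiny P \<sigma>" and g: "\<And>i. i < m \<Longrightarrow> \<not> rdy P \<sigma> (bseq P \<sigma> i)"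
  shows "5 * ln (real (zz \<sigma>)) + 2 \<le> real (bseq P \<sigma> m)" "bseq P \<sigma> m * (m + 1) \<le> zz \<sigma>"
    "ew (bseq P \<sigma> m) m \<le> zz \<sigma> div 4" "real m \<le> ln (real (zz \<sigma>)) + 1"
proof -
  define z where "z = zz \<sigma>"
  have z: "nP P \<le> z" using nt by (simp add: tiny_def z_def)
  note zb = nP[OF z]
  have "5 * ln (real z) + 2 \<le> real (bseq P \<sigma> m) \<and> bseq P \<sigma> m * (m + 1) \<le> z \<and> ew (bseq P \<sigma> m) m \<le> z div 4 \<and>
    real m \<le> ln (real z) + 1"
  proof (cases m)
    case 0
    have "real z / 40 - 1 \<le> real (z div 40)" using nat_div_real[of z 40] by simp
    moreover have "1 + 4 * (z div 40) \<le> z div 4" using zb by linarith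
    ultimately show ?thesis using zb 0 nt by (simp add: gb0_def z_def[symmetric] ew_def)
  next
    case (Suc i)
    define b where "b = bseq P \<sigma> i"
    define b' where "b' = bseq P \<sigma> m"
    have b': "b' = b div (i + 9)" using nt by (simp add: b'_def Suc b_def)
    have "\<not> rP P * b ^ 8 \<le> z" using g[of i] nt Suc unfolding rdy_def b_def z_def by simp
    then have zr: "z < rP P * b ^ 8" by simp
    then have b1: "1 \<le> b" by (cases b) auto
    have "9 ^ i \<le> b * 9 ^ i" using b1 by simp
    also have "\<dots> \<le> z" unfolding b_def z_def by (rule bseq_upper[OF nt])
    finally have "real (9 ^ i) \<le> real z" by (subst of_nat_le_iff)
    then have "exp (real i) \<le> real z"
    proof -
      have "exp (real i) = exp 1 ^ i" by (simp add: exp_of_nat_mult[symmetric])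
      also have "\<dots> \<le> 9 ^ i" using exp_le by (intro power_mono) auto
      finally show ?thesis using \<open>real (9 ^ i) \<le> real z\<close>
        unfolding of_nat_power of_nat_numeral by linarith
    qed
    then have i: "real i \<le> ln (real z)" using zb by (subst ln_ge_iff) auto
    have "real z / real (rP P) \<le> real b ^ 8"
    proof -
      have "real z \<le> real (rP P * b ^ 8)" using zr by (subst of_nat_le_iff) simp
      then show ?thesis using rP1 by (simp add: field_simps)
    qed
    then have "(real z / real (rP P)) powr (1 / 8) \<le> (real b ^ 8) powr (1 / 8)" by (intro powr_mono2) auto
    also have "real b ^ 8 = real b powr 8" using b1 powr_realpow[of "real b" 8] by simp
    also have "(real b powr 8) powr (1 / 8) = real b" using b1 by (subst powr_powr) simp
    finally have r: "(real z / real (rP P)) powr (1 / 8) \<le> real b" .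
    have "5 * ln (real z) + 2 \<le> (real z / real (rP P)) powr (1 / 8) / (ln (real z) + 9) - 1" using zb by blast
    also have "\<dots> \<le> real b / (real i + 9) - 1"
      using r i by (intro diff_right_mono frac_le) auto
    also have "\<dots> \<le> real b'" using nat_div_real[of b "i + 9"] unfolding b' by simp
    finally have 1: "5 * ln (real z) + 2 \<le> real b'" .
    have "b' * (i + 9) \<le> b" unfolding b' by simp
    moreover have "b \<le> z div 40" unfolding b_def z_def by (rule bseq_upper[OF nt])
    ultimately have 2: "b' * (i + 9) \<le> z div 40" by linarith
    have "b' * (m + 1) \<le> b' * (i + 9)" unfolding Suc by (rule mult_le_mono2) simp
    then have 3: "b' * (m + 1) \<le> z" using 2 by linarith
    \<comment> \<open>The 9 pays for the header: \<open>3 * i + 7\<close> cells are fewer than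
      \<open>3 * (i + 9)\<close>.\<close>
    have "ew b' m = 1 + 3 * (b' * i) + 7 * b'" by (simp add: ew_def Suc algebra_simps)
    moreover have "b' * (i + 9) = b' * i + 9 * b'" by (simp add: algebra_simps)
    ultimately have "ew b' m \<le> 1 + 3 * (z div 40)" using 2 by linarith
    also have "\<dots> \<le> z div 4" using zb by linarith
    finally show ?thesis using 1 3 i Suc by (simp add: b'_def)
  qed
  then show "5 * ln (real (zz \<sigma>)) + 2 \<le> real (bseq P \<sigma> m)" "bseq P \<sigma> m * (m + 1) \<le> zz \<sigma>"
    "ew (bseq P \<sigma> m) m \<le> zz \<sigma> div 4" "real m \<le> ln (real (zz \<sigma>)) + 1"
    unfolding z_def by auto
qed

text \<open>With \<open>z\<close> for \<open>zz \<sigma>\<close>, the bounds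
  \<open>b \<ge> 5 * ln z + 2\<close> and \<open>ln 2 \<ge> 3 / 5\<close> give
  \<open>2 ^ (b - 1) > z ^ 3\<close>. This is the origin of the 5: groups have up to
  \<open>2 * (z * z)\<close> elements, and their numbers must fit into a cell.\<close>

lemma bseq_large:
  assumes nt: "\<not> tiny P \<sigma>" and g: "\<And>i. i < m \<Longrightarrow> \<not> rdy P \<sigma> (bseq P \<sigma> i)"
  shows "2 * (zz \<sigma> * zz \<sigma>) + 2 + cP P < 2 ^ (bseq P \<sigma> m - 1)" "2 \<le> bseq P \<sigma> m" "ln (real (zz \<sigma>)) \<le> real (bseq P \<sigma> m)"
    "m < zz \<sigma>" "m \<le> bseq P \<sigma> m"
proof -
  define z where "z = zz \<sigma>"
  define b where "b = bseq P \<sigma> m"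
  have z: "nP P \<le> z" using nt by (simp add: tiny_def z_def)
  note zb = nP[OF z]
  note bb = bseq_bounds[OF nt g, of m, folded z_def b_def]
  have l0: "0 \<le> ln (real z)" using zb by simp
  then show "2 \<le> bseq P \<sigma> m" "ln (real (zz \<sigma>)) \<le> real (bseq P \<sigma> m)" "m \<le> bseq P \<sigma> m"
    using bb unfolding b_def[symmetric] z_def[symmetric] by linarith+
  have "b * (m + 1) \<le> z" "2 \<le> b" using bb l0 by linarith+
  moreover have "2 * (m + 1) \<le> b * (m + 1)" using \<open>2 \<le> b\<close> by (rule mult_le_mono1)
  ultimately have "2 * (m + 1) \<le> z" by (meson le_trans)
  then show "m < zz \<sigma>" unfolding z_def[symmetric] by simp
  \<comment> \<open>From \<open>exp 3 \<le> 27\<close> and \<open>27 \<le> 2 ^ 5\<close> follows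
    \<open>3 \<le> 5 * ln 2\<close>.\<close>
  have "exp 3 = exp (1 :: real) ^ 3" by (simp add: exp_of_nat_mult[symmetric])
  also have "\<dots> \<le> 3 ^ 3" using exp_le by (intro power_mono) auto
  finally have "3 \<le> ln (2 ^ 5 :: real)" by (subst ln_ge_iff) auto
  then have ln2: "3 \<le> 5 * ln (2 :: real)" unfolding ln_realpow by simp
  have "3 * ln (real z) \<le> ln 2 * (5 * ln (real z))"
    using mult_right_mono[OF ln2, of "ln (real z)"] l0 by (simp add: mult_ac)
  also have "\<dots> < ln 2 * (real b - 1)" using bb(1) by (intro mult_strict_left_mono) auto
  also have "\<dots> = ln (2 ^ (b - 1))" using \<open>2 \<le> b\<close> by (simp add: ln_realpow of_nat_diff)
  finally have "ln (real z ^ 3) < ln (2 ^ (b - 1))" using zb by (simp add: ln_realpow)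
  then have "real z ^ 3 < 2 ^ (b - 1)" using zb by (subst (asm) ln_less_cancel_iff) auto
  then have "real (z ^ 3) < real (2 ^ (b - 1))" by simp
  then have "z ^ 3 < 2 ^ (b - 1)" by (simp only: of_nat_less_iff)
  moreover have "2 * (z * z) + 2 + cP P \<le> z ^ 3"
  proof -
    have "3 * (z * z) \<le> z * (z * z)" "z * 1 \<le> z * z" using zb by (intro mult_le_mono; simp)+
    moreover have "z ^ 3 = z * (z * z)" by (simp add: power3_eq_cube)
    ultimately show ?thesis using zb by linarith
  qed
  ultimately show "2 * (zz \<sigma> * zz \<sigma>) + 2 + cP P < 2 ^ (bseq P \<sigma> m - 1)" unfolding z_def[symmetric] b_def[symmetric] by linarith
qed

text \<open>A fortieth of \<open>zz \<sigma>\<close>, rounded down, is at least 3, and its eighth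
  power is at least 729 times itself, hence too large. So a group always begins with a list.\<close>

lemma not_rdy_gb0: "\<not> rdy P \<sigma> (gb0 P \<sigma>)"
proof
  assume r: "rdy P \<sigma> (gb0 P \<sigma>)"
  define q where "q = zz \<sigma> div 40"
  have nt: "\<not> tiny P \<sigma>" using r by (simp add: rdy_def)
  then have z: "120 \<le> zz \<sigma>" using nP[of "zz \<sigma>"] by (simp add: tiny_def)
  have "rP P * q ^ 8 \<le> zz \<sigma>" using r nt by (simp add: rdy_def gb0_def q_def)
  moreover have "1 * q ^ 8 \<le> rP P * q ^ 8" using rP1 by (rule mult_le_mono1)
  ultimately have "q ^ 8 \<le> zz \<sigma>" by linarith
  moreover have q3: "3 \<le> q" using z by (simp add: q_def)
  have "729 * q \<le> q ^ 8"
  proof -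
    have "(3 :: nat) ^ 6 * 1 \<le> q ^ 6 * q" using q3 by (intro mult_le_mono power_mono) auto
    then have "729 * q \<le> q ^ 6 * q * q" by (intro mult_le_mono1) simp
    also have "\<dots> = q ^ 8" by (simp add: eval_nat_numeral)
    finally show ?thesis .
  qed
  moreover have "zz \<sigma> < 40 * (q + 1)" unfolding q_def by presburger
  ultimately have "729 * q < 40 * (q + 1)" by (meson le_trans le_less_trans)
  then show False using q3 by simp
qed

end

text \<open>The operations of groups recompute addresses from the current state; on states with the
  parameters of \<open>\<sigma>0\<close> they agree with operations at fixed addresses.\<close>

lemma struct_cong:
  assumes S: "struct c d \<sigma>0 FP sz get first nxt set' ini R"
    and "\<And>\<sigma>. same \<sigma>0 \<sigma> \<Longrightarrow> get' \<sigma> = get \<sigma>" "\<And>\<sigma>. same \<sigma>0 \<sigma> \<Longrightarrow> first' \<sigma> = first \<sigma>"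
      "\<And>\<sigma>. same \<sigma>0 \<sigma> \<Longrightarrow> nxt' \<sigma> = nxt \<sigma>" "\<And>\<sigma>. same \<sigma>0 \<sigma> \<Longrightarrow> set'' \<sigma> = set' \<sigma>" "\<And>\<sigma>. same \<sigma>0 \<sigma> \<Longrightarrow> ini' \<sigma> = ini \<sigma>"
    and FP: "FP \<subseteq> FP'"
  shows "struct c d \<sigma>0 FP' sz get' first' nxt' set'' ini' R"
proof (unfold_locales, goal_cases)
  case (1 \<sigma> \<sigma>' f)
  then show ?case using struct.stable[OF S, of \<sigma> \<sigma>' f] FP by blast
next
  case (2 \<sigma> f f')
  then show ?case using struct.ext[OF S, of \<sigma> f f'] by blast
next
  case (3 \<sigma> f x)
  then show ?case using struct.get[OF S 3] assms(2) by simp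
next
  case (4 \<sigma> f j)
  then show ?case using struct.enum[OF S 4] assms(3,4) by simp
next
  case (5 \<sigma> f x j)
  have "R (set' \<sigma> x j) (f(x := j))" "frame FP' \<sigma> (set' \<sigma> x j)"
    using struct.set'[OF S 5] frame_mono[OF _ FP] by blast+
  then show ?case using assms(5)[OF 5(1)] by simp
next
  case (6 \<sigma>)
  then show ?case using struct.ini[OF S 6] assms(6) frame_mono[OF _ FP] by simp
qed

lemma nblk_props:
  assumes "1 \<le> b" "1 \<le> q"
  shows "1 \<le> nblk b q" "(nblk b q - 1) * (b * b) < q" "q \<le> nblk b q * (b * b)" "nblk b q \<le> q"
proof -
  define B where "B = b * b"
  have B: "1 \<le> B" using assms by (simp add: B_def)
  define N where "N = (q + B - 1) div B"
  have N: "N * B \<le> q + B - 1" "q + B - 1 < N * B + B"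
    using div_mult_mod_eq[of "q + B - 1" B] mod_less_divisor[of B "q + B - 1"] B unfolding N_def by linarith+
  then have "q \<le> N * B" by linarith
  then have N1: "1 \<le> N" using assms by (cases N) auto
  then obtain M where M: "N = Suc M" by (cases N) auto
  have "M * B < q" using N(1) M B assms by simp
  moreover have "M * 1 \<le> M * B" using B by (rule mult_le_mono2)
  ultimately have "N \<le> q" using M by linarith
  then show "1 \<le> nblk b q" "(nblk b q - 1) * (b * b) < q" "q \<le> nblk b q * (b * b)" "nblk b q \<le> q"
    using N1 \<open>q \<le> N * B\<close> \<open>M * B < q\<close> M unfolding nblk_def B_def[symmetric] N_def[symmetric] by auto
qed

text \<open>The third bound explains \<open>rP\<close>: as \<open>1 \<le> b * b\<close>, the factor
  \<open>gw\<close> is at most \<open>3 * c + 2\<close> times \<open>b * b\<close>, and the other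
  factor at most \<open>c + 2\<close> times \<open>b * b\<close>.\<close>

lemma (in params) rdy_bounds:
  assumes w: "1 \<le> wid \<sigma>0" and r: "rdy P \<sigma>0 b" and b: "1 \<le> b"
  shows "b ^ 8 \<le> zz \<sigma>0" "b \<le> wid \<sigma>0" "gw (cP P) (b * b) * (cP P * (b * b) + 2) \<le> kP P * wid \<sigma>0"
proof -
  let ?c = "cP P" let ?B = "b * b"
  have zw: "zz \<sigma>0 \<le> wid \<sigma>0" by (simp add: zz_def)
  have r: "rP P * b ^ 8 \<le> zz \<sigma>0" using r by (simp add: rdy_def)
  have "1 * b ^ 8 \<le> rP P * b ^ 8" using rP1 by (rule mult_le_mono1)
  then show b8: "b ^ 8 \<le> zz \<sigma>0" using r by linarith
  have "b ^ 1 \<le> b ^ 8" using b by (intro power_increasing) auto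
  then show "b \<le> wid \<sigma>0" using b8 zw by simp
  have B: "1 \<le> ?B" using b by simp
  have "gw ?c ?B \<le> 2 * (?c * ?B) + ?c * ?B + 2 * ?B"
    unfolding gw_def using mult_le_mono2[OF B, of ?c, unfolded mult_1_right] B by linarith
  then have 1: "gw ?c ?B \<le> (3 * ?c + 2) * ?B" by (simp add: algebra_simps)
  have "?c * ?B + 2 \<le> ?c * ?B + 2 * ?B" using B by linarith
  then have 2: "?c * ?B + 2 \<le> (?c + 2) * ?B" by (simp only: add_mult_distrib)
  have "gw ?c ?B * (?c * ?B + 2) \<le> (3 * ?c + 2) * ?B * ((?c + 2) * ?B)"
    using 1 2 by (rule mult_le_mono)
  also have "\<dots> = rP P * b ^ 4"
  proof -
    have "x * (b * b) * (y * (b * b)) = x * y * b ^ 4" for x y by (simp add: eval_nat_numeral)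
    then show ?thesis unfolding rP .
  qed
  also have "\<dots> \<le> rP P * b ^ 8" using b by (intro mult_le_mono2 power_increasing) auto
  also have "\<dots> \<le> 1 * wid \<sigma>0" using r zw by simp
  also have "\<dots> \<le> kP P * wid \<sigma>0" using kP by (rule mult_le_mono1)
  finally show "gw ?c ?B * (?c * ?B + 2) \<le> kP P * wid \<sigma>0" .
qed

lemma (in params) F_struct:
  assumes w: "1 \<le> wid \<sigma>0" and r: "rdy P \<sigma>0 b" and b: "1 \<le> b" and q: "m < sz" "sz < 2 ^ b"
    and lim: "gF P \<sigma>0 a t b m + flen P \<sigma>0 b (sz - m) \<le> lim \<sigma>0"
  shows "\<exists>RF. struct (cP P) (dP P) \<sigma>0 {gF P \<sigma>0 a t b m..<gF P \<sigma>0 a t b m + flen P \<sigma>0 b (sz - m)} (sz - m)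
    (\<lambda>\<sigma>. fget P \<sigma> a t b m sz) (\<lambda>\<sigma>. ffirst P \<sigma> a t b m sz) (\<lambda>\<sigma>. fnext P \<sigma> a t b m sz)
    (\<lambda>\<sigma>. fset P \<sigma> a t b m sz) (\<lambda>\<sigma>. fini P \<sigma> a t b m) RF"
proof -
  define O' where "O' = gF P \<sigma>0 a t b m"
  define N where "N = nblk b (sz - m)"
  define A where "A = larea (cP P) O' b N"
  define l where "l = blen (pw (kP P) \<sigma>0) (cP P) (b * b)"
  note rb = rdy_bounds[OF w r b]
  have q1: "1 \<le> sz - m" using q by simp
  note Np = nblk_props[OF b q1, folded N_def]
  have A: "A = O' + larea (cP P) 0 b N" by (simp add: A_def larea_def)
  have fl: "O' + flen P \<sigma>0 b (sz - m) = A + N * l" unfolding flen_def A N_def l_def by simp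
  have ba: "baddr (kP P) (cP P) \<sigma>0 A b i = A + i * l" for i by (simp add: baddr_def l_def)
  have bl: "A + i * l + l \<le> A + N * l" if "i < N" for i
  proof -
    have "(i + 1) * l \<le> N * l" using that by (intro mult_le_mono1) simp
    then show ?thesis by (simp add: algebra_simps)
  qed
  let ?FPi = "\<lambda>i. {A + i * l..<A + i * l + l}"
  have lv: "level (cP P) (dP P) (kP P) \<sigma>0 O' b (b * b) N (sz - m) (bops P) ?FPi
      (\<lambda>i. blk (kP P) (cP P) \<sigma>0 A b i (lsz (b * b) N (sz - m) i))"
  proof (rule level.intro, goal_cases)
    case 1 show ?case by (rule w)
  next
    case 2
    have "1 * wid \<sigma>0 \<le> kP P * wid \<sigma>0" using kP by (rule mult_le_mono1)
    then show ?case using rb(2) by linarith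
  next
    case 3 show ?case using Np(4) q by linarith
  next
    case 4 show ?case by (rule Np(1))
  next
    case 5 show ?case using b by simp
  next
    case 6 show ?case by (rule Np(2))
  next
    case 7 show ?case by (rule dc)
  next
    case 8 show ?case using lim[folded O'_def] fl unfolding A_def[symmetric] by linarith
  next
    case (9 i)
    have "lsz (b * b) N (sz - m) i \<le> b * b"
    proof (cases "Suc i = N")
      case True
      then have "sz - m \<le> i * (b * b) + b * b" using Np(3) by (simp add: algebra_simps flip: True)
      then show ?thesis using True by (simp add: lsz_def)
    qed (simp add: lsz_def)
    moreover have "A + i * l + l \<le> lim \<sigma>0" using bl[OF 9] lim[folded O'_def] fl by linarith
    ultimately show ?case unfolding A_def[symmetric]
      using block_struct[OF w c1 dc _ rb(3), of "lsz (b * b) N (sz - m) i" A i, unfolded ba, folded l_def]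
      by (simp add: bops_def)
  next
    case (10 i i')
    have "i * l + l \<le> i' * l \<or> i' * l + l \<le> i * l"
    proof (cases "i < i'")
      case True
      then have "(i + 1) * l \<le> i' * l" by (intro mult_le_mono1) simp
      then show ?thesis by simp
    next
      case False
      then have "(i' + 1) * l \<le> i * l" using 10 by (intro mult_le_mono1) simp
      then show ?thesis by simp
    qed
    then show ?case by auto
  next
    case (11 i)
    show ?case unfolding A_def[symmetric] by auto
  qed
  have "level.FP (cP P) O' b N ?FPi \<subseteq> {O'..<O' + flen P \<sigma>0 b (sz - m)}"
  proof -
    have "x \<in> {O'..<O' + flen P \<sigma>0 b (sz - m)}" if "x \<in> {O'..<A} \<or> (\<exists>i<N. x \<in> ?FPi i)" for x
      unfolding fl using that bl A by fastforce
    then show ?thesis unfolding level.FP_def[OF lv] A_def[symmetric] by blast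
  qed
  note sub = this
  have ps: "gF P \<sigma> a t b m = O'" if "same \<sigma>0 \<sigma>" for \<sigma> unfolding O'_def par_same(6)[OF that] ..
  show ?thesis unfolding O'_def[symmetric]
    by (rule exI, rule struct_cong[OF level.level_struct[OF lv] _ _ _ _ _ sub];
      ((intro ext)?, simp only: fget_def ffirst_def fnext_def fset_def fini_def ps N_def))
qed

text \<open>The layout of a group changes as its list grows, so the footprint is the union over all
  lengths that can be reached.\<close>

definition gfp where
  "gfp P \<sigma> a t sz =
    (\<Union>m\<in>{m. greach P \<sigma> sz m}. {gE \<sigma> a t..<gE \<sigma> a t + ew (bseq P \<sigma> m) m}) \<union>
    (\<Union>m\<in>{m. greach P \<sigma> sz m \<and> rdy P \<sigma> (bseq P \<sigma> m)}.
       {gF P \<sigma> a t (bseq P \<sigma> m) m..<gF P \<sigma> a t (bseq P \<sigma> m) m + flen P \<sigma> (bseq P \<sigma> m) (sz - m)})"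

lemma (in params) greach_bounds:
  assumes g: "greach P \<sigma> sz m" and big: "\<not> tiny P \<sigma> \<Longrightarrow> sz \<le> 2 * (zz \<sigma> * zz \<sigma>) \<and> zz \<sigma> \<le> sz"
    and ti: "tiny P \<sigma> \<Longrightarrow> sz \<le> n1" and w: "1 \<le> wid \<sigma>"
  shows "1 \<le> bseq P \<sigma> m \<and> m + 2 < 2 ^ bseq P \<sigma> m \<and> sz < 2 ^ (bseq P \<sigma> m - 1) \<and>
      cP P \<le> 2 ^ (bseq P \<sigma> m - 1) \<and> bseq P \<sigma> m * (m + 1) \<le> kP P * wid \<sigma> \<and> ew (bseq P \<sigma> m) m \<le> elen P \<sigma>"
proof -
  let ?b = "bseq P \<sigma> m"
  have ms: "m \<le> sz" using g by (simp add: greach_def)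
  have "1 * wid \<sigma> \<le> kP P * wid \<sigma>" using kP by (rule mult_le_mono1)
  then have kw: "wid \<sigma> \<le> kP P * wid \<sigma>" by simp
  have kw': "kP P * 1 \<le> kP P * wid \<sigma>" using w by (rule mult_le_mono2)
  have p: "(2::nat) ^ (x - 1) \<le> 2 ^ x" for x by (intro power_increasing) auto
  show ?thesis
  proof (cases "tiny P \<sigma>")
    case True
    have b: "?b = bP P" using True by (induction m) (auto simp: gb0_def)
    have s: "sz \<le> n1" by (rule ti[OF True])
    have "bP P * (m + 1) = bP P + m * bP P" by (simp add: algebra_simps)
    moreover have "m * bP P \<le> n1 * bP P" using s ms by (intro mult_le_mono1) simp
    ultimately have "bP P * (m + 1) \<le> lP P" "ew (bP P) m \<le> lP P"
      unfolding ew_def lP(1) by linarith+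
    moreover have "m + 2 < 2 ^ bP P" "sz < 2 ^ (bP P - 1)" using bP(2) p[of "bP P"] ms s by linarith+
    ultimately show ?thesis unfolding b elen_def if_P[OF True] using bP(1,3) lP(2) kw' by linarith
  next
    case False
    have nr: "\<not> rdy P \<sigma> (bseq P \<sigma> i)" if "i < m" for i using g that by (simp add: greach_def)
    have "zz \<sigma> \<le> wid \<sigma>" by (simp add: zz_def)
    moreover have "sz \<le> 2 * (zz \<sigma> * zz \<sigma>)" using big[OF False] by blast
    moreover have "?b * (m + 1) \<le> zz \<sigma>" by (rule bseq_bounds(2)[OF False]) (rule nr)
    moreover have "ew ?b m \<le> zz \<sigma> div 4" by (rule bseq_bounds(3)[OF False]) (rule nr)
    moreover have "2 * (zz \<sigma> * zz \<sigma>) + 2 + cP P < 2 ^ (?b - 1)" by (rule bseq_large(1)[OF False]) (rule nr)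
    moreover have "2 \<le> ?b" by (rule bseq_large(2)[OF False]) (rule nr)
    moreover note p[of ?b] kw ms
    ultimately show ?thesis unfolding elen_def if_not_P[OF False] by (intro conjI; linarith)
  qed
qed

lemma (in params) group_exists:
  assumes w: "1 \<le> wid \<sigma>0" and big: "\<not> tiny P \<sigma>0 \<Longrightarrow> sz \<le> 2 * (zz \<sigma>0 * zz \<sigma>0) \<and> zz \<sigma>0 \<le> sz"
    and ti: "tiny P \<sigma>0 \<Longrightarrow> sz \<le> n1"
    and E: "\<And>m. greach P \<sigma>0 sz m \<Longrightarrow> gE \<sigma>0 a t + ew (bseq P \<sigma>0 m) m \<le> lim \<sigma>0"
    and F: "\<And>m. greach P \<sigma>0 sz m \<Longrightarrow> rdy P \<sigma>0 (bseq P \<sigma>0 m) \<Longrightarrow>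
      gE \<sigma>0 a t + ew (bseq P \<sigma>0 m) m \<le> gF P \<sigma>0 a t (bseq P \<sigma>0 m) m \<and>
      gF P \<sigma>0 a t (bseq P \<sigma>0 m) m + flen P \<sigma>0 (bseq P \<sigma>0 m) (sz - m) \<le> lim \<sigma>0"
  shows "\<exists>FPF RF. group P \<sigma>0 a t sz (gfp P \<sigma>0 a t sz) FPF RF"
proof -
  note gb = greach_bounds[OF _ big ti w]
  let ?b = "bseq P \<sigma>0"
  let ?FPF = "\<lambda>m. {gF P \<sigma>0 a t (?b m) m..<gF P \<sigma>0 a t (?b m) m + flen P \<sigma>0 (?b m) (sz - m)}"
  have "\<forall>m. \<exists>RF. greach P \<sigma>0 sz m \<and> rdy P \<sigma>0 (?b m) \<longrightarrow> struct (cP P) (dP P) \<sigma>0 (?FPF m) (sz - m)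
        (\<lambda>\<sigma>. fget P \<sigma> a t (?b m) m sz) (\<lambda>\<sigma>. ffirst P \<sigma> a t (?b m) m sz)
        (\<lambda>\<sigma>. fnext P \<sigma> a t (?b m) m sz) (\<lambda>\<sigma>. fset P \<sigma> a t (?b m) m sz)
        (\<lambda>\<sigma>. fini P \<sigma> a t (?b m) m) RF"
  proof
    fix m
    show "\<exists>RF. greach P \<sigma>0 sz m \<and> rdy P \<sigma>0 (?b m) \<longrightarrow> struct (cP P) (dP P) \<sigma>0 (?FPF m) (sz - m)
        (\<lambda>\<sigma>. fget P \<sigma> a t (?b m) m sz) (\<lambda>\<sigma>. ffirst P \<sigma> a t (?b m) m sz)
        (\<lambda>\<sigma>. fnext P \<sigma> a t (?b m) m sz) (\<lambda>\<sigma>. fset P \<sigma> a t (?b m) m sz)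
        (\<lambda>\<sigma>. fini P \<sigma> a t (?b m) m) RF"
    proof (cases "greach P \<sigma>0 sz m \<and> rdy P \<sigma>0 (?b m)")
      case True
      then have g: "greach P \<sigma>0 sz m" and r: "rdy P \<sigma>0 (?b m)" by auto
      have nt: "\<not> tiny P \<sigma>0" using r by (simp add: rdy_def)
      have "m < zz \<sigma>0" by (rule bseq_large(4)[OF nt]) (use g in \<open>simp add: greach_def\<close>)
      then have "m < sz" using big[OF nt] by linarith
      moreover have "(2::nat) ^ (?b m - 1) \<le> 2 ^ ?b m" by (intro power_increasing) auto
      then have "sz < 2 ^ ?b m" using gb[OF g] by linarith
      ultimately obtain RF where "struct (cP P) (dP P) \<sigma>0 (?FPF m) (sz - m)
        (\<lambda>\<sigma>. fget P \<sigma> a t (?b m) m sz) (\<lambda>\<sigma>. ffirst P \<sigma> a t (?b m) m sz)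
        (\<lambda>\<sigma>. fnext P \<sigma> a t (?b m) m sz) (\<lambda>\<sigma>. fset P \<sigma> a t (?b m) m sz)
        (\<lambda>\<sigma>. fini P \<sigma> a t (?b m) m) RF"
        using F_struct[OF w r, of m sz a t] gb[OF g] F[OF g r] by blast
      then show ?thesis by (intro exI[of _ RF] impI)
    next
      case False
      show ?thesis using False by (intro exI impI) (rule notE)
    qed
  qed
  from choice[OF this] obtain RF where RF: "\<And>m. greach P \<sigma>0 sz m \<Longrightarrow> rdy P \<sigma>0 (?b m) \<Longrightarrow>
      struct (cP P) (dP P) \<sigma>0 (?FPF m) (sz - m)
        (\<lambda>\<sigma>. fget P \<sigma> a t (?b m) m sz) (\<lambda>\<sigma>. ffirst P \<sigma> a t (?b m) m sz)
        (\<lambda>\<sigma>. fnext P \<sigma> a t (?b m) m sz) (\<lambda>\<sigma>. fset P \<sigma> a t (?b m) m sz)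
        (\<lambda>\<sigma>. fini P \<sigma> a t (?b m) m) (RF m)" by blast
  have "group P \<sigma>0 a t sz (gfp P \<sigma>0 a t sz) ?FPF RF"
  proof (unfold_locales, goal_cases)
    case 1 show ?case by (rule w)
  next
    case 2 show ?case by (rule dc)
  next
    case 3 show ?case by (rule not_rdy_gb0)
  next
    case 4
    have "kP P * 1 \<le> kP P * wid \<sigma>0" using w by (rule mult_le_mono2)
    moreover have "1 * wid \<sigma>0 \<le> kP P * wid \<sigma>0" using kP by (rule mult_le_mono1)
    moreover have "zz \<sigma>0 \<le> wid \<sigma>0" by (simp add: zz_def)
    moreover have "zz \<sigma>0 div 4 \<le> zz \<sigma>0" by simp
    ultimately have "zz \<sigma>0 div 4 \<le> kP P * wid \<sigma>0" "lP P \<le> kP P * wid \<sigma>0" using lP(2) by linarith+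
    then show ?case unfolding elen_def by simp
  next
    case (5 p)
    then consider m where "greach P \<sigma>0 sz m" "p < gE \<sigma>0 a t + ew (?b m) m"
      | m where "greach P \<sigma>0 sz m" "rdy P \<sigma>0 (?b m)" "p < gF P \<sigma>0 a t (?b m) m + flen P \<sigma>0 (?b m) (sz - m)"
      unfolding gfp_def by auto
    then show ?case
    proof cases
      case (1 m)
      then show ?thesis using E[OF 1(1)] by linarith
    next
      case (2 m)
      then show ?thesis using F[OF 2(1,2)] by linarith
    qed
  next
    case (6 m) then show ?case by (rule gb)
  next
    case (7 m) then show ?case unfolding gfp_def by blast
  next
    case (8 m)
    have "?FPF m \<subseteq> gfp P \<sigma>0 a t sz" unfolding gfp_def using 8 by blast
    moreover have "?FPF m \<inter> {gE \<sigma>0 a t..<gE \<sigma>0 a t + ew (?b m) m} = {}" using F[OF 8] by auto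
    ultimately show ?case using RF[OF 8] by blast
  qed
  then show ?thesis by blast
qed

text \<open>A block of \<open>b\<^sup>2\<close> elements takes at most
  \<open>b\<^sup>2 * log 2 c + 1\<close> bits, and its row in the table O(\<open>b\<close>) bits.
  All deviations from \<open>Q * log 2 c\<close> are O(\<open>Q / b\<close>), including those caused
  by rounding up the number of blocks, since \<open>b ^ 3 \<le> Q\<close>.\<close>

lemma (in params) flen_bound:
  assumes w: "1 \<le> wid \<sigma>" and r: "rdy P \<sigma> b" and b: "1 \<le> b" and Q: "zz \<sigma> \<le> Q" "m < Q"
  shows "real (flen P \<sigma> b (Q - m)) \<le> real Q * log 2 (real (cP P)) + (7 * real (cP P) + 8) * (real Q / real b)"
    "real b ^ 2 \<le> real Q / real b"
proof -
  let ?c = "cP P"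
  define L where "L = log 2 (real ?c)"
  define x where "x = real Q / real b"
  define N where "N = nblk b (Q - m)"
  define l where "l = blen (pw (kP P) \<sigma>) ?c (b * b)"
  note rb = rdy_bounds[OF w r b]
  have L0: "0 \<le> L" using c1 unfolding L_def by simp
  have Lc: "L \<le> real ?c" unfolding L_def using c1 less_imp_le[OF of_nat_less_two_power[of ?c]]
    by (subst log_le_iff) (auto simp: powr_realpow)
  have "b ^ 3 \<le> b ^ 8" using b by (intro power_increasing) auto
  then have "b ^ 3 \<le> Q" using rb(1) Q by linarith
  then have "real (b ^ 3) \<le> real Q" by (simp only: of_nat_le_iff)
  then show bx: "real b ^ 2 \<le> real Q / real b" using b by (simp add: field_simps eval_nat_numeral)
  have b2: "1 \<le> real b ^ 2" "real b \<le> real b ^ 2" using b by (auto intro: one_le_power self_le_power)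
  have x: "1 \<le> x" "real b ^ 2 \<le> x" "real b \<le> x" using bx b2 unfolding x_def by linarith+
  have N1: "real N - 1 \<le> real Q / real b ^ 2"
  proof -
    have "(N - 1) * (b * b) < Q - m" "1 \<le> N" using nblk_props[OF b, of "Q - m"] Q unfolding N_def by auto
    then have "real ((N - 1) * (b * b)) \<le> real Q" by (simp only: of_nat_le_iff)
    then have "(real N - 1) * real b ^ 2 \<le> real Q"
      using \<open>1 \<le> N\<close> by (simp only: of_nat_mult of_nat_diff of_nat_1 power2_eq_square)
    then show ?thesis using b by (subst pos_le_divide_eq) auto
  qed
  have lb: "real l \<le> real b ^ 2 * L + 1"
  proof (cases "l = 0")
    case True
    then show ?thesis using L0 by simp
  next
    case False
    have pe: "pw (kP P) \<sigma> y = 2 ^ y" if "y \<le> gw ?c (b * b) * (?c * (b * b) + 2)" for y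
      using that rb(3) by (intro pw_eq) linarith
    have "l = 0 \<or> 2 ^ (l - 1) < ?c ^ (b * b)" unfolding l_def by (rule blen_props(3)[OF pe c1]) assumption
    with False have "2 ^ (l - 1) < ?c ^ (b * b)" by satx
    then have "real (2 ^ (l - 1)) < real (?c ^ (b * b))" by (simp only: of_nat_less_iff)
    then have "log 2 (real (2 ^ (l - 1))) < log 2 (real (?c ^ (b * b)))" using c1 by (subst log_less_cancel_iff) auto
    then have "real (l - 1) < real (b * b) * L" using c1 by (simp add: log_nat_power L_def)
    then show ?thesis using False by (simp add: power2_eq_square of_nat_diff)
  qed
  have "real (N * l) \<le> (real Q / real b ^ 2 + 1) * (real b ^ 2 * L + 1)"
    unfolding of_nat_mult using N1 lb by (intro mult_mono) auto
  also have "\<dots> = real Q * L + real Q / real b ^ 2 + real b ^ 2 * L + 1" using b by (simp add: field_simps)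
  also have "real Q / real b ^ 2 \<le> x" unfolding x_def using b2 b by (intro divide_left_mono) auto
  also have "real b ^ 2 * L \<le> x * real ?c" using x Lc L0 by (intro mult_mono) auto
  finally have 1: "real (N * l) \<le> real Q * L + x + x * real ?c + x" using x by simp
  have "real ((N + 1) * (?c + 1) * 2 * b) = 2 * (real ?c + 1) * ((real N + 1) * real b)" by (simp add: algebra_simps)
  also have "\<dots> \<le> 2 * (real ?c + 1) * ((real Q / real b ^ 2 + 2) * real b)"
    using N1 by (intro mult_left_mono mult_right_mono) auto
  also have "(real Q / real b ^ 2 + 2) * real b = x + 2 * real b"
    using b unfolding x_def by (simp add: field_simps power2_eq_square)
  also have "2 * (real ?c + 1) * (x + 2 * real b) \<le> 2 * (real ?c + 1) * (3 * x)" using x by (intro mult_left_mono) auto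
  finally have "real (flen P \<sigma> b (Q - m)) \<le> 2 * (real ?c + 1) * (3 * x) + (real Q * L + x + x * real ?c + x)"
    unfolding flen_def larea_def N_def[symmetric] l_def[symmetric] of_nat_add using 1 by simp
  then show "real (flen P \<sigma> b (Q - m)) \<le> real Q * log 2 (real ?c) + (7 * real ?c + 8) * (real Q / real b)"
    unfolding L_def[symmetric] x_def[symmetric] by (simp add: algebra_simps)
qed

section \<open>The collection\<close>

abbreviation "tw P \<sigma> \<equiv> kP P * wid \<sigma>"
abbreviation "sq \<sigma> \<equiv> wid \<sigma> * wid \<sigma>"

text \<open>With several groups, the missing element has \<open>kP\<close> words of its own. A
  single group keeps it in the header of its list, since a word may then exceed the permitted
  overhead.\<close>

definition tops :: "par \<Rightarrow> cops" where
  "tops P = \<lparr>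
     cget = (\<lambda>\<sigma> x. if small P \<sigma> then gget P \<sigma> 0 0 0 (univ \<sigma>) x
       else lv_get (kP P) (cP P) (dP P) (gops P) \<sigma> (tw P \<sigma>) (tw P \<sigma>) (sq \<sigma>) (univ \<sigma> div sq \<sigma>) (univ \<sigma>) x),
     cfirst = (\<lambda>\<sigma> j. if small P \<sigma> then gfirst P \<sigma> 0 0 0 (univ \<sigma>) j
       else lv_first (kP P) (cP P) (dP P) (gops P) \<sigma> (tw P \<sigma>) (tw P \<sigma>) (sq \<sigma>) (univ \<sigma> div sq \<sigma>) (univ \<sigma>) j),
     cnext = (\<lambda>\<sigma> j x. if small P \<sigma> then gnext P \<sigma> 0 0 0 (univ \<sigma>) j x
       else lv_next (kP P) (cP P) (dP P) (gops P) \<sigma> (tw P \<sigma>) (tw P \<sigma>) (sq \<sigma>) (univ \<sigma> div sq \<sigma>) (univ \<sigma>) j x),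
     cset = (\<lambda>\<sigma> x j. if small P \<sigma> then gset P \<sigma> 0 0 0 (univ \<sigma>) x j
       else lv_set (kP P) (cP P) (gops P) \<sigma> (tw P \<sigma>) (tw P \<sigma>) (sq \<sigma>) (univ \<sigma> div sq \<sigma>) (univ \<sigma>) x j),
     cini = (\<lambda>\<sigma>. if small P \<sigma> then gini P \<sigma> 0 0 0 (univ \<sigma>)
       else let \<sigma>' = lv_zero (kP P) (cP P) \<sigma> (tw P \<sigma>) (tw P \<sigma>) (Suc (cP P)) in wr (kP P) \<sigma>' 0 (tw P \<sigma>') 0),
     cav = (\<lambda>\<sigma>. if small P \<sigma> then gav P \<sigma> 0 0 else rd (kP P) \<sigma> 0 (tw P \<sigma>)),
     csetav = (\<lambda>\<sigma> v. if small P \<sigma> then gsetav P \<sigma> 0 0 v else wr (kP P) \<sigma> 0 (tw P \<sigma>) v)\<rparr>"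

lemma cops_computable_tops: "cops_computable (tops P)"
proof -
  note go = ops_computable_gops
  note ce = ops_computable.CE_lv_get[OF go] ops_computable.CE_lv_first[OF go] ops_computable.CE_lv_next[OF go]
    ops_computable.CM_lv_set[OF go] CM_lv_zero CE_gget CE_gfirst CE_gnext CM_gset CM_gini CE_gav CM_gsetav
    CM_wr CM_if CM_state_let CB_small CE_b
  show ?thesis
    by unfold_locales (simp_all only: tops_def cops.select_convs, (intro ce; assumption)+)
qed

lemma small_same: "same \<sigma>0 \<sigma> \<Longrightarrow> small P \<sigma> = small P \<sigma>0"
  by (simp add: same_def small_def tiny_def zz_def)

lemma collection_group:
  assumes g: "group P \<sigma>0 0 0 (univ \<sigma>0) FPg FPF RF" and s: "small P \<sigma>0" and u: "1 \<le> univ \<sigma>0"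
  shows "collection (cP P) (dP P) \<sigma>0 (tops P) (group.RG P \<sigma>0 0 0 (univ \<sigma>0) RF)"
proof -
  interpret group P \<sigma>0 0 0 "univ \<sigma>0" FPg FPF RF by (rule g)
  have sm: "small P \<sigma>" "univ \<sigma> = univ \<sigma>0" if "same \<sigma>0 \<sigma>" for \<sigma>
    unfolding small_same[OF that] using s that by (simp_all add: same_def)
  have fs: "frame FPg \<sigma> \<sigma>' \<Longrightarrow> same \<sigma> \<sigma>'" for \<sigma> \<sigma>' by (simp add: frame_def)
  show ?thesis
  proof (unfold_locales, goal_cases)
    case (1 \<sigma> f v x)
    then show ?case using RG_get[OF 1] sm[OF 1(1)] by (simp add: tops_def)
  next
    case (2 \<sigma> f v)
    obtain m \<pi> where "v \<le> univ \<sigma>0" by (rule RG_E[OF 2(2)]) blast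
    then show ?case using RG_get(2)[OF 2, of 0] u sm[OF 2(1)] by (simp add: tops_def)
  next
    case (3 \<sigma> f v j)
    show ?case using RG_enum[OF 3, of 0] sm[OF 3(1)] by (simp add: tops_def)
  next
    case (4 \<sigma> f v x j)
    show ?case using RG_set[OF 4, of 0] sm[OF 4(1)] fs by (auto simp add: tops_def)
  next
    case (5 \<sigma> f v v')
    show ?case using RG_setav[OF 5] sm[OF 5(1)] fs by (auto simp add: tops_def)
  next
    case (6 \<sigma>)
    show ?case using RG_ini[OF 6, of 0] sm[OF 6] fs by (auto simp add: tops_def)
  qed
qed

lemma collection_level:
  assumes S: "struct (cP P) (dP P) \<sigma>0 FP (univ \<sigma>0)
      (\<lambda>\<sigma>. lv_get (kP P) (cP P) (dP P) (gops P) \<sigma> (tw P \<sigma>0) (tw P \<sigma>0) (sq \<sigma>0) (univ \<sigma>0 div sq \<sigma>0) (univ \<sigma>0))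
      (\<lambda>\<sigma>. lv_first (kP P) (cP P) (dP P) (gops P) \<sigma> (tw P \<sigma>0) (tw P \<sigma>0) (sq \<sigma>0) (univ \<sigma>0 div sq \<sigma>0) (univ \<sigma>0))
      (\<lambda>\<sigma>. lv_next (kP P) (cP P) (dP P) (gops P) \<sigma> (tw P \<sigma>0) (tw P \<sigma>0) (sq \<sigma>0) (univ \<sigma>0 div sq \<sigma>0) (univ \<sigma>0))
      (\<lambda>\<sigma>. lv_set (kP P) (cP P) (gops P) \<sigma> (tw P \<sigma>0) (tw P \<sigma>0) (sq \<sigma>0) (univ \<sigma>0 div sq \<sigma>0) (univ \<sigma>0))
      (\<lambda>\<sigma>. lv_zero (kP P) (cP P) \<sigma> (tw P \<sigma>0) (tw P \<sigma>0) (Suc (cP P))) R"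
    and FP: "FP \<inter> {0..<tw P \<sigma>0} = {}" and s: "\<not> small P \<sigma>0" and w: "1 \<le> wid \<sigma>0"
    and n: "univ \<sigma>0 < 2 ^ tw P \<sigma>0" and lim: "tw P \<sigma>0 \<le> lim \<sigma>0"
  shows "collection (cP P) (dP P) \<sigma>0 (tops P) (\<lambda>\<sigma> f v. R \<sigma> f \<and> rd (kP P) \<sigma> 0 (tw P \<sigma>0) = v \<and> v \<le> univ \<sigma>0)"
proof -
  have sm: "\<not> small P \<sigma>" "univ \<sigma> = univ \<sigma>0" "wid \<sigma> = wid \<sigma>0" "lim \<sigma> = lim \<sigma>0" if "same \<sigma>0 \<sigma>" for \<sigma>
    unfolding small_same[OF that] using s that by (simp_all add: same_def)
  have rd: "rd (kP P) \<sigma> 0 (tw P \<sigma>0) = fld (bitv \<sigma>) 0 (tw P \<sigma>0)" if "same \<sigma>0 \<sigma>" for \<sigma>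
    using w sm[OF that] by (intro rd_eq) auto
  have fr: "rd (kP P) \<sigma>' 0 (tw P \<sigma>0) = rd (kP P) \<sigma> 0 (tw P \<sigma>0)" if "same \<sigma>0 \<sigma>" "frame FP \<sigma> \<sigma>'" for \<sigma> \<sigma>'
    unfolding rd[OF that(1)] rd[OF frame_same[OF that(2,1)]]
    by (rule fld_cong) (use that(2) FP in \<open>auto simp: frame_def disjoint_iff\<close>)
  have wr: "R (wr (kP P) \<sigma> 0 (tw P \<sigma>0) v) f \<and> same \<sigma> (wr (kP P) \<sigma> 0 (tw P \<sigma>0) v) \<and>
      rd (kP P) (wr (kP P) \<sigma> 0 (tw P \<sigma>0) v) 0 (tw P \<sigma>0) = v"
    if s: "same \<sigma>0 \<sigma>" and "R \<sigma> f" and v: "v \<le> univ \<sigma>0" for \<sigma> f v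
  proof -
    have sw: "same \<sigma> (wr (kP P) \<sigma> 0 (tw P \<sigma>0) v)" by (rule same_wr)
    have s': "same \<sigma>0 (wr (kP P) \<sigma> 0 (tw P \<sigma>0) v)" by (rule same_trans[OF s sw])
    have b: "bitv (wr (kP P) \<sigma> 0 (tw P \<sigma>0) v) p \<longleftrightarrow>
        (if p < lim \<sigma>0 \<and> p < tw P \<sigma>0 then bit v p else bitv \<sigma> p)" for p
      using bitv_wr[of \<sigma> "tw P \<sigma>0" "kP P" 0 v p] w sm[OF s] by simp
    have "R (wr (kP P) \<sigma> 0 (tw P \<sigma>0) v) f"
      by (rule struct.stable[OF S s s' that(2)]) (use b FP in \<open>auto simp: disjoint_iff\<close>)
    moreover have "fld (bitv (wr (kP P) \<sigma> 0 (tw P \<sigma>0) v)) 0 (tw P \<sigma>0) = v"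
      by (rule fld_eqI) (use b v n lim in auto)
    ultimately show ?thesis using sw rd[OF s'] by simp
  qed
  show ?thesis
  proof (unfold_locales, goal_cases)
    case (1 \<sigma> f v x)
    then show ?case using struct.get[OF S 1(1) _ 1(3), of f] sm[OF 1(1)] by (simp add: tops_def)
  next
    case (2 \<sigma> f v)
    then show ?case using sm[OF 2(1)] by (simp add: tops_def)
  next
    case (3 \<sigma> f v j)
    then show ?case using struct.enum[OF S 3(1) _ 3(3), of f] sm[OF 3(1)] by (simp add: tops_def)
  next
    case (4 \<sigma> f v x j)
    let ?\<sigma> = "lv_set (kP P) (cP P) (gops P) \<sigma> (tw P \<sigma>0) (tw P \<sigma>0) (sq \<sigma>0) (univ \<sigma>0 div sq \<sigma>0) (univ \<sigma>0) x j"
    have c: "cset (tops P) \<sigma> x j = ?\<sigma>" using sm[OF 4(1)] by (simp add: tops_def)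
    have "R ?\<sigma> (f(x := j))" "frame FP \<sigma> ?\<sigma>" using struct.set'[OF S 4(1) _ 4(3,4), of f] 4(2) by blast+
    then show ?case unfolding c using fr[OF 4(1)] 4(2) by (simp add: frame_def)
  next
    case (5 \<sigma> f v v')
    have c: "csetav (tops P) \<sigma> v' = wr (kP P) \<sigma> 0 (tw P \<sigma>0) v'" using sm[OF 5(1)] by (simp add: tops_def)
    show ?case unfolding c using wr[OF 5(1) conjunct1[OF 5(2)] 5(3)] 5(3) by blast
  next
    case (6 \<sigma>)
    let ?\<sigma> = "lv_zero (kP P) (cP P) \<sigma> (tw P \<sigma>0) (tw P \<sigma>0) (Suc (cP P))"
    have r: "R ?\<sigma> (\<lambda>_. dP P)" "frame FP \<sigma> ?\<sigma>" using struct.ini[OF S 6] by blast+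
    have s': "same \<sigma>0 ?\<sigma>" by (rule frame_same[OF r(2) 6])
    have c: "cini (tops P) \<sigma> = wr (kP P) ?\<sigma> 0 (tw P \<sigma>0) 0"
      using sm[OF 6] sm(3)[OF s'] by (simp add: tops_def Let_def del: lv_zero.simps)
    have "same \<sigma> ?\<sigma>" using r(2) by (simp add: frame_def del: lv_zero.simps)
    then show ?case unfolding c using wr[OF s' r(1), of 0] same_trans by blast
  qed
qed

text \<open>\<open>7 * c + 8\<close> comes from \<open>flen_bound\<close>, another 8 from the list
  of a single group, and \<open>5 * (c + 1) * k + 1\<close> from the outer table and the lists of
  several groups.\<close>

definition overhead :: "par \<Rightarrow> real" where
  "overhead P = 7 * real (cP P) + 16 + 5 * (real (cP P) + 1) * real (kP P) + 1"

definition roomy where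
  "roomy P \<sigma> \<longleftrightarrow> real (univ \<sigma>) * log 2 (real (cP P)) + overhead P * (real (univ \<sigma>) / ln (real (zz \<sigma>))) \<le> real (lim \<sigma>)"

context params
begin

lemma ln_zz: "\<not> tiny P \<sigma> \<Longrightarrow> 1 \<le> ln (real (zz \<sigma>))"
proof -
  assume "\<not> tiny P \<sigma>"
  then have "120 \<le> zz \<sigma>" using nP[of "zz \<sigma>"] by (simp add: tiny_def)
  then have "exp 1 \<le> real (zz \<sigma>)" using exp_le by linarith
  then show ?thesis using \<open>120 \<le> zz \<sigma>\<close> by (subst ln_ge_iff) auto
qed

lemma collection_small:
  assumes s: "small P \<sigma>0" and w: "1 \<le> wid \<sigma>0" and u: "1 \<le> univ \<sigma>0" and c2: "2 \<le> cP P"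
    and ti: "tiny P \<sigma>0 \<Longrightarrow> univ \<sigma>0 \<le> n1 \<and> lP P \<le> lim \<sigma>0" and room: "\<not> tiny P \<sigma>0 \<Longrightarrow> roomy P \<sigma>0"
  shows "\<exists>R. collection (cP P) (dP P) \<sigma>0 (tops P) R"
proof -
  define n where "n = univ \<sigma>0"
  let ?z = "zz \<sigma>0" let ?b = "bseq P \<sigma>0"
  have zn: "?z \<le> n" by (simp add: zz_def n_def)
  have big: "n \<le> 2 * (?z * ?z) \<and> ?z \<le> n" if "\<not> tiny P \<sigma>0"
  proof -
    have "n \<le> sq \<sigma>0" using s that by (simp add: small_def n_def)
    moreover have "n * 1 \<le> n * n" using u unfolding n_def by (rule mult_le_mono2)
    ultimately have "n \<le> ?z * ?z" unfolding zz_def n_def by simp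
    then show ?thesis using zn by simp
  qed
  have ti': "n \<le> n1" if "tiny P \<sigma>0" using ti[OF that] by (simp add: n_def)
  note gb = greach_bounds[OF _ big ti' w]
  have L: "1 \<le> log 2 (real (cP P))" using c2 by simp
  \<comment> \<open>Early lists have wide cells and extend over bits that later belong to the
    blocks. For at least two colours the main term of the space is at least \<open>n\<close> bits,
    and there they fit.\<close>
  have lim: "elen P \<sigma>0 \<le> lim \<sigma>0"
  proof (cases "tiny P \<sigma>0")
    case True
    then show ?thesis using ti by (simp add: elen_def)
  next
    case False
    have "0 \<le> overhead P * (real n / ln (real ?z))" using ln_zz[OF False] by (simp add: overhead_def)
    moreover have "real n * 1 \<le> real n * log 2 (real (cP P))" using L by (intro mult_left_mono) auto
    ultimately have "n \<le> lim \<sigma>0" using room[OF False] unfolding roomy_def n_def[symmetric] by linarith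
    then show ?thesis using False zn by (simp add: elen_def)
  qed
  have "\<exists>FPF RF. group P \<sigma>0 0 0 n (gfp P \<sigma>0 0 0 n) FPF RF"
  proof (rule group_exists[OF w big ti'], goal_cases)
    case (3 m)
    then show ?case using gb[OF 3] lim by (simp add: gE_def)
  next
    case (4 m)
    have nt: "\<not> tiny P \<sigma>0" using 4(2) by (simp add: rdy_def)
    have nr: "\<not> rdy P \<sigma>0 (?b i)" if "i < m" for i using 4(1) that by (simp add: greach_def)
    have b1: "1 \<le> ?b m" using gb[OF 4(1)] by blast
    have lnb: "ln (real ?z) \<le> real (?b m)" by (rule bseq_large(3)[OF nt]) (rule nr)
    have mz: "m < ?z" by (rule bseq_large(4)[OF nt]) (rule nr)
    have mb: "m \<le> ?b m" by (rule bseq_large(5)[OF nt]) (rule nr)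
    define x where "x = real n / real (?b m)"
    have fb: "real (flen P \<sigma>0 (?b m) (n - m)) \<le> real n * log 2 (real (cP P)) + (7 * real (cP P) + 8) * x"
      "real (?b m) ^ 2 \<le> x"
      unfolding x_def using flen_bound[OF w 4(2) b1 zn less_le_trans[OF mz zn]] by blast+
    \<comment> \<open>The list has at most as many entries as its cells have bits, so it takes
      O(\<open>b\<^sup>2\<close>) bits, which is O(\<open>n / b\<close>).\<close>
    have "ew (?b m) m \<le> 8 * (?b m) ^ 2"
    proof -
      have "m * ?b m \<le> ?b m * ?b m" "?b m * 1 \<le> ?b m * ?b m" using mb b1 by (intro mult_le_mono; simp)+
      then show ?thesis using b1 unfolding ew_def power2_eq_square by linarith
    qed
    then have "real (ew (?b m) m) \<le> real (8 * (?b m) ^ 2)" by (simp only: of_nat_le_iff)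
    then have "real (ew (?b m) m) \<le> 8 * x" using fb(2) by simp
    then have "real (ew (?b m) m + flen P \<sigma>0 (?b m) (n - m)) \<le> real n * log 2 (real (cP P)) + (7 * real (cP P) + 16) * x"
      using fb(1) by (simp add: algebra_simps)
    also have "(7 * real (cP P) + 16) * x \<le> overhead P * (real n / ln (real ?z))"
    proof (rule mult_mono)
      show "x \<le> real n / ln (real ?z)" unfolding x_def using lnb ln_zz[OF nt] by (intro divide_left_mono) auto
    qed (auto simp: overhead_def x_def)
    finally have "ew (?b m) m + flen P \<sigma>0 (?b m) (n - m) \<le> lim \<sigma>0"
      using room[OF nt] unfolding roomy_def n_def[symmetric] by linarith
    then show ?case using s by (simp add: gE_def gF_def)
  qed
  then show ?thesis using collection_group[OF _ s u] unfolding n_def by blast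
qed

text \<open>The list is frozen as soon as its width is ready, and the widths do not depend on the
  group. Hence all groups use the same stride in \<open>gF\<close>.\<close>

lemma greach_unique:
  assumes "greach P \<sigma> sz m" "rdy P \<sigma> (bseq P \<sigma> m)" "greach P \<sigma> sz' m'" "rdy P \<sigma> (bseq P \<sigma> m')"
  shows "m = m'"
  using assms unfolding greach_def by (metis linorder_neqE_nat)

lemma collection_big:
  assumes s: "\<not> small P \<sigma>0" and w: "1 \<le> wid \<sigma>0" and n2: "univ \<sigma>0 < 2 ^ tw P \<sigma>0" and room: "roomy P \<sigma>0"
  shows "\<exists>R. collection (cP P) (dP P) \<sigma>0 (tops P) R"
proof -
  define n where "n = univ \<sigma>0"
  define v where "v = wid \<sigma>0"
  define T where "T = tw P \<sigma>0"
  define N where "N = n div (v * v)"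
  define A where "A = larea (cP P) T T N"
  let ?sz = "lsz (v * v) N n" let ?b = "bseq P \<sigma>0" let ?c = "cP P"
  let ?fl = "\<lambda>m. flen P \<sigma>0 (?b m) (v * v - m)"
  have nt: "\<not> tiny P \<sigma>0" and nv: "v * v < n" using s by (auto simp: small_def n_def v_def)
  have v1: "1 \<le> v" using w by (simp add: v_def)
  have "v * 1 \<le> v * v" using v1 by (rule mult_le_mono2)
  then have "\<not> n < v" using nv by linarith
  then have zv: "zz \<sigma>0 = v" by (simp add: zz_def n_def v_def)
  have vv: "1 \<le> v * v" using v1 by simp
  have Nn: "N * (v * v) \<le> n" "n < N * (v * v) + v * v"
    using div_mult_mod_eq[of n "v * v"] mod_less_divisor[of "v * v" n] vv unfolding N_def by linarith+
  have N1: "1 \<le> N" using Nn nv by (cases N) auto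
  have szp: "v * v \<le> ?sz t" "?sz t \<le> 2 * (v * v)" "t * (v * v) + ?sz t \<le> n" "Suc t < N \<Longrightarrow> ?sz t = v * v" if t: "t < N" for t
  proof -
    have tN: "(t + 1) * (v * v) \<le> N * (v * v)" using t by (intro mult_le_mono1) simp
    then have tn: "t * (v * v) + v * v \<le> n" using Nn by simp
    have l: "n < t * (v * v) + 2 * (v * v)" if "Suc t = N" using Nn(2) unfolding that[symmetric] by simp
    show "v * v \<le> ?sz t" "?sz t \<le> 2 * (v * v)" "t * (v * v) + ?sz t \<le> n" "Suc t < N \<Longrightarrow> ?sz t = v * v"
      using tn l by (auto simp: lsz_def)
  qed
  have vz: "v \<le> v * v" using \<open>v * 1 \<le> v * v\<close> by simp
  have big: "?sz t \<le> 2 * (zz \<sigma>0 * zz \<sigma>0) \<and> zz \<sigma>0 \<le> ?sz t" if "t < N" for t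
    unfolding zv using szp[OF that] vz by linarith
  have ti: "?sz t \<le> n1" if "tiny P \<sigma>0" for t using nt that by simp
  note gb = greach_bounds[OF _ big ti w]
  have gE: "gE \<sigma>0 A t = A + t * v" for t by (simp add: gE_def v_def)
  have gF: "gF P \<sigma>0 A t b m = A + N * v + t * flen P \<sigma>0 b (v * v - m)" for t b m
    using s by (simp add: gF_def v_def N_def n_def)
  have ewv: "ew (?b m) m \<le> v" if "greach P \<sigma>0 (?sz t) m" "t < N" for t m
    using gb[OF that(1,2)] nt unfolding elen_def zv by (simp only: if_False) linarith
  have tv: "A + t * v + v \<le> A + N * v" if "t < N" for t
  proof -
    have "(t + 1) * v \<le> N * v" using that by (intro mult_le_mono1) simp
    then show ?thesis by simp
  qed
  define L where "L = log 2 (real ?c)"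
  have L0: "0 \<le> L" using c1 by (simp add: L_def)
  define y where "y = real n / ln (real v)"
  have ln1: "1 \<le> ln (real v)" using ln_zz[OF nt] by (simp add: zv)
  have y0: "0 \<le> y" using ln1 by (simp add: y_def)
  \<comment> \<open>There are at most \<open>n / w\<^sup>2\<close> groups, so a table with cells of
    \<open>kP\<close> words and lists of one word each cost O(\<open>n / w\<close>) bits;
    \<open>ln w \<le> w\<close> brings them under the common bound.\<close>
  have AN: "real (A + N * v) \<le> (5 * (real ?c + 1) * real (kP P) + 1) * y"
  proof -
    have "A + N * v = T * (1 + 2 * ((N + 1) * (?c + 1))) + N * v" by (simp add: A_def larea_def algebra_simps)
    also have "1 + 2 * ((N + 1) * (?c + 1)) \<le> 5 * (N * (?c + 1))"
    proof -
      have "1 * (?c + 1) \<le> N * (?c + 1)" using N1 by (rule mult_le_mono1)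
      then show ?thesis by simp
    qed
    finally have "A + N * v \<le> T * (5 * (N * (?c + 1))) + N * v" by (simp only: add_le_mono mult_le_mono)
    also have "\<dots> = (5 * (?c + 1) * kP P + 1) * (N * v)" by (simp add: T_def v_def algebra_simps)
    finally have "real (A + N * v) \<le> real ((5 * (?c + 1) * kP P + 1) * (N * v))" by (simp only: of_nat_le_iff)
    also have "\<dots> = (5 * (real ?c + 1) * real (kP P) + 1) * real (N * v)" by (simp add: algebra_simps)
    also have "\<dots> \<le> (5 * (real ?c + 1) * real (kP P) + 1) * y"
    proof (rule mult_left_mono)
      have "real (N * (v * v)) \<le> real n" using Nn(1) by (simp only: of_nat_le_iff)
      then have "real (N * v) \<le> real n / real v" using v1 by (simp add: field_simps)
      also have "\<dots> \<le> y" unfolding y_def using v1 ln1 ln_le_minus_one[of "real v"] by (intro divide_left_mono) auto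
      finally show "real (N * v) \<le> y" .
    qed simp
    finally show ?thesis .
  qed
  have lim': "real n * L + (7 * real ?c + 16) * y + real (A + N * v) \<le> real (lim \<sigma>0)"
  proof -
    have "real n * L + overhead P * y \<le> real (lim \<sigma>0)"
      using room unfolding roomy_def zv n_def[symmetric] L_def[symmetric] y_def[symmetric] .
    moreover have "overhead P * y = (7 * real ?c + 16) * y + (5 * (real ?c + 1) * real (kP P) + 1) * y"
      by (simp add: overhead_def algebra_simps)
    ultimately show ?thesis using AN by linarith
  qed
  have ANlim: "A + N * v \<le> lim \<sigma>0"
  proof -
    have "0 \<le> real n * L" "0 \<le> (7 * real ?c + 16) * y" using L0 y0 by simp_all
    then show ?thesis using lim' by linarith
  qed
  have "\<exists>FPF RF. group P \<sigma>0 A t (?sz t) (gfp P \<sigma>0 A t (?sz t)) FPF RF" if t: "t < N" for t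
  proof (rule group_exists[OF w big[OF t] ti], goal_cases)
    case (2 m)
    then show ?case unfolding gE using ewv[OF 2 t] tv[OF t] ANlim by linarith
  next
    case (3 m)
    have nr: "\<not> rdy P \<sigma>0 (?b i)" if "i < m" for i using 3(1) that by (simp add: greach_def)
    have b1: "1 \<le> ?b m" using gb[OF 3(1) t] by blast
    have lnb: "ln (real (zz \<sigma>0)) \<le> real (?b m)" by (rule bseq_large(3)[OF nt]) (rule nr)
    have mz: "m < zz \<sigma>0" by (rule bseq_large(4)[OF nt]) (rule nr)
    \<comment> \<open>A bound per element is additive, so the blocks of all groups up to
      \<open>t\<close> together stay within \<open>n * C\<close>.\<close>
    define C where "C = L + (7 * real ?c + 8) / real (?b m)"
    have C0: "0 \<le> C" using L0 by (simp add: C_def)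
    have fb: "real (flen P \<sigma>0 (?b m) (Q - m)) \<le> real Q * C" if "v * v \<le> Q" for Q
    proof -
      have "zz \<sigma>0 \<le> Q" "m < Q" using mz zv vz that by linarith+
      from flen_bound(1)[OF w 3(2) b1 this] show ?thesis by (simp add: C_def L_def algebra_simps add_divide_distrib)
    qed
    have "real (t * ?fl m + flen P \<sigma>0 (?b m) (?sz t - m)) \<le> real t * (real (v * v) * C) + real (?sz t) * C"
      unfolding of_nat_add of_nat_mult[of t] using fb[of "v * v"] fb[OF szp(1)[OF t]]
      by (intro add_mono mult_left_mono) auto
    also have "\<dots> = real (t * (v * v) + ?sz t) * C" by (simp add: algebra_simps)
    also have "\<dots> \<le> real n * C" using szp(3)[OF t] C0 by (intro mult_right_mono) (simp_all only: of_nat_le_iff)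
    also have "\<dots> = real n * L + (7 * real ?c + 8) * (real n / real (?b m))" by (simp add: C_def algebra_simps add_divide_distrib)
    also have "(7 * real ?c + 8) * (real n / real (?b m)) \<le> (7 * real ?c + 16) * y"
    proof (rule mult_mono)
      show "real n / real (?b m) \<le> y" unfolding y_def using lnb ln1 unfolding zv by (intro divide_left_mono) auto
    qed auto
    finally have "t * ?fl m + flen P \<sigma>0 (?b m) (?sz t - m) + (A + N * v) \<le> lim \<sigma>0" using lim' by linarith
    moreover have "A + t * v + ew (?b m) m \<le> A + N * v" using ewv[OF 3(1) t] tv[OF t] by linarith
    ultimately show ?case unfolding gE gF by linarith
  qed
  then have "\<forall>t. \<exists>FR. t < N \<longrightarrow> group P \<sigma>0 A t (?sz t) (gfp P \<sigma>0 A t (?sz t)) (fst FR) (snd FR)" by fastforce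
  from choice[OF this] obtain FR where FR: "\<And>t. t < N \<Longrightarrow>
      group P \<sigma>0 A t (?sz t) (gfp P \<sigma>0 A t (?sz t)) (fst (FR t)) (snd (FR t))" by blast
  \<comment> \<open>A coarse outline of the footprints that suffices to separate them. The blocks of
    the last group get no upper end, as they may be longer than the stride.\<close>
  have gin: "(A + t * v \<le> x \<and> x < A + t * v + v) \<or> (\<exists>m. greach P \<sigma>0 (?sz t) m \<and> rdy P \<sigma>0 (?b m) \<and>
      A + N * v + t * ?fl m \<le> x \<and> (Suc t < N \<longrightarrow> x < A + N * v + t * ?fl m + ?fl m))"
    if t: "t < N" and x: "x \<in> gfp P \<sigma>0 A t (?sz t)" for t x
  proof -
    from x consider m where "greach P \<sigma>0 (?sz t) m" "A + t * v \<le> x" "x < A + t * v + ew (?b m) m"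
      | m where "greach P \<sigma>0 (?sz t) m" "rdy P \<sigma>0 (?b m)" "A + N * v + t * ?fl m \<le> x"
        "x < A + N * v + t * ?fl m + flen P \<sigma>0 (?b m) (?sz t - m)"
      unfolding gfp_def gE gF by auto
    then show ?thesis
    proof cases
      case (1 m)
      then show ?thesis using ewv[OF 1(1) t] by auto
    next
      case (2 m)
      then show ?thesis using szp(4)[OF t] by auto
    qed
  qed
  have dj: False if t: "t < t'" "t' < N" and x: "x \<in> gfp P \<sigma>0 A t (?sz t)" "x \<in> gfp P \<sigma>0 A t' (?sz t')" for t t' x
  proof -
    have tN: "t < N" "Suc t < N" using t by auto
    have le: "t * z + z \<le> t' * z" for z
    proof -
      have "(t + 1) * z \<le> t' * z" using t by (intro mult_le_mono1) simp
      then show ?thesis by simp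
    qed
    from gin[OF tN(1) x(1)] show False
    proof (elim disjE exE conjE)
      assume "x < A + t * v + v"
      then show False using gin[OF t(2) x(2)] le[of v] tv[OF tN(1)] by auto
    next
      fix m assume m: "greach P \<sigma>0 (?sz t) m" "rdy P \<sigma>0 (?b m)" "A + N * v + t * ?fl m \<le> x"
        "Suc t < N \<longrightarrow> x < A + N * v + t * ?fl m + ?fl m"
      from gin[OF t(2) x(2)] show False
      proof (elim disjE exE conjE)
        assume "x < A + t' * v + v"
        then show False using m(3) tv[OF t(2)] by linarith
      next
        fix m' assume m': "greach P \<sigma>0 (?sz t') m'" "rdy P \<sigma>0 (?b m')" "A + N * v + t' * ?fl m' \<le> x"
        have "m = m'" by (rule greach_unique[OF m(1,2) m'(1,2)])
        then have "A + N * v + t' * ?fl m \<le> x" using m'(3) by simp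
        moreover have "x < A + N * v + t * ?fl m + ?fl m" using m(4) tN(2) by blast
        ultimately show False using le[of "?fl m"] by linarith
      qed
    qed
  qed
  have gA: "A \<le> x" if "t < N" "x \<in> gfp P \<sigma>0 A t (?sz t)" for t x
    using gin[OF that] by auto
  have nn: "N < 2 ^ T"
  proof -
    have "N * 1 \<le> N * (v * v)" using vv by (rule mult_le_mono2)
    then show ?thesis using Nn(1) n2 unfolding T_def n_def by linarith
  qed
  let ?FP = "\<lambda>t. gfp P \<sigma>0 A t (?sz t)"
  have lv: "level ?c (dP P) (kP P) \<sigma>0 T T (v * v) N n (gops P) ?FP
      (\<lambda>t \<sigma> f. \<exists>v. group.RG P \<sigma>0 A t (?sz t) (snd (FR t)) \<sigma> f v)"
  proof (rule level.intro, goal_cases)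
    case 1 show ?case by (rule w)
  next
    case 2 show ?case by (simp add: T_def)
  next
    case 3 show ?case by (rule nn)
  next
    case 4 show ?case by (rule N1)
  next
    case 5 show ?case by (rule vv)
  next
    case 6
    have "(N - 1) * (v * v) + v * v = N * (v * v)" using N1 by (cases N) auto
    then show ?case using Nn(1) vv by linarith
  next
    case 7 show ?case by (rule dc)
  next
    case 8 show ?case using ANlim unfolding A_def[symmetric] by linarith
  next
    case (9 t)
    show ?case unfolding A_def[symmetric] gops_def iops.select_convs
      by (rule group.group_struct[OF FR[OF 9]])
  next
    case (10 t t')
    then show ?case using dj[of t t'] dj[of t' t] by (cases "t < t'") auto
  next
    case (11 t)
    show ?case using gA[OF 11] unfolding A_def[symmetric] by fastforce
  qed
  have FP: "level.FP ?c T T N ?FP \<inter> {0..<T} = {}"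
  proof -
    have "T \<le> A" by (simp add: A_def larea_def)
    then have "T \<le> x" if "x \<in> {T..<A} \<or> (\<exists>t<N. x \<in> ?FP t)" for x using that gA by fastforce
    then show ?thesis unfolding level.FP_def[OF lv] A_def[symmetric] by fastforce
  qed
  have "T \<le> lim \<sigma>0" using ANlim by (simp add: A_def larea_def)
  from collection_level[OF level.level_struct[OF lv, unfolded T_def v_def N_def n_def] FP[unfolded T_def v_def N_def n_def] s w n2 this[unfolded T_def]]
  show ?thesis by blast
qed

end

text \<open>For \<open>c = 1\<close> the main term of the space is 0 and the colouring is constant.
  Only the missing element is stored, in about \<open>log 2 n\<close> bits.\<close>

definition single_ops :: "nat \<Rightarrow> cops" where
  "single_ops k = \<lparr>
     cget = (\<lambda>\<sigma> x. 0),
     cfirst = (\<lambda>\<sigma> j. if univ \<sigma> = 0 then 0 else 1),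
     cnext = (\<lambda>\<sigma> j x. if Suc x < univ \<sigma> then Suc (Suc x) else 0),
     cset = (\<lambda>\<sigma> x j. \<sigma>),
     cini = (\<lambda>\<sigma>. wr k \<sigma> 0 (k * wid \<sigma>) 0),
     cav = (\<lambda>\<sigma>. rd k \<sigma> 0 (k * wid \<sigma>)),
     csetav = (\<lambda>\<sigma> v. wr k \<sigma> 0 (k * wid \<sigma>) v)\<rparr>"

lemma cops_computable_single_ops: "cops_computable (single_ops k)"
  by unfold_locales (simp_all only: single_ops_def cops.select_convs, (intro CM_wr CM_id CE_b; assumption)+)

lemma collection_single:
  assumes w: "1 \<le> wid \<sigma>0" and n: "univ \<sigma>0 < 2 ^ (k * wid \<sigma>0)" "univ \<sigma>0 < 2 ^ lim \<sigma>0"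
  shows "collection 1 0 \<sigma>0 (single_ops k)
    (\<lambda>\<sigma> f v. (\<forall>x<univ \<sigma>0. f x = 0) \<and> rd k \<sigma> 0 (k * wid \<sigma>0) = v \<and> v \<le> univ \<sigma>0)"
proof -
  have sm: "univ \<sigma> = univ \<sigma>0" "wid \<sigma> = wid \<sigma>0" "lim \<sigma> = lim \<sigma>0" if "same \<sigma>0 \<sigma>" for \<sigma>
    using that by (simp_all add: same_def)
  have wr: "rd k (wr k \<sigma> 0 (k * wid \<sigma>0) v) 0 (k * wid \<sigma>0) = v" if s: "same \<sigma>0 \<sigma>" and v: "v \<le> univ \<sigma>0" for \<sigma> v
  proof -
    \<comment> \<open>The field of \<open>k\<close> words may be longer than the memory; the bits of
      \<open>v\<close> that get lost are zeros.\<close>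
    have "\<not> bit v p" if "lim \<sigma>0 \<le> p" for p
    proof -
      have "(2::nat) ^ lim \<sigma>0 \<le> 2 ^ p" using that by (intro power_increasing) auto
      then have "v < 2 ^ p" using v n(2) by linarith
      then show ?thesis by (simp add: bit_iff_odd)
    qed
    then have "bitv (wr k \<sigma> 0 (k * wid \<sigma>0) v) p = bit v p" if "p < k * wid \<sigma>0" for p
      using bitv_wr[of \<sigma> "k * wid \<sigma>0" k 0 v p] w sm[OF s] that by (auto simp: bitv_def not_less)
    then have "fld (bitv (wr k \<sigma> 0 (k * wid \<sigma>0) v)) 0 (k * wid \<sigma>0) = v"
      using v n(1) by (intro fld_eqI) auto
    then show ?thesis using w sm[OF s] by (subst rd_eq) auto
  qed
  show ?thesis
  proof (unfold_locales, goal_cases)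
    case (1 \<sigma> f v x)
    then show ?case by (simp add: single_ops_def)
  next
    case (2 \<sigma> f v)
    then show ?case using sm[OF 2(1)] by (simp add: single_ops_def)
  next
    case (3 \<sigma> f v j)
    let ?n = "univ \<sigma>0"
    have "lnk (\<lambda>r. if Suc r < ?n then Suc (Suc r) else 0) (if 0 < ?n then Suc 0 else 0) [0..<?n] 0"
      by (rule lnk_upt) simp
    moreover have "cnext (single_ops k) \<sigma> j = (\<lambda>r. if Suc r < ?n then Suc (Suc r) else 0)"
      "cfirst (single_ops k) \<sigma> j = (if 0 < ?n then Suc 0 else 0)"
      by (simp_all add: single_ops_def sm[OF 3(1)])
    moreover have "set [0..<?n] = {x. x < ?n \<and> f x = j}" using 3(2,3) by auto
    ultimately show ?case by (intro exI[of _ "[0..<?n]"]) (simp only: distinct_upt simp_thms)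
  next
    case (4 \<sigma> f v x j)
    then show ?case by (simp add: single_ops_def)
  next
    case (5 \<sigma> f v v')
    have "csetav (single_ops k) \<sigma> v' = wr k \<sigma> 0 (k * wid \<sigma>0) v'" using sm[OF 5(1)] by (simp add: single_ops_def)
    then show ?case using wr[OF 5(1,3)] same_wr 5(2,3) by simp
  next
    case (6 \<sigma>)
    have "cini (single_ops k) \<sigma> = wr k \<sigma> 0 (k * wid \<sigma>0) 0" using sm[OF 6] by (simp add: single_ops_def)
    then show ?case using wr[OF 6, of 0] same_wr by simp
  qed
qed

lemma real_nat_ceiling_le: "0 \<le> x \<Longrightarrow> real (nat \<lceil>x\<rceil>) \<le> x + 1" for x :: real
  by linarith

theorem theorem4:
  fixes c d :: nat and \<kappa> :: real
  assumes "1 \<le> c" and "d < c" and "0 < \<kappa>"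
  shows "\<exists>(D :: data_structure) (K :: nat) (T :: nat) (s :: nat \<Rightarrow> nat) (r :: nat \<Rightarrow> real).
    r \<in> o(\<lambda>n. real n) \<and>
    (\<forall>n\<ge>1. real (s n) \<le> real n * log 2 (real c) + r n) \<and>
    (\<forall>n\<ge>1. \<forall>w\<ge>1. \<kappa> * log 2 (real n) \<le> real w \<longrightarrow>
      maintains_collection D K T (s n) w n c d)"
proof -
  obtain P n1 where "params P n1" and P: "cP P = c" "dP P = d"
    and kn: "\<And>n w. 1 \<le> n \<Longrightarrow> \<kappa> * log 2 (real n) \<le> real w \<Longrightarrow> 1 \<le> w \<Longrightarrow> n < 2 ^ (kP P * w)"
    and n1: "\<And>n. n1 < n \<Longrightarrow> real (nP P) \<le> \<kappa> * log 2 (real n) \<and> nP P \<le> n"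
    using params_exist[OF assms(2,3)] by blast
  interpret params P n1 by fact
  have A: "n < 2 ^ ((kP P + c) * w) \<and> w < 2 ^ ((kP P + c) * w) \<and> c < 2 ^ ((kP P + c) * w)"
    if "1 \<le> n" "1 \<le> w" "\<kappa> * log 2 (real n) \<le> real w" for n w
  proof -
    have p: "(2::nat) ^ x \<le> 2 ^ ((kP P + c) * w)" if "x \<le> (kP P + c) * w" for x
      using that by (intro power_increasing) auto
    have "1 * w \<le> (kP P + c) * w" using kP by (intro mult_le_mono1) simp
    then have "w < 2 ^ ((kP P + c) * w)" using p[of w] less_exp[of w] by linarith
    moreover have "c * 1 \<le> (kP P + c) * w" using that(2) by (intro mult_le_mono) simp_all
    then have "c < 2 ^ ((kP P + c) * w)" using p[of c] less_exp[of c] by linarith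
    moreover have "kP P * w \<le> (kP P + c) * w" by (intro mult_le_mono1) simp
    then have "n < 2 ^ ((kP P + c) * w)" using p[of "kP P * w"] kn[OF that(1,3,2)] by linarith
    ultimately show ?thesis by blast
  qed
  show ?thesis
  proof (cases "c = 1")
    case True
    \<comment> \<open>\<open>n + 1\<close> values have to be told apart: the missing element, or
      that there is none.\<close>
    define s where "s n = nat \<lceil>log 2 (real n + 1)\<rceil>" for n
    define r where "r n = log 2 (real n + 1) + 1" for n
    have "r \<in> o(\<lambda>n. real n)" unfolding r_def by real_asymp
    moreover have "real (s n) \<le> real n * log 2 (real c) + r n" for n
      using real_nat_ceiling_le[of "log 2 (real n + 1)"] True by (simp add: s_def r_def)
    moreover have "\<exists>D K T. \<forall>n\<ge>1. \<forall>w\<ge>1. \<kappa> * log 2 (real n) \<le> real w \<longrightarrow> maintains_collection D K T (s n) w n c d"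
    proof (rule maintains_collection_exists[OF cops_computable_single_ops[of "kP P"] A], assumption+)
      fix n w :: nat assume nw: "1 \<le> n" "1 \<le> w" "\<kappa> * log 2 (real n) \<le> real w"
      have "real n + 1 = 2 powr (log 2 (real n + 1))" by simp
      also have "\<dots> \<le> 2 powr real (s n)" unfolding s_def by (intro powr_mono real_nat_ceiling_ge) simp
      also have "\<dots> = real (2 ^ s n)" by (simp add: powr_realpow)
      finally have "n < 2 ^ s n" by linarith
      then have "collection 1 0 (state_of (s n) w n (\<lambda>_. False)) (single_ops (kP P)) (\<lambda>\<sigma> f v. (\<forall>x<n. f x = 0) \<and>
          rd (kP P) \<sigma> 0 (kP P * w) = v \<and> v \<le> n)"
        using collection_single[of "state_of (s n) w n (\<lambda>_. False)" "kP P"] kn[OF nw(1,3,2)] nw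
        by (simp add: state_of_def)
      then show "\<exists>R. collection c d (state_of (s n) w n (\<lambda>_. False)) (single_ops (kP P)) R"
        using True assms(2) by auto
    qed
    ultimately show ?thesis by blast
  next
    case False
    then have c2: "2 \<le> c" using assms(1) by linarith
    \<comment> \<open>The size of the memory must not depend on \<open>w\<close>. \<open>h n\<close>
      is a lower bound for \<open>ln zz\<close> over all admissible words, taken at the shortest
      possible length.\<close>
    define h where "h n = ln (min (real n) (\<kappa> * log 2 (real n)))" for n
    \<comment> \<open>Finitely many \<open>n\<close> do not affect o(\<open>n\<close>). For them
      \<open>lP\<close> covers the tiny instances, and the linear term covers the others, where
      \<open>ln zz \<ge> 1\<close>.\<close>
    define x where "x n = (if n \<le> n1 then real (lP P) + overhead P * real n else overhead P * (real n / h n))" for n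
    define s where "s n = nat \<lceil>real n * log 2 (real c) + x n\<rceil>" for n
    have ov: "0 \<le> overhead P" by (simp add: overhead_def)
    have hp: "0 < h n" if "n1 < n" for n
    proof -
      have "120 \<le> real (nP P)" using nP[OF order_refl] by simp
      then have "1 < min (real n) (\<kappa> * log 2 (real n))" using n1[OF that] by linarith
      then show ?thesis unfolding h_def by simp
    qed
    have x0: "0 \<le> real n * log 2 (real c) + x n" for n
    proof -
      have "0 \<le> real n * log 2 (real c)" using c2 by simp
      moreover have "0 \<le> x n" unfolding x_def using ov hp[of n] by (auto intro!: mult_nonneg_nonneg)
      ultimately show ?thesis by linarith
    qed
    have "(\<lambda>n. overhead P * (real n / h n) + 1) \<in> o(\<lambda>n. real n)"
    proof -
      have "(\<lambda>n. overhead P * (real n / ln (\<kappa> * log 2 (real n))) + 1) \<in> o(\<lambda>n. real n)"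
        using assms(3) by real_asymp
      moreover have "eventually (\<lambda>n. min (real n) (\<kappa> * log 2 (real n)) = \<kappa> * log 2 (real n)) sequentially"
      proof -
        have "eventually (\<lambda>n. \<kappa> * log 2 (real n) \<le> real n) sequentially" using assms(3) by real_asymp
        then show ?thesis by eventually_elim simp
      qed
      then have "eventually (\<lambda>n. overhead P * (real n / h n) + 1 = overhead P * (real n / ln (\<kappa> * log 2 (real n))) + 1) sequentially"
        by eventually_elim (simp add: h_def)
      ultimately show ?thesis by (subst landau_o.small.in_cong)
    qed
    moreover have "eventually (\<lambda>n. x n + 1 = overhead P * (real n / h n) + 1) sequentially"
      using eventually_gt_at_top[of n1] by eventually_elim (simp add: x_def)
    ultimately have "(\<lambda>n. x n + 1) \<in> o(\<lambda>n. real n)" by (subst landau_o.small.in_cong)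
    moreover have "real (s n) \<le> real n * log 2 (real c) + (x n + 1)" for n
      using real_nat_ceiling_le[OF x0[of n]] by (simp add: s_def)
    moreover have "\<exists>D K T. \<forall>n\<ge>1. \<forall>w\<ge>1. \<kappa> * log 2 (real n) \<le> real w \<longrightarrow> maintains_collection D K T (s n) w n c d"
    proof (rule maintains_collection_exists[OF cops_computable_tops[of P] A], assumption+)
      fix n w :: nat assume nw: "1 \<le> n" "1 \<le> w" "\<kappa> * log 2 (real n) \<le> real w"
      let ?\<sigma> = "state_of (s n) w n (\<lambda>_. False)"
      have u: "univ ?\<sigma> = n" "wid ?\<sigma> = w" "lim ?\<sigma> = s n" by (simp_all add: state_of_def)
      have zz: "real (zz ?\<sigma>) = min (real n) (real w)" by (simp add: zz_def u)
      have sx: "real n * log 2 (real c) + x n \<le> real (s n)" unfolding s_def by (rule real_nat_ceiling_ge)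
      have ti: "n \<le> n1 \<and> lP P \<le> s n" if t: "tiny P ?\<sigma>"
      proof -
        have le: "n \<le> n1"
        proof (rule ccontr)
          assume "\<not> n \<le> n1"
          then have "real (nP P) \<le> real (zz ?\<sigma>)" using n1[of n] nw(3) unfolding zz by simp
          then show False using t by (simp add: tiny_def)
        qed
        have "0 \<le> real n * log 2 (real c)" "0 \<le> overhead P * real n" using c2 ov by simp_all
        then show ?thesis using sx le by (simp add: x_def)
      qed
      have room: "roomy P ?\<sigma>" if nt: "\<not> tiny P ?\<sigma>"
      proof -
        note l1 = ln_zz[OF nt]
        have "overhead P * (real n / ln (real (zz ?\<sigma>))) \<le> x n"
        proof (cases "n \<le> n1")
          case True
          have "real n / ln (real (zz ?\<sigma>)) \<le> real n" using l1 by (simp add: divide_le_eq mult_le_cancel_left1)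
          from mult_left_mono[OF this ov] show ?thesis using True by (simp add: x_def)
        next
          case False
          then have "0 < h n" using hp by simp
          moreover have "h n \<le> ln (real (zz ?\<sigma>))"
          proof -
            have "120 \<le> real (nP P)" using nP[OF order_refl] by simp
            then have "0 < min (real n) (\<kappa> * log 2 (real n))" using n1[of n] False by linarith
            then show ?thesis unfolding h_def zz using nw by (subst ln_le_cancel_iff) auto
          qed
          ultimately have "real n / ln (real (zz ?\<sigma>)) \<le> real n / h n" by (intro divide_left_mono) auto
          from mult_left_mono[OF this ov] show ?thesis using False by (simp add: x_def)
        qed
        then show ?thesis using sx by (simp add: roomy_def u P)
      qed
      have "\<exists>R. collection (cP P) (dP P) ?\<sigma> (tops P) R"
      proof (cases "small P ?\<sigma>")
        case True
        then show ?thesis by (rule collection_small) (use nw u c2 P ti room in simp_all)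
      next
        case False
        then have "\<not> tiny P ?\<sigma>" by (simp add: small_def)
        then show ?thesis using collection_big[OF False _ _ room] nw u kn[OF nw(1,3,2)] by simp
      qed
      then show "\<exists>R. collection c d ?\<sigma> (tops P) R" by (simp add: P)
    qed
    ultimately show ?thesis by blast
  qed
qed

end
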